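(* Mapping $A_U$ (for $U\in\prod_{1\le i<j\le k}M_{r_i,r_j}(\mathbf{C}(\{z\}))$) to the class of the Čech cocycle $(F_{D,D'}(U))_{D,D'}$ (with $D,D'$ running over all allowed summation divisors adapted to $A_0$) yields a bijection $$\mathcal{F}(M_0)\;\simeq\; H^1(\mathbf{E}_q,\Lambda_I(M_0)).$$
   Context: Fix $q\in\mathbf{C}$ with $|q|>1$; $\sigma_q f(z)=f(qz)$, applied entrywise. $\mathbf{C}(\{z\})$ is the fraction field of the ring of convergent power series; $\mathcal{M}(\mathbf{C}^*,0)$ is the field of germs of meromorphic functions in a punctured neighbourhood of $0$. Fix integers $\mu_1>\cdots>\mu_k$, ranks $r_1,\dots,r_k\ge1$, $A_i\in GL_{r_i}(\mathbf{C})$; $n=\sum r_i$. For a family $U=(U_{i,j})_{1\le i<j\le k}$ of $r_i\times r_j$ matrices, $A_U$ is the block upper triangular matrix with diagonal blocks $z^{-\mu_i}A_i$ and $(i,j)$-block $U_{i,j}$ ($i<j$); $A_0$ corresponds to $U=0$. $\mathfrak{G}\subset GL_n$ is the group of block upper triangular matrices with diagonal blocks $I_{r_1},\dots,I_{r_k}$; $F[A]=(\sigma_qF)AF^{-1}$. $M_0$ is the $q$-difference module $(\mathbf{C}(\{z\})^n,\Phi_{A_0})$, $\Phi_{A_0}(X)=A_0^{-1}\sigma_qX$. $\mathcal{F}(M_0)$ is the set of analytic isoformal classes in the formal class of $M_0$: the set of matrices $A_U$ with $U\in\prod_{i<j}M_{r_i,r_j}(\mathbf{C}(\{z\}))$ modulo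 the relation $A_U\sim A_V$ iff $A_V=F[A_U]$ for some $F\in\mathfrak{G}(\mathbf{C}(\{z\}))$. $\mathbf{E}_q=\mathbf{C}^*/q^{\mathbf{Z}}$; $\overline{a},\overline{X}$ denote images in $\mathbf{E}_q$; $ev_{\mathbf{E}_q}(\sum n_i[\alpha_i])=\sum n_i\alpha_i$ (group law of $\mathbf{E}_q$). A summation divisor adapted to $A_0$ is a family $D=(D_{i,j})_{1\le i<j\le k}$ of effective divisors on $\mathbf{E}_q$, $\deg D_{i,j}=\mu_{i,j}=\mu_i-\mu_j$, with $D_{i,j}=D_{i,l}+D_{l,j}$ for $i<l<j$; it is allowed if $ev_{\mathbf{E}_q}(D_{i,j})\notin\overline{(-1)^{\mu_{i,j}}Sp(A_i)/Sp(A_j)}$ for all $i<j$ (where $S/T=\{s/t\}$). For $D$ allowed and $U,V$ over $\mathbf{C}(\{z\})$, $F_D(U,V)$ is the unique $F\in\mathfrak{G}(\mathcal{M}(\mathbf{C}^*,0))$ with $F[A_U]=A_V$ and $\mathrm{div}_{\mathbf{E}_q}(F_{i,j})\ge-D_{i,j}$ for all $i<j$ (i.e. at each point $z_0$ near $0$, entries of $F_{i,j}$ have poles of order at most the multiplicity of $\overline{z_0}$ in $D_{i,j}$); it is known that it exists. $F_D(U)=F_D(0,U)$ and $F_{D,D'}(U)=F_D(U)^{-1}F_{D'}(U)$. $V_D=\mathbf{E}_q\setminus\bigcup_{i<j}\mathrm{Supp}(D_{i,j})$, and $\mathfrak{V}$ is the open covering of $\mathbf{E}_q$ by all $V_D$,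 $D$ allowed; $(F_{D,D'}(U))$ is a Čech 1-cocycle of $\Lambda_I(M_0)$ for $\mathfrak{V}$. Stokes sheaf. A sector is a germ at $0$ of a $q^{-\mathbf{N}}$-invariant open subset $W$ of $\mathbf{C}^*$; its horizon is its image in $\mathbf{E}_q$. A function $f$ holomorphic on $W$ is (infinitely) flat if for every $m\in\mathbf{N}$, $z^{-m}f$ is bounded on every invariant relatively compact subset of $W$, i.e. on $q^{-\mathbf{N}}K$ for every compact $K\subset W$. $\mathcal{A}_0$ is the sheaf on $\mathbf{E}_q$ whose sections over $V$ are (classes, under restriction to smaller sectors with the same horizon, of) flat functions on sectors with horizon $V$. $\Lambda_I(M_0)$ is the sheaf of groups on $\mathbf{E}_q$ whose sections over $V$ are the matrices $F$ in $\mathfrak{G}$ with all over-diagonal blocks $F_{i,j}$ having entries in $\mathcal{A}_0(V)$ and with $F[A_0]=A_0$. $H^1$ is the (non-abelian) Čech cohomology pointed set, the direct limit of the $H^1$ of open coverings. *)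

theory Defs
  imports
    "HOL-Complex_Analysis.Complex_Analysis"
    "HOL-Algebra.Coset"
    "HOL-Algebra.FiniteProduct"
    "Jordan_Normal_Form.Gauss_Jordan_Elimination"
    "Jordan_Normal_Form.Spectral_Radius"
begin

no_notation fls_nth (infixl \<open>$$\<close> 75)

section \<open>Block matrices\<close>

text \<open>Blocks are numbered \<open>1, \<dots>, k\<close>, as in the source; rows and columns are numbered from \<open>0\<close>,
  as in the matrix library. Block \<open>i\<close> consists of the rows \<open>offset r i, \<dots>, offset r i + r i - 1\<close>.\<close>

definition total_rank :: "nat \<Rightarrow> (nat \<Rightarrow> nat) \<Rightarrow> nat" where
  "total_rank k r = (\<Sum>i=1..k. r i)"

definition offset :: "(nat \<Rightarrow> nat) \<Rightarrow> nat \<Rightarrow> nat" where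
  "offset r i = (\<Sum>l\<in>{1..<i}. r l)"

definition block_of :: "(nat \<Rightarrow> nat) \<Rightarrow> nat \<Rightarrow> nat" where
  "block_of r a = (LEAST i. a < offset r (Suc i))"

definition assemble :: "nat \<Rightarrow> (nat \<Rightarrow> nat) \<Rightarrow> (nat \<Rightarrow> nat \<Rightarrow> 'a mat) \<Rightarrow> 'a mat" where
  "assemble k r B = Matrix.mat (total_rank k r) (total_rank k r)
     (\<lambda>(a, b). let i = block_of r a; j = block_of r b in B i j $$ (a - offset r i, b - offset r j))"

definition block :: "(nat \<Rightarrow> nat) \<Rightarrow> 'a mat \<Rightarrow> nat \<Rightarrow> nat \<Rightarrow> 'a mat" where
  "block r M i j = Matrix.mat (r i) (r j) (\<lambda>(a, b). M $$ (offset r i + a, offset r j + b))"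

lemma offset_Suc: "1 \<le> i \<Longrightarrow> offset r (Suc i) = offset r i + r i"
  by (simp add: offset_def)

lemma offset_mono: "i \<le> j \<Longrightarrow> offset r i \<le> offset r j"
  unfolding offset_def by (rule sum_mono2) auto

lemma offset_last: "offset r (Suc k) = total_rank k r"
  by (simp add: offset_def total_rank_def atLeastLessThanSuc_atLeastAtMost)

lemma block_of_offset:
  assumes "1 \<le> i" "a < r i"
  shows "block_of r (offset r i + a) = i"
  unfolding block_of_def
proof (rule Least_equality)
  show "offset r i + a < offset r (Suc i)" using assms by (simp add: offset_Suc)
next
  fix y assume y: "offset r i + a < offset r (Suc y)"
  show "i \<le> y"
  proof (rule ccontr)
    assume "\<not> i \<le> y"
    hence "Suc y \<le> i" by simp
    from offset_mono[OF this, of r] y show False by simp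
  qed
qed

lemma block_assemble:
  assumes "i \<in> {1..k}" "j \<in> {1..k}" "B i j \<in> carrier_mat (r i) (r j)"
  shows "block r (assemble k r B) i j = B i j"
proof (rule eq_matI)
  fix a b assume ab: "a < dim_row (B i j)" "b < dim_col (B i j)"
  hence a: "a < r i" and b: "b < r j" using assms by auto
  have bound: "offset r l + c < total_rank k r" if "l \<in> {1..k}" "c < r l" for l c
  proof -
    have "offset r l + c < offset r (Suc l)" using that by (simp add: offset_Suc)
    also have "\<dots> \<le> offset r (Suc k)" using that by (intro offset_mono) simp
    finally show ?thesis by (simp add: offset_last)
  qed
  show "block r (assemble k r B) i j $$ (a, b) = B i j $$ (a, b)"
    using assms a b bound[of i a] bound[of j b]
    by (simp add: block_def assemble_def block_of_offset)
qed (use assms in \<open>auto simp: block_def\<close>)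

text \<open>The unipotent group \<open>\<GG>\<close>, with coefficients in any ring.\<close>

definition frakG :: "nat \<Rightarrow> (nat \<Rightarrow> nat) \<Rightarrow> 'a::{zero,one} mat set" where
  "frakG k r = {M \<in> carrier_mat (total_rank k r) (total_rank k r).
     (\<forall>i\<in>{1..k}. block r M i i = 1\<^sub>m (r i)) \<and>
     (\<forall>i\<in>{1..k}. \<forall>j\<in>{1..k}. j < i \<longrightarrow> block r M i j = 0\<^sub>m (r i) (r j))}"

text \<open>Unspecified on matrices that are not invertible.\<close>

definition minv :: "'a::field mat \<Rightarrow> 'a mat" where
  "minv M = the (mat_inverse M)"


section \<open>Analytic isoformal classes\<close>

text \<open>The field \<open>\<complex>({z})\<close>, as a subfield of the field of formal Laurent series.\<close>

definition conv_field :: "complex fls set" where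
  "conv_field = {fps_to_fls f / fps_to_fls g | f g.
     fps_conv_radius f > 0 \<and> fps_conv_radius g > 0 \<and> g \<noteq> 0}"

definition sigma_fls :: "complex \<Rightarrow> complex fls \<Rightarrow> complex fls" where
  "sigma_fls q f = fls_compose_fps f (fps_const q * fps_X)"

definition gauge_fls :: "complex \<Rightarrow> complex fls mat \<Rightarrow> complex fls mat \<Rightarrow> complex fls mat" where
  "gauge_fls q F M = map_mat (sigma_fls q) F * M * minv F"

definition over_diag_families :: "nat \<Rightarrow> (nat \<Rightarrow> nat) \<Rightarrow> (nat \<Rightarrow> nat \<Rightarrow> complex fls mat) set" where
  "over_diag_families k r = {U. \<forall>i j. 1 \<le> i \<and> i < j \<and> j \<le> k \<longrightarrow>
     U i j \<in> carrier_mat (r i) (r j) \<and> elements_mat (U i j) \<subseteq> conv_field}"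

definition A_mat :: "nat \<Rightarrow> (nat \<Rightarrow> int) \<Rightarrow> (nat \<Rightarrow> nat) \<Rightarrow> (nat \<Rightarrow> complex mat) \<Rightarrow>
    (nat \<Rightarrow> nat \<Rightarrow> complex fls mat) \<Rightarrow> complex fls mat" where
  "A_mat k mu r A U = assemble k r (\<lambda>i j.
     if i = j then fls_X_intpow (- mu i) \<cdot>\<^sub>m map_mat fls_const (A i)
     else if i < j then U i j
     else 0\<^sub>m (r i) (r j))"

definition zero_family :: "(nat \<Rightarrow> nat) \<Rightarrow> nat \<Rightarrow> nat \<Rightarrow> complex fls mat" where
  "zero_family r i j = 0\<^sub>m (r i) (r j)"

definition isoformal_rel :: "complex \<Rightarrow> nat \<Rightarrow> (nat \<Rightarrow> int) \<Rightarrow> (nat \<Rightarrow> nat) \<Rightarrow> (nat \<Rightarrow> complex mat) \<Rightarrow>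
    (complex fls mat \<times> complex fls mat) set" where
  "isoformal_rel q k mu r A = {(A_mat k mu r A U, A_mat k mu r A V) | U V.
     U \<in> over_diag_families k r \<and> V \<in> over_diag_families k r \<and>
     (\<exists>F \<in> frakG k r. elements_mat F \<subseteq> conv_field \<and>
        A_mat k mu r A V = gauge_fls q F (A_mat k mu r A U))}"

definition isoformal_classes :: "complex \<Rightarrow> nat \<Rightarrow> (nat \<Rightarrow> int) \<Rightarrow> (nat \<Rightarrow> nat) \<Rightarrow> (nat \<Rightarrow> complex mat) \<Rightarrow>
    complex fls mat set set" where
  "isoformal_classes q k mu r A = (A_mat k mu r A ` over_diag_families k r) // isoformal_rel q k mu r A"


section \<open>The elliptic curve\<close>

definition Cstar :: "complex monoid" where
  "Cstar = \<lparr>carrier = UNIV - {0}, mult = (*), one = 1\<rparr>"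

definition qZ :: "complex \<Rightarrow> complex set" where
  "qZ q = range (\<lambda>m::int. q powi m)"

definition Eq :: "complex \<Rightarrow> complex set monoid" where
  "Eq q = Cstar Mod qZ q"

definition Eq_proj :: "complex \<Rightarrow> complex \<Rightarrow> complex set" where
  "Eq_proj q z = qZ q #>\<^bsub>Cstar\<^esub> z"

text \<open>The quotient topology.\<close>

definition Eq_top :: "complex \<Rightarrow> complex set topology" where
  "Eq_top q = topology (\<lambda>V. V \<subseteq> carrier (Eq q) \<and> open {z. z \<noteq> 0 \<and> Eq_proj q z \<in> V})"

lemma openin_Eq_top:
  "openin (Eq_top q) V \<longleftrightarrow> V \<subseteq> carrier (Eq q) \<and> open {z. z \<noteq> 0 \<and> Eq_proj q z \<in> V}"
proof -
  have "istopology (\<lambda>V. V \<subseteq> carrier (Eq q) \<and> open {z. z \<noteq> 0 \<and> Eq_proj q z \<in> V})"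
    unfolding istopology_def
  proof (intro conjI allI impI; (elim conjE)?)
    fix S T assume "open {z. z \<noteq> 0 \<and> Eq_proj q z \<in> S}" "open {z. z \<noteq> 0 \<and> Eq_proj q z \<in> T}"
    from open_Int[OF this] show "open {z. z \<noteq> 0 \<and> Eq_proj q z \<in> S \<inter> T}"
      by (rule back_subst) auto
  next
    fix \<K> assume "\<forall>K\<in>\<K>. K \<subseteq> carrier (Eq q) \<and> open {z. z \<noteq> 0 \<and> Eq_proj q z \<in> K}"
    hence "open (\<Union>K\<in>\<K>. {z. z \<noteq> 0 \<and> Eq_proj q z \<in> K})" by (intro open_UN) auto
    thus "open {z. z \<noteq> 0 \<and> Eq_proj q z \<in> \<Union>\<K>}" by (rule back_subst) auto
  qed auto
  thus ?thesis unfolding Eq_top_def by (simp add: topology_inverse')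
qed

lemma topspace_Eq_top: "topspace (Eq_top q) = carrier (Eq q)"
proof -
  have carr: "carrier (Eq q) = Eq_proj q ` (UNIV - {0})"
    by (auto simp: Eq_def FactGroup_def RCOSETS_def Cstar_def Eq_proj_def)
  have "{z. z \<noteq> 0 \<and> Eq_proj q z \<in> carrier (Eq q)} = - {0}"
    by (auto simp: carr)
  hence "openin (Eq_top q) (carrier (Eq q))"
    by (simp add: openin_Eq_top open_Compl)
  thus ?thesis
    using openin_Eq_top[of q "topspace (Eq_top q)"] by (auto intro: openin_subset[THEN subsetD])
qed

text \<open>Effective divisors on \<open>E\<^sub>q\<close> are finite multisets of points: the degree is \<^const>\<open>size\<close>, the
  multiplicity \<^const>\<open>count\<close>, the support \<^const>\<open>set_mset\<close>.\<close>

definition ev_Eq :: "complex \<Rightarrow> complex set multiset \<Rightarrow> complex set" where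
  "ev_Eq q D = finprod (Eq q) (\<lambda>\<alpha>. \<alpha> [^]\<^bsub>Eq q\<^esub> count D \<alpha>) (set_mset D)"


section \<open>Summation divisors\<close>

type_synonym sum_div = "nat \<Rightarrow> nat \<Rightarrow> complex set multiset"

text \<open>The last condition only normalises the meaningless components.\<close>

definition summation_divisor :: "complex \<Rightarrow> nat \<Rightarrow> (nat \<Rightarrow> int) \<Rightarrow> sum_div \<Rightarrow> bool" where
  "summation_divisor q k mu D \<longleftrightarrow>
     (\<forall>i j. 1 \<le> i \<and> i < j \<and> j \<le> k \<longrightarrow>
        set_mset (D i j) \<subseteq> carrier (Eq q) \<and> int (size (D i j)) = mu i - mu j) \<and>
     (\<forall>i l j. 1 \<le> i \<and> i < l \<and> l < j \<and> j \<le> k \<longrightarrow> D i j = D i l + D l j) \<and>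
     (\<forall>i j. \<not> (1 \<le> i \<and> i < j \<and> j \<le> k) \<longrightarrow> D i j = {#})"

definition allowed_divisors ::
    "complex \<Rightarrow> nat \<Rightarrow> (nat \<Rightarrow> int) \<Rightarrow> (nat \<Rightarrow> complex mat) \<Rightarrow> sum_div set" where
  "allowed_divisors q k mu A = {D. summation_divisor q k mu D \<and>
     (\<forall>i j. 1 \<le> i \<and> i < j \<and> j \<le> k \<longrightarrow>
        ev_Eq q (D i j) \<notin>
          {Eq_proj q ((-1) powi (mu i - mu j) * (s / t)) | s t. s \<in> spectrum (A i) \<and> t \<in> spectrum (A j)})}"

definition V_set :: "complex \<Rightarrow> nat \<Rightarrow> sum_div \<Rightarrow> complex set set" where
  "V_set q k D = carrier (Eq q) - (\<Union>(i, j) \<in> {(i, j). 1 \<le> i \<and> i < j \<and> j \<le> k}. set_mset (D i j))"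

definition mat_fun :: "complex fls mat \<Rightarrow> complex \<Rightarrow> complex mat" where
  "mat_fun M z = map_mat (\<lambda>f. eval_fls f z) M"

definition gauge_fun ::
    "complex \<Rightarrow> (complex \<Rightarrow> complex mat) \<Rightarrow> (complex \<Rightarrow> complex mat) \<Rightarrow> complex \<Rightarrow> complex mat" where
  "gauge_fun q F M z = F (q * z) * M z * minv (F z)"

text \<open>An element of \<open>\<GG>(\<M>(\<complex>\<^sup>*,0))\<close> is represented by a function whose entries are meromorphic on some
  punctured disc, have removable singularities removed, and take the value \<open>0\<close> at poles
  (\<^const>\<open>nicely_meromorphic_on\<close>). Two such representatives of the same germ agree near \<open>0\<close>. An identity
  between meromorphic germs is an identity outside a closed discrete subset of a punctured disc; the
  exceptional set may accumulate at \<open>0\<close>.\<close>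

definition is_FD :: "complex \<Rightarrow> nat \<Rightarrow> (nat \<Rightarrow> nat) \<Rightarrow> sum_div \<Rightarrow> complex fls mat \<Rightarrow> complex fls mat \<Rightarrow>
    (complex \<Rightarrow> complex mat) \<Rightarrow> bool" where
  "is_FD q k r D M N F \<longleftrightarrow> (\<exists>\<epsilon>>0.
     (\<forall>z \<in> ball 0 \<epsilon> - {0}. F z \<in> frakG k r) \<and>
     (\<forall>i j a b. 1 \<le> i \<and> i < j \<and> j \<le> k \<and> a < r i \<and> b < r j \<longrightarrow>
        (\<lambda>z. block r (F z) i j $$ (a, b)) nicely_meromorphic_on (ball 0 \<epsilon> - {0}) \<and>
        (\<forall>z\<^sub>0 \<in> ball 0 \<epsilon> - {0}.
           is_pole (\<lambda>z. block r (F z) i j $$ (a, b)) z\<^sub>0 \<longrightarrow>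
           - zorder (\<lambda>z. block r (F z) i j $$ (a, b)) z\<^sub>0 \<le> int (count (D i j) (Eq_proj q z\<^sub>0))))) \<and>
     (\<exists>\<delta>>0. \<forall>\<^sub>F z in cosparse (ball 0 \<delta> - {0}). gauge_fun q F (mat_fun M) z = mat_fun N z)"

text \<open>\<open>F\<^sub>D(U) = F\<^sub>D(0, U)\<close>, up to the choice of a representative of the germ.\<close>

definition F_D :: "complex \<Rightarrow> nat \<Rightarrow> (nat \<Rightarrow> int) \<Rightarrow> (nat \<Rightarrow> nat) \<Rightarrow> (nat \<Rightarrow> complex mat) \<Rightarrow>
    sum_div \<Rightarrow> (nat \<Rightarrow> nat \<Rightarrow> complex fls mat) \<Rightarrow> complex \<Rightarrow> complex mat" where
  "F_D q k mu r A D U =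
     (SOME F. is_FD q k r D (A_mat k mu r A (zero_family r)) (A_mat k mu r A U) F)"

definition F_DD :: "complex \<Rightarrow> nat \<Rightarrow> (nat \<Rightarrow> int) \<Rightarrow> (nat \<Rightarrow> nat) \<Rightarrow> (nat \<Rightarrow> complex mat) \<Rightarrow>
    sum_div \<Rightarrow> sum_div \<Rightarrow> (nat \<Rightarrow> nat \<Rightarrow> complex fls mat) \<Rightarrow> complex \<Rightarrow> complex mat" where
  "F_DD q k mu r A D D' U z = minv (F_D q k mu r A D U z) * F_D q k mu r A D' U z"


section \<open>The Stokes sheaf\<close>

text \<open>Only germs at \<open>0\<close> of sectors matter below: the intersection of a sector with a disc centred at \<open>0\<close>
  is a sector with the same horizon.\<close>

definition sector :: "complex \<Rightarrow> complex set \<Rightarrow> bool" where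
  "sector q W \<longleftrightarrow> open W \<and> 0 \<notin> W \<and> (\<forall>z\<in>W. z / q \<in> W)"

definition horizon :: "complex \<Rightarrow> complex set \<Rightarrow> complex set set" where
  "horizon q W = Eq_proj q ` W"

definition flat_on :: "complex \<Rightarrow> complex set \<Rightarrow> (complex \<Rightarrow> complex) \<Rightarrow> bool" where
  "flat_on q W f \<longleftrightarrow> (\<forall>m::nat. \<forall>K. compact K \<and> K \<subseteq> W \<longrightarrow>
     bounded ((\<lambda>z. f z / z ^ m) ` {z / q ^ l | z l. z \<in> K}))"

text \<open>The class of a function over \<open>V\<close> consists of the functions agreeing with it on some sector
  with horizon \<open>V\<close>. (The sectors with horizon \<open>V\<close> are closed under binary intersections.)\<close>

definition sector_class :: "complex \<Rightarrow> complex set set \<Rightarrow> (complex \<Rightarrow> complex mat) \<Rightarrow>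
    (complex \<Rightarrow> complex mat) set" where
  "sector_class q V F = {G. \<exists>W. sector q W \<and> horizon q W = V \<and> (\<forall>z\<in>W. G z = F z)}"

text \<open>\<open>F[A\<^sub>0] = A\<^sub>0\<close> is required wherever \<open>F\<close> and \<open>\<sigma>\<^sub>q F\<close> are both given.\<close>

definition stokes_fun :: "complex \<Rightarrow> nat \<Rightarrow> (nat \<Rightarrow> int) \<Rightarrow> (nat \<Rightarrow> nat) \<Rightarrow> (nat \<Rightarrow> complex mat) \<Rightarrow>
    complex set set \<Rightarrow> (complex \<Rightarrow> complex mat) \<Rightarrow> bool" where
  "stokes_fun q k mu r A V F \<longleftrightarrow> (\<exists>W. sector q W \<and> horizon q W = V \<and>
     (\<forall>z\<in>W. F z \<in> frakG k r) \<and>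
     (\<forall>i j a b. 1 \<le> i \<and> i < j \<and> j \<le> k \<and> a < r i \<and> b < r j \<longrightarrow>
        (\<lambda>z. block r (F z) i j $$ (a, b)) holomorphic_on W \<and>
        flat_on q W (\<lambda>z. block r (F z) i j $$ (a, b))) \<and>
     (\<forall>z\<in>W. q * z \<in> W \<longrightarrow>
        gauge_fun q F (mat_fun (A_mat k mu r A (zero_family r))) z =
        mat_fun (A_mat k mu r A (zero_family r)) z))"

definition Lambda_I :: "complex \<Rightarrow> nat \<Rightarrow> (nat \<Rightarrow> int) \<Rightarrow> (nat \<Rightarrow> nat) \<Rightarrow> (nat \<Rightarrow> complex mat) \<Rightarrow>
    complex set set \<Rightarrow> (complex \<Rightarrow> complex mat) set monoid" where
  "Lambda_I q k mu r A V =
     \<lparr>carrier = {sector_class q V F | F. stokes_fun q k mu r A V F},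
      mult = (\<lambda>s t. \<Union>F\<in>s. \<Union>G\<in>t. sector_class q V (\<lambda>z. F z * G z)),
      one = sector_class q V (\<lambda>z. 1\<^sub>m (total_rank k r))\<rparr>"

definition Lambda_res :: "complex \<Rightarrow> complex set set \<Rightarrow> complex set set \<Rightarrow>
    (complex \<Rightarrow> complex mat) set \<Rightarrow> (complex \<Rightarrow> complex mat) set" where
  "Lambda_res q V V' s = (\<Union>F\<in>s. sector_class q V' F)"


section \<open>Non-abelian Cech cohomology\<close>

text \<open>\<open>G V\<close> is the group of sections over \<open>V\<close>, and \<open>res V V'\<close> the restriction from \<open>V\<close> to \<open>V' \<subseteq> V\<close>.
  Coverings are indexed by subsets of a type \<open>'i\<close>. When \<open>'i\<close> is large enough for every
  covering to be, up to renaming its indices, indexed in this way (as \<^typ>\<open>sum_div\<close> is for the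
  coverings of \<open>E\<^sub>q\<close> by sets of open subsets), this is the full direct limit.\<close>

definition open_covering :: "'a topology \<Rightarrow> 'i set \<Rightarrow> ('i \<Rightarrow> 'a set) \<Rightarrow> bool" where
  "open_covering X I V \<longleftrightarrow> (\<forall>a\<in>I. openin X (V a)) \<and> (\<Union>a\<in>I. V a) = topspace X"

type_synonym ('i, 'a, 's) cech_data = "'i set \<times> ('i \<Rightarrow> 'a set) \<times> ('i \<Rightarrow> 'i \<Rightarrow> 's)"

definition cech_cocycles :: "'a topology \<Rightarrow> ('a set \<Rightarrow> 's monoid) \<Rightarrow> ('a set \<Rightarrow> 'a set \<Rightarrow> 's \<Rightarrow> 's) \<Rightarrow>
    ('i, 'a, 's) cech_data set" where
  "cech_cocycles X G res = {(I, V, g). open_covering X I V \<and>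
     (\<forall>a\<in>I. \<forall>b\<in>I. g a b \<in> carrier (G (V a \<inter> V b))) \<and>
     (\<forall>a\<in>I. \<forall>b\<in>I. \<forall>c\<in>I. let T = V a \<inter> V b \<inter> V c in
        res (V a \<inter> V b) T (g a b) \<otimes>\<^bsub>G T\<^esub> res (V b \<inter> V c) T (g b c) = res (V a \<inter> V c) T (g a c))}"

text \<open>Two cocycles, possibly for different coverings, define the same element of the direct limit
  if they become cohomologous on a common refinement.\<close>

definition cech_rel :: "'a topology \<Rightarrow> ('a set \<Rightarrow> 's monoid) \<Rightarrow> ('a set \<Rightarrow> 'a set \<Rightarrow> 's \<Rightarrow> 's) \<Rightarrow>
    (('i, 'a, 's) cech_data \<times> ('i, 'a, 's) cech_data) set" where
  "cech_rel X G res = {((I, V, g), (I', V', g')) | I V g I' V' g'.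
     (I, V, g) \<in> cech_cocycles X G res \<and> (I', V', g') \<in> cech_cocycles X G res \<and>
     (\<exists>(J :: 'i set) W \<tau> \<tau>' c. open_covering X J W \<and>
        (\<forall>a\<in>J. \<tau> a \<in> I \<and> W a \<subseteq> V (\<tau> a) \<and> \<tau>' a \<in> I' \<and> W a \<subseteq> V' (\<tau>' a) \<and> c a \<in> carrier (G (W a))) \<and>
        (\<forall>a\<in>J. \<forall>b\<in>J. let T = W a \<inter> W b in
           res (V' (\<tau>' a) \<inter> V' (\<tau>' b)) T (g' (\<tau>' a) (\<tau>' b)) =
           inv\<^bsub>G T\<^esub> (res (W a) T (c a)) \<otimes>\<^bsub>G T\<^esub> res (V (\<tau> a) \<inter> V (\<tau> b)) T (g (\<tau> a) (\<tau> b))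
             \<otimes>\<^bsub>G T\<^esub> res (W b) T (c b)))}"

definition cech_H1 :: "'a topology \<Rightarrow> ('a set \<Rightarrow> 's monoid) \<Rightarrow> ('a set \<Rightarrow> 'a set \<Rightarrow> 's \<Rightarrow> 's) \<Rightarrow>
    ('i, 'a, 's) cech_data set set" where
  "cech_H1 X G res = cech_cocycles X G res // cech_rel X G res"


section \<open>The cocycle of a matrix\<close>

definition stokes_cocycle :: "complex \<Rightarrow> nat \<Rightarrow> (nat \<Rightarrow> int) \<Rightarrow> (nat \<Rightarrow> nat) \<Rightarrow> (nat \<Rightarrow> complex mat) \<Rightarrow>
    (nat \<Rightarrow> nat \<Rightarrow> complex fls mat) \<Rightarrow>
    (sum_div, complex set, (complex \<Rightarrow> complex mat) set) cech_data" where
  "stokes_cocycle q k mu r A U =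
     (allowed_divisors q k mu A, V_set q k,
      \<lambda>D D'. sector_class q (V_set q k D \<inter> V_set q k D') (F_DD q k mu r A D D' U))"

end

theory Submission
  imports Defs
begin

text \<open>Let \<open>S\<close> be the relation \<open>F[A\<^sub>0] = A\<^sub>U\<close> on sectors. The theorem rests on three facts about a pair of a
 cocycle \<open>d\<close> and a matrix \<open>A\<^sub>U\<close>, where \<open>d\<close> is called trivialised by \<open>U\<close> if \<open>d\<close> is the coboundary of
 solutions \<open>f\<^sub>a\<close> of \<open>S\<close> over the members of its covering.

 Every cocycle is trivialised by some \<open>U\<close> (\<open>cocycle_trivialised\<close>). Its representatives live on the
 preimages in \<open>\<complex>\<^sup>*\<close> of the overlaps, and on an annulus that contains a fundamental domain the equation
 \<open>f\<^sub>b = f\<^sub>a \<gamma>\<^sub>a\<^sub>b\<close> is solved one block diagonal at a time by the additive Cousin problem. The matrix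
 \<open>f\<^sub>a(q z) A\<^sub>0(z) f\<^sub>a(z) inverse\<close> does not depend on \<open>a\<close>, so it is holomorphic on a thinner annulus. Removing the part
 of its Laurent series that a gauge transformation holomorphic outside a disc can absorb leaves matrices
 \<open>U\<close> with Laurent series of finite principal part; this uses \<open>\<mu>\<^sub>i > \<mu>\<^sub>j\<close>. The functional equation
 then carries the solutions down to \<open>0\<close>.

 The cocycle of \<open>A\<^sub>U\<close> is trivialised by \<open>U\<close> (\<open>stokes_cocycle_trivialised\<close>). This contains the existence
 of the meromorphic gauge transformations: multiplying the block \<open>(i, j)\<close> by the theta function of
 \<open>D\<^sub>i\<^sub>j\<close> turns the block equation into a Sylvester equation with constant coefficients and a
 holomorphic right-hand side, and it is solvable coefficient by coefficient exactly because \<open>D\<close> is allowed.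

 For cocycles trivialised by \<open>U\<close> and \<open>V\<close>, being cohomologous is the same as the existence of a
 gauge transformation from \<open>A\<^sub>U\<close> to \<open>A\<^sub>V\<close> that is holomorphic on a punctured disc: the local
 transformations glue, and conversely one transformation restricts to all sectors
 (\<open>cohomologous_imp_iso\<close>, \<open>iso_imp_cohomologous\<close>). Such a transformation grows at most like a power of
 \<open>z\<close>, again by \<open>\<mu>\<^sub>i > \<mu>\<^sub>j\<close>, so it is the sum of a convergent Laurent series
 (\<open>iso_imp_isoformal\<close>). The bijection is a formal consequence.\<close>

section \<open>Laurent series on an annulus\<close>

abbreviation annulus :: "real => real => complex set" where
 "annulus r1 r2 \<equiv> {z. r1 < norm z & norm z < r2}"

lemma open_annulus: "open (annulus r1 r2)"
 by (intro open_Collect_conj open_Collect_less continuous_intros)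

lemma contour_integral_circle_radius:
 assumes f: "f holomorphic_on annulus r1 r2"
  and s: "r1 < s" "s < r2" "r1 < s'" "s' < r2" "0 < s" "0 < s'"
 shows "contour_integral (circlepath 0 s) f = contour_integral (circlepath 0 s') f"
proof (rule Cauchy_theorem_homotopic_loops[OF _ open_annulus f])
 show "homotopic_loops (annulus r1 r2) (circlepath 0 s) (circlepath 0 s')"
 proof (rule homotopic_loops_linear)
  fix t :: real
  have "norm ((1 - u) *\<^sub>R circlepath 0 s t + u *\<^sub>R circlepath 0 s' t) = (1 - u) * s + u * s'"
   if "0 <= u" "u <= 1" for u
  proof -
   have "(1 - u) *\<^sub>R circlepath 0 s t + u *\<^sub>R circlepath 0 s' t =
     complex_of_real ((1 - u) * s + u * s') * exp (2 * of_real pi * \<i> * of_real t)"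
    by (simp add: circlepath scaleR_conv_of_real algebra_simps)
   then have "norm ((1 - u) *\<^sub>R circlepath 0 s t + u *\<^sub>R circlepath 0 s' t) = \<bar>(1 - u) * s + u * s'\<bar>"
    by (simp only: norm_mult norm_of_real norm_exp_eq_Re) simp
   also have "... = (1 - u) * s + u * s'"
    using that s by simp
   finally show ?thesis .
  qed
  moreover have "r1 < (1 - u) * s + u * s'" "(1 - u) * s + u * s' < r2" if "0 <= u" "u <= 1" for u
   using convex_bound_lt[of s r2 s' "1 - u" u] convex_bound_lt[of "-s" "-r1" "-s'" "1 - u" u] that s
   by (simp_all add: algebra_simps)
  ultimately show "closed_segment (circlepath 0 s t) (circlepath 0 s' t) \<subseteq> annulus r1 r2"
   by (auto simp: closed_segment_def)
 qed auto
qed auto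

lemma annulus_Cauchy_formula:
 assumes f: "f holomorphic_on annulus r1 r2"
  and s: "r1 < s1" "s1 < norm z" "norm z < s2" "s2 < r2" "0 < s1"
 shows "contour_integral (circlepath 0 s2) (%w. f w / (w - z))
    - contour_integral (circlepath 0 s1) (%w. f w / (w - z)) = 2 * of_real pi * \<i> * f z"
proof -
 define h where "h = (%w. if w = z then deriv f z else (f w - f z) / (w - z))"
 have cont: "continuous_on (sphere 0 s) f" if "r1 < s" "s < r2" for s
  by (rule continuous_on_subset[OF holomorphic_on_imp_continuous_on[OF f]]) (use that in auto)
 have int: "(%w. g w / (w - z)) contour_integrable_on circlepath 0 s"
  if "s ~= norm z" "0 < s" "continuous_on (sphere 0 s) g" for g s
  using that by (intro contour_integrable_continuous_circlepath continuous_intros) auto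
 have hs: "contour_integral (circlepath 0 s) h =
   contour_integral (circlepath 0 s) (%w. f w / (w - z)) -
   contour_integral (circlepath 0 s) (%w. f z / (w - z))"
  if "r1 < s" "s < r2" "0 < s" "s ~= norm z" for s
 proof -
  have "contour_integral (circlepath 0 s) h =
    contour_integral (circlepath 0 s) (%w. f w / (w - z) - f z / (w - z))"
   using that by (intro contour_integral_eq) (auto simp: h_def diff_divide_distrib)
  also have "... = contour_integral (circlepath 0 s) (%w. f w / (w - z)) -
   contour_integral (circlepath 0 s) (%w. f z / (w - z))"
   using that by (intro contour_integral_diff int cont continuous_intros) auto
  finally show ?thesis .
 qed
 have "h holomorphic_on annulus r1 r2"
  unfolding h_def by (rule pole_lemma_open[OF f open_annulus])
 then have "contour_integral (circlepath 0 s2) h = contour_integral (circlepath 0 s1) h"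
  by (rule contour_integral_circle_radius[of h r1 r2]) (use s in linarith)+
 moreover have "contour_integral (circlepath 0 s2) (%w. f z / (w - z)) = 2 * of_real pi * \<i> * f z"
  using s by (intro contour_integral_unique Cauchy_integral_circlepath_simple) auto
 moreover have "contour_integral (circlepath 0 s1) (%w. f z / (w - z)) = 0"
  using s by (intro contour_integral_unique Cauchy_theorem_convex_simple[where S = "ball 0 (norm z)"])
   (auto intro!: holomorphic_intros)
 moreover have "0 < s2" "s1 < r2" "r1 < s2" using s by linarith+
 ultimately show ?thesis
  using hs[of s1] hs[of s2] s by (auto simp: algebra_simps)
qed

lemma sums_contour_integral_circle:
 assumes "0 < s" and g: "!!n. continuous_on (sphere 0 s) (g n)"
  and M: "!!n w. norm w = s ==> norm (g n w) <= M n" "summable M"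
  and K: "!!w. norm w = s ==> (%n. g n w) sums K w"
 shows "(%n. contour_integral (circlepath 0 s) (g n)) sums contour_integral (circlepath 0 s) K"
proof -
 have int: "g n contour_integrable_on circlepath 0 s" for n
  using g assms(1) by (intro contour_integrable_continuous_circlepath) (simp add: less_imp_le)
 have ul: "uniform_limit (sphere 0 s) (%n w. \<Sum>i<n. g i w) (%w. suminf (%i. g i w)) sequentially"
  by (rule Weierstrass_m_test[OF _ M(2)]) (use M(1) in auto)
 have "uniform_limit (sphere 0 s) (%n w. \<Sum>i<n. g i w) K sequentially"
  by (rule uniform_limit_cong'[THEN iffD1, OF _ _ ul]) (use K in \<open>auto simp: sums_iff\<close>)
 then have "(%n. contour_integral (circlepath 0 s) (%w. \<Sum>i<n. g i w)) \<longlonglongrightarrow> contour_integral (circlepath 0 s) K"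
  using int assms(1) by (intro contour_integral_uniform_limit_circlepath)
   (auto intro!: always_eventually contour_integrable_sum)
 then show ?thesis
  using int by (simp add: sums_def contour_integral_sum)
qed

lemma sums_outer_circle:
 assumes "continuous_on (sphere 0 s) f" "norm z < s"
 shows "(%n. contour_integral (circlepath 0 s) (%w. f w * w powi (- int n - 1)) * z ^ n)
  sums contour_integral (circlepath 0 s) (%w. f w / (w - z))"
proof -
 have s: "0 < s" using assms(2) by (meson norm_ge_zero le_less_trans)
 obtain B where B: "!!w. norm w = s ==> norm (f w) <= B"
  using compact_imp_bounded[OF compact_continuous_image[OF assms(1) compact_sphere]]
  by (force simp: bounded_iff)
 have "(%n. contour_integral (circlepath 0 s) (%w. f w * w powi (- int n - 1) * z ^ n))
  sums contour_integral (circlepath 0 s) (%w. f w / (w - z))"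
 proof (rule sums_contour_integral_circle[OF s, where M = "%n. B / s * (norm z / s) ^ n"])
  show "continuous_on (sphere 0 s) (%w. f w * w powi (- int n - 1) * z ^ n)" for n
   using s by (intro continuous_intros assms(1)) auto
  show "norm (f w * w powi (- int n - 1) * z ^ n) <= B / s * (norm z / s) ^ n"
   if "norm w = s" for n w
  proof -
   have "norm (f w * w powi (- int n - 1) * z ^ n) = norm (f w) * (1 / s * (norm z / s) ^ n)"
    using that s by (simp add: norm_mult norm_divide norm_power_int norm_power power_int_diff power_int_minus
      divide_simps power_int_add)
   also have "... <= B * (1 / s * (norm z / s) ^ n)"
    using B[OF that] s by (intro mult_right_mono) auto
   finally show ?thesis by simp
  qed
  show "summable (%n. B / s * (norm z / s) ^ n)"
   using s assms(2) by (intro summable_mult summable_geometric) auto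
  show "(%n. f w * w powi (- int n - 1) * z ^ n) sums (f w / (w - z))" if w: "norm w = s" for w
  proof -
   have w0: "w ~= 0" "w ~= z" using w s assms(2) by auto
   have "(%n. (z / w) ^ n) sums (1 / (1 - z / w))"
    using w s assms(2) by (intro geometric_sums) (simp add: norm_divide)
   then have "(%n. f w / w * (z / w) ^ n) sums (f w / w * (1 / (1 - z / w)))"
    by (rule sums_mult)
   moreover have "f w / w * (1 / (1 - z / w)) = f w / (w - z)"
    using w0 by (simp add: field_simps)
   moreover have "f w / w * (z / w) ^ n = f w * w powi (- int n - 1) * z ^ n" for n
    using w0 by (simp add: power_int_diff power_int_minus divide_simps power_int_add)
   ultimately show ?thesis by (simp only:)
  qed
 qed
 then show ?thesis
  using s assms(1) by (subst (asm) contour_integral_rmul)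
   (auto intro!: contour_integrable_continuous_circlepath continuous_intros)
qed

lemma sums_inner_circle:
 assumes "continuous_on (sphere 0 s) f" "s < norm z" "0 < s"
 shows "(%n. contour_integral (circlepath 0 s) (%w. f w * w powi int n) * z powi (- int n - 1))
  sums (- contour_integral (circlepath 0 s) (%w. f w / (w - z)))"
proof -
 obtain B where B: "!!w. norm w = s ==> norm (f w) <= B"
  using compact_imp_bounded[OF compact_continuous_image[OF assms(1) compact_sphere]]
  by (force simp: bounded_iff)
 have z: "z ~= 0" using assms by auto
 have "(%n. contour_integral (circlepath 0 s) (%w. f w * w powi int n * z powi (- int n - 1)))
  sums contour_integral (circlepath 0 s) (%w. - (f w / (w - z)))"
 proof (rule sums_contour_integral_circle[OF assms(3), where M = "%n. B / norm z * (s / norm z) ^ n"])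
  show "continuous_on (sphere 0 s) (%w. f w * w powi int n * z powi (- int n - 1))" for n
   using assms by (intro continuous_intros) auto
  show "norm (f w * w powi int n * z powi (- int n - 1)) <= B / norm z * (s / norm z) ^ n"
   if "norm w = s" for n w
  proof -
   have "norm (f w * w powi int n * z powi (- int n - 1)) = norm (f w) * (1 / norm z * (s / norm z) ^ n)"
    using that assms z by (simp add: norm_mult norm_divide norm_power_int norm_power power_int_diff power_int_minus
      divide_simps power_int_add)
   also have "... <= B * (1 / norm z * (s / norm z) ^ n)"
    using B[OF that] assms by (intro mult_right_mono) auto
   finally show ?thesis by simp
  qed
  show "summable (%n. B / norm z * (s / norm z) ^ n)"
   using assms z by (intro summable_mult summable_geometric) auto
  show "(%n. f w * w powi int n * z powi (- int n - 1)) sums (- (f w / (w - z)))" if w: "norm w = s" for w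
  proof -
   have w0: "w ~= z" using w assms(2) by auto
   have "(%n. (w / z) ^ n) sums (1 / (1 - w / z))"
    using w z assms by (intro geometric_sums) (simp add: norm_divide)
   then have "(%n. f w / z * (w / z) ^ n) sums (f w / z * (1 / (1 - w / z)))"
    by (rule sums_mult)
   moreover have "f w / z * (1 / (1 - w / z)) = - (f w / (w - z))"
    using w0 z by (simp add: divide_simps) (simp add: algebra_simps)
   moreover have "f w / z * (w / z) ^ n = f w * w powi int n * z powi (- int n - 1)" for n
    using w0 z by (simp add: power_int_diff power_int_minus divide_simps power_int_add)
   ultimately show ?thesis by simp
  qed
 qed
 moreover have "contour_integral (circlepath 0 s) (%w. - (f w / (w - z))) =
   - contour_integral (circlepath 0 s) (%w. f w / (w - z))"
  by (rule contour_integral_neg)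
 moreover have "contour_integral (circlepath 0 s) (%w. f w * w powi int n * z powi (- int n - 1)) =
   contour_integral (circlepath 0 s) (%w. f w * w powi int n) * z powi (- int n - 1)" for n
  using assms by (intro contour_integral_rmul contour_integrable_continuous_circlepath continuous_intros) auto
 ultimately show ?thesis by simp
qed

lemma has_sum_int_split:
 fixes f :: "int => complex"
 assumes "((%n. f (int n)) has_sum a) UNIV" "((%n. f (- int n - 1)) has_sum b) UNIV"
 shows "(f has_sum (a + b)) UNIV"
proof -
 have 1: "(f has_sum a) {0..}"
  using assms(1) by (subst (asm) has_sum_reindex_bij_witness[where i = nat and j = int and T = "{0..}" and h = f])
   auto
 have 2: "(f has_sum b) {..<0}"
  using assms(2) by (subst (asm) has_sum_reindex_bij_witness[where i = "%n. nat (- n - 1)"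
     and j = "%n. - int n - 1" and T = "{..<0}" and h = f]) auto
 have "(f has_sum (a + b)) ({0..} \<union> {..<0})"
  by (rule has_sum_Un_disjoint[OF 1 2]) auto
 also have "{0..} \<union> {..<0} = (UNIV :: int set)" by auto
 finally show ?thesis .
qed

text \<open>Cauchy's theorem for homotopic circles makes the coefficients independent of the radius; the integrals over an outer and an inner circle give the nonnegative and the negative powers.\<close>

theorem Laurent_expansion_annulus:
 assumes f: "f holomorphic_on annulus r1 r2" and r: "0 <= r1" "r1 < r2"
 obtains c :: "int => complex"
 where "!!z. z \<in> annulus r1 r2 ==> ((%n. c n * z powi n) has_sum f z) UNIV"
proof
 define I where "I = (%s n. contour_integral (circlepath 0 s) (%w. f w * w powi (- n - 1)))"
 define s0 where "s0 = (r1 + r2) / 2"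
 define c where "c = (%n. I s0 n / (2 * of_real pi * \<i>))"
 have s0: "r1 < s0" "s0 < r2" "0 < s0" using r by (auto simp: s0_def)
 have I: "I s n = 2 * of_real pi * \<i> * c n" if "r1 < s" "s < r2" for s n
 proof -
  have "I s n = I s0 n" unfolding I_def
   by (rule contour_integral_circle_radius[of _ r1 r2])
    (use f that s0 r in \<open>auto intro!: holomorphic_intros\<close>)
  then show ?thesis by (simp add: c_def)
 qed
 have cont: "continuous_on (sphere 0 s) f" if "r1 < s" "s < r2" for s
  by (rule continuous_on_subset[OF holomorphic_on_imp_continuous_on[OF f]]) (use that in auto)
 fix z assume z: "z \<in> annulus r1 r2"
 from z have "r1 < norm z" "norm z < r2" by auto
 from dense[OF this(1)] dense[OF this(2)] obtain t1 t2
  where t: "r1 < t1" "t1 < norm z" "norm z < t2" "t2 < r2" by blast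
 from dense[OF t(1)] dense[OF t(4)] obtain s1 s2 where "r1 < s1" "s1 < t1" "t2 < s2" "s2 < r2" by blast
 with t have s1: "r1 < s1" "s1 < t1" "t1 < norm z" and s2: "norm z < t2" "t2 < s2" "s2 < r2" by auto
 have pos: "0 < s1" "0 < t1" "0 < t2" using s1 s2 r norm_ge_zero[of z] by linarith+
 let ?J1 = "contour_integral (circlepath 0 s1)" and ?J2 = "contour_integral (circlepath 0 s2)"
 have out: "(%n. 2 * of_real pi * \<i> * c (int n) * w ^ n) sums ?J2 (%u. f u / (u - w))" if "norm w < s2" for w
  using sums_outer_circle[OF cont that] s2 z I[of s2] by (simp add: I_def)
 have inn: "(%n. 2 * of_real pi * \<i> * c (- int n - 1) * w powi (- int n - 1)) sums (- ?J1 (%u. f u / (u - w)))"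
  if "s1 < norm w" for w
 proof -
  have "I s1 (- int n - 1) = ?J1 (%w. f w * w powi int n)" for n
   by (simp add: I_def)
  then show ?thesis
   using sums_inner_circle[OF cont that pos(1)] s1 z I[of s1 "- int _ - 1"] by simp
 qed
 have "summable (%n. 2 * of_real pi * \<i> * c (int n) * of_real t2 ^ n)"
  using out[of "of_real t2"] s2 pos by (auto simp: sums_iff)
 then have "summable (%n. norm (2 * of_real pi * \<i> * c (int n) * z ^ n))"
  using s2 z by (intro powser_insidea[where x = "of_real t2"]) auto
 then have *: "((%n. 2 * of_real pi * \<i> * c (int n) * z ^ n) has_sum ?J2 (%u. f u / (u - z))) UNIV"
  using out[of z] s2 by (intro norm_summable_imp_has_sum) auto
 have "summable (%n. 2 * of_real pi * \<i> * c (- int n - 1) * of_real t1 powi (- int n - 1))"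
  using inn[of "of_real t1"] s1 pos by (auto simp: sums_iff)
 then have "summable (%n. of_real t1 * (2 * of_real pi * \<i> * c (- int n - 1) * of_real t1 powi (- int n - 1)))"
  by (rule summable_mult)
 also have "(%n. of_real t1 * (2 * of_real pi * \<i> * c (- int n - 1) * of_real t1 powi (- int n - 1))) =
   (%n. 2 * of_real pi * \<i> * c (- int n - 1) * (1 / of_real t1) ^ n)"
  using pos by (auto simp: power_int_diff power_int_minus divide_simps power_int_add)
 finally have "summable (%n. norm (2 * of_real pi * \<i> * c (- int n - 1) * (1 / z) ^ n))"
  using s1 z pos by (intro powser_insidea[where x = "1 / of_real t1"]) (auto simp: norm_divide divide_simps)
 then have "summable (%n. norm (1 / z) * norm (2 * of_real pi * \<i> * c (- int n - 1) * (1 / z) ^ n))"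
  by (rule summable_mult)
 also have "(%n. norm (1 / z) * norm (2 * of_real pi * \<i> * c (- int n - 1) * (1 / z) ^ n)) =
   (%n. norm (2 * of_real pi * \<i> * c (- int n - 1) * z powi (- int n - 1)))"
  using s1 pos by (intro ext) (auto simp: norm_mult norm_divide norm_power norm_power_int power_int_diff power_int_minus divide_simps power_int_add)
 finally have **: "((%n. 2 * of_real pi * \<i> * c (- int n - 1) * z powi (- int n - 1)) has_sum
   (- ?J1 (%u. f u / (u - z)))) UNIV"
  using inn[of z] s1 by (intro norm_summable_imp_has_sum) auto
 have "((%n. 2 * of_real pi * \<i> * c n * z powi n) has_sum
   (?J2 (%u. f u / (u - z)) + (- ?J1 (%u. f u / (u - z))))) UNIV"
  by (rule has_sum_int_split) (use * ** in simp_all)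
 also have "?J2 (%u. f u / (u - z)) + (- ?J1 (%u. f u / (u - z))) = 2 * of_real pi * \<i> * f z"
  using annulus_Cauchy_formula[OF f, of s1 z s2] s1 s2 pos by simp
 finally have "((%n. (2 * of_real pi * \<i>) * (c n * z powi n)) has_sum (2 * of_real pi * \<i> * f z)) UNIV"
  by (simp add: mult_ac)
 then show "((%n. c n * z powi n) has_sum f z) UNIV"
  by (subst (asm) has_sum_cmult_right_iff) auto
qed

lemma Laurent_series_holomorphic:
 fixes c :: "int => complex"
 assumes c: "!!z. z \<in> annulus r1 r2 ==> (%n. c n * z powi n) summable_on UNIV" and "0 <= r1"
 shows "(%z. \<Sum>\<^sub>\<infinity>n. c n * z powi n) holomorphic_on annulus r1 r2"
proof -
 define P where "P = (%w. \<Sum>n. c (int n) * w ^ n)"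
 define N where "N = (%w. \<Sum>n. c (- int n - 1) * w ^ n)"
 have sub: "(%n. c n * z powi n) summable_on A" if "z \<in> annulus r1 r2" for z A
  by (rule summable_on_subset_banach[OF c[OF that]]) auto
 have sP: "(%n. c (int n) * z powi int n) summable_on UNIV" if "z \<in> annulus r1 r2" for z
  using summable_on_reindex[of int UNIV "%n. c n * z powi n"] sub[OF that] by (simp add: o_def)
 have sN: "(%n. c (- int n - 1) * z powi (- int n - 1)) summable_on UNIV" if "z \<in> annulus r1 r2" for z
  using summable_on_reindex[of "%n. - int n - 1" UNIV "%n. c n * z powi n"] sub[OF that]
  by (simp add: o_def inj_def)
 have cP: "summable (%n. norm (c (int n) * w ^ n))" if w: "norm w < r2" "r1 < r2" for w
 proof -
  obtain t where t: "max r1 (norm w) < t" "t < r2" using w dense[of "max r1 (norm w)" r2] by auto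
  have "0 <= t" using t norm_ge_zero[of w] by linarith
  then have "summable (%n. c (int n) * of_real t ^ n)"
   using sP[of "of_real t"] t by (intro summable_on_imp_summable) auto
  then show ?thesis
   using t by (intro powser_insidea[where x = "of_real t"]) auto
 qed
 have cN: "summable (%n. norm (c (- int n - 1) * w ^ n))" if w: "norm w * r1 < 1" "norm w * r2 > 1" for w
 proof -
  have w0: "w ~= 0" using w by auto
  have *: "r1 < 1 / norm w" "1 / norm w < r2" using w w0 by (simp_all add: field_simps)
  obtain t where t: "r1 < t" "t < 1 / norm w" using * dense by blast
  have t0: "0 < t" using t assms(2) by auto
  have "summable (%n. of_real t * (c (- int n - 1) * of_real t powi (- int n - 1)))"
   using sN[of "of_real t"] t * t0 by (intro summable_mult) (auto intro!: summable_on_imp_summable)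
  also have "(%n. of_real t * (c (- int n - 1) * of_real t powi (- int n - 1))) = (%n. c (- int n - 1) * (1 / of_real t) ^ n)"
   using t0 by (auto simp: power_int_diff power_int_minus divide_simps power_int_add)
  finally show ?thesis
   using t t0 w0 by (intro powser_insidea[where x = "1 / of_real t"]) (auto simp: norm_divide field_simps)
 qed
 have eq: "(\<Sum>\<^sub>\<infinity>n. c n * z powi n) = P z + N (1 / z) / z" if z: "z \<in> annulus r1 r2" for z
 proof -
  have z0: "z ~= 0" using z assms(2) by auto
  have nz: "norm (1 / z) * r1 < 1" "norm (1 / z) * r2 > 1" using z z0 by (auto simp: norm_divide field_simps)
  have "((%n. c (int n) * z ^ n) has_sum P z) UNIV"
   unfolding P_def using cP[of z] z by (intro norm_summable_imp_has_sum summable_sums) (auto dest: summable_norm_cancel)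
  then have 1: "((%n. c (int n) * z powi int n) has_sum P z) UNIV" by simp
  have "((%n. c (- int n - 1) * (1 / z) ^ n) has_sum N (1 / z)) UNIV"
   unfolding N_def using cN[OF nz] by (intro norm_summable_imp_has_sum summable_sums) (auto dest: summable_norm_cancel)
  then have "((%n. c (- int n - 1) * (1 / z) ^ n * (1 / z)) has_sum N (1 / z) * (1 / z)) UNIV"
   by (rule has_sum_cmult_left)
  also have "(%n. c (- int n - 1) * (1 / z) ^ n * (1 / z)) = (%n. c (- int n - 1) * z powi (- int n - 1))"
   using z0 by (auto simp: power_int_diff power_int_minus divide_simps power_int_add)
  finally have 2: "((%n. c (- int n - 1) * z powi (- int n - 1)) has_sum N (1 / z) * (1 / z)) UNIV" .
  show ?thesis
   using has_sum_int_split[OF 1 2] by (simp add: infsumI)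
 qed
 show ?thesis
 proof (cases "r1 < r2")
  case True
  have "P holomorphic_on ball 0 r2"
   by (rule power_series_holomorphic[where a = "%n. c (int n)"])
    (use cP True in \<open>auto simp: P_def intro!: summable_sums intro: summable_norm_cancel\<close>)
  then have P: "P holomorphic_on annulus r1 r2"
   by (rule holomorphic_on_subset) auto
  have "(%z. N (1 / z) / z) holomorphic_on annulus r1 r2"
  proof (rule holomorphic_on_subset[of _ "\<Union>t\<in>{r1<..<r2}. annulus t r2"])
   show "(%z. N (1 / z) / z) holomorphic_on (\<Union>t\<in>{r1<..<r2}. annulus t r2)"
   proof (rule holomorphic_on_UN_open)
    fix t assume t: "t \<in> {r1<..<r2}"
    have t0: "0 < t" using t assms(2) by auto
    have *: "norm w * r1 < 1" if "norm w < 1 / t" for w :: complex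
    proof -
     have "norm w * r1 <= norm w * t" using t by (intro mult_left_mono) auto
     then show ?thesis using that t0 by (simp add: field_simps)
    qed
    have cN': "summable (%n. c (- int n - 1) * w ^ n)" if w: "norm w < 1 / t" for w
    proof -
     obtain u where u: "max (norm w) (1 / r2) < u" "u < 1 / t"
     proof -
      have "max (norm w) (1 / r2) < 1 / t" using w t t0 by (auto simp: field_simps max_def)
      from dense[OF this] that show thesis by blast
     qed
     have u0: "0 < u" using u by (meson max_less_iff_conj norm_ge_zero le_less_trans)
     have ur: "norm (complex_of_real u) * r2 > 1" using u u0 t t0 by (simp add: field_simps)
     have "summable (%n. c (- int n - 1) * of_real u ^ n)"
      by (rule summable_norm_cancel[OF cN]) (use ur *[of "of_real u"] u u0 in auto)
     then show ?thesis
      by (rule summable_norm_cancel[OF powser_insidea[where x = "of_real u"]]) (use u u0 in auto)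
    qed
    have N: "N holomorphic_on ball 0 (1 / t)"
     by (rule power_series_holomorphic[where a = "%n. c (- int n - 1)"])
      (use cN' in \<open>auto simp: N_def intro!: summable_sums\<close>)
    have "(%z. N (1 / z)) holomorphic_on annulus t r2"
     using t0 by (intro holomorphic_on_compose_gen[OF _ N, unfolded o_def] holomorphic_intros)
      (auto simp: norm_divide divide_simps)
    then show "(%z. N (1 / z) / z) holomorphic_on annulus t r2"
     using t0 by (intro holomorphic_intros) auto
   qed (rule open_annulus)
  next
   show "annulus r1 r2 \<subseteq> (\<Union>t\<in>{r1<..<r2}. annulus t r2)"
    using dense by fastforce
  qed
  with P have "(%z. P z + N (1 / z) / z) holomorphic_on annulus r1 r2"
   by (rule holomorphic_on_add)
  then show ?thesis
   by (rule holomorphic_transform) (use eq in auto)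
 next
  case False
  then have "annulus r1 r2 = {}" by auto
  then show ?thesis by (simp only: holomorphic_on_empty)
 qed
qed

section \<open>A theta function\<close>

locale q_base =
 fixes q :: complex
 assumes q: "norm q > 1"
begin

lemma q0 [simp]: "q ~= 0" using q by auto

lemma norm_q_pos [simp]: "0 < norm q" by simp

lemma q_pow_neq_1: "n > 0 ==> q ^ n ~= 1"
 using one_less_power[OF q, of n] by (metis norm_one norm_power less_irrefl)

text \<open>The entire function \<open>\<Sum> c\<^sub>n w\<^sup>n\<close> with these coefficients satisfies \<open>e(q w) = (1 - w) e(w)\<close>; its product form would be \<open>\<Prod>\<^sub>m (1 - w / q\<^sup>m)\<close> over \<open>m > 0\<close>. The series makes holomorphy and the functional equation immediate.\<close>

definition euler_coeff :: "nat => complex" where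
 "euler_coeff n = (\<Prod>l=1..n. - 1 / (q ^ l - 1))"

definition euler_fun :: "complex => complex" where
 "euler_fun w = (\<Sum>n. euler_coeff n * w ^ n)"

lemma euler_coeff_Suc: "euler_coeff (Suc n) * (q ^ Suc n - 1) = - euler_coeff n"
 using q_pow_neq_1[of "Suc n"] by (simp add: euler_coeff_def field_simps)

lemma euler_summable: "summable (%n. euler_coeff n * w ^ n)"
proof -
 obtain N where "norm q ^ N > 2 * norm w + 1"
  using real_arch_pow[OF q] by blast
 then have N: "norm q ^ n >= 2 * norm w + 1" if "n >= N" for n
  using power_increasing[OF that less_imp_le[OF q]] by linarith
 show ?thesis
 proof (rule summable_ratio_test[of "1 / 2" N])
  fix n assume n: "N <= n"
  have "norm q ^ Suc n - 1 <= norm (q ^ Suc n - 1)"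
   by (metis norm_one norm_power norm_triangle_ineq2)
  then have big: "2 * norm w <= norm (q ^ Suc n - 1)"
   using N[of "Suc n"] n by simp
  have ne: "norm (q ^ Suc n - 1) > 0" using q_pow_neq_1[of "Suc n"] by simp
  have "euler_coeff (Suc n) = - euler_coeff n / (q ^ Suc n - 1)"
   using euler_coeff_Suc[of n] q_pow_neq_1[of "Suc n"] by (subst eq_divide_eq) (simp del: power_Suc)
  then have "norm (euler_coeff (Suc n) * w ^ Suc n) = norm (euler_coeff n * w ^ n) * (norm w / norm (q ^ Suc n - 1))"
   by (simp add: norm_mult norm_divide del: power_Suc)
  also have "... <= norm (euler_coeff n * w ^ n) * (1 / 2)"
   using big ne by (intro mult_left_mono) (auto simp: divide_simps)
  finally show "norm (euler_coeff (Suc n) * w ^ Suc n) <= 1 / 2 * norm (euler_coeff n * w ^ n)"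
   by simp
 qed simp
qed

lemma euler_fun_holomorphic: "euler_fun holomorphic_on A"
proof -
 have "euler_fun holomorphic_on ball 0 r" for r
  by (rule power_series_holomorphic[where a = euler_coeff])
   (simp add: euler_fun_def summable_sums[OF euler_summable])
 then have "euler_fun holomorphic_on (\<Union>r. ball 0 r)"
  by (intro holomorphic_on_UN_open) auto
 moreover have "(\<Union>r. ball 0 r) = (UNIV :: complex set)"
  by (auto intro: gt_ex)
 ultimately show ?thesis
  using holomorphic_on_subset by blast
qed

lemma euler_fun_0 [simp]: "euler_fun 0 = 1"
 using powser_zero[of euler_coeff] by (simp add: euler_fun_def euler_coeff_def)

lemma euler_fun_q: "euler_fun (q * w) = (1 - w) * euler_fun w"
proof -
 let ?c = euler_coeff
 have s1: "(%n. ?c n * w ^ n) sums euler_fun w" and s2: "(%n. ?c n * (q * w) ^ n) sums euler_fun (q * w)"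
  by (simp_all add: euler_fun_def summable_sums[OF euler_summable])
 have "(%n. ?c (Suc n) * (q * w) ^ Suc n) sums (euler_fun (q * w) - 1)"
  using s2 sums_Suc_iff[of "%n. ?c n * (q * w) ^ n" "euler_fun (q * w) - 1"]
  by (simp add: euler_coeff_def)
 moreover have "(%n. ?c (Suc n) * w ^ Suc n) sums (euler_fun w - 1)"
  using s1 sums_Suc_iff[of "%n. ?c n * w ^ n" "euler_fun w - 1"]
  by (simp add: euler_coeff_def)
 ultimately have "(%n. ?c (Suc n) * (q * w) ^ Suc n - ?c (Suc n) * w ^ Suc n) sums
   ((euler_fun (q * w) - 1) - (euler_fun w - 1))"
  by (rule sums_diff)
 moreover have "?c (Suc n) * (q * w) ^ Suc n - ?c (Suc n) * w ^ Suc n = - w * (?c n * w ^ n)" for n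
 proof -
  have "?c (Suc n) * (q * w) ^ Suc n - ?c (Suc n) * w ^ Suc n = (?c (Suc n) * (q ^ Suc n - 1)) * w ^ Suc n"
   by (simp only: power_mult_distrib) (simp add: algebra_simps)
  then show ?thesis by (simp only: euler_coeff_Suc) simp
 qed
 ultimately have "(%n. - w * (?c n * w ^ n)) sums (euler_fun (q * w) - euler_fun w)"
  by simp
 moreover have "(%n. - w * (?c n * w ^ n)) sums (- w * euler_fun w)"
  by (rule sums_mult[OF s1])
 ultimately have "euler_fun (q * w) - euler_fun w = - w * euler_fun w"
  using sums_unique2 by blast
 then show ?thesis by (simp add: algebra_simps)
qed

lemma tendsto_divide_q_power: "(%n. w / q ^ n) \<longlonglongrightarrow> 0"
proof -
 have "(%n. w * (1 / q) ^ n) \<longlonglongrightarrow> w * 0"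
  using q by (intro tendsto_intros LIMSEQ_power_zero) (simp add: norm_divide)
 then show ?thesis by (simp add: power_one_over field_simps)
qed

text \<open>A zero that is not a positive power of \<open>q\<close> would propagate to all \<open>w / q\<^sup>n\<close>, contradicting the value 1 at \<open>0\<close>.\<close>

lemma euler_fun_zeroD:
 assumes "euler_fun w = 0"
 shows "\<exists>m>0. w = q ^ m"
proof (rule ccontr)
 assume no: "\<not> ?thesis"
 have "euler_fun (w / q ^ n) = 0" for n
 proof (induction n)
  case (Suc n)
  have "w / q ^ n = q * (w / q ^ Suc n)" by simp
  then have "(1 - w / q ^ Suc n) * euler_fun (w / q ^ Suc n) = 0"
   using Suc euler_fun_q[of "w / q ^ Suc n"] by simp
  moreover have "w / q ^ Suc n ~= 1" using no by (auto simp: field_simps)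
  ultimately show ?case by simp
 qed (use assms in simp)
 moreover have "(%n. euler_fun (w / q ^ n)) \<longlonglongrightarrow> euler_fun 0"
  using holomorphic_on_imp_continuous_on[OF euler_fun_holomorphic[of UNIV]]
  by (intro isCont_tendsto_compose[OF _ tendsto_divide_q_power]) (simp add: continuous_on_eq_continuous_at)
 ultimately show False by (simp add: LIMSEQ_const_iff)
qed

lemma euler_fun_zero: "m > 0 ==> euler_fun (q ^ m) = 0"
proof (induction m)
 case (Suc m)
 then show ?case using euler_fun_q[of "q ^ m"] by (cases "m = 0") auto
qed simp

text \<open>By the equation of the Euler function, \<open>\<Theta>(q z) = - z \<Theta>(z)\<close>, and the zeros are simple and form the group \<open>q\<^sup>\<int>\<close>.\<close>

definition Theta :: "complex => complex" where
 "Theta z = (1 - 1 / z) * euler_fun z * euler_fun (1 / z)"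

lemma Theta_holomorphic: "Theta holomorphic_on (- {0})"
proof -
 have "(%z. euler_fun (1 / z)) holomorphic_on (- {0})"
  by (intro holomorphic_on_compose_gen[OF _ euler_fun_holomorphic[of UNIV], unfolded o_def] holomorphic_intros) auto
 then have "(%z. (1 - 1 / z) * euler_fun z * euler_fun (1 / z)) holomorphic_on (- {0})"
  by (intro holomorphic_intros euler_fun_holomorphic) auto
 then show ?thesis unfolding Theta_def .
qed

lemma Theta_q: "z ~= 0 ==> Theta (q * z) = - z * Theta z"
proof -
 assume z: "z ~= 0"
 have "euler_fun (1 / z) = (1 - 1 / (q * z)) * euler_fun (1 / (q * z))"
  using euler_fun_q[of "1 / (q * z)"] z by simp
 then have "Theta (q * z) = (1 - z) * euler_fun z * euler_fun (1 / z)"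
  by (simp add: Theta_def euler_fun_q mult_ac)
 also have "... = - z * Theta z"
  using z by (simp add: Theta_def field_simps)
 finally show ?thesis .
qed

lemma Theta_zero_iff:
 assumes "z ~= 0"
 shows "Theta z = 0 \<longleftrightarrow> (\<exists>m::int. z = q powi m)"
proof
 assume "Theta z = 0"
 then consider "z = 1" | "euler_fun z = 0" | "euler_fun (1 / z) = 0"
  using assms by (auto simp: Theta_def field_simps)
 then show "\<exists>m::int. z = q powi m"
 proof cases
  case 1 then show ?thesis by (intro exI[of _ 0]) simp
 next
  case 2 then show ?thesis using euler_fun_zeroD[of z] by (metis power_int_of_nat)
 next
  case 3
  then obtain m where "1 / z = q ^ m" using euler_fun_zeroD[of "1 / z"] by auto
  then have "z = q powi (- int m)" using assms by (simp add: power_int_minus field_simps)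
  then show ?thesis by blast
 qed
next
 assume "\<exists>m::int. z = q powi m"
 then obtain m :: int where m: "z = q powi m" by blast
 consider "m = 0" | "m > 0" | "m < 0" by linarith
 then show "Theta z = 0"
 proof cases
  case 1 then show ?thesis by (simp add: m Theta_def)
 next
  case 2
  then have "z = q ^ nat m" by (simp add: m power_int_def)
  then show ?thesis using euler_fun_zero[of "nat m"] 2 by (simp add: Theta_def)
 next
  case 3
  then have "1 / z = q ^ nat (- m)" by (simp add: m power_int_def field_simps)
  then show ?thesis using euler_fun_zero[of "nat (- m)"] 3 by (simp add: Theta_def)
 qed
qed

lemma deriv_Theta_q: "z ~= 0 ==> Theta z = 0 ==> q * deriv Theta (q * z) = - z * deriv Theta z"
proof -
 assume z: "z ~= 0" "Theta z = 0"
 have D: "(Theta has_field_derivative deriv Theta w) (at w)" if "w ~= 0" for w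
  using holomorphic_derivI[OF Theta_holomorphic _ , of w] that by auto
 have "((%w. Theta (q * w)) has_field_derivative deriv Theta (q * z) * q) (at z)"
  by (rule DERIV_chain2[OF D]) (use z in \<open>auto intro!: derivative_eq_intros\<close>)
 moreover have "((%w. - w * Theta w) has_field_derivative (- 1 * Theta z + deriv Theta z * - z)) (at z)"
  by (intro DERIV_mult D derivative_eq_intros z) (use z in auto)
 moreover have "((%w. Theta (q * w)) has_field_derivative d) (at z) \<longleftrightarrow>
   ((%w. - w * Theta w) has_field_derivative d) (at z)" for d
  by (intro DERIV_cong_ev refl) (use z Theta_q in \<open>auto intro!: eventually_mono[OF t1_space_nhds[of z 0]]\<close>)
 ultimately have "deriv Theta (q * z) * q = - 1 * Theta z + deriv Theta z * - z"
  using DERIV_unique by blast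
 then show ?thesis using z by (simp add: mult_ac)
qed

lemma deriv_Theta_1: "deriv Theta 1 ~= 0"
proof -
 have e1: "euler_fun 1 ~= 0"
  using euler_fun_zeroD[of 1] q_pow_neq_1 by metis
 have hol: "(%z. euler_fun z * euler_fun (1 / z)) holomorphic_on (- {0})"
  by (intro holomorphic_on_compose_gen[OF _ euler_fun_holomorphic[of UNIV], unfolded o_def]
    holomorphic_intros euler_fun_holomorphic) auto
 then obtain d where d: "((%z. euler_fun z * euler_fun (1 / z)) has_field_derivative d) (at 1)"
  using holomorphic_derivI[OF hol, of 1] by (auto simp: open_Compl)
 have "((%z. (1 - 1 / z) * (euler_fun z * euler_fun (1 / z))) has_field_derivative
   1 * (euler_fun 1 * euler_fun (1 / 1)) + d * (1 - 1 / 1)) (at 1)"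
  by (intro DERIV_mult d) (auto intro!: derivative_eq_intros)
 then have "(Theta has_field_derivative euler_fun 1 * euler_fun 1) (at 1)"
  by (simp add: Theta_def[abs_def] mult.assoc)
 then show ?thesis using e1 by (simp add: DERIV_imp_deriv)
qed

lemma deriv_Theta_nonzero: "deriv Theta (q powi m) ~= 0"
proof (induction m rule: int_induct[where k = 0])
 case base then show ?case by (simp add: deriv_Theta_1)
next
 case (step1 i)
 have "q * deriv Theta (q * q powi i) = - (q powi i) * deriv Theta (q powi i)"
  by (rule deriv_Theta_q) (use Theta_zero_iff in auto)
 then show ?case using step1 by (auto simp: power_int_add mult.commute)
next
 case (step2 i)
 have "q * deriv Theta (q * q powi (i - 1)) = - (q powi (i - 1)) * deriv Theta (q powi (i - 1))"
  by (rule deriv_Theta_q) (use Theta_zero_iff in auto)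
 moreover have "q * q powi (i - 1) = q powi i" by (simp add: power_int_diff)
 ultimately show ?case using step2 by auto
qed

end

section \<open>Linear equations with matrix coefficients\<close>

type_synonym array = "nat => nat => complex"

definition lm :: "nat => array => array => array" where
 "lm a A X = (%x y. \<Sum>x'<a. A x x' * X x' y)"

definition rm :: "nat => array => array => array" where
 "rm b X B = (%x y. \<Sum>y'<b. X x y' * B y' y)"

definition nrm :: "nat => nat => array => real" where
 "nrm a b X = (\<Sum>x<a. \<Sum>y<b. norm (X x y))"

definition inverse_arrays :: "nat => array => array => bool" where
 "inverse_arrays a A A' \<longleftrightarrow> (\<forall>x<a. \<forall>y<a. lm a A A' x y = (if x = y then 1 else 0) & lm a A' A x y = (if x = y then 1 else 0))"

lemma nrm_nonneg: "0 <= nrm a b X"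
 by (simp add: nrm_def sum_nonneg)

lemma nrm_entry: "x < a ==> y < b ==> norm (X x y) <= nrm a b X"
proof -
 assume "x < a" "y < b"
 then have "norm (X x y) <= (\<Sum>y<b. norm (X x y))"
  by (intro member_le_sum) auto
 also have "... <= nrm a b X"
  unfolding nrm_def using \<open>x < a\<close> by (intro member_le_sum[of x "{..<a}" "%x. \<Sum>y<b. norm (X x y)"]) (auto intro: sum_nonneg)
 finally show ?thesis .
qed

lemma nrm_cong: "(!!x y. x < a ==> y < b ==> X x y = Y x y) ==> nrm a b X = nrm a b Y"
 by (simp add: nrm_def)

lemma nrm_add: "nrm a b (%x y. X x y + Y x y) <= nrm a b X + nrm a b Y"
 unfolding nrm_def sum.distrib[symmetric] by (intro sum_mono norm_triangle_ineq)

lemma nrm_scale: "nrm a b (%x y. c * X x y) = norm c * nrm a b X"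
 by (simp add: nrm_def norm_mult sum_distrib_left)

lemma nrm_lm: "nrm a b (lm a A X) <= nrm a a A * nrm a b X"
proof -
 have "nrm a b (lm a A X) <= (\<Sum>x<a. \<Sum>y<b. \<Sum>x'<a. norm (A x x') * norm (X x' y))"
  unfolding nrm_def lm_def by (intro sum_mono order_trans[OF norm_sum]) (simp add: norm_mult)
 also have "... = (\<Sum>x<a. \<Sum>x'<a. norm (A x x') * (\<Sum>y<b. norm (X x' y)))"
  by (subst sum.swap) (simp add: sum_distrib_left)
 also have "... <= (\<Sum>x<a. \<Sum>x'<a. norm (A x x') * nrm a b X)"
  unfolding nrm_def
  by (intro sum_mono mult_left_mono member_le_sum[of _ "{..<a}" "%x. \<Sum>y<b. norm (X x y)"]) (auto intro: sum_nonneg)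
 also have "... = nrm a a A * nrm a b X"
  by (simp add: nrm_def sum_distrib_right)
 finally show ?thesis .
qed

lemma nrm_rm: "nrm a b (rm b X B) <= nrm a b X * nrm b b B"
proof -
 have "nrm a b (rm b X B) <= (\<Sum>x<a. \<Sum>y<b. \<Sum>y'<b. norm (X x y') * norm (B y' y))"
  unfolding nrm_def rm_def by (intro sum_mono order_trans[OF norm_sum]) (simp add: norm_mult)
 also have "... = (\<Sum>x<a. \<Sum>y'<b. norm (X x y') * (\<Sum>y<b. norm (B y' y)))"
  by (subst sum.swap[of _ "{..<b}" "{..<b}"]) (simp add: sum_distrib_left)
 also have "... <= (\<Sum>x<a. \<Sum>y'<b. norm (X x y') * nrm b b B)"
  unfolding nrm_def
  by (intro sum_mono mult_left_mono member_le_sum[of _ "{..<b}" "%y'. \<Sum>y<b. norm (B y' y)"]) (auto intro: sum_nonneg)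
 also have "... = nrm a b X * nrm b b B"
  by (simp add: nrm_def sum_distrib_right)
 finally show ?thesis .
qed

lemma inverse_arrays_sym: "inverse_arrays a A A' ==> inverse_arrays a A' A"
 by (auto simp: inverse_arrays_def)

lemma lm_lm: "lm a A (lm a B X) = lm a (lm a A B) X"
proof (intro ext)
 fix x y
 have "lm a A (lm a B X) x y = (\<Sum>x'<a. \<Sum>c<a. A x x' * B x' c * X c y)"
  by (simp add: lm_def sum_distrib_left mult.assoc)
 also have "... = lm a (lm a A B) X x y"
  by (subst sum.swap) (simp add: lm_def sum_distrib_right)
 finally show "lm a A (lm a B X) x y = lm a (lm a A B) X x y" .
qed

lemma rm_rm: "rm b (rm b X A) B = rm b X (lm b A B)"
proof (intro ext)
 fix x y
 have "rm b (rm b X A) B x y = (\<Sum>y'<b. \<Sum>c<b. X x c * A c y' * B y' y)"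
  by (simp add: rm_def sum_distrib_right)
 also have "... = rm b X (lm b A B) x y"
  by (subst sum.swap) (simp add: rm_def lm_def sum_distrib_left mult.assoc)
 finally show "rm b (rm b X A) B x y = rm b X (lm b A B) x y" .
qed

lemma lm_inverse:
 assumes "inverse_arrays a A A'" "x < a"
 shows "lm a A (lm a A' X) x y = X x y"
proof -
 have "lm a (lm a A A') X x y = (\<Sum>c<a. (if x = c then 1 else 0) * X c y)"
  using assms by (auto simp: lm_def[of a "lm a A A'"] inverse_arrays_def intro!: sum.cong)
 also have "... = (\<Sum>c<a. if c = x then X c y else 0)" by (intro sum.cong) auto
 finally show ?thesis using assms by (simp add: lm_lm)
qed

lemma rm_inverse:
 assumes "inverse_arrays b B B'" "y < b"
 shows "rm b (rm b X B) B' x y = X x y"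
proof -
 have "rm b X (lm b B B') x y = (\<Sum>c<b. X x c * (if c = y then 1 else 0))"
  using assms by (auto simp: rm_def inverse_arrays_def intro!: sum.cong)
 also have "... = (\<Sum>c<b. if c = y then X x c else 0)" by (intro sum.cong) auto
 finally show ?thesis using assms by (simp add: rm_rm)
qed

lemma lm_cong_entry: "(!!x. x < a ==> X x y = Y x y) ==> lm a A X x y = lm a A Y x y"
 by (simp add: lm_def)

lemma rm_cong_entry: "(!!y. y < b ==> X x y = Y x y) ==> rm b X B x y = rm b Y B x y"
 by (simp add: rm_def)

text \<open>The equation for a single row of an upper triangular system.\<close>

lemma row_equation:
 assumes B: "B \<in> carrier_mat b b" and t: "t \<notin> spectrum B"
 shows "\<exists>v :: nat => complex. \<forall>y<b. (\<Sum>y'<b. v y' * B $$ (y', y)) - t * v y = h y"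
proof -
 define M where "M = char_matrix B t"
 have M: "M \<in> carrier_mat b b" unfolding M_def using B by simp
 have "det M ~= 0"
  using t eigenvalue_det[OF B, of t] by (simp add: spectrum_def M_def)
 then obtain N where N: "N \<in> carrier_mat b b" "N * M = 1\<^sub>m b"
  using det_non_zero_imp_unit[OF M, of undefined] M
  by (auto simp: Units_def ring_mat_def)
 define v where "v = (%y. \<Sum>y'<b. h y' * N $$ (y', y))"
 have Mxy: "M $$ (x, y) = B $$ (x, y) - (if x = y then t else 0)" if "x < b" "y < b" for x y
  using B that by (simp add: M_def char_matrix_def)
 have "(\<Sum>y'<b. v y' * B $$ (y', y)) - t * v y = h y" if y: "y < b" for y
 proof -
  have "(\<Sum>y'<b. v y' * M $$ (y', y)) = (\<Sum>y'<b. v y' * B $$ (y', y)) - (\<Sum>y'<b. if y' = y then t * v y' else 0)"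
   unfolding sum_subtractf[symmetric] using y by (intro sum.cong) (auto simp: Mxy algebra_simps)
  also have "(\<Sum>y'<b. if y' = y then t * v y' else 0) = t * v y" using y by simp
  finally have "(\<Sum>y'<b. v y' * B $$ (y', y)) - t * v y = (\<Sum>y'<b. v y' * M $$ (y', y))" by simp
  also have "... = (\<Sum>y'<b. \<Sum>c<b. h c * N $$ (c, y') * M $$ (y', y))"
   by (simp add: v_def sum_distrib_right)
  also have "... = (\<Sum>c<b. h c * (\<Sum>y'<b. N $$ (c, y') * M $$ (y', y)))"
   by (subst sum.swap) (simp add: sum_distrib_left mult.assoc)
  also have "... = (\<Sum>c<b. h c * (if c = y then 1 else 0))"
  proof (intro sum.cong refl arg_cong2[where f = "(*)"])
   fix c assume c: "c \<in> {..<b}"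
   have "(N * M) $$ (c, y) = (\<Sum>y'<b. N $$ (c, y') * M $$ (y', y))"
    using c y N(1) M by (simp add: scalar_prod_def atLeast0LessThan)
   then show "(\<Sum>y'<b. N $$ (c, y') * M $$ (y', y)) = (if c = y then 1 else 0)"
    using c y N(2) by simp
  qed
  also have "... = (\<Sum>c<b. if c = y then h c else 0)" by (intro sum.cong) auto
  also have "... = h y" using y by simp
  finally show ?thesis .
 qed
 then show ?thesis by blast
qed

lemma Sylvester_triangular:
 assumes B: "B \<in> carrier_mat b b"
  and T: "!!x. x < a ==> T x x \<notin> spectrum B"
   "!!x x'. x < a ==> x' < x ==> T x x' = 0"
 shows "\<exists>Y. \<forall>x<a. \<forall>y<b. rm b Y (%x y. B $$ (x, y)) x y - lm a T Y x y = (H x y :: complex)"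
proof -
 define R where "R = {(x', x). x < x' & x' < a}"
 define P where "P = (%Y x v. x < a --> (\<forall>y<b. (\<Sum>y'<b. v y' * B $$ (y', y)) - T x x * v y =
   H x y + (\<Sum>x'\<in>{x<..<a}. T x x' * Y x' y)))"
 have "\<exists>Y. \<forall>x. P Y x (Y x)"
 proof (rule dependent_wf_choice[of R])
  show "wf R"
   by (rule wf_subset[OF wf_measure[of "%x. a - x"]]) (auto simp: R_def)
 next
  fix f g :: "nat => nat => complex" and x r assume "!!z. (z, x) \<in> R ==> f z = g z"
  then have "(\<Sum>x'\<in>{x<..<a}. T x x' * f x' y) = (\<Sum>x'\<in>{x<..<a}. T x x' * g x' y)" for y
   by (intro sum.cong) (auto simp: R_def)
  then show "P f x r = P g x r" by (simp add: P_def)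
 next
  fix x and f :: "nat => nat => complex"
  show "\<exists>r. P f x r"
   using row_equation[OF B T(1)[of x], where h = "%y. H x y + (\<Sum>x'\<in>{x<..<a}. T x x' * f x' y)"]
   by (auto simp: P_def)
 qed
 then obtain Y where Y: "!!x. P Y x (Y x)" by blast
 have "rm b Y (%x y. B $$ (x, y)) x y - lm a T Y x y = H x y" if x: "x < a" and y: "y < b" for x y
 proof -
  have "{..<a} = {..<x} \<union> {x} \<union> {x<..<a}" using x by auto
  then have "lm a T Y x y = (\<Sum>x'\<in>{..<x} \<union> {x} \<union> {x<..<a}. T x x' * Y x' y)" by (simp add: lm_def)
  also have "... = (\<Sum>x'\<in>{..<x}. T x x' * Y x' y) + T x x * Y x y + (\<Sum>x'\<in>{x<..<a}. T x x' * Y x' y)"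
   by (subst sum.union_disjoint, simp, simp, force)+ simp
  also have "(\<Sum>x'\<in>{..<x}. T x x' * Y x' y) = 0" using T(2) x by (intro sum.neutral) auto
  finally show ?thesis
   using Y[of x] x y by (simp add: P_def rm_def algebra_simps)
 qed
 then show ?thesis by blast
qed

text \<open>Triangularising the left factor reduces the equation to one row at a time, where the operator is invertible because the spectra are separated.\<close>

lemma Sylvester_equation:
 fixes A B :: "complex mat"
 assumes A: "A \<in> carrier_mat a a" and B: "B \<in> carrier_mat b b"
  and disj: "!!s t. s \<in> spectrum A ==> t \<in> spectrum B ==> \<kappa> * t ~= s" and \<kappa>: "\<kappa> ~= 0"
 shows "\<exists>X. \<forall>x<a. \<forall>y<b. \<kappa> * rm b X (%x y. B $$ (x, y)) x y - lm a (%x y. A $$ (x, y)) X x y = H x y"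
proof -
 obtain es where es: "char_poly A = (\<Prod>e\<leftarrow>es. [:- e, 1:])"
  using char_poly_factorized[OF A] by blast
 obtain T where T: "T \<in> carrier_mat a a" "upper_triangular T" "similar_mat A T"
  using schur_decomposition_exists[OF A es] by blast
 then obtain P Q where "similar_mat_wit A T P Q" by (auto simp: similar_mat_def)
 then have PQ: "P \<in> carrier_mat a a" "Q \<in> carrier_mat a a" "P * Q = 1\<^sub>m a" "Q * P = 1\<^sub>m a" "A = P * T * Q"
  using A by (auto simp: similar_mat_wit_def Let_def)
 define e where "e M = (%x y. M $$ (x, y))" for M :: "complex mat"
 have e_mult: "e (M * N) x y = lm a (e M) (e N) x y"
  if "M \<in> carrier_mat a a" "N \<in> carrier_mat a c" "x < a" "y < c" for M N x y c
  using that by (simp add: e_def lm_def scalar_prod_def atLeast0LessThan)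
 have Tspec: "T $$ (x, x) / \<kappa> \<notin> spectrum B" if x: "x < a" for x
 proof -
  have "char_poly A = char_poly T" by (rule char_poly_similar[OF T(3)])
  also have "... = (\<Prod>c\<leftarrow>diag_mat T. [:- c, 1:])" by (rule char_poly_upper_triangular[OF T(1,2)])
  finally have "poly (char_poly A) (T $$ (x, x)) = 0"
   using x T(1) by (auto simp: poly_prod_list prod_list_zero_iff diag_mat_def o_def image_iff)
  then have "T $$ (x, x) \<in> spectrum A"
   using eigenvalue_root_char_poly[OF A] by (simp add: spectrum_def)
  then show ?thesis using disj[of _ "T $$ (x, x) / \<kappa>"] \<kappa> by auto
 qed
 have "\<exists>Y. \<forall>x<a. \<forall>y<b. rm b Y (e B) x y - lm a (%x y. e T x y / \<kappa>) Y x y = lm a (e Q) H x y / \<kappa>"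
  unfolding e_def[of B]
  by (rule Sylvester_triangular[OF B]) (use Tspec upper_triangularD[OF T(2)] T(1) in \<open>auto simp: e_def\<close>)
 then obtain Y where Y: "!!x y. x < a ==> y < b ==> rm b Y (e B) x y - lm a (%x y. e T x y / \<kappa>) Y x y = lm a (e Q) H x y / \<kappa>"
  by blast
 have Y: "\<kappa> * rm b Y (e B) x y - lm a (e T) Y x y = lm a (e Q) H x y" if "x < a" "y < b" for x y
 proof -
  have "lm a (%x y. e T x y / \<kappa>) Y x y = lm a (e T) Y x y / \<kappa>"
   by (simp add: lm_def sum_divide_distrib)
  then show ?thesis using Y[OF that] \<kappa> by (simp add: field_simps)
 qed
 have inv: "inverse_arrays a (e P) (e Q)"
  unfolding inverse_arrays_def
 proof (intro allI impI conjI)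
  fix x y assume xy: "x < a" "y < a"
  show "lm a (e P) (e Q) x y = (if x = y then 1 else 0)"
   using e_mult[OF PQ(1,2) xy] xy PQ(3) by (simp add: e_def)
  show "lm a (e Q) (e P) x y = (if x = y then 1 else 0)"
   using e_mult[OF PQ(2,1) xy] xy PQ(4) by (simp add: e_def)
 qed
 define X where "X = lm a (e P) Y"
 have "\<kappa> * rm b X (e B) x y - lm a (e A) X x y = H x y" if x: "x < a" and y: "y < b" for x y
 proof -
  have "lm a (e A) X x y = lm a (lm a (lm a (e P) (e T)) (e Q)) X x y"
  proof -
   have "e A x x' = lm a (lm a (e P) (e T)) (e Q) x x'" if "x' < a" for x'
   proof -
    have "e A x x' = e (P * T * Q) x x'" by (simp only: PQ(5))
    also have "... = lm a (e (P * T)) (e Q) x x'"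
     by (rule e_mult) (use PQ(1,2) T(1) x that in auto)
    also have "... = lm a (lm a (e P) (e T)) (e Q) x x'"
     using PQ T x unfolding lm_def[of a _ "e Q"] by (intro sum.cong) (auto simp: e_mult[of P T a])
    finally show ?thesis .
   qed
   then show ?thesis unfolding lm_def[of a _ X] by (intro sum.cong) auto
  qed
  also have "... = lm a (e P) (lm a (e T) (lm a (e Q) X)) x y" by (simp add: lm_lm)
  also have "... = lm a (e P) (lm a (e T) Y) x y"
   unfolding lm_def[of a "e P"] using lm_inverse[OF inverse_arrays_sym[OF inv], where X = Y]
   by (intro sum.cong refl arg_cong2[where f = "(*)"] lm_cong_entry) (simp add: X_def)
  finally have 1: "lm a (e A) X x y = lm a (e P) (lm a (e T) Y) x y" .
  have 2: "rm b X (e B) x y = lm a (e P) (rm b Y (e B)) x y"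
   unfolding X_def lm_def rm_def sum_distrib_left sum_distrib_right
   by (subst sum.swap) (simp add: mult.assoc)
  have "\<kappa> * rm b X (e B) x y - lm a (e A) X x y = lm a (e P) (%x y. \<kappa> * rm b Y (e B) x y - lm a (e T) Y x y) x y"
   by (simp add: 1 2) (simp add: lm_def sum_subtractf right_diff_distrib sum_distrib_left mult_ac)
  also have "... = lm a (e P) (lm a (e Q) H) x y"
   unfolding lm_def[of a "e P"] using y by (intro sum.cong) (auto simp: Y)
  also have "... = H x y" by (rule lm_inverse[OF inv x])
  finally show ?thesis .
 qed
 then show ?thesis by (auto simp: e_def)
qed

section \<open>Linear q-difference equations on an annulus\<close>

lemma has_sum_lessThan:
 fixes f :: "nat => 'a => complex"
 shows "(!!i. i < n ==> (f i has_sum s i) A) ==> ((%x. \<Sum>i<n. f i x) has_sum (\<Sum>i<n. s i)) A"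
 by (induction n) (auto intro: has_sum_add)

lemma has_sum_diff_complex:
 fixes f g :: "'a => complex"
 assumes "(f has_sum s) A" "(g has_sum t) A"
 shows "((%x. f x - g x) has_sum (s - t)) A"
 using has_sum_add[OF assms(1), of "%x. - g x" "- t"] assms(2) by (simp add: has_sum_uminus)

lemma summable_on_finite_sum:
 fixes f :: "'i => 'a => real"
 assumes "finite I" "!!i. i \<in> I ==> f i summable_on A"
 shows "(%x. \<Sum>i\<in>I. f i x) summable_on A"
 using assms by (induction I rule: finite_induct) (auto intro: summable_on_add)

lemma summable_on_cofinite:
 fixes f :: "int => complex"
 assumes "g summable_on UNIV" "finite F" "!!n. n \<notin> F ==> norm (f n) <= g n"
 shows "f summable_on UNIV"
proof -
 have "(%n. norm (f n)) summable_on (- F)"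
 proof (rule Infinite_Sum.abs_summable_on_comparison_test[of g])
  show "(%n. norm (g n)) summable_on - F"
   using summable_on_subset_banach[OF assms(1), of "- F"] summable_on_iff_abs_summable_on_real[of g "- F"] by auto
  show "norm (f n) <= norm (g n)" if "n \<in> - F" for n
   using assms(3)[of n] that by auto
 qed
 then have "f summable_on (- F)" by (rule Infinite_Sum.abs_summable_summable)
 then have "f summable_on (- F \<union> F)"
  using assms(2) by (intro summable_on_Un_disjoint) auto
 then show ?thesis by simp
qed

lemma has_sum_shift:
 fixes f :: "int => complex"
 shows "((%n. f (n + k)) has_sum s) UNIV \<longleftrightarrow> (f has_sum s) UNIV"
 by (rule has_sum_reindex_bij_witness[where i = "%n. n - k" and j = "%n. n + k"]) auto

context q_base
begin

text \<open>For large \<open>\<bar>n\<bar>\<close> one of the two terms on the left-hand side dominates the other one.\<close>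

lemma Sylvester_bound:
 fixes A A' B B' :: array and g h :: "int => array"
 assumes A: "inverse_arrays a A A'" and B: "inverse_arrays b B B'" and \<kappa>: "\<kappa> ~= 0"
  and g: "!!n x y. x < a ==> y < b ==> \<kappa> * q powi n * rm b (g n) B x y - lm a A (g n) x y = h n x y"
 shows "\<exists>C N. \<forall>n. \<bar>n\<bar> > N --> nrm a b (g n) <= C * nrm a b (h n)"
proof -
 define K1 where "K1 = nrm b b B' * (2 * nrm a a A + 1) + 1"
 define K2 where "K2 = 2 * nrm a a A' * nrm b b B + 1"
 have pos: "0 < K1" "0 < K2" "K1 >= 1"
  by (simp_all add: K1_def K2_def nrm_nonneg add_nonneg_pos)
 obtain m1 where m1: "norm q ^ m1 > K1 / norm \<kappa>" using real_arch_pow[OF q] by blast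
 obtain m2 where m2: "norm q ^ m2 > K2 * norm \<kappa>" using real_arch_pow[OF q] by blast
 have q1: "1 <= norm q" using q by simp
 have "nrm a b (g n) <= (2 * nrm b b B' + 2 * nrm a a A') * nrm a b (h n)" if n: "\<bar>n\<bar> > int (max m1 m2)" for n
 proof (cases "n >= 0")
  case True
  let ?k = "\<kappa> * q powi n"
  have "K1 <= norm \<kappa> * norm q ^ m1" using m1 \<kappa> by (simp add: field_simps)
  also have "... <= norm \<kappa> * norm q ^ nat n"
   using n True by (intro mult_left_mono power_increasing[OF _ q1]) auto
  also have "... = norm ?k" using True by (simp add: norm_mult norm_power_int power_int_def norm_power)
  finally have k: "K1 <= norm ?k" .
  then have "1 <= norm ?k" using pos by linarith
  have "nrm a b (%x y. ?k * g n x y) = nrm a b (rm b (%x y. h n x y + lm a A (g n) x y) B')"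
  proof (rule nrm_cong)
   fix x y assume x: "x < a" and y: "y < b"
   have "?k * g n x y = ?k * rm b (rm b (g n) B) B' x y" by (simp add: rm_inverse[OF B y])
   also have "... = rm b (%x y. ?k * rm b (g n) B x y) B' x y"
    by (simp add: rm_def[of b _ B'] sum_distrib_left mult_ac)
   also have "... = rm b (%x y. h n x y + lm a A (g n) x y) B' x y"
    by (rule rm_cong_entry) (simp add: g[OF x, symmetric])
   finally show "?k * g n x y = rm b (%x y. h n x y + lm a A (g n) x y) B' x y" .
  qed
  also have "... <= nrm a b (%x y. h n x y + lm a A (g n) x y) * nrm b b B'" by (rule nrm_rm)
  also have "... <= (nrm a b (h n) + nrm a a A * nrm a b (g n)) * nrm b b B'"
   by (intro mult_right_mono order_trans[OF nrm_add] add_left_mono nrm_lm nrm_nonneg)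
  finally have 1: "norm ?k * nrm a b (g n) <= nrm b b B' * nrm a b (h n) + (nrm b b B' * nrm a a A) * nrm a b (g n)"
   by (simp only: nrm_scale) (simp add: norm_mult algebra_simps)
  have "2 * (nrm b b B' * nrm a a A) <= K1 - 1" by (simp add: K1_def algebra_simps nrm_nonneg)
  then have "2 * (nrm b b B' * nrm a a A) * nrm a b (g n) <= (norm ?k - 1) * nrm a b (g n)"
   using k by (intro mult_right_mono nrm_nonneg) auto
  with 1 have "(norm ?k + 1) * nrm a b (g n) <= 2 * (nrm b b B' * nrm a b (h n))"
   by (simp add: algebra_simps)
  moreover have "1 * nrm a b (g n) <= (norm ?k + 1) * nrm a b (g n)"
   by (intro mult_right_mono nrm_nonneg) auto
  moreover have "0 <= nrm a a A' * nrm a b (h n)" by (simp add: nrm_nonneg)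
  ultimately show ?thesis by (simp add: algebra_simps)
 next
  case False
  let ?k = "\<kappa> * q powi n"
  have "norm q ^ m2 <= norm q ^ nat (- n)"
   using n False by (intro power_increasing[OF _ q1]) auto
  then have big: "K2 * norm \<kappa> <= norm q ^ nat (- n)" using m2 by simp
  have "norm ?k = norm \<kappa> / norm q ^ nat (- n)"
   using False by (simp add: norm_mult norm_divide norm_power norm_power_int power_int_def power_inverse field_simps)
  then have k: "K2 * norm ?k <= 1"
   using big by (simp add: divide_le_eq)
  have "nrm a b (g n) = nrm a b (lm a A' (%x y. ?k * rm b (g n) B x y + (- 1) * h n x y))"
  proof (rule nrm_cong)
   fix x y assume x: "x < a" and y: "y < b"
   have "g n x y = lm a A' (lm a A (g n)) x y" by (simp add: lm_inverse[OF inverse_arrays_sym[OF A] x])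
   also have "... = lm a A' (%x y. ?k * rm b (g n) B x y + (- 1) * h n x y) x y"
    by (rule lm_cong_entry) (use y in \<open>simp add: g[symmetric]\<close>)
   finally show "g n x y = lm a A' (%x y. ?k * rm b (g n) B x y + (- 1) * h n x y) x y" .
  qed
  also have "... <= nrm a a A' * nrm a b (%x y. ?k * rm b (g n) B x y + (- 1) * h n x y)" by (rule nrm_lm)
  also have "... <= nrm a a A' * (norm ?k * (nrm a b (g n) * nrm b b B) + nrm a b (h n))"
  proof (intro mult_left_mono nrm_nonneg order_trans[OF nrm_add])
   have "nrm a b (%x y. ?k * rm b (g n) B x y) <= norm ?k * (nrm a b (g n) * nrm b b B)"
    unfolding nrm_scale by (intro mult_left_mono nrm_rm) auto
   moreover have "nrm a b (%x y. (- 1) * h n x y) = nrm a b (h n)" unfolding nrm_scale by simp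
   ultimately show "nrm a b (%x y. ?k * rm b (g n) B x y) + nrm a b (%x y. (- 1) * h n x y)
     <= norm ?k * (nrm a b (g n) * nrm b b B) + nrm a b (h n)" by simp
  qed
  finally have 1: "nrm a b (g n) <= (nrm a a A' * nrm b b B * norm ?k) * nrm a b (g n) + nrm a a A' * nrm a b (h n)"
   by (simp only: algebra_simps)
  have "2 * (nrm a a A' * nrm b b B * norm ?k) <= K2 * norm ?k"
   by (simp add: K2_def algebra_simps)
  then have "2 * (nrm a a A' * nrm b b B * norm ?k) * nrm a b (g n) <= 1 * nrm a b (g n)"
   using k by (intro mult_right_mono nrm_nonneg) linarith
  then have "2 * ((nrm a a A' * nrm b b B * norm ?k) * nrm a b (g n)) <= nrm a b (g n)" by (simp only: mult.assoc mult_1)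
  with 1 have "nrm a b (g n) <= 2 * (nrm a a A' * nrm a b (h n))" by linarith
  moreover have "0 <= nrm b b B' * nrm a b (h n)" by (simp add: nrm_nonneg)
  ultimately show ?thesis by (simp add: algebra_simps)
 qed
 then show ?thesis by blast
qed

text \<open>Comparing Laurent coefficients leaves one Sylvester equation with \<open>\<kappa> q\<^sup>n\<close> for each \<open>n\<close>. For large \<open>\<bar>n\<bar>\<close> the inverse operators are uniformly bounded, which gives convergence.\<close>

lemma Sylvester_Laurent:
 fixes A B :: "complex mat" and H :: "nat => nat => complex => complex"
 defines "eA \<equiv> %x y. A $$ (x, y)" and "eB \<equiv> %x y. B $$ (x, y)"
 assumes A: "A \<in> carrier_mat a a" "inverse_arrays a eA A'"
  and B: "B \<in> carrier_mat b b" "inverse_arrays b eB B'" and \<kappa>: "\<kappa> ~= 0"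
  and nonres: "!!n s t. s \<in> spectrum A ==> t \<in> spectrum B ==> \<kappa> * q powi n * t ~= s"
  and H: "!!x y. x < a ==> y < b ==> H x y holomorphic_on annulus 0 R" and R: "0 < R"
 shows "\<exists>G. (\<forall>x<a. \<forall>y<b. G x y holomorphic_on annulus 0 R) &
  (\<forall>z. z ~= 0 --> norm (q * z) < R --> (\<forall>x<a. \<forall>y<b.
   \<kappa> * rm b (%x y. G x y (q * z)) eB x y - lm a eA (%x y. G x y z) x y = H x y z))"
proof -
 have ex: "\<exists>c. \<forall>z \<in> annulus 0 R. ((%n. c n * z powi n) has_sum H x y z) UNIV" if "x < a" "y < b" for x y
  by (rule Laurent_expansion_annulus[OF H[OF that] order_refl R]) blast
 define h where "h = (%x y. SOME c. \<forall>z \<in> annulus 0 R. ((%n. c n * z powi n) has_sum H x y z) UNIV)"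
 have h: "((%n. h x y n * z powi n) has_sum H x y z) UNIV" if "x < a" "y < b" "z \<in> annulus 0 R" for x y z
  using someI_ex[OF ex[OF that(1,2)]] that(3) unfolding h_def by blast
 have "\<exists>X. \<forall>x<a. \<forall>y<b. (\<kappa> * q powi n) * rm b X eB x y - lm a eA X x y = h x y n" for n
  unfolding eA_def eB_def
  by (rule Sylvester_equation[OF A(1) B(1) nonres]) (use \<kappa> in auto)
 then have "\<exists>g. \<forall>n. \<forall>x<a. \<forall>y<b. (\<kappa> * q powi n) * rm b (g n) eB x y - lm a eA (g n) x y = h x y n"
  by (intro choice) blast
 then obtain g where g: "!!n x y. x < a ==> y < b ==> \<kappa> * q powi n * rm b (g n) eB x y - lm a eA (g n) x y = h x y n"
  by blast
 obtain C N where CN: "!!n. \<bar>n\<bar> > N ==> nrm a b (g n) <= C * nrm a b (%x y. h x y n)"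
  using Sylvester_bound[OF A(2) B(2) \<kappa>, of g "%n x y. h x y n"] g by blast
 have sum_g: "(%n. g n x y * z powi n) summable_on UNIV" if xy: "x < a" "y < b" and z: "z \<in> annulus 0 R" for x y z
 proof (rule summable_on_cofinite)
  show "(%n. C * (\<Sum>x<a. \<Sum>y<b. norm (h x y n * z powi n))) summable_on UNIV"
  proof (intro summable_on_cmult_right summable_on_finite_sum finite_lessThan)
   fix x y assume "x \<in> {..<a}" "y \<in> {..<b}"
   then have "(%n. h x y n * z powi n) summable_on UNIV"
    using h[of x y z] z by (auto simp: summable_on_def)
   then show "(%n. norm (h x y n * z powi n)) summable_on UNIV"
    by (rule iffD1[OF summable_on_iff_abs_summable_on_complex])
  qed
  show "finite {-N..N}" by simp
  fix n assume "n \<notin> {-N..N}"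
  then have n: "\<bar>n\<bar> > N" by auto
  have "norm (g n x y * z powi n) <= nrm a b (g n) * norm (z powi n)"
   using nrm_entry[OF xy] by (simp add: norm_mult mult_right_mono)
  also have "... <= C * nrm a b (%x y. h x y n) * norm (z powi n)"
   by (intro mult_right_mono CN n) auto
  also have "... = C * (\<Sum>x<a. \<Sum>y<b. norm (h x y n * z powi n))"
   by (simp add: nrm_def norm_mult sum_distrib_right mult.assoc)
  finally show "norm (g n x y * z powi n) <= C * (\<Sum>x<a. \<Sum>y<b. norm (h x y n * z powi n))" .
 qed
 define G where "G = (%x y z. \<Sum>\<^sub>\<infinity>n. g n x y * z powi n)"
 have sG: "((%n. g n x y * z powi n) has_sum G x y z) UNIV" if "x < a" "y < b" "z \<in> annulus 0 R" for x y z
  unfolding G_def by (rule has_sum_infsum[OF sum_g[OF that]])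
 have "G x y holomorphic_on annulus 0 R" if "x < a" "y < b" for x y
  unfolding G_def by (rule Laurent_series_holomorphic) (use sum_g that in auto)
 moreover have "\<kappa> * rm b (%x y. G x y (q * z)) eB x y - lm a eA (%x y. G x y z) x y = H x y z"
  if z: "z ~= 0" "norm (q * z) < R" and x: "x < a" and y: "y < b" for x y z
 proof -
  have "norm z <= norm (q * z)" using q by (simp add: norm_mult mult_le_cancel_right1)
  from order.strict_trans1[OF this z(2)]
  have z1: "z \<in> annulus 0 R" and z2: "q * z \<in> annulus 0 R" using z by auto
  have "((%n. \<kappa> * (\<Sum>y'<b. g n x y' * (q * z) powi n * eB y' y) - (\<Sum>x'<a. eA x x' * (g n x' y * z powi n))) has_sum
    (\<kappa> * (\<Sum>y'<b. G x y' (q * z) * eB y' y) - (\<Sum>x'<a. eA x x' * G x' y z))) UNIV"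
   by (intro has_sum_diff_complex has_sum_cmult_right has_sum_cmult_left has_sum_lessThan sG z1 z2 x y) auto
  also have "(%n. \<kappa> * (\<Sum>y'<b. g n x y' * (q * z) powi n * eB y' y) - (\<Sum>x'<a. eA x x' * (g n x' y * z powi n)))
    = (%n. h x y n * z powi n)"
   by (rule ext, simp add: g[OF x y, symmetric] rm_def lm_def power_int_mult_distrib sum_distrib_left sum_distrib_right algebra_simps)
  finally show ?thesis
   using h[OF x y z1] by (simp add: rm_def lm_def has_sum_unique)
 qed
 ultimately show ?thesis by blast
qed

end

lemma fls_of_Laurent_coefficients:
 fixes u :: "int => complex"
 assumes u0: "!!n. n < N ==> u n = 0" and r: "0 <= r1" "r1 < r2"
  and s: "!!z. z \<in> annulus r1 r2 ==> ((%n. u n * z powi n) has_sum S z) UNIV"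
 shows "\<exists>f. fls_conv_radius f >= ereal r2 & (\<forall>z \<in> annulus r1 r2. eval_fls f z = S z)"
proof -
 define F where "F = Abs_fps (%n. u (int n + N))"
 have *: "(%n. fps_nth F n * z ^ n) sums (S z * z powi (- N))" if z: "z \<in> annulus r1 r2" for z
 proof -
  have z0: "z ~= 0" using z r by auto
  have "((%n. u n * z powi n) has_sum S z) {N..}"
   using s[OF z] by (subst (asm) has_sum_cong_neutral[where T = "{N..}"]) (use u0 in auto)
  then have "((%n. u (int n + N) * z powi (int n + N)) has_sum S z) UNIV"
   by (subst (asm) has_sum_reindex_bij_witness[where j = "%n. nat (n - N)" and i = "%n. int n + N" and T = UNIV
      and h = "%n. u (int n + N) * z powi (int n + N)"]) auto
  then have "((%n. u (int n + N) * z powi (int n + N) * z powi (- N)) has_sum S z * z powi (- N)) UNIV"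
   by (rule has_sum_cmult_left)
  also have "(%n. u (int n + N) * z powi (int n + N) * z powi (- N)) = (%n. fps_nth F n * z ^ n)"
   using z0 by (auto simp: F_def power_int_add power_int_minus fun_eq_iff field_simps)
  finally show ?thesis by (rule has_sum_imp_sums)
 qed
 have rad: "fps_conv_radius F >= ereal r2"
  unfolding fps_conv_radius_def
 proof (rule conv_radius_geI_ex)
  fix t :: real assume t: "0 < t" "ereal t < ereal r2"
  have "max t r1 < r2" using t r by auto
  from dense[OF this] obtain t' where t': "max t r1 < t'" "t' < r2" by blast
  have "summable (%n. fps_nth F n * of_real t' ^ n)"
   using *[of "of_real t'"] t' t by (auto simp: sums_iff)
  then have "summable (%n. fps_nth F n * of_real t ^ n)"
   by (rule powser_inside) (use t t' in auto)
  then show "\<exists>z. norm z = t & summable (%n. fps_nth F n * z ^ n)"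
   using t by (intro exI[of _ "of_real t"]) auto
 qed
 have "eval_fls (fls_shift (- N) (fps_to_fls F)) z = S z" if z: "z \<in> annulus r1 r2" for z
 proof -
  have z0: "z ~= 0" using z r by auto
  have "ereal (norm z) < ereal r2" using z by simp
  then have "ereal (norm z) < fps_conv_radius F" using rad by (rule less_le_trans)
  then have "eval_fls (fls_shift (- N) (fps_to_fls F)) z = eval_fps F z * z powi N"
   using z0 by (subst eval_fls_shift) (auto simp: eval_fps_to_fls)
  also have "eval_fps F z = S z * z powi (- N)"
   using *[OF z] by (simp add: eval_fps_def sums_iff)
  finally show ?thesis using z0 by (simp add: power_int_minus)
 qed
 then show ?thesis using rad by (intro exI[of _ "fls_shift (- N) (fps_to_fls F)"]) auto
qed

lemma summable_on_int_nonpos: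
 fixes f :: "int => complex"
 assumes "summable (%m. norm (f (- int m)))" "!!n. n > 0 ==> f n = 0"
 shows "f summable_on UNIV"
proof -
 have "(%m. f (- int m)) summable_on UNIV"
  by (rule norm_summable_imp_summable_on[OF assms(1)])
 then have "f summable_on {..0}"
  using summable_on_reindex_bij_witness[where i = "%n. nat (- n)" and j = "%m. - int m" and S = UNIV
    and T = "{..0}" and h = f and g = "%m. f (- int m)"] by auto
 then show ?thesis
  by (subst summable_on_cong_neutral[where T = "{..0}" and g = f]) (use assms(2) in auto)
qed

context q_base
begin

lemma summable_super_geometric:
 fixes c :: real and bl :: "nat => real"
 assumes "\<mu> > 0" "0 <= c" "!!m. 0 <= bl m"
  and "!!m. bl (Suc m) = c * norm q powi (- \<mu> * (int m + 1)) * bl m"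
 shows "summable bl"
proof -
 obtain N where N: "norm q ^ N > 2 * c" using real_arch_pow[OF q] by blast
 show ?thesis
 proof (rule summable_ratio_test[of "1 / 2" N])
  fix m assume m: "N <= m"
  have "int N <= \<mu> * (int m + 1)"
  proof -
   have "1 * (int m + 1) <= \<mu> * (int m + 1)" using assms(1) by (intro mult_right_mono) auto
   moreover have "int N <= 1 * (int m + 1)" using m by simp
   ultimately show ?thesis by (rule order_trans[rotated])
  qed
  then have "norm q powi int N <= norm q powi (\<mu> * (int m + 1))"
   using q by (intro power_int_increasing) auto
  then have "2 * c <= norm q powi (\<mu> * (int m + 1))" using N by simp
  then have *: "c * norm q powi (- \<mu> * (int m + 1)) <= 1 / 2"
   by (simp add: power_int_minus divide_simps)
  show "norm (bl (Suc m)) <= 1 / 2 * norm (bl m)"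
   using mult_right_mono[OF * assms(3)[of m]] assms(2) assms(3)[of m] assms(3)[of "Suc m"]
   by (simp only: assms(4) real_norm_def abs_of_nonneg)
 qed simp
qed

text \<open>The coefficients of the equation below satisfy, for \<open>n \<le> 0\<close>,
 \<open>A F\<^sub>n = q\<^bsup>n - \<mu>\<^esup> F\<^bsub>n - \<mu>\<^esub> B + Y\<^bsub>n - m\<^sub>i\<^esub>\<close>. Running this recursion from \<open>- \<infinity>\<close> gives a
 rapidly convergent series, because each step contributes a factor \<open>q\<^bsup>n - l \<mu>\<^esup>\<close>.\<close>

lemma principal_part_solution:
 fixes A A' B B' :: array and Y :: "nat => nat => complex => complex"
 assumes A: "inverse_arrays a A A'"
  and mu: "mi > mj" and r: "0 <= r1" "r1 < r2"
  and Y: "!!x y. x < a ==> y < b ==> Y x y holomorphic_on annulus r1 r2"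
 shows "\<exists>F u. (\<forall>x<a. \<forall>y<b. F x y holomorphic_on {z. r1 < norm z}) &
  (\<forall>x<a. \<forall>y<b. fls_conv_radius (u x y) >= ereal r2) &
  (\<forall>z \<in> annulus r1 r2. \<forall>x<a. \<forall>y<b.
   z powi (- mj) * rm b (%x y. F x y (q * z)) B x y - z powi (- mi) * lm a A (%x y. F x y z) x y + Y x y z
    = eval_fls (u x y) z)"
proof -
 define \<mu> where "\<mu> = mi - mj"
 have \<mu>: "\<mu> > 0" using mu by (simp add: \<mu>_def)
 have ex: "\<exists>c. \<forall>z \<in> annulus r1 r2. ((%n. c n * z powi n) has_sum Y x y z) UNIV" if "x < a" "y < b" for x y
  by (rule Laurent_expansion_annulus[OF Y[OF that] r]) blast
 define h where "h = (%n x y. (SOME c. \<forall>z \<in> annulus r1 r2. ((%n. c n * z powi n) has_sum Y x y z) UNIV) n)"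
 have h: "((%n. h n x y * z powi n) has_sum Y x y z) UNIV" if "x < a" "y < b" "z \<in> annulus r1 r2" for x y z
  using someI_ex[OF ex[OF that(1,2)]] that(3) unfolding h_def by blast
 define t :: "nat => int => array" where
  "t = rec_nat (%n. lm a A' (h (n - mi))) (%m T n x y. q powi (n - \<mu>) * lm a A' (rm b (T (n - \<mu>)) B) x y)"
 have t0: "t 0 n = lm a A' (h (n - mi))"
  and tS: "t (Suc m) n = (%x y. q powi (n - \<mu>) * lm a A' (rm b (t m (n - \<mu>)) B) x y)" for m n
  by (simp_all add: t_def)
 have bound: "\<exists>E bl. summable bl & (\<forall>m. \<forall>n\<le>0. nrm a b (t m n) <= E * s powi (- n) * bl m) & 0 <= E & (\<forall>m. 0 <= bl m)"
  if s: "r1 < s" "s < r2" for s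
 proof -
  have s0: "0 < s" using s r by simp
  have sz: "complex_of_real s \<in> annulus r1 r2" using s s0 by simp
  define D where "D = (\<Sum>\<^sub>\<infinity>n. \<Sum>x<a. \<Sum>y<b. norm (h n x y * of_real s powi n))"
  have sumD: "(%n. \<Sum>x<a. \<Sum>y<b. norm (h n x y * of_real s powi n)) summable_on UNIV"
  proof (intro summable_on_finite_sum finite_lessThan)
   fix x y assume "x \<in> {..<a}" "y \<in> {..<b}"
   then have "(%n. h n x y * of_real s powi n) summable_on UNIV"
    using h[of x y "of_real s"] sz by (auto simp: summable_on_def)
   then show "(%n. norm (h n x y * of_real s powi n)) summable_on UNIV"
    by (rule iffD1[OF summable_on_iff_abs_summable_on_complex])
  qed
  have D: "nrm a b (h n) * s powi n <= D" for n
  proof -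
   have "nrm a b (h n) * s powi n = (\<Sum>n\<in>{n}. \<Sum>x<a. \<Sum>y<b. norm (h n x y * of_real s powi n))"
    using s0 by (simp add: nrm_def norm_mult norm_power_int sum_distrib_right)
   also have "... <= D" unfolding D_def
    by (rule finite_sum_le_infsum[OF sumD]) (auto intro!: sum_nonneg)
   finally show ?thesis .
  qed
  have D0: "0 <= D" using D[of 0] nrm_nonneg[of a b "h 0"] by simp
  define E where "E = nrm a a A' * D * s powi mi"
  define c where "c = nrm a a A' * nrm b b B * s powi \<mu>"
  define bl where "bl = rec_nat 1 (%m b. c * norm q powi (- \<mu> * (int m + 1)) * b)"
  have c0: "0 <= c" using s0 by (simp add: c_def nrm_nonneg)
  have bl: "bl 0 = 1" "!!m. bl (Suc m) = c * norm q powi (- \<mu> * (int m + 1)) * bl m"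
   by (simp_all add: bl_def)
  have bl0: "0 <= bl m" for m by (induction m) (auto simp: bl c0)
  have E0: "0 <= E" using s0 D0 by (simp add: E_def nrm_nonneg)
  have main: "nrm a b (t m n) <= E * s powi (- n) * norm q powi (int m * n) * bl m" for m n
  proof (induction m arbitrary: n)
   case 0
   have "nrm a b (t 0 n) <= nrm a a A' * nrm a b (h (n - mi))" by (simp add: t0 nrm_lm)
   also have "nrm a b (h (n - mi)) <= D * s powi (mi - n)"
    using D[of "n - mi"] s0 by (simp add: power_int_diff divide_simps mult_ac)
   finally have "nrm a b (t 0 n) <= nrm a a A' * (D * s powi (mi - n))"
    by (simp add: mult_left_mono nrm_nonneg)
   then show ?case using s0 by (simp add: E_def bl power_int_diff power_int_minus divide_simps mult_ac)
  next
   case (Suc m)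
   have "nrm a b (t (Suc m) n) = norm q powi (n - \<mu>) * nrm a b (lm a A' (rm b (t m (n - \<mu>)) B))"
    by (simp only: tS nrm_scale norm_power_int)
   also have "... <= norm q powi (n - \<mu>) * (nrm a a A' * (nrm a b (t m (n - \<mu>)) * nrm b b B))"
    by (intro mult_left_mono order_trans[OF nrm_lm] nrm_rm nrm_nonneg) auto
   also have "... <= norm q powi (n - \<mu>) * (nrm a a A' * ((E * s powi (- (n - \<mu>)) * norm q powi (int m * (n - \<mu>)) * bl m) * nrm b b B))"
    by (intro mult_left_mono mult_right_mono Suc.IH nrm_nonneg) auto
   also have "... = (E * s powi (- (n - \<mu>)) * (nrm a a A' * nrm b b B)) * (norm q powi (n - \<mu>) * norm q powi (int m * (n - \<mu>))) * bl m"
    by (simp add: mult_ac)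
   also have "norm q powi (n - \<mu>) * norm q powi (int m * (n - \<mu>)) = norm q powi (int (Suc m) * n) * norm q powi (- \<mu> * (int m + 1))"
    by (subst power_int_add[symmetric], simp, subst power_int_add[symmetric], simp) (simp add: algebra_simps)
   also have "E * s powi (- (n - \<mu>)) * (nrm a a A' * nrm b b B) = E * s powi (- n) * c"
    using s0 by (simp add: c_def power_int_diff power_int_minus divide_simps mult_ac)
   finally show ?case by (simp add: bl mult_ac)
  qed
  have "nrm a b (t m n) <= E * s powi (- n) * bl m" if "n <= 0" for m n
  proof -
   have "norm q powi (int m * n) <= norm q powi 0"
    using q that by (intro power_int_increasing) (auto simp: mult_le_0_iff)
   then have "E * s powi (- n) * norm q powi (int m * n) * bl m <= E * s powi (- n) * 1 * bl m"
    using E0 s0 bl0 by (intro mult_left_mono mult_right_mono) auto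
   with main[of m n] show ?thesis by simp
  qed
  moreover have "summable bl" by (rule summable_super_geometric[OF \<mu> c0 bl0 bl(2)])
  ultimately show ?thesis using E0 bl0 by blast
 qed
 define F where "F = (%n x y. \<Sum>m. t m n x y)"
 have t_summable: "summable (%m. norm (t m n x y))" if xy: "x < a" "y < b" and n: "n <= 0" for x y n
 proof -
  from dense[OF r(2)] obtain s where s: "r1 < s" "s < r2" by blast
  from bound[OF s] obtain E bl where E: "summable bl" "!!m n. n <= 0 ==> nrm a b (t m n) <= E * s powi (- n) * bl m"
   by blast
  show ?thesis
  proof (rule summable_comparison_test)
   show "\<exists>N. \<forall>m\<ge>N. norm (norm (t m n x y)) <= E * s powi (- n) * bl m"
    using order_trans[OF nrm_entry[OF xy] E(2)[OF n]] by auto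
   show "summable (%m. E * s powi (- n) * bl m)" by (rule summable_mult[OF E(1)])
  qed
 qed
 have t_sums: "(%m. t m n x y) sums F n x y" if "x < a" "y < b" "n <= 0" for x y n
  unfolding F_def by (rule summable_sums[OF summable_norm_cancel[OF t_summable[OF that]]])
 have rec: "lm a A (F n) x y = h (n - mi) x y + q powi (n - \<mu>) * rm b (F (n - \<mu>)) B x y"
  if n: "n <= 0" and x: "x < a" and y: "y < b" for n x y
 proof -
  have n': "n - \<mu> <= 0" using n \<mu> by simp
  have F: "F n x y = lm a A' (%x y. h (n - mi) x y + q powi (n - \<mu>) * rm b (F (n - \<mu>)) B x y) x y"
   if x: "x < a" for x
  proof -
   have "(%m. q powi (n - \<mu>) * lm a A' (rm b (t m (n - \<mu>)) B) x y) sums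
     (q powi (n - \<mu>) * lm a A' (rm b (F (n - \<mu>)) B) x y)"
    unfolding lm_def rm_def
    by (intro sums_mult sums_sum sums_mult2 t_sums n') auto
   then have "(%m. t (Suc m) n x y) sums (q powi (n - \<mu>) * lm a A' (rm b (F (n - \<mu>)) B) x y)"
    by (simp add: tS)
   then have "(%m. t m n x y) sums (q powi (n - \<mu>) * lm a A' (rm b (F (n - \<mu>)) B) x y + t 0 n x y)"
    by (rule sums_Suc)
   with t_sums[OF x y n] have "F n x y = q powi (n - \<mu>) * lm a A' (rm b (F (n - \<mu>)) B) x y + lm a A' (h (n - mi)) x y"
    using sums_unique2 by (force simp: t0)
   then show ?thesis by (simp add: lm_def sum.distrib sum_distrib_left algebra_simps)
  qed
  have "lm a A (F n) x y = lm a A (lm a A' (%x y. h (n - mi) x y + q powi (n - \<mu>) * rm b (F (n - \<mu>)) B x y)) x y"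
   by (rule lm_cong_entry) (rule F)
  then show ?thesis by (simp add: lm_inverse[OF A x])
 qed
 define f where "f = (%n x y. if n <= 0 then F n x y else 0)"
 have f_summable: "(%n. f n x y * z powi n) summable_on UNIV" if xy: "x < a" "y < b" and z: "r1 < norm z" for x y z
 proof (rule summable_on_int_nonpos)
  have "r1 < min (norm z) r2" using z r by simp
  from dense[OF this] obtain s where s: "r1 < s" "s < norm z" "s < r2" by auto
  from bound[OF s(1,3)] obtain E bl where E: "summable bl" "!!m n. n <= 0 ==> nrm a b (t m n) <= E * s powi (- n) * bl m"
   by blast
  have s0: "0 < s" "0 < norm z" using s r by linarith+
  have Fb: "norm (F (- int m) x y) <= E * s ^ m * suminf bl" for m
  proof -
   have "norm (F (- int m) x y) <= (\<Sum>l. norm (t l (- int m) x y))"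
    unfolding F_def by (rule summable_norm[OF t_summable]) (use xy in auto)
   also have "... <= (\<Sum>l. E * s ^ m * bl l)"
    using order_trans[OF nrm_entry[OF xy] E(2)[of "- int m"]]
    by (intro suminf_le t_summable xy summable_mult E(1)) auto
   also have "... = E * s ^ m * suminf bl" by (rule suminf_mult[OF E(1)])
   finally show ?thesis .
  qed
  show "summable (%m. norm (f (- int m) x y * z powi - int m))"
  proof (rule summable_comparison_test)
   show "\<exists>N. \<forall>m\<ge>N. norm (norm (f (- int m) x y * z powi - int m)) <= E * suminf bl * (s / norm z) ^ m"
   proof (intro exI[of _ 0] allI impI)
    fix m
    have "norm (norm (f (- int m) x y * z powi - int m)) = norm (F (- int m) x y) / norm z ^ m"
     by (simp add: f_def norm_mult norm_power_int power_int_minus norm_inverse norm_power divide_inverse)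
    also have "... <= (E * s ^ m * suminf bl) / norm z ^ m"
     by (intro divide_right_mono Fb) auto
    finally show "norm (norm (f (- int m) x y * z powi - int m)) <= E * suminf bl * (s / norm z) ^ m"
     by (simp add: power_divide mult_ac)
   qed
   show "summable (%m. E * suminf bl * (s / norm z) ^ m)"
    using s s0 by (intro summable_mult summable_geometric) auto
  qed
 qed (simp add: f_def)
 define G where "G = (%x y z. \<Sum>\<^sub>\<infinity>n. f n x y * z powi n)"
 have sG: "((%n. f n x y * z powi n) has_sum G x y z) UNIV" if "x < a" "y < b" "r1 < norm z" for x y z
  unfolding G_def by (rule has_sum_infsum[OF f_summable[OF that]])
 have hol: "G x y holomorphic_on {z. r1 < norm z}" if "x < a" "y < b" for x y
 proof -
  have "G x y holomorphic_on annulus r1 R" for R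
   unfolding G_def by (rule Laurent_series_holomorphic) (use f_summable that r in auto)
  then have "G x y holomorphic_on (\<Union>R. annulus r1 R)"
   by (intro holomorphic_on_UN_open open_annulus)
  moreover have "(\<Union>R. annulus r1 R) = {z. r1 < norm z}" by (auto intro: gt_ex)
  ultimately show ?thesis by simp
 qed
 define uc where "uc = (%n x y. q powi (n + mj) * rm b (f (n + mj)) B x y - lm a A (f (n + mi)) x y + h n x y)"
 define S where "S = (%x y z. z powi (- mj) * rm b (%x y. G x y (q * z)) B x y - z powi (- mi) * lm a A (%x y. G x y z) x y + Y x y z)"
 have "\<exists>u. fls_conv_radius u >= ereal r2 & (\<forall>z \<in> annulus r1 r2. eval_fls u z = S x y z)"
  if x: "x < a" and y: "y < b" for x y
 proof (rule fls_of_Laurent_coefficients[OF _ r])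
  show "uc n x y = 0" if "n < - mi + 1" for n
  proof -
   have e: "n + mi <= 0" "n + mj <= 0" "n + mi - \<mu> = n + mj" using that mu by (auto simp: \<mu>_def)
   show ?thesis using rec[OF e(1) x y, unfolded e(3)] e(1,2) by (simp add: uc_def f_def)
  qed
  fix z assume z: "z \<in> annulus r1 r2"
  have z0: "z ~= 0" using z r by auto
  have "norm z <= norm q * norm z" using q by (simp add: mult_le_cancel_right1)
  then have qz: "r1 < norm (q * z)" and zr: "r1 < norm z" using z by (auto simp: norm_mult)
  have "((%n. z powi (- mj) * (\<Sum>y'<b. f n x y' * (q * z) powi n * B y' y)) has_sum
    (z powi (- mj) * (\<Sum>y'<b. G x y' (q * z) * B y' y))) UNIV"
   by (intro has_sum_cmult_right has_sum_cmult_left has_sum_lessThan sG qz x y)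
  then have 1: "((%n. z powi (- mj) * (\<Sum>y'<b. f (n + mj) x y' * (q * z) powi (n + mj) * B y' y)) has_sum
    (z powi (- mj) * rm b (%x y. G x y (q * z)) B x y)) UNIV"
   unfolding rm_def by (subst has_sum_shift[where k = mj])
  have "((%n. z powi (- mi) * (\<Sum>x'<a. A x x' * (f n x' y * z powi n))) has_sum
    (z powi (- mi) * (\<Sum>x'<a. A x x' * G x' y z))) UNIV"
   by (intro has_sum_cmult_right has_sum_cmult_left has_sum_lessThan sG zr x y)
  then have 2: "((%n. z powi (- mi) * (\<Sum>x'<a. A x x' * (f (n + mi) x' y * z powi (n + mi)))) has_sum
    (z powi (- mi) * lm a A (%x y. G x y z) x y)) UNIV"
   unfolding lm_def by (subst has_sum_shift[where k = mi])
  have "((%n. z powi (- mj) * (\<Sum>y'<b. f (n + mj) x y' * (q * z) powi (n + mj) * B y' y)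
    - z powi (- mi) * (\<Sum>x'<a. A x x' * (f (n + mi) x' y * z powi (n + mi))) + h n x y * z powi n) has_sum S x y z) UNIV"
   unfolding S_def by (intro has_sum_add has_sum_diff_complex 1 2 h x y z)
  also have "(%n. z powi (- mj) * (\<Sum>y'<b. f (n + mj) x y' * (q * z) powi (n + mj) * B y' y)
    - z powi (- mi) * (\<Sum>x'<a. A x x' * (f (n + mi) x' y * z powi (n + mi))) + h n x y * z powi n) = (%n. uc n x y * z powi n)"
  proof
   fix n
   have "z powi (- mj) * (\<Sum>y'<b. f (n + mj) x y' * (q * z) powi (n + mj) * B y' y) =
     q powi (n + mj) * rm b (f (n + mj)) B x y * z powi n"
    using z0 by (simp add: rm_def sum_distrib_left sum_distrib_right power_int_mult_distrib power_int_add power_int_minus field_simps)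
   moreover have "z powi (- mi) * (\<Sum>x'<a. A x x' * (f (n + mi) x' y * z powi (n + mi))) = lm a A (f (n + mi)) x y * z powi n"
    using z0 by (simp add: lm_def sum_distrib_left sum_distrib_right power_int_add power_int_minus field_simps)
   ultimately show "z powi (- mj) * (\<Sum>y'<b. f (n + mj) x y' * (q * z) powi (n + mj) * B y' y)
    - z powi (- mi) * (\<Sum>x'<a. A x x' * (f (n + mi) x' y * z powi (n + mi))) + h n x y * z powi n = uc n x y * z powi n"
    by (simp add: uc_def algebra_simps)
  qed
  finally show "((%n. uc n x y * z powi n) has_sum S x y z) UNIV" .
 qed
 then have "\<forall>x y. \<exists>u. x < a & y < b --> fls_conv_radius u >= ereal r2 & (\<forall>z \<in> annulus r1 r2. eval_fls u z = S x y z)"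
  by blast
 then obtain u where u: "!!x y. x < a ==> y < b ==> fls_conv_radius (u x y) >= ereal r2"
  "!!x y z. x < a ==> y < b ==> z \<in> annulus r1 r2 ==> eval_fls (u x y) z = S x y z"
  by metis
 show ?thesis
  by (rule exI[of _ G], rule exI[of _ u]) (use hol u in \<open>auto simp: S_def\<close>)
qed

end

section \<open>The additive Cousin problem on an annulus\<close>

definition cousin_data :: "'i set => ('i => complex set) => ('i => 'i => complex => complex) => bool" where
 "cousin_data I W C \<longleftrightarrow> (\<forall>a\<in>I. open (W a)) &
   (\<forall>a\<in>I. \<forall>b\<in>I. C a b holomorphic_on W a Int W b) &
   (\<forall>a\<in>I. \<forall>b\<in>I. \<forall>c\<in>I. \<forall>z \<in> W a Int W b Int W c. C a b z + C b c z = C a c z)"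

definition cousin_solvable :: "'i set => ('i => complex set) => ('i => 'i => complex => complex) => complex set => bool" where
 "cousin_solvable I W C S \<longleftrightarrow> S \<subseteq> (\<Union>a\<in>I. W a) &
   (\<exists>f. (\<forall>a\<in>I. f a holomorphic_on W a Int S) &
    (\<forall>a\<in>I. \<forall>b\<in>I. \<forall>z \<in> W a Int W b Int S. f b z = f a z + C a b z))"

lemma cousin_solvable_subset:
 assumes "cousin_solvable I W C S" "S' \<subseteq> S"
 shows "cousin_solvable I W C S'"
proof -
 obtain f where f: "\<forall>a\<in>I. f a holomorphic_on W a Int S"
  "\<forall>a\<in>I. \<forall>b\<in>I. \<forall>z \<in> W a Int W b Int S. f b z = f a z + C a b z" and S: "S \<subseteq> (\<Union>a\<in>I. W a)"
  using assms(1) unfolding cousin_solvable_def by blast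
 have "f a holomorphic_on W a Int S'" if "a \<in> I" for a
  by (rule holomorphic_on_subset[of _ "W a Int S"]) (use f that assms(2) in auto)
 then show ?thesis
  unfolding cousin_solvable_def using f(2) S assms(2) by blast
qed

lemma cousin_solvable_member:
 assumes "cousin_data I W C" "a \<in> I" "S \<subseteq> W a"
 shows "cousin_solvable I W C S"
 unfolding cousin_solvable_def
proof (intro conjI exI[of _ "%b. C a b"] ballI)
 show "S \<subseteq> (\<Union>a\<in>I. W a)" using assms by blast
 show "C a b holomorphic_on W b Int S" if "b \<in> I" for b
  by (rule holomorphic_on_subset[of _ "W a Int W b"]) (use assms that in \<open>auto simp: cousin_data_def\<close>)
 show "C a c z = C a b z + C b c z" if "b \<in> I" "c \<in> I" "z \<in> W b Int W c Int S" for b c z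
 proof -
  have "z \<in> W a Int W b Int W c" using assms(3) that by auto
  with assms(1,2) that have "C a b z + C b c z = C a c z" unfolding cousin_data_def by blast
  then show ?thesis by simp
 qed
qed

text \<open>Two solutions differ, on the overlap of their domains, by a function that does not depend on the
 index of the covering. Splitting this function glues the solutions.\<close>

lemma cousin_solvable_merge:
 assumes data: "cousin_data I W C"
  and sol: "cousin_solvable I W C S1" "cousin_solvable I W C S2"
  and op: "open S1" "open S2" "open S1'" "open S2'" and sub: "S1' \<subseteq> S1" "S2' \<subseteq> S2"
  and split: "!!h. h holomorphic_on S1 Int S2 ==> \<exists>h1 h2. h1 holomorphic_on S1' & h2 holomorphic_on S2' &
    (\<forall>z \<in> S1' Int S2'. h z = h1 z - h2 z)"
 shows "cousin_solvable I W C (S1' \<union> S2')"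
proof -
 obtain f1 where f1: "!!a. a \<in> I ==> f1 a holomorphic_on W a Int S1"
  "!!a b z. a \<in> I ==> b \<in> I ==> z \<in> W a Int W b Int S1 ==> f1 b z = f1 a z + C a b z"
  using sol(1) unfolding cousin_solvable_def by blast
 obtain f2 where f2: "!!a. a \<in> I ==> f2 a holomorphic_on W a Int S2"
  "!!a b z. a \<in> I ==> b \<in> I ==> z \<in> W a Int W b Int S2 ==> f2 b z = f2 a z + C a b z"
  using sol(2) unfolding cousin_solvable_def by blast
 have opW: "open (W a)" if "a \<in> I" for a using data that by (simp add: cousin_data_def)
 have cov: "S1 \<subseteq> (\<Union>a\<in>I. W a)" "S2 \<subseteq> (\<Union>a\<in>I. W a)" using sol by (auto simp: cousin_solvable_def)
 define idx where "idx z = (SOME a. a \<in> I & z \<in> W a)" for z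
 define h where "h = (%z. f1 (idx z) z - f2 (idx z) z)"
 have h: "h z = f1 a z - f2 a z" if "a \<in> I" "z \<in> W a" "z \<in> S1 Int S2" for a z
 proof -
  have "idx z \<in> I & z \<in> W (idx z)" unfolding idx_def by (rule someI[of _ a]) (use that in auto)
  then show ?thesis
   using f1(2)[of a "idx z" z] f2(2)[of a "idx z" z] that by (simp add: h_def)
 qed
 have "h holomorphic_on (\<Union>a\<in>I. W a Int (S1 Int S2))"
 proof (rule holomorphic_on_UN_open)
  fix a assume a: "a \<in> I"
  have "(%z. f1 a z - f2 a z) holomorphic_on W a Int (S1 Int S2)"
   by (intro holomorphic_on_diff holomorphic_on_subset[OF f1(1)[OF a]] holomorphic_on_subset[OF f2(1)[OF a]]) auto
  then show "h holomorphic_on W a Int (S1 Int S2)"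
   by (rule holomorphic_transform) (use h a in auto)
  show "open (W a Int (S1 Int S2))" using opW[OF a] op by auto
 qed
 then have "h holomorphic_on S1 Int S2"
  by (rule holomorphic_on_subset) (use cov in blast)
 from split[OF this] obtain h1 h2 where h12: "h1 holomorphic_on S1'" "h2 holomorphic_on S2'"
  "!!z. z \<in> S1' Int S2' ==> h z = h1 z - h2 z" by blast
 define f where "f a z = (if z \<in> S1' then f1 a z - h1 z else f2 a z - h2 z)" for a z
 have fS1: "f a z = f1 a z - h1 z" if "z \<in> S1'" for a z using that by (simp add: f_def)
 have fS2: "f a z = f2 a z - h2 z" if "a \<in> I" "z \<in> W a" "z \<in> S2'" for a z
 proof (cases "z \<in> S1'")
  case True
  then have "z \<in> S1 Int S2" "z \<in> S1' Int S2'" using that sub by auto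
  from h[OF that(1,2) this(1)] h12(3)[OF this(2)] True show ?thesis by (simp add: f_def algebra_simps)
 qed (simp add: f_def)
 have fS: "f a holomorphic_on (W a Int S1') \<union> (W a Int S2')" if a: "a \<in> I" for a
 proof (rule holomorphic_on_Un)
  have "(%z. f1 a z - h1 z) holomorphic_on W a Int S1'"
   by (intro holomorphic_on_diff holomorphic_on_subset[OF f1(1)[OF a]] holomorphic_on_subset[OF h12(1)]) (use sub in auto)
  then show "f a holomorphic_on W a Int S1'"
   by (rule holomorphic_transform) (use fS1 in auto)
  have "(%z. f2 a z - h2 z) holomorphic_on W a Int S2'"
   by (intro holomorphic_on_diff holomorphic_on_subset[OF f2(1)[OF a]] holomorphic_on_subset[OF h12(2)]) (use sub in auto)
  then show "f a holomorphic_on W a Int S2'"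
   by (rule holomorphic_transform) (use fS2 a in auto)
 qed (use opW[OF a] op in auto)
 show ?thesis unfolding cousin_solvable_def
 proof (intro conjI exI[of _ f] ballI)
  show "S1' \<union> S2' \<subseteq> (\<Union>a\<in>I. W a)" using cov sub by blast
  show "f a holomorphic_on W a Int (S1' \<union> S2')" if "a \<in> I" for a
   using fS[OF that] by (simp add: Int_Un_distrib)
  fix a b z assume ab: "a \<in> I" "b \<in> I" and z: "z \<in> W a Int W b Int (S1' \<union> S2')"
  show "f b z = f a z + C a b z"
  proof (cases "z \<in> S1'")
   case True
   then show ?thesis using f1(2)[OF ab, of z] z sub fS1[of z] by auto
  next
   case False
   then show ?thesis using f2(2)[OF ab, of z] z sub fS2[of _ z] ab by auto
  qed
 qed
qed

lemma cousin_solvable_disjoint: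
 assumes "cousin_data I W C" "cousin_solvable I W C S1" "cousin_solvable I W C S2"
  and "open S1" "open S2" "S1 Int S2 = {}"
 shows "cousin_solvable I W C (S1 \<union> S2)"
 by (rule cousin_solvable_merge[OF assms(1-3,4,5,4,5)])
  (use assms(6) in \<open>auto intro!: exI[of _ "%_. 0"]\<close>)

subsection \<open>Cauchy integrals over the sides of a rectangle\<close>

lemma Cauchy_integral_segment_holomorphic:
 assumes "continuous_on (closed_segment p p') h"
 shows "(%z. contour_integral (linepath p p') (%w. h w / (w - z))) holomorphic_on - closed_segment p p'"
proof -
 have int: "(%w. h w / (w - z)) contour_integrable_on linepath p p'" if "z \<notin> closed_segment p p'" for z
  using that assms by (intro contour_integrable_continuous_linepath continuous_intros) auto
 have "((%z. contour_integral (linepath p p') (%w. h w / (w - z))) has_field_derivative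
   of_nat 1 * contour_integral (linepath p p') (%u. h u / (u - z) ^ Suc 1)) (at z)"
  if z: "z \<notin> closed_segment p p'" for z
 proof (rule Cauchy_next_derivative(2)[where S = UNIV and B = "norm (p' - p)"])
  show "((%u. h u / (u - w) ^ 1) has_contour_integral contour_integral (linepath p p') (%u. h u / (u - w))) (linepath p p')"
   if "w \<in> UNIV - path_image (linepath p p')" for w
   using that int[of w] by (simp add: has_contour_integral_integral)
 qed (use assms z in auto)
 then show ?thesis
  by (auto simp: holomorphic_on_def field_differentiable_def intro: has_field_derivative_at_within)
qed

text \<open>Cauchy's integral over the boundary of the rectangle splits into its four sides, and each side gives a function holomorphic off that side.\<close>

lemma rectangle_splitting:
 assumes h: "h holomorphic_on U" and x: "x0 < x1" and y: "y0 < y1"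
  and U: "cbox (Complex x0 y0) (Complex x1 y1) \<subseteq> U"
 obtains kL kR kB kT where
  "kL holomorphic_on {z. \<not> (Re z = x0 & y0 <= Im z & Im z <= y1)}"
  "kR holomorphic_on {z. \<not> (Re z = x1 & y0 <= Im z & Im z <= y1)}"
  "kB holomorphic_on {z. \<not> (Im z = y0 & x0 <= Re z & Re z <= x1)}"
  "kT holomorphic_on {z. \<not> (Im z = y1 & x0 <= Re z & Re z <= x1)}"
  "!!z. x0 < Re z ==> Re z < x1 ==> y0 < Im z ==> Im z < y1 ==> kL z + kR z + kB z + kT z = h z"
  "!!z. \<not> (x0 <= Re z & Re z <= x1 & y0 <= Im z & Im z <= y1) ==> kL z + kR z + kB z + kT z = 0"
proof
 define a1 where "a1 = Complex x0 y0"
 define a2 where "a2 = Complex x1 y0"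
 define a3 where "a3 = Complex x1 y1"
 define a4 where "a4 = Complex x0 y1"
 note a = a1_def a2_def a3_def a4_def
 define J where "J = (%p p' z. contour_integral (linepath p p') (%w. h w / (w - z)) / (2 * of_real pi * \<i>))"
 have seg: "closed_segment a1 a2 = {z. Im z = y0 & x0 <= Re z & Re z <= x1}"
  "closed_segment a2 a3 = {z. Re z = x1 & y0 <= Im z & Im z <= y1}"
  "closed_segment a3 a4 = {z. Im z = y1 & x0 <= Re z & Re z <= x1}"
  "closed_segment a4 a1 = {z. Re z = x0 & y0 <= Im z & Im z <= y1}"
  using x y by (auto simp: a closed_segment_same_Re closed_segment_same_Im closed_segment_eq_real_ivl complex_eq_iff)
 have hc: "h holomorphic_on cbox a1 a3" unfolding a by (rule holomorphic_on_subset[OF h U])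
 have sub: "closed_segment p p' \<subseteq> cbox a1 a3" if "(p, p') \<in> {(a1,a2),(a2,a3),(a3,a4),(a4,a1)}" for p p'
  using that x y seg by (auto simp: a in_cbox_complex_iff)
 have cont: "continuous_on (closed_segment p p') h" if "(p, p') \<in> {(a1,a2),(a2,a3),(a3,a4),(a4,a1)}" for p p'
  by (rule continuous_on_subset[OF holomorphic_on_imp_continuous_on[OF hc] sub[OF that]])
 have J: "J p p' holomorphic_on - closed_segment p p'" if "(p, p') \<in> {(a1,a2),(a2,a3),(a3,a4),(a4,a1)}" for p p'
  unfolding J_def by (intro holomorphic_intros Cauchy_integral_segment_holomorphic cont that) auto
 have int: "(%w. h w / (w - z)) contour_integrable_on linepath p p'"
  if "(p, p') \<in> {(a1,a2),(a2,a3),(a3,a4),(a4,a1)}" "z \<notin> closed_segment p p'" for p p' z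
  using that(2) cont[OF that(1)] by (intro contour_integrable_continuous_linepath continuous_intros) auto
 have tot: "J a4 a1 z + J a2 a3 z + J a1 a2 z + J a3 a4 z = contour_integral (rectpath a1 a3) (%w. h w / (w - z)) / (2 * of_real pi * \<i>)"
  if z: "z \<notin> closed_segment a1 a2" "z \<notin> closed_segment a2 a3" "z \<notin> closed_segment a3 a4" "z \<notin> closed_segment a4 a1" for z
 proof -
  have r: "rectpath a1 a3 = linepath a1 a2 +++ linepath a2 a3 +++ linepath a3 a4 +++ linepath a4 a1"
   by (simp add: rectpath_def a Let_def)
  note ints = int[of a1 a2 z] int[of a2 a3 z] int[of a3 a4 z] int[of a4 a1 z]
  have i: "(%w. h w / (w - z)) contour_integrable_on linepath a3 a4 +++ linepath a4 a1"
   "(%w. h w / (w - z)) contour_integrable_on linepath a2 a3 +++ linepath a3 a4 +++ linepath a4 a1"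
   using ints z by (auto intro!: contour_integrable_joinI valid_path_join)
  have "contour_integral (rectpath a1 a3) (%w. h w / (w - z)) =
   contour_integral (linepath a1 a2) (%w. h w / (w - z)) +
   (contour_integral (linepath a2 a3) (%w. h w / (w - z)) +
   (contour_integral (linepath a3 a4) (%w. h w / (w - z)) +
   contour_integral (linepath a4 a1) (%w. h w / (w - z))))"
   unfolding r using i ints z by (simp add: contour_integral_join valid_path_join)
  then show ?thesis by (simp add: J_def add_divide_distrib)
 qed
 show "J a4 a1 holomorphic_on {z. \<not> (Re z = x0 & y0 <= Im z & Im z <= y1)}"
  "J a2 a3 holomorphic_on {z. \<not> (Re z = x1 & y0 <= Im z & Im z <= y1)}"
  "J a1 a2 holomorphic_on {z. \<not> (Im z = y0 & x0 <= Re z & Re z <= x1)}"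
  "J a3 a4 holomorphic_on {z. \<not> (Im z = y1 & x0 <= Re z & Re z <= x1)}"
  using J[of a4 a1] J[of a2 a3] J[of a1 a2] J[of a3 a4] by (simp_all add: seg Compl_eq)
 have img: "path_image (rectpath a1 a3) \<subseteq> cbox a1 a3"
  by (rule path_image_rectpath_subset_cbox) (use x y in \<open>auto simp: a\<close>)
 {
  fix z assume z: "x0 < Re z" "Re z < x1" "y0 < Im z" "Im z < y1"
  then have zb: "z \<in> box a1 a3" by (simp add: a in_box_complex_iff)
  have "((%w. h w / (w - z)) has_contour_integral
    complex_of_real (2 * pi) * \<i> * winding_number (rectpath a1 a3) z * h z) (rectpath a1 a3)"
  proof (rule Cauchy_integral_formula_convex_simple[OF _ hc])
   show "z \<in> interior (cbox a1 a3)" using zb by (simp add: interior_cbox)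
   show "path_image (rectpath a1 a3) \<subseteq> cbox a1 a3 - {z}"
    using img path_image_rectpath_inter_box[of a1 a3] zb x y by (auto simp: a)
  qed auto
  then have "contour_integral (rectpath a1 a3) (%w. h w / (w - z)) = 2 * of_real pi * \<i> * h z"
   using winding_number_rectpath[OF zb] by (simp add: contour_integral_unique)
  then show "J a4 a1 z + J a2 a3 z + J a1 a2 z + J a3 a4 z = h z"
   using tot[of z] z by (simp add: seg)
 next
  fix z assume z: "\<not> (x0 <= Re z & Re z <= x1 & y0 <= Im z & Im z <= y1)"
  then have zb: "z \<notin> cbox a1 a3" by (auto simp: a in_cbox_complex_iff)
  have "((%w. h w / (w - z)) has_contour_integral 0) (rectpath a1 a3)"
   by (rule Cauchy_theorem_convex_simple[where S = "cbox a1 a3"])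
    (use zb img in \<open>auto intro!: holomorphic_intros hc\<close>)
  then have "contour_integral (rectpath a1 a3) (%w. h w / (w - z)) = 0"
   by (rule contour_integral_unique)
  then show "J a4 a1 z + J a2 a3 z + J a1 a2 z + J a3 a4 z = 0"
   using tot[of z] z x y by (auto simp: seg)
 }
qed

subsection \<open>Rectangles\<close>

definition orect :: "real => real => real => real => complex set" where
 "orect x0 x1 y0 y1 = {z. x0 < Re z & Re z < x1 & y0 < Im z & Im z < y1}"

lemma open_orect: "open (orect x0 x1 y0 y1)"
 unfolding orect_def by (intro open_Collect_conj open_Collect_less continuous_intros)

definition cousin_rect :: "'i set => ('i => complex set) => ('i => 'i => complex => complex) =>
  real => real => real => real => bool" where
 "cousin_rect I W C x0 x1 y0 y1 \<longleftrightarrow> (\<exists>\<delta>>0. cousin_solvable I W C (orect (x0 - \<delta>) (x1 + \<delta>) (y0 - \<delta>) (y1 + \<delta>)))"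

lemma cousin_rect_horizontal:
 assumes data: "cousin_data I W C" and le: "x0 <= x1" "x1 <= x2" "y0 <= y1"
  and g: "cousin_rect I W C x0 x1 y0 y1" "cousin_rect I W C x1 x2 y0 y1"
 shows "cousin_rect I W C x0 x2 y0 y1"
proof -
 obtain d1 d2 where d: "0 < d1" "0 < d2" "cousin_solvable I W C (orect (x0 - d1) (x1 + d1) (y0 - d1) (y1 + d1))"
  "cousin_solvable I W C (orect (x1 - d2) (x2 + d2) (y0 - d2) (y1 + d2))"
  using g unfolding cousin_rect_def by blast
 define e where "e = min d1 d2 / 6"
 have e: "0 < e" "6 * e <= d1" "6 * e <= d2" using d by (auto simp: e_def)
 let ?S1 = "orect (x0 - 6 * e) (x1 + 6 * e) (y0 - 6 * e) (y1 + 6 * e)"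
 let ?S2 = "orect (x1 - 6 * e) (x2 + 6 * e) (y0 - 6 * e) (y1 + 6 * e)"
 let ?T1 = "orect (x0 - 2 * e) (x1 + 2 * e) (y0 - 2 * e) (y1 + 2 * e)"
 let ?T2 = "orect (x1 - 2 * e) (x2 + 2 * e) (y0 - 2 * e) (y1 + 2 * e)"
 have "cousin_solvable I W C (?T1 \<union> ?T2)"
 proof (rule cousin_solvable_merge[OF data, of ?S1 ?S2])
  fix h assume h: "h holomorphic_on ?S1 Int ?S2"
  obtain kL kR kB kT where k:
   "kL holomorphic_on {z. \<not> (Re z = x1 - 3 * e & y0 - 3 * e <= Im z & Im z <= y1 + 3 * e)}"
   "kR holomorphic_on {z. \<not> (Re z = x1 + 3 * e & y0 - 3 * e <= Im z & Im z <= y1 + 3 * e)}"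
   "kB holomorphic_on {z. \<not> (Im z = y0 - 3 * e & x1 - 3 * e <= Re z & Re z <= x1 + 3 * e)}"
   "kT holomorphic_on {z. \<not> (Im z = y1 + 3 * e & x1 - 3 * e <= Re z & Re z <= x1 + 3 * e)}"
   "!!z. x1 - 3 * e < Re z ==> Re z < x1 + 3 * e ==> y0 - 3 * e < Im z ==> Im z < y1 + 3 * e ==> kL z + kR z + kB z + kT z = h z"
   by (rule rectangle_splitting[OF h, of "x1 - 3 * e" "x1 + 3 * e" "y0 - 3 * e" "y1 + 3 * e"])
    (use e le in \<open>auto simp: orect_def in_cbox_complex_iff\<close>)
  show "\<exists>h1 h2. h1 holomorphic_on ?T1 & h2 holomorphic_on ?T2 & (\<forall>z \<in> ?T1 Int ?T2. h z = h1 z - h2 z)"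
  proof (intro exI conjI ballI)
   show "(%z. kR z + kB z + kT z) holomorphic_on ?T1"
    by (intro holomorphic_on_add holomorphic_on_subset[OF k(2)] holomorphic_on_subset[OF k(3)] holomorphic_on_subset[OF k(4)])
     (use e in \<open>auto simp: orect_def\<close>)
   show "(%z. - kL z) holomorphic_on ?T2"
    by (intro holomorphic_on_minus holomorphic_on_subset[OF k(1)]) (use e in \<open>auto simp: orect_def\<close>)
   show "h z = (kR z + kB z + kT z) - (- kL z)" if "z \<in> ?T1 Int ?T2" for z
    using k(5)[of z] that e by (auto simp: orect_def algebra_simps)
  qed
 next
  show "cousin_solvable I W C ?S1" by (rule cousin_solvable_subset[OF d(3)]) (use e in \<open>auto simp: orect_def\<close>)
  show "cousin_solvable I W C ?S2" by (rule cousin_solvable_subset[OF d(4)]) (use e in \<open>auto simp: orect_def\<close>)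
  show "?T1 \<subseteq> ?S1" "?T2 \<subseteq> ?S2" using e by (auto simp: orect_def)
 qed (rule open_orect)+
 then have "cousin_solvable I W C (orect (x0 - 2 * e) (x2 + 2 * e) (y0 - 2 * e) (y1 + 2 * e))"
  by (rule cousin_solvable_subset) (use e le in \<open>auto simp: orect_def\<close>)
 then show ?thesis unfolding cousin_rect_def using e by (intro exI[of _ "2 * e"]) auto
qed

lemma cousin_rect_vertical:
 assumes data: "cousin_data I W C" and le: "x0 <= x1" "y0 <= y1" "y1 <= y2"
  and g: "cousin_rect I W C x0 x1 y0 y1" "cousin_rect I W C x0 x1 y1 y2"
 shows "cousin_rect I W C x0 x1 y0 y2"
proof -
 obtain d1 d2 where d: "0 < d1" "0 < d2" "cousin_solvable I W C (orect (x0 - d1) (x1 + d1) (y0 - d1) (y1 + d1))"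
  "cousin_solvable I W C (orect (x0 - d2) (x1 + d2) (y1 - d2) (y2 + d2))"
  using g unfolding cousin_rect_def by blast
 define e where "e = min d1 d2 / 6"
 have e: "0 < e" "6 * e <= d1" "6 * e <= d2" using d by (auto simp: e_def)
 let ?S1 = "orect (x0 - 6 * e) (x1 + 6 * e) (y0 - 6 * e) (y1 + 6 * e)"
 let ?S2 = "orect (x0 - 6 * e) (x1 + 6 * e) (y1 - 6 * e) (y2 + 6 * e)"
 let ?T1 = "orect (x0 - 2 * e) (x1 + 2 * e) (y0 - 2 * e) (y1 + 2 * e)"
 let ?T2 = "orect (x0 - 2 * e) (x1 + 2 * e) (y1 - 2 * e) (y2 + 2 * e)"
 have "cousin_solvable I W C (?T1 \<union> ?T2)"
 proof (rule cousin_solvable_merge[OF data, of ?S1 ?S2])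
  fix h assume h: "h holomorphic_on ?S1 Int ?S2"
  obtain kL kR kB kT where k:
   "kL holomorphic_on {z. \<not> (Re z = x0 - 3 * e & y1 - 3 * e <= Im z & Im z <= y1 + 3 * e)}"
   "kR holomorphic_on {z. \<not> (Re z = x1 + 3 * e & y1 - 3 * e <= Im z & Im z <= y1 + 3 * e)}"
   "kB holomorphic_on {z. \<not> (Im z = y1 - 3 * e & x0 - 3 * e <= Re z & Re z <= x1 + 3 * e)}"
   "kT holomorphic_on {z. \<not> (Im z = y1 + 3 * e & x0 - 3 * e <= Re z & Re z <= x1 + 3 * e)}"
   "!!z. x0 - 3 * e < Re z ==> Re z < x1 + 3 * e ==> y1 - 3 * e < Im z ==> Im z < y1 + 3 * e ==> kL z + kR z + kB z + kT z = h z"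
   by (rule rectangle_splitting[OF h, of "x0 - 3 * e" "x1 + 3 * e" "y1 - 3 * e" "y1 + 3 * e"])
    (use e le in \<open>auto simp: orect_def in_cbox_complex_iff\<close>)
  show "\<exists>h1 h2. h1 holomorphic_on ?T1 & h2 holomorphic_on ?T2 & (\<forall>z \<in> ?T1 Int ?T2. h z = h1 z - h2 z)"
  proof (intro exI conjI ballI)
   show "(%z. kL z + kR z + kT z) holomorphic_on ?T1"
    by (intro holomorphic_on_add holomorphic_on_subset[OF k(2)] holomorphic_on_subset[OF k(1)] holomorphic_on_subset[OF k(4)])
     (use e in \<open>auto simp: orect_def\<close>)
   show "(%z. - kB z) holomorphic_on ?T2"
    by (intro holomorphic_on_minus holomorphic_on_subset[OF k(3)]) (use e in \<open>auto simp: orect_def\<close>)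
   show "h z = (kL z + kR z + kT z) - (- kB z)" if "z \<in> ?T1 Int ?T2" for z
    using k(5)[of z] that e by (auto simp: orect_def algebra_simps)
  qed
 next
  show "cousin_solvable I W C ?S1" by (rule cousin_solvable_subset[OF d(3)]) (use e in \<open>auto simp: orect_def\<close>)
  show "cousin_solvable I W C ?S2" by (rule cousin_solvable_subset[OF d(4)]) (use e in \<open>auto simp: orect_def\<close>)
  show "?T1 \<subseteq> ?S1" "?T2 \<subseteq> ?S2" using e by (auto simp: orect_def)
 qed (rule open_orect)+
 then have "cousin_solvable I W C (orect (x0 - 2 * e) (x1 + 2 * e) (y0 - 2 * e) (y2 + 2 * e))"
  by (rule cousin_solvable_subset) (use e le in \<open>auto simp: orect_def\<close>)
 then show ?thesis unfolding cousin_rect_def using e by (intro exI[of _ "2 * e"]) auto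
qed

lemma cousin_rectI:
 assumes data: "cousin_data I W C" and xy: "x0 <= x1" "y0 <= y1"
  and cov: "!!z. x0 <= Re z ==> Re z <= x1 ==> y0 <= Im z ==> Im z <= y1 ==> z \<in> (\<Union>a\<in>I. W a)"
 shows "cousin_rect I W C x0 x1 y0 y1"
 using xy(2)
proof (induction rule: Bolzano)
 case (trans a b c)
 show ?case by (rule cousin_rect_vertical[OF data xy(1) trans(3,4) trans(1,2)])
next
 case (local y)
 have "\<exists>d>0. \<forall>c e. c <= y & y <= e & e - c < d --> cousin_rect I W C x0 x1 c e"
  using xy(1)
 proof (induction rule: Bolzano)
  case (trans a b c)
  then obtain d1 d2 where "d1 > 0" "d2 > 0" "\<forall>c e. c <= y & y <= e & e - c < d1 --> cousin_rect I W C a b c e"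
   "\<forall>c' e. c' <= y & y <= e & e - c' < d2 --> cousin_rect I W C b c c' e" by blast
  then show ?case
   using trans(3,4) by (intro exI[of _ "min d1 d2"]) (auto intro!: cousin_rect_horizontal[OF data, of a b c])
 next
  case (local x)
  then obtain a where a: "a \<in> I" "Complex x y \<in> W a"
   using cov[of "Complex x y"] \<open>y0 \<le> y\<close> \<open>y \<le> y1\<close> by auto
  then obtain eps where eps: "eps > 0" "ball (Complex x y) eps \<subseteq> W a"
   using data by (metis cousin_data_def open_contains_ball)
  have *: "orect (b - eps / 4) (b' + eps / 4) (c - eps / 4) (e + eps / 4) \<subseteq> W a"
   if "b <= x" "x <= b'" "b' - b < eps / 4" "c <= y" "y <= e" "e - c < eps / 4" for b b' c e
  proof
   fix z assume z: "z \<in> orect (b - eps / 4) (b' + eps / 4) (c - eps / 4) (e + eps / 4)"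
   then have "b - eps / 4 < Re z" "Re z < b' + eps / 4" "c - eps / 4 < Im z" "Im z < e + eps / 4"
    by (auto simp: orect_def)
   with that have "\<bar>Re z - x\<bar> < eps / 2" "\<bar>Im z - y\<bar> < eps / 2"
    by linarith+
   then have "norm (z - Complex x y) < eps"
    using cmod_le[of "z - Complex x y"] by simp
   then show "z \<in> W a" using eps(2) by (auto simp: dist_norm norm_minus_commute)
  qed
  have "cousin_rect I W C b b' c e"
   if "b <= x & x <= b' & b' - b < eps / 4" "c <= y & y <= e & e - c < eps / 4" for b b' c e
   unfolding cousin_rect_def using eps(1) cousin_solvable_member[OF data a(1) *, of b b' c e] that
   by (intro exI[of _ "eps / 4"]) auto
  then show ?case using eps(1) by (intro exI[of _ "eps / 4"] conjI) (auto intro!: exI[of _ "eps / 4"])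
 qed
 then show ?case by blast
qed

text \<open>Bisection solves the problem on rectangles, and four rectangles form a frame around the origin that covers the annulus. The frame is glued from two vertical and two horizontal bars, whose overlap consists of four small rectangles.\<close>

theorem cousin_annulus:
 assumes data: "cousin_data I W C" and \<rho>: "0 < \<rho>1" "\<rho>1 < \<rho>2"
  and cov: "{z. \<rho>1 / 3 < norm z & norm z < 2 * \<rho>2} \<subseteq> (\<Union>a\<in>I. W a)"
 shows "cousin_solvable I W C {z. \<rho>1 < norm z & norm z < \<rho>2}"
proof -
 define r where "r = \<rho>1 / 2"
 have r: "0 < r" "r < \<rho>2" "\<rho>1 = 2 * r" using \<rho> by (auto simp: r_def)
 have nz: "z \<in> (\<Union>a\<in>I. W a)" if z: "\<bar>Re z\<bar> <= \<rho>2" "\<bar>Im z\<bar> <= \<rho>2" "r <= \<bar>Re z\<bar> \<or> r <= \<bar>Im z\<bar>" for z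
 proof (rule subsetD[OF cov])
  have "r <= norm z" using z(3) abs_Re_le_cmod[of z] abs_Im_le_cmod[of z] by linarith
  moreover have "norm z < 2 * \<rho>2"
  proof -
   have "(norm z)\<^sup>2 = \<bar>Re z\<bar>\<^sup>2 + \<bar>Im z\<bar>\<^sup>2" by (simp add: cmod_power2)
   also have "... <= \<rho>2\<^sup>2 + \<rho>2\<^sup>2" using z by (intro add_mono power_mono) auto
   also have "... < (2 * \<rho>2)\<^sup>2" using r by (simp add: power_mult_distrib)
   finally show ?thesis by (rule power_less_imp_less_base) (use r in simp)
  qed
  ultimately show "z \<in> {z. \<rho>1 / 3 < norm z & norm z < 2 * \<rho>2}" using r by auto
 qed
 have "cousin_rect I W C r \<rho>2 (-\<rho>2) \<rho>2" by (intro cousin_rectI[OF data] nz) (use r in auto)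
 moreover have "cousin_rect I W C (-\<rho>2) (-r) (-\<rho>2) \<rho>2" by (intro cousin_rectI[OF data] nz) (use r in auto)
 moreover have "cousin_rect I W C (-r) r r \<rho>2" by (intro cousin_rectI[OF data] nz) (use r in auto)
 moreover have "cousin_rect I W C (-r) r (-\<rho>2) (-r)" by (intro cousin_rectI[OF data] nz) (use r in auto)
 ultimately obtain d1 d2 d3 d4 where d: "0 < d1" "0 < d2" "0 < d3" "0 < d4"
  and sol: "cousin_solvable I W C (orect (r - d1) (\<rho>2 + d1) (-\<rho>2 - d1) (\<rho>2 + d1))"
   "cousin_solvable I W C (orect (-\<rho>2 - d2) (-r + d2) (-\<rho>2 - d2) (\<rho>2 + d2))"
   "cousin_solvable I W C (orect (-r - d3) (r + d3) (r - d3) (\<rho>2 + d3))"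
   "cousin_solvable I W C (orect (-r - d4) (r + d4) (-\<rho>2 - d4) (-r + d4))"
  unfolding cousin_rect_def by blast
 define e where "e = min r (min (min d1 d2) (min d3 d4)) / 6"
 have e: "0 < e" "6 * e <= d1" "6 * e <= d2" "6 * e <= d3" "6 * e <= d4" "6 * e <= r"
  using d r by (auto simp: e_def)
 define A1 where "A1 t = orect (r - t) (\<rho>2 + t) (-\<rho>2 - t) (\<rho>2 + t)" for t
 define A2 where "A2 t = orect (-\<rho>2 - t) (-r + t) (-\<rho>2 - t) (\<rho>2 + t)" for t
 define B1 where "B1 t = orect (-r - t) (r + t) (r - t) (\<rho>2 + t)" for t
 define B2 where "B2 t = orect (-r - t) (r + t) (-\<rho>2 - t) (-r + t)" for t
 note AB = A1_def A2_def B1_def B2_def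
 let ?S1 = "A1 (6 * e) \<union> A2 (6 * e)" and ?S2 = "B1 (6 * e) \<union> B2 (6 * e)"
 let ?T1 = "A1 (2 * e) \<union> A2 (2 * e)" and ?T2 = "B1 (2 * e) \<union> B2 (2 * e)"
 have op: "open (A1 t)" "open (A2 t)" "open (B1 t)" "open (B2 t)" for t
  by (auto simp: AB open_orect)
 have S1: "cousin_solvable I W C ?S1"
 proof (rule cousin_solvable_disjoint[OF data])
  show "cousin_solvable I W C (A1 (6 * e))" by (rule cousin_solvable_subset[OF sol(1)]) (use e in \<open>auto simp: AB orect_def\<close>)
  show "cousin_solvable I W C (A2 (6 * e))" by (rule cousin_solvable_subset[OF sol(2)]) (use e in \<open>auto simp: AB orect_def\<close>)
  show "A1 (6 * e) Int A2 (6 * e) = {}" using e r by (auto simp: AB orect_def)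
 qed (rule op)+
 have S2: "cousin_solvable I W C ?S2"
 proof (rule cousin_solvable_disjoint[OF data])
  show "cousin_solvable I W C (B1 (6 * e))" by (rule cousin_solvable_subset[OF sol(3)]) (use e in \<open>auto simp: AB orect_def\<close>)
  show "cousin_solvable I W C (B2 (6 * e))" by (rule cousin_solvable_subset[OF sol(4)]) (use e in \<open>auto simp: AB orect_def\<close>)
  show "B1 (6 * e) Int B2 (6 * e) = {}" using e r by (auto simp: AB orect_def)
 qed (rule op)+
 have "cousin_solvable I W C (?T1 \<union> ?T2)"
 proof (rule cousin_solvable_merge[OF data S1 S2])
  have "A1 (2 * e) \<subseteq> A1 (6 * e)" "A2 (2 * e) \<subseteq> A2 (6 * e)" "B1 (2 * e) \<subseteq> B1 (6 * e)" "B2 (2 * e) \<subseteq> B2 (6 * e)"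
   unfolding AB orect_def using e(1) by (safe; simp)+
  then show "?T1 \<subseteq> ?S1" "?T2 \<subseteq> ?S2" by blast+
 next
  fix h assume h: "h holomorphic_on ?S1 Int ?S2"
  have cc: "cbox (Complex (r - 3 * e) (r - 3 * e)) (Complex (r + 3 * e) (\<rho>2 + 3 * e)) \<subseteq> A1 (6 * e) Int B1 (6 * e)"
   "cbox (Complex (r - 3 * e) (- \<rho>2 - 3 * e)) (Complex (r + 3 * e) (- r + 3 * e)) \<subseteq> A1 (6 * e) Int B2 (6 * e)"
   "cbox (Complex (- r - 3 * e) (r - 3 * e)) (Complex (- r + 3 * e) (\<rho>2 + 3 * e)) \<subseteq> A2 (6 * e) Int B1 (6 * e)"
   "cbox (Complex (- r - 3 * e) (- \<rho>2 - 3 * e)) (Complex (- r + 3 * e) (- r + 3 * e)) \<subseteq> A2 (6 * e) Int B2 (6 * e)"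
   unfolding AB orect_def using e r by (intro subsetI; simp add: in_cbox_complex_iff)+
  have c: "X Int Y \<subseteq> ?S1 Int ?S2" if "X \<in> {A1 (6 * e), A2 (6 * e)}" "Y \<in> {B1 (6 * e), B2 (6 * e)}" for X Y
   using that by blast
  \<comment> \<open>The overlap consists of four rectangles, at the corners of the frame. The sides of each rectangle
   that lie in \<open>S1\<close> go to \<open>h2\<close>, and those in \<open>S2\<close> to \<open>h1\<close>.\<close>
  obtain k1L k1R k1B k1T where k1:
   "k1L holomorphic_on {z. \<not> (Re z = r - 3 * e & r - 3 * e <= Im z & Im z <= \<rho>2 + 3 * e)}"
   "k1R holomorphic_on {z. \<not> (Re z = r + 3 * e & r - 3 * e <= Im z & Im z <= \<rho>2 + 3 * e)}"
   "k1B holomorphic_on {z. \<not> (Im z = r - 3 * e & r - 3 * e <= Re z & Re z <= r + 3 * e)}"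
   "k1T holomorphic_on {z. \<not> (Im z = \<rho>2 + 3 * e & r - 3 * e <= Re z & Re z <= r + 3 * e)}"
   "!!z. r - 3 * e < Re z ==> Re z < r + 3 * e ==> r - 3 * e < Im z ==> Im z < \<rho>2 + 3 * e ==> k1L z + k1R z + k1B z + k1T z = h z"
   "!!z. \<not> (r - 3 * e <= Re z & Re z <= r + 3 * e & r - 3 * e <= Im z & Im z <= \<rho>2 + 3 * e) ==> k1L z + k1R z + k1B z + k1T z = 0"
   by (rule rectangle_splitting[OF h _ _ subset_trans[OF cc(1) c]]) (use e r in simp_all)
  obtain k2L k2R k2B k2T where k2:
   "k2L holomorphic_on {z. \<not> (Re z = r - 3 * e & - \<rho>2 - 3 * e <= Im z & Im z <= - r + 3 * e)}"
   "k2R holomorphic_on {z. \<not> (Re z = r + 3 * e & - \<rho>2 - 3 * e <= Im z & Im z <= - r + 3 * e)}"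
   "k2B holomorphic_on {z. \<not> (Im z = - \<rho>2 - 3 * e & r - 3 * e <= Re z & Re z <= r + 3 * e)}"
   "k2T holomorphic_on {z. \<not> (Im z = - r + 3 * e & r - 3 * e <= Re z & Re z <= r + 3 * e)}"
   "!!z. r - 3 * e < Re z ==> Re z < r + 3 * e ==> - \<rho>2 - 3 * e < Im z ==> Im z < - r + 3 * e ==> k2L z + k2R z + k2B z + k2T z = h z"
   "!!z. \<not> (r - 3 * e <= Re z & Re z <= r + 3 * e & - \<rho>2 - 3 * e <= Im z & Im z <= - r + 3 * e) ==> k2L z + k2R z + k2B z + k2T z = 0"
   by (rule rectangle_splitting[OF h _ _ subset_trans[OF cc(2) c]]) (use e r in simp_all)
  obtain k3L k3R k3B k3T where k3:
   "k3L holomorphic_on {z. \<not> (Re z = - r - 3 * e & r - 3 * e <= Im z & Im z <= \<rho>2 + 3 * e)}"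
   "k3R holomorphic_on {z. \<not> (Re z = - r + 3 * e & r - 3 * e <= Im z & Im z <= \<rho>2 + 3 * e)}"
   "k3B holomorphic_on {z. \<not> (Im z = r - 3 * e & - r - 3 * e <= Re z & Re z <= - r + 3 * e)}"
   "k3T holomorphic_on {z. \<not> (Im z = \<rho>2 + 3 * e & - r - 3 * e <= Re z & Re z <= - r + 3 * e)}"
   "!!z. - r - 3 * e < Re z ==> Re z < - r + 3 * e ==> r - 3 * e < Im z ==> Im z < \<rho>2 + 3 * e ==> k3L z + k3R z + k3B z + k3T z = h z"
   "!!z. \<not> (- r - 3 * e <= Re z & Re z <= - r + 3 * e & r - 3 * e <= Im z & Im z <= \<rho>2 + 3 * e) ==> k3L z + k3R z + k3B z + k3T z = 0"
   by (rule rectangle_splitting[OF h _ _ subset_trans[OF cc(3) c]]) (use e r in simp_all)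
  obtain k4L k4R k4B k4T where k4:
   "k4L holomorphic_on {z. \<not> (Re z = - r - 3 * e & - \<rho>2 - 3 * e <= Im z & Im z <= - r + 3 * e)}"
   "k4R holomorphic_on {z. \<not> (Re z = - r + 3 * e & - \<rho>2 - 3 * e <= Im z & Im z <= - r + 3 * e)}"
   "k4B holomorphic_on {z. \<not> (Im z = - \<rho>2 - 3 * e & - r - 3 * e <= Re z & Re z <= - r + 3 * e)}"
   "k4T holomorphic_on {z. \<not> (Im z = - r + 3 * e & - r - 3 * e <= Re z & Re z <= - r + 3 * e)}"
   "!!z. - r - 3 * e < Re z ==> Re z < - r + 3 * e ==> - \<rho>2 - 3 * e < Im z ==> Im z < - r + 3 * e ==> k4L z + k4R z + k4B z + k4T z = h z"
   "!!z. \<not> (- r - 3 * e <= Re z & Re z <= - r + 3 * e & - \<rho>2 - 3 * e <= Im z & Im z <= - r + 3 * e) ==> k4L z + k4R z + k4B z + k4T z = 0"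
   by (rule rectangle_splitting[OF h _ _ subset_trans[OF cc(4) c]]) (use e r in simp_all)
  define h1 where "h1 = (%z. k1L z + k1T z + k2L z + k2B z + k3R z + k3T z + k4R z + k4B z)"
  define h2 where "h2 = (%z. - (k1R z + k1B z + k2R z + k2T z + k3L z + k3B z + k4L z + k4T z))"
  show "\<exists>h1 h2. h1 holomorphic_on ?T1 & h2 holomorphic_on ?T2 & (\<forall>z \<in> ?T1 Int ?T2. h z = h1 z - h2 z)"
  proof (intro exI conjI ballI)
   show "h1 holomorphic_on ?T1" unfolding h1_def
    by (intro holomorphic_on_add holomorphic_on_subset[OF k1(1)] holomorphic_on_subset[OF k1(4)]
      holomorphic_on_subset[OF k2(1)] holomorphic_on_subset[OF k2(3)] holomorphic_on_subset[OF k3(2)]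
      holomorphic_on_subset[OF k3(4)] holomorphic_on_subset[OF k4(2)] holomorphic_on_subset[OF k4(3)])
     (use e r in \<open>auto simp: AB orect_def\<close>)
   show "h2 holomorphic_on ?T2" unfolding h2_def
    by (intro holomorphic_on_minus holomorphic_on_add holomorphic_on_subset[OF k1(2)] holomorphic_on_subset[OF k1(3)]
      holomorphic_on_subset[OF k2(2)] holomorphic_on_subset[OF k2(4)] holomorphic_on_subset[OF k3(1)]
      holomorphic_on_subset[OF k3(3)] holomorphic_on_subset[OF k4(1)] holomorphic_on_subset[OF k4(4)])
     (use e r in \<open>auto simp: AB orect_def\<close>)
   fix z assume z: "z \<in> ?T1 Int ?T2"
   have eq: "h1 z - h2 z = (k1L z + k1R z + k1B z + k1T z) + (k2L z + k2R z + k2B z + k2T z) +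
     (k3L z + k3R z + k3B z + k3T z) + (k4L z + k4R z + k4B z + k4T z)"
    by (simp add: h1_def h2_def)
   consider "z \<in> A1 (2 * e) Int B1 (2 * e)" | "z \<in> A1 (2 * e) Int B2 (2 * e)"
    | "z \<in> A2 (2 * e) Int B1 (2 * e)" | "z \<in> A2 (2 * e) Int B2 (2 * e)" using z by blast
   then show "h z = h1 z - h2 z"
   proof cases
    case 1
    then have "r - 3 * e < Re z" "Re z < r + 3 * e" "r - 3 * e < Im z" "Im z < \<rho>2 + 3 * e"
     using e r by (auto simp: AB orect_def)
    then show ?thesis unfolding eq using e r k1(5)[of z] k2(6)[of z] k3(6)[of z] k4(6)[of z] by simp
   next
    case 2
    then have "r - 3 * e < Re z" "Re z < r + 3 * e" "- \<rho>2 - 3 * e < Im z" "Im z < - r + 3 * e"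
     using e r by (auto simp: AB orect_def)
    then show ?thesis unfolding eq using e r k2(5)[of z] k1(6)[of z] k3(6)[of z] k4(6)[of z] by simp
   next
    case 3
    then have "- r - 3 * e < Re z" "Re z < - r + 3 * e" "r - 3 * e < Im z" "Im z < \<rho>2 + 3 * e"
     using e r by (auto simp: AB orect_def)
    then show ?thesis unfolding eq using e r k3(5)[of z] k2(6)[of z] k1(6)[of z] k4(6)[of z] by simp
   next
    case 4
    then have "- r - 3 * e < Re z" "Re z < - r + 3 * e" "- \<rho>2 - 3 * e < Im z" "Im z < - r + 3 * e"
     using e r by (auto simp: AB orect_def)
    then show ?thesis unfolding eq using e r k4(5)[of z] k2(6)[of z] k3(6)[of z] k1(6)[of z] by simp
   qed
  qed
 qed (intro open_Un op)+
 then show ?thesis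
 proof (rule cousin_solvable_subset, intro subsetI)
  fix z :: complex assume "z \<in> {z. \<rho>1 < norm z & norm z < \<rho>2}"
  then have z: "2 * r < norm z" "norm z < \<rho>2" using r by auto
  have "\<bar>Re z\<bar> < \<rho>2" "\<bar>Im z\<bar> < \<rho>2" using z abs_Re_le_cmod[of z] abs_Im_le_cmod[of z] by linarith+
  moreover have "\<bar>Re z\<bar> > r \<or> \<bar>Im z\<bar> > r" using z cmod_le[of z] by linarith
  ultimately show "z \<in> ?T1 \<union> ?T2" using e r by (auto simp: AB orect_def abs_if split: if_splits)
 qed
qed

section \<open>Block triangular matrices\<close>

lemma minv_inverse:
 fixes M :: "'a::field mat"
 assumes M: "M \<in> carrier_mat n n" and d: "det M ~= 0"
 shows "minv M \<in> carrier_mat n n" "M * minv M = 1\<^sub>m n" "minv M * M = 1\<^sub>m n"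
proof -
 have "mat_inverse M ~= None"
  using mat_inverse(1)[OF M, of undefined] det_non_zero_imp_unit[OF M d, of undefined] by auto
 then obtain N where "mat_inverse M = Some N" by blast
 with mat_inverse(2)[OF M this]
 show "minv M \<in> carrier_mat n n" "M * minv M = 1\<^sub>m n" "minv M * M = 1\<^sub>m n"
  by (auto simp: minv_def)
qed

lemma inverse_mat_unique:
 fixes M :: "'a::semiring_1 mat"
 assumes "M \<in> carrier_mat n n" "N \<in> carrier_mat n n" "N' \<in> carrier_mat n n" "M * N = 1\<^sub>m n" "N' * M = 1\<^sub>m n"
 shows "N = N'"
proof -
 have "N = (N' * M) * N" using assms by simp
 also have "... = N' * (M * N)" using assms(1-3) by (simp only: assoc_mult_mat)
 finally show ?thesis using assms by simp
qed

locale blocks =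
 fixes k :: nat and r :: "nat => nat"
begin

definition n :: nat where "n = total_rank k r"

abbreviation bl :: "nat => nat" where "bl \<equiv> block_of r"

definition loc :: "nat => nat" where "loc a = a - offset r (bl a)"

lemma block_bounds:
 assumes "a < n"
 shows "1 <= bl a" "bl a <= k" "offset r (bl a) <= a" "loc a < r (bl a)" "offset r (bl a) + loc a = a"
proof -
 have ex: "a < offset r (Suc k)" using assms by (simp add: n_def offset_last)
 have *: "a < offset r (Suc (bl a))" unfolding block_of_def by (rule LeastI[of _ k]) (rule ex)
 show 1: "1 <= bl a" using * by (cases "bl a") (auto simp: offset_def)
 show "bl a <= k" unfolding block_of_def by (rule Least_le[of _ k]) (rule ex)
 show 2: "offset r (bl a) <= a"
 proof (rule ccontr)
  assume "\<not> offset r (bl a) <= a"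
  then have "a < offset r (Suc (bl a - 1))" using 1 by simp
  then have "bl a <= bl a - 1" unfolding block_of_def[of r a] by (rule Least_le)
  then show False using 1 by simp
 qed
 show "loc a < r (bl a)" using * 1 2 by (simp add: loc_def offset_Suc)
 show "offset r (bl a) + loc a = a" using 2 by (simp add: loc_def)
qed

lemma index_less: "1 <= i ==> i <= k ==> x < r i ==> offset r i + x < n"
proof -
 assume "1 <= i" "i <= k" "x < r i"
 then have "offset r i + x < offset r (Suc i)" by (simp add: offset_Suc)
 also have "... <= offset r (Suc k)" using \<open>i \<le> k\<close> by (intro offset_mono) simp
 finally show ?thesis by (simp add: offset_last n_def)
qed

lemma loc_offset: "1 <= i ==> x < r i ==> loc (offset r i + x) = x"
 by (simp add: loc_def block_of_offset)

lemma block_of_mono: "a <= b ==> b < n ==> bl a <= bl b"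
proof -
 assume ab: "a <= b" "b < n"
 have "a < offset r (Suc (bl b))"
  using block_bounds[OF ab(2)] ab by (simp add: offset_Suc)
 then show ?thesis unfolding block_of_def[of r a] by (rule Least_le)
qed

text \<open>Sums over the indices of one block.\<close>

lemma sum_block:
 assumes "1 <= i" "i <= k"
 shows "(\<Sum>c\<in>{c. c < n & bl c = i}. f c) = (\<Sum>x<r i. f (offset r i + x))"
 by (rule sum.reindex_bij_witness[where i = "%x. offset r i + x" and j = loc])
  (use assms block_bounds index_less loc_offset block_of_offset in auto)

text \<open>Block upper triangular matrices, and equality of their diagonal blocks. The latter is a congruence
 for the product, and \<open>\<GG>\<close> consists of the matrices with the same diagonal blocks as \<open>1\<close>.\<close>

definition BU :: "'a::zero mat set" where
 "BU = {M \<in> carrier_mat n n. \<forall>a<n. \<forall>b<n. bl b < bl a --> M $$ (a, b) = 0}"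

definition eqd :: "'a mat => 'a mat => bool" where
 "eqd M N \<longleftrightarrow> (\<forall>a<n. \<forall>b<n. bl a = bl b --> M $$ (a, b) = N $$ (a, b))"

lemma BU_carrier: "M \<in> BU ==> M \<in> carrier_mat n n"
 by (simp add: BU_def)

lemma BU_zero: "M \<in> BU ==> a < n ==> b < n ==> bl b < bl a ==> M $$ (a, b) = 0"
 by (simp add: BU_def)

lemma eqd_refl [simp]: "eqd M M" and eqd_sym: "eqd M N ==> eqd N M"
 and eqd_trans: "eqd M N ==> eqd N L ==> eqd M L"
 by (auto simp: eqd_def)

lemma mult_entry:
 assumes "M \<in> carrier_mat n n" "N \<in> carrier_mat n n" "a < n" "b < n"
 shows "(M * N) $$ (a, b) = (\<Sum>c<n. M $$ (a, c) * N $$ (c, b))"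
 using assms by (simp add: scalar_prod_def atLeast0LessThan)

lemma BU_mult:
 fixes M N :: "'a::semiring_0 mat"
 assumes M: "M \<in> BU" and N: "N \<in> BU"
 shows "M * N \<in> BU"
 unfolding BU_def
proof (intro CollectI conjI allI impI)
 show "M * N \<in> carrier_mat n n" by (rule mult_carrier_mat[OF BU_carrier[OF M] BU_carrier[OF N]])
 fix a b assume ab: "a < n" "b < n" "bl b < bl a"
 have "M $$ (a, c) * N $$ (c, b) = 0" if c: "c < n" for c
  using BU_zero[OF M ab(1) c] BU_zero[OF N c ab(2)] ab(3) by (cases "bl c < bl a") auto
 then show "(M * N) $$ (a, b) = 0"
  using ab by (simp add: mult_entry[OF BU_carrier[OF M] BU_carrier[OF N]])
qed

lemma BU_mult_diag:
 fixes M N :: "'a::semiring_0 mat"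
 assumes M: "M \<in> BU" and N: "N \<in> BU" and ab: "a < n" "b < n" "bl a = bl b"
 shows "(M * N) $$ (a, b) = (\<Sum>c\<in>{c. c < n & bl c = bl a}. M $$ (a, c) * N $$ (c, b))"
 unfolding mult_entry[OF BU_carrier[OF M] BU_carrier[OF N] ab(1,2)]
proof (rule sum.mono_neutral_right)
 show "\<forall>c\<in>{..<n} - {c. c < n & bl c = bl a}. M $$ (a, c) * N $$ (c, b) = 0"
 proof
  fix c assume c: "c \<in> {..<n} - {c. c < n & bl c = bl a}"
  then show "M $$ (a, c) * N $$ (c, b) = 0"
   using BU_zero[OF M ab(1), of c] BU_zero[OF N _ ab(2), of c] ab(3) by (cases "bl c < bl a") auto
 qed
qed auto

lemma eqd_mult:
 fixes M N :: "'a::semiring_0 mat"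
 assumes "M \<in> BU" "N \<in> BU" "M' \<in> BU" "N' \<in> BU" "eqd M M'" "eqd N N'"
 shows "eqd (M * N) (M' * N')"
 unfolding eqd_def
proof (intro allI impI)
 fix a b assume ab: "a < n" "b < n" "bl a = bl b"
 show "(M * N) $$ (a, b) = (M' * N') $$ (a, b)"
  unfolding BU_mult_diag[OF assms(1,2) ab] BU_mult_diag[OF assms(3,4) ab]
  using assms(5,6) ab by (intro sum.cong) (auto simp: eqd_def)
qed

lemma BU_one: "(1\<^sub>m n :: 'a::{zero,one} mat) \<in> BU"
 by (auto simp: BU_def)

lemma frakG_iff: "(M :: 'a::{zero,one} mat) \<in> frakG k r \<longleftrightarrow> M \<in> BU & eqd M (1\<^sub>m n)"
proof
 assume M: "M \<in> frakG k r"
 then have c: "M \<in> carrier_mat n n" by (simp add: frakG_def n_def)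
 have e: "M $$ (a, b) = block r M (bl a) (bl b) $$ (loc a, loc b)" if "a < n" "b < n" for a b
  using block_bounds[OF that(1)] block_bounds[OF that(2)] by (simp add: block_def)
 have "M $$ (a, b) = 0" if "a < n" "b < n" "bl b < bl a" for a b
  using M e[OF that(1,2)] block_bounds[OF that(1)] block_bounds[OF that(2)] that(3) by (simp add: frakG_def)
 moreover have "M $$ (a, b) = 1\<^sub>m n $$ (a, b)" if ab: "a < n" "b < n" "bl a = bl b" for a b
 proof -
  have "M $$ (a, b) = 1\<^sub>m (r (bl a)) $$ (loc a, loc b)"
   using M e[OF ab(1,2)] block_bounds[OF ab(1)] ab(3) by (simp add: frakG_def)
  moreover have "loc a = loc b \<longleftrightarrow> a = b"
   using block_bounds(5)[OF ab(1)] block_bounds(5)[OF ab(2)] ab(3) by metis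
  ultimately show ?thesis
   using ab block_bounds(4)[OF ab(1)] block_bounds(4)[OF ab(2)] by simp
 qed
 ultimately show "M \<in> BU & eqd M (1\<^sub>m n)" using c by (auto simp: BU_def eqd_def)
next
 assume M: "M \<in> BU & eqd M (1\<^sub>m n)"
 have "block r M i i = 1\<^sub>m (r i)" if i: "i \<in> {1..k}" for i
 proof (rule eq_matI)
  fix a b assume ab: "a < dim_row (1\<^sub>m (r i) :: 'a mat)" "b < dim_col (1\<^sub>m (r i) :: 'a mat)"
  then have "offset r i + a < n" "offset r i + b < n" "bl (offset r i + a) = i" "bl (offset r i + b) = i"
   using i index_less block_of_offset by auto
  then show "block r M i i $$ (a, b) = 1\<^sub>m (r i) $$ (a, b)"
   using M ab by (auto simp: block_def eqd_def)
 qed (auto simp: block_def)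
 moreover have "block r M i j = 0\<^sub>m (r i) (r j)" if i: "i \<in> {1..k}" "j \<in> {1..k}" "j < i" for i j
 proof (rule eq_matI)
  fix a b assume ab: "a < dim_row (0\<^sub>m (r i) (r j) :: 'a mat)" "b < dim_col (0\<^sub>m (r i) (r j) :: 'a mat)"
  then have "offset r i + a < n" "offset r j + b < n" "bl (offset r i + a) = i" "bl (offset r j + b) = j"
   using i index_less block_of_offset by auto
  then show "block r M i j $$ (a, b) = 0\<^sub>m (r i) (r j) $$ (a, b)"
   using M ab i by (auto simp: block_def BU_def)
 qed (auto simp: block_def)
 ultimately show "M \<in> frakG k r"
  using M by (auto simp: frakG_def BU_def n_def)
qed

lemma frakG_carrier: "M \<in> frakG k r ==> M \<in> carrier_mat n n"
 by (simp add: frakG_iff BU_def)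

lemma frakG_entry:
 "M \<in> frakG k r ==> a < n ==> b < n ==> bl b <= bl a ==> M $$ (a, b) = (if a = b then 1 else 0)"
 by (cases "bl b < bl a") (auto simp: frakG_iff eqd_def BU_def)

lemma frakG_I:
 assumes "M \<in> carrier_mat n n" "!!a b. a < n ==> b < n ==> bl b <= bl a ==> M $$ (a, b) = (if a = b then 1 else 0)"
 shows "M \<in> frakG k r"
 using assms by (auto simp: frakG_iff eqd_def BU_def)

lemma frakG_one: "(1\<^sub>m n :: 'a::{zero,one} mat) \<in> frakG k r"
 by (simp add: frakG_iff BU_one)

lemma frakG_mult:
 fixes M N :: "'a::semiring_1 mat"
 assumes "M \<in> frakG k r" "N \<in> frakG k r"
 shows "M * N \<in> frakG k r"
proof -
 have "eqd (M * N) (1\<^sub>m n * 1\<^sub>m n)"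
  using assms by (intro eqd_mult) (auto simp: frakG_iff BU_one)
 then show ?thesis using assms BU_mult by (auto simp: frakG_iff)
qed

lemma frakG_det:
 fixes M :: "'a::field mat"
 assumes "M \<in> frakG k r"
 shows "det M = 1"
proof -
 have M: "M \<in> carrier_mat n n" by (rule frakG_carrier[OF assms])
 have "upper_triangular M"
  using frakG_entry[OF assms] block_of_mono M by (auto simp: upper_triangular_def)
 then have "det M = prod_list (diag_mat M)" by (rule det_upper_triangular[OF _ M])
 also have "diag_mat M = map (%i. 1) [0..<n]"
  using frakG_entry[OF assms] M by (auto simp: diag_mat_def)
 finally show ?thesis by (simp add: prod_list_replicate map_replicate_const)
qed

lemma frakG_minv:
 fixes M :: "'a::field mat"
 assumes "M \<in> frakG k r"
 shows "minv M \<in> carrier_mat n n" "M * minv M = 1\<^sub>m n" "minv M * M = 1\<^sub>m n"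
 using minv_inverse[OF frakG_carrier[OF assms]] frakG_det[OF assms] by auto

text \<open>The rows of the inverse are determined recursively, starting with the last block.\<close>

lemma frakG_minv_entry:
 fixes M :: "'a::field mat"
 assumes M: "M \<in> frakG k r" and ab: "a < n" "b < n"
 shows "minv M $$ (a, b) = (if a = b then 1 else 0) - (\<Sum>c\<in>{c. c < n & bl a < bl c}. M $$ (a, c) * minv M $$ (c, b))"
proof -
 have "(if a = b then 1 else 0) = (M * minv M) $$ (a, b)"
  using frakG_minv(2)[OF M] ab by simp
 also have "... = (\<Sum>c<n. M $$ (a, c) * minv M $$ (c, b))"
  by (rule mult_entry[OF frakG_carrier[OF M] frakG_minv(1)[OF M] ab])
 also have "... = (\<Sum>c\<in>insert a {c. c < n & bl a < bl c}. M $$ (a, c) * minv M $$ (c, b))"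
 proof (rule sum.mono_neutral_right)
  show "\<forall>c\<in>{..<n} - insert a {c. c < n & bl a < bl c}. M $$ (a, c) * minv M $$ (c, b) = 0"
  proof
   fix c assume "c \<in> {..<n} - insert a {c. c < n & bl a < bl c}"
   then have "c < n" "bl c <= bl a" "c ~= a" by auto
   then show "M $$ (a, c) * minv M $$ (c, b) = 0" using frakG_entry[OF M ab(1)] by simp
  qed
 qed (use ab in auto)
 also have "... = minv M $$ (a, b) + (\<Sum>c\<in>{c. c < n & bl a < bl c}. M $$ (a, c) * minv M $$ (c, b))"
  using frakG_entry[OF M ab(1) ab(1)] by (subst sum.insert) auto
 finally show ?thesis by (simp add: algebra_simps)
qed

lemma minv_frakG:
 fixes M :: "'a::field mat"
 assumes M: "M \<in> frakG k r"
 shows "minv M \<in> frakG k r"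
proof (rule frakG_I[OF frakG_minv(1)[OF M]])
 fix a b :: nat assume "a < n" "b < n" "bl b <= bl a"
 then show "minv M $$ (a, b) = (if a = b then 1 else 0)"
 proof (induction "k - bl a" arbitrary: a rule: less_induct)
  case less
  have "minv M $$ (c, b) = 0" if c: "c < n" "bl a < bl c" for c
  proof -
   have "k - bl c < k - bl a" using c block_bounds(2)[OF c(1)] by simp
   then show ?thesis using less(1)[of c] c less.prems by auto
  qed
  then show ?case
   using frakG_minv_entry[OF M less.prems(1,2)] by simp
 qed
qed

text \<open>Entrywise holomorphy.\<close>

definition hol_mat :: "complex set => (complex => complex mat) => bool" where
 "hol_mat S F \<longleftrightarrow> (\<forall>a<n. \<forall>b<n. (%z. F z $$ (a, b)) holomorphic_on S)"

lemma hol_matD: "hol_mat S F ==> a < n ==> b < n ==> (%z. F z $$ (a, b)) holomorphic_on S"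
 by (simp add: hol_mat_def)

lemma hol_mat_subset: "hol_mat S F ==> S' \<subseteq> S ==> hol_mat S' F"
 unfolding hol_mat_def by (blast intro: holomorphic_on_subset)

lemma hol_mat_cong:
 assumes "hol_mat S F" "!!z. z \<in> S ==> F z = G z"
 shows "hol_mat S G"
 unfolding hol_mat_def
proof (intro allI impI)
 fix a b assume "a < n" "b < n"
 from hol_matD[OF assms(1) this] show "(%z. G z $$ (a, b)) holomorphic_on S"
  by (rule holomorphic_transform) (simp add: assms(2))
qed

lemma hol_mat_UN:
 assumes "!!i. i \<in> I ==> open (S i)" "!!i. i \<in> I ==> hol_mat (S i) F"
 shows "hol_mat (\<Union>i\<in>I. S i) F"
 unfolding hol_mat_def by (intro allI impI holomorphic_on_UN_open hol_matD[OF assms(2)] assms(1)) auto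

lemma hol_mat_mult:
 assumes "hol_mat S F" "hol_mat S G" "!!z. z \<in> S ==> F z \<in> carrier_mat n n" "!!z. z \<in> S ==> G z \<in> carrier_mat n n"
 shows "hol_mat S (%z. F z * G z)"
 unfolding hol_mat_def
proof (intro allI impI)
 fix a b assume ab: "a < n" "b < n"
 have "(%z. \<Sum>c<n. F z $$ (a, c) * G z $$ (c, b)) holomorphic_on S"
  using ab by (intro holomorphic_intros hol_matD[OF assms(1)] hol_matD[OF assms(2)]) auto
 then show "(%z. (F z * G z) $$ (a, b)) holomorphic_on S"
  by (rule holomorphic_transform) (simp add: mult_entry[OF assms(3,4) ab])
qed

lemma hol_mat_minv:
 assumes F: "hol_mat S F" and G: "!!z. z \<in> S ==> F z \<in> frakG k r"
 shows "hol_mat S (%z. minv (F z))"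
 unfolding hol_mat_def
proof (intro allI impI)
 fix a b assume "a < n" "b < n"
 then show "(%z. minv (F z) $$ (a, b)) holomorphic_on S"
 proof (induction "k - bl a" arbitrary: a rule: less_induct)
  case less
  have "(%z. minv (F z) $$ (c, b)) holomorphic_on S" if c: "c < n" "bl a < bl c" for c
  proof -
   have "k - bl c < k - bl a" using c block_bounds(2)[OF c(1)] by simp
   then show ?thesis using less(1)[of c] c less.prems by auto
  qed
  then have "(%z. (if a = b then 1 else 0) - (\<Sum>c\<in>{c. c < n & bl a < bl c}. F z $$ (a, c) * minv (F z) $$ (c, b))) holomorphic_on S"
   using less.prems by (intro holomorphic_intros hol_matD[OF F]) auto
  then show ?case
   by (rule holomorphic_transform) (rule frakG_minv_entry[OF G less.prems(1,2), symmetric])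
 qed
qed

lemma hol_mat_compose_scale:
 assumes "hol_mat S F" "!!z. z \<in> T ==> c * z \<in> S"
 shows "hol_mat T (%z. F (c * z))"
 unfolding hol_mat_def
proof (intro allI impI)
 fix a b assume "a < n" "b < n"
 from hol_matD[OF assms(1) this]
 show "(%z. F (c * z) $$ (a, b)) holomorphic_on T"
  by (rule holomorphic_on_compose_gen[where g = "%z. F z $$ (a, b)" and f = "%z. c * z", unfolded o_def, rotated])
   (use assms(2) in \<open>auto intro!: holomorphic_intros\<close>)
qed

end

section \<open>The elliptic curve\<close>

context q_base
begin

lemma Eq_proj_altdef: "Eq_proj q z = range (%m::int. q powi m * z)"
 by (auto simp: Eq_proj_def qZ_def r_coset_def Cstar_def)

lemma carrier_Eq: "carrier (Eq q) = Eq_proj q ` (- {0})"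
 by (auto simp: Eq_def FactGroup_def RCOSETS_def Cstar_def Eq_proj_def)

lemma Eq_proj_eq_iff: "Eq_proj q z = Eq_proj q w \<longleftrightarrow> (\<exists>m::int. w = q powi m * z)"
proof
 assume "Eq_proj q z = Eq_proj q w"
 moreover have "w \<in> Eq_proj q w" unfolding Eq_proj_altdef by (rule range_eqI[of _ _ 0]) simp
 ultimately show "\<exists>m::int. w = q powi m * z" by (auto simp: Eq_proj_altdef)
next
 assume "\<exists>m::int. w = q powi m * z"
 then obtain m :: int where m: "w = q powi m * z" by blast
 have "q powi l * z = q powi (l - m) * w" "q powi l * w = q powi (l + m) * z" for l :: int
  by (simp_all add: m power_int_diff power_int_add)
 then show "Eq_proj q z = Eq_proj q w"
  unfolding Eq_proj_altdef by (metis (no_types, lifting) rangeI subsetI subset_antisym rangeE)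
qed

lemma Eq_proj_powi [simp]: "Eq_proj q (q powi m * z) = Eq_proj q z"
 using Eq_proj_eq_iff by metis

lemma Eq_proj_mult [simp]: "Eq_proj q (q * z) = Eq_proj q z"
 using Eq_proj_powi[of 1 z] by simp

lemma Eq_proj_power [simp]: "Eq_proj q (q ^ m * z) = Eq_proj q z"
 using Eq_proj_powi[of "int m" z] by simp

lemma Eq_proj_divide_power [simp]: "Eq_proj q (z / q ^ m) = Eq_proj q z"
 using Eq_proj_power[of m "z / q ^ m"] by simp

lemma Eq_proj_divide [simp]: "Eq_proj q (z / q) = Eq_proj q z"
 using Eq_proj_divide_power[of z 1] by simp

definition Pre :: "complex set set => complex set" where
 "Pre V = {z. z ~= 0 & Eq_proj q z \<in> V}"

lemma Pre_0 [simp]: "0 \<notin> Pre V" by (simp add: Pre_def)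

lemma Pre_mult [simp]: "q * z \<in> Pre V \<longleftrightarrow> z \<in> Pre V"
 and Pre_divide [simp]: "z / q \<in> Pre V \<longleftrightarrow> z \<in> Pre V"
 and Pre_power [simp]: "q ^ m * z \<in> Pre V \<longleftrightarrow> z \<in> Pre V"
 and Pre_divide_power [simp]: "z / q ^ m \<in> Pre V \<longleftrightarrow> z \<in> Pre V"
 by (simp_all add: Pre_def)

lemma Pre_Int [simp]: "Pre (V Int V') = Pre V Int Pre V'"
 by (auto simp: Pre_def)

lemma Pre_mono: "V \<subseteq> V' ==> Pre V \<subseteq> Pre V'"
 by (auto simp: Pre_def)

lemma openin_Eq_iff: "openin (Eq_top q) V \<longleftrightarrow> V \<subseteq> carrier (Eq q) & open (Pre V)"
 by (simp add: openin_Eq_top Pre_def)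

lemma small_divide:
 assumes "0 < eps"
 shows "\<exists>m. norm (z / q ^ m) < eps"
proof -
 have "eventually (%m. dist (z / q ^ m) 0 < eps) sequentially"
  using tendsto_divide_q_power[of z] assms by (rule tendstoD)
 then show ?thesis by (auto simp: eventually_sequentially)
qed

lemma norm_divide_q_le: "norm (z / q ^ m) <= norm z"
 using q one_le_power[of "norm q" m] by (simp add: norm_divide norm_power divide_le_eq mult_le_cancel_left1)

lemma norm_le_mult_q: "norm z <= norm (q * z)"
 using q by (simp add: norm_mult mult_le_cancel_right1)

lemma sector_Pre:
 assumes "openin (Eq_top q) V" "0 < eps"
 shows "sector q (Pre V Int ball 0 eps)" "horizon q (Pre V Int ball 0 eps) = V"
proof -
 have "norm (z / q) < eps" if "norm z < eps" for z
  using norm_divide_q_le[of z 1] that by simp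
 then show "sector q (Pre V Int ball 0 eps)"
  using assms by (auto simp: sector_def openin_Eq_iff)
 show "horizon q (Pre V Int ball 0 eps) = V"
 proof
  show "horizon q (Pre V Int ball 0 eps) \<subseteq> V" by (auto simp: horizon_def Pre_def)
  show "V \<subseteq> horizon q (Pre V Int ball 0 eps)"
  proof
   fix v assume v: "v \<in> V"
   then obtain z where z: "z ~= 0" "v = Eq_proj q z" using assms(1) by (auto simp: openin_Eq_iff carrier_Eq)
   obtain m where "norm (z / q ^ m) < eps" using small_divide[OF assms(2)] by blast
   then have "z / q ^ m \<in> Pre V Int ball 0 eps" using z v by (simp add: Pre_def)
   then show "v \<in> horizon q (Pre V Int ball 0 eps)"
    unfolding horizon_def by (rule rev_image_eqI) (simp add: z)
  qed
 qed
qed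

lemma sector_power: "sector q W ==> z \<in> W ==> z / q ^ m \<in> W"
proof (induction m)
 case (Suc m)
 then have "(z / q ^ m) / q \<in> W" by (auto simp: sector_def simp del: divide_divide_eq_left)
 then show ?case by (simp add: mult.commute)
qed simp

lemma sector_subset_Pre: "sector q W ==> horizon q W = V ==> W \<subseteq> Pre V"
 by (auto simp: sector_def horizon_def Pre_def)

lemma sector_reach:
 assumes W: "sector q W" "horizon q W = V" and z: "z \<in> Pre V"
 shows "\<exists>m. z / q ^ m \<in> W"
proof -
 have "Eq_proj q z \<in> horizon q W" using z W by (simp add: Pre_def)
 then obtain w where w: "w \<in> W" "Eq_proj q z = Eq_proj q w" by (auto simp: horizon_def)
 then obtain m :: int where m: "w = q powi m * z" using Eq_proj_eq_iff by blast
 show ?thesis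
 proof (cases "m >= 0")
  case True
  then have "w / q ^ nat m = z" by (simp add: m power_int_def)
  then have "z \<in> W" using sector_power[OF W(1) w(1), of "nat m"] by simp
  then show ?thesis by (intro exI[of _ 0]) simp
 next
  case False
  then have "z / q ^ nat (- m) = w" by (simp add: m power_int_def divide_inverse mult.commute power_inverse)
  then show ?thesis using w by (intro exI[of _ "nat (- m)"]) simp
 qed
qed

lemma sector_Int:
 assumes "sector q W" "horizon q W = V" "sector q W'" "horizon q W' = V"
 shows "sector q (W Int W')" "horizon q (W Int W') = V"
proof -
 show "sector q (W Int W')" using assms by (auto simp: sector_def)
 have "V \<subseteq> horizon q (W Int W')"
 proof
  fix v assume "v \<in> V"
  then obtain z where z: "z \<in> W" "v = Eq_proj q z" using assms(2) by (auto simp: horizon_def)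
  then have "z \<in> Pre V" using sector_subset_Pre[OF assms(1,2)] by blast
  then obtain m where "z / q ^ m \<in> W'" using sector_reach[OF assms(3,4)] by blast
  then have "z / q ^ m \<in> W Int W'" using sector_power[OF assms(1) z(1)] by blast
  then show "v \<in> horizon q (W Int W')" unfolding horizon_def by (rule rev_image_eqI) (simp add: z)
 qed
 then show "horizon q (W Int W') = V" using assms(2) by (auto simp: horizon_def)
qed

lemma sector_restrict:
 assumes "sector q W" "horizon q W = V" "V' \<subseteq> V" "openin (Eq_top q) V'"
 shows "sector q (W Int Pre V')" "horizon q (W Int Pre V') = V'"
proof -
 show "sector q (W Int Pre V')" using assms by (auto simp: sector_def openin_Eq_iff)
 have "V' \<subseteq> horizon q (W Int Pre V')"
 proof
  fix v assume v: "v \<in> V'"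
  then obtain z where z: "z \<in> W" "v = Eq_proj q z" using assms by (auto simp: horizon_def)
  then have "z \<in> W Int Pre V'" using v assms(1) by (auto simp: Pre_def sector_def)
  then show "v \<in> horizon q (W Int Pre V')" unfolding horizon_def by (rule rev_image_eqI) (simp add: z)
 qed
 then show "horizon q (W Int Pre V') = V'" by (auto simp: horizon_def Pre_def)
qed

end

section \<open>Extension by means of the functional equation\<close>

primrec transport :: "(complex => 'x => 'x) => complex => nat => complex => 'x => 'x" where
 "transport S p 0 w X = X"
| "transport S p (Suc m) w X = S (p ^ m * w) (transport S p m w X)"

lemma transport_add: "transport S p (m + l) w X = transport S p l (p ^ m * w) (transport S p m w X)"
 by (induction l) (simp_all add: power_add mult_ac)

text \<open>A solution of \<open>f (p w) = S w (f w)\<close> on a set meeting every orbit in an interval extends uniquely to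
 all orbits.\<close>

lemma functional_extension:
 fixes p :: complex and f :: "complex => 'x"
 assumes p: "p ~= 0" and reach: "!!z. z \<in> \<Omega> ==> \<exists>m. z / p ^ m \<in> W"
  and conv: "!!w m l. w \<in> W ==> p ^ m * w \<in> W ==> l <= m ==> p ^ l * w \<in> W"
  and eq: "!!w. w \<in> W ==> p * w \<in> W ==> f (p * w) = S w (f w)"
 obtains f' where "!!z m. z \<in> \<Omega> ==> z / p ^ m \<in> W ==> f' z = transport S p m (z / p ^ m) (f (z / p ^ m))"
  "!!w. w \<in> \<Omega> ==> p * w \<in> \<Omega> ==> f' (p * w) = S w (f' w)"
proof
 have step: "f (p ^ m * w) = transport S p m w (f w)" if "w \<in> W" "p ^ m * w \<in> W" for w m
  using that
 proof (induction m)
  case (Suc m)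
  have m: "p ^ m * w \<in> W" using conv[OF Suc.prems, of m] by simp
  then show ?case
   using Suc eq[of "p ^ m * w"] by (simp add: mult.assoc)
 qed simp
 define N where "N z = (LEAST m. z / p ^ m \<in> W)" for z
 define f' where "f' z = transport S p (N z) (z / p ^ N z) (f (z / p ^ N z))" for z
 show f': "f' z = transport S p m (z / p ^ m) (f (z / p ^ m))" if z: "z \<in> \<Omega>" "z / p ^ m \<in> W" for z m
 proof -
  have N: "z / p ^ N z \<in> W" unfolding N_def by (rule LeastI[of _ m]) (rule z(2))
  have "N z <= m" unfolding N_def by (rule Least_le) (rule z(2))
  then have m: "m = (m - N z) + N z" by simp
  have e: "p ^ (m - N z) * (z / p ^ m) = z / p ^ N z"
   using p \<open>N z \<le> m\<close> by (simp add: power_diff)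
  have "transport S p m (z / p ^ m) (f (z / p ^ m)) =
    transport S p (N z) (p ^ (m - N z) * (z / p ^ m)) (transport S p (m - N z) (z / p ^ m) (f (z / p ^ m)))"
   by (subst m, subst transport_add) simp
  also have "transport S p (m - N z) (z / p ^ m) (f (z / p ^ m)) = f (z / p ^ N z)"
   using step[OF z(2), of "m - N z"] e N by simp
  finally show ?thesis unfolding e f'_def by simp
 qed
 fix w assume w: "w \<in> \<Omega>" "p * w \<in> \<Omega>"
 obtain m where m: "w / p ^ m \<in> W" using reach[OF w(1)] by blast
 have e: "p * w / p ^ Suc m = w / p ^ m" using p by simp
 show "f' (p * w) = S w (f' w)"
  using f'[OF w(2), of "Suc m"] f'[OF w(1) m] m p unfolding e by simp
qed

context blocks
begin

lemma functional_extension_holomorphic: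
 fixes p :: complex and f :: "complex => complex mat"
 assumes p: "p ~= 0" and op: "open \<Omega>" "open W" and sub: "W \<subseteq> \<Omega>"
  and reach: "!!z. z \<in> \<Omega> ==> \<exists>m. z / p ^ m \<in> W"
  and path: "!!z m l. z \<in> \<Omega> ==> z / p ^ m \<in> W ==> l <= m ==> z / p ^ l \<in> \<Omega>"
  and conv: "!!w m l. w \<in> W ==> p ^ m * w \<in> W ==> l <= m ==> p ^ l * w \<in> W"
  and M: "hol_mat {w \<in> \<Omega>. p * w \<in> \<Omega>} M1" "hol_mat {w \<in> \<Omega>. p * w \<in> \<Omega>} M2"
   "!!w. w \<in> \<Omega> ==> p * w \<in> \<Omega> ==> M1 w \<in> carrier_mat n n"
   "!!w. w \<in> \<Omega> ==> p * w \<in> \<Omega> ==> M2 w \<in> carrier_mat n n"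
   "!!w X. w \<in> \<Omega> ==> p * w \<in> \<Omega> ==> X \<in> frakG k r ==> M1 w * X * M2 w \<in> frakG k r"
  and f: "hol_mat W f" "!!w. w \<in> W ==> f w \<in> frakG k r"
  and eq: "!!w. w \<in> W ==> p * w \<in> W ==> f (p * w) = M1 w * f w * M2 w"
 obtains f' where "!!w. w \<in> W ==> f' w = f w" "hol_mat \<Omega> f'" "!!w. w \<in> \<Omega> ==> f' w \<in> frakG k r"
  "!!w. w \<in> \<Omega> ==> p * w \<in> \<Omega> ==> f' (p * w) = M1 w * f' w * M2 w"
proof -
 define S where "S = (%w X. M1 w * X * M2 w)"
 obtain f' where f': "!!z m. z \<in> \<Omega> ==> z / p ^ m \<in> W ==> f' z = transport S p m (z / p ^ m) (f (z / p ^ m))"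
  "!!w. w \<in> \<Omega> ==> p * w \<in> \<Omega> ==> f' (p * w) = S w (f' w)"
  by (rule functional_extension[OF p reach conv, where f = f and S = S]) (use eq in \<open>auto simp: S_def\<close>)
 define Wm where "Wm m = {z \<in> \<Omega>. z / p ^ m \<in> W}" for m
 have opW: "open (Wm m)" for m
 proof -
  have "open ((%z. z / p ^ m) -` W)" by (intro open_vimage op continuous_intros) (use p in auto)
  moreover have "Wm m = \<Omega> Int (%z. z / p ^ m) -` W" by (auto simp: Wm_def)
  ultimately show ?thesis using op by auto
 qed
 have main: "hol_mat (Wm m) (%z. transport S p l (z / p ^ m) (f (z / p ^ m))) &
   (\<forall>z \<in> Wm m. transport S p l (z / p ^ m) (f (z / p ^ m)) \<in> frakG k r)" if "l <= m" for l m
  using that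
 proof (induction l)
  case 0
  have "hol_mat (Wm m) (%z. f ((1 / p ^ m) * z))"
   by (rule hol_mat_compose_scale[OF f(1)]) (auto simp: Wm_def)
  then show ?case using f(2) by (auto simp: Wm_def)
 next
  case (Suc l)
  have dom: "p ^ l * (z / p ^ m) \<in> \<Omega>" "p * (p ^ l * (z / p ^ m)) \<in> \<Omega>" if z: "z \<in> Wm m" for z
  proof -
   have "p ^ l * (z / p ^ m) = z / p ^ (m - l)" "p * (p ^ l * (z / p ^ m)) = z / p ^ (m - Suc l)"
    using Suc.prems p by (simp_all add: power_diff field_simps)
   then show "p ^ l * (z / p ^ m) \<in> \<Omega>" "p * (p ^ l * (z / p ^ m)) \<in> \<Omega>"
    using path[of z m "m - l"] path[of z m "m - Suc l"] z by (auto simp: Wm_def)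
  qed
  have h: "hol_mat (Wm m) (%z. Mi (p ^ l * (z / p ^ m)))" if "hol_mat {w \<in> \<Omega>. p * w \<in> \<Omega>} Mi" for Mi
   using hol_mat_compose_scale[OF that, of "Wm m" "p ^ l / p ^ m"] dom by simp
  have IH: "hol_mat (Wm m) (%z. transport S p l (z / p ^ m) (f (z / p ^ m)))"
   "!!z. z \<in> Wm m ==> transport S p l (z / p ^ m) (f (z / p ^ m)) \<in> frakG k r"
   using Suc by auto
  have "hol_mat (Wm m) (%z. M1 (p ^ l * (z / p ^ m)) * transport S p l (z / p ^ m) (f (z / p ^ m)) * M2 (p ^ l * (z / p ^ m)))"
   by (intro hol_mat_mult h IH M mult_carrier_mat[of _ n n] frakG_carrier dom)
  moreover have "\<forall>z \<in> Wm m. M1 (p ^ l * (z / p ^ m)) * transport S p l (z / p ^ m) (f (z / p ^ m)) * M2 (p ^ l * (z / p ^ m)) \<in> frakG k r"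
   by (intro ballI M(5) dom IH(2))
  ultimately show ?case by (simp add: S_def)
 qed
 show thesis
 proof (rule that[of f'])
  show "f' w = f w" if "w \<in> W" for w using f'(1)[of w 0] sub that by auto
  have U: "\<Omega> = (\<Union>m. Wm m)" using reach by (auto simp: Wm_def)
  have "hol_mat (Wm m) f'" for m
   by (rule hol_mat_cong[OF conjunct1[OF main[OF order_refl]]]) (use f'(1)[of _ m] in \<open>auto simp: Wm_def\<close>)
  then show "hol_mat \<Omega> f'" unfolding U by (intro hol_mat_UN opW)
  show "f' w \<in> frakG k r" if w: "w \<in> \<Omega>" for w
  proof -
   obtain m where "w / p ^ m \<in> W" using reach[OF w] by blast
   then show ?thesis using main[of m m] f'(1)[OF w, of m] w by (auto simp: Wm_def)
  qed
  show "f' (p * w) = M1 w * f' w * M2 w" if "w \<in> \<Omega>" "p * w \<in> \<Omega>" for w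
   using f'(2)[OF that] by (simp add: S_def)
 qed
qed

end

section \<open>The matrices of the formal class\<close>

locale qdiff = q_base q + blocks k r for q :: complex and k :: nat and r :: "nat => nat" +
 fixes mu :: "nat => int" and A :: "nat => complex mat"
 assumes k1: "k >= 1"
  and mu: "!!i j. 1 <= i ==> i < j ==> j <= k ==> mu i > mu j"
  and A: "!!i. 1 <= i ==> i <= k ==> A i \<in> carrier_mat (r i) (r i) & invertible_mat (A i)"
begin

lemma A_minv:
 assumes "1 <= i" "i <= k"
 shows "minv (A i) \<in> carrier_mat (r i) (r i)" "A i * minv (A i) = 1\<^sub>m (r i)" "minv (A i) * A i = 1\<^sub>m (r i)"
proof -
 have Ai: "A i \<in> carrier_mat (r i) (r i)" "invertible_mat (A i)" using A[OF assms] by auto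
 then obtain B where B: "inverts_mat (A i) B" "inverts_mat B (A i)" by (auto simp: invertible_mat_def)
 have "A i * B = 1\<^sub>m (r i)" using B(1) Ai by (simp add: inverts_mat_def)
 moreover have "B \<in> carrier_mat (r i) (r i)"
 proof -
  have "dim_col (A i * B) = r i" using calculation by simp
  moreover have "dim_col (B * A i) = r i" using Ai by simp
  moreover have "B * A i = 1\<^sub>m (dim_row B)" using B(2) by (simp add: inverts_mat_def)
  ultimately show ?thesis by (intro carrier_matI) auto
 qed
 ultimately have "det (A i) * det B = 1"
  using det_mult[OF Ai(1), of B] by simp
 then have "det (A i) ~= 0" by auto
 from minv_inverse[OF Ai(1) this]
 show "minv (A i) \<in> carrier_mat (r i) (r i)" "A i * minv (A i) = 1\<^sub>m (r i)" "minv (A i) * A i = 1\<^sub>m (r i)"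
  by auto
qed

abbreviation AM :: "(nat => nat => complex fls mat) => complex fls mat" where
 "AM U \<equiv> A_mat k mu r A U"

definition AU :: "(nat => nat => complex fls mat) => complex => complex mat" where
 "AU U z = mat_fun (AM U) z"

definition A0 :: "complex => complex mat" where
 "A0 z = Matrix.mat n n (%(a, b). if bl a = bl b then z powi (- mu (bl a)) * A (bl a) $$ (loc a, loc b) else 0)"

definition A0i :: "complex => complex mat" where
 "A0i z = Matrix.mat n n (%(a, b). if bl a = bl b then z powi (mu (bl a)) * minv (A (bl a)) $$ (loc a, loc b) else 0)"

lemmas mat_simps = assoc_mult_mat[of _ n n _ n _ n] right_mult_one_mat[of _ n n] left_mult_one_mat[of _ n n]
 mult_carrier_mat[of _ n n _ n]

lemma A0_BU: "A0 z \<in> BU" and A0i_BU: "A0i z \<in> BU"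
 by (auto simp: BU_def A0_def A0i_def)

lemma A0_carrier [simp]: "A0 z \<in> carrier_mat n n" and A0i_carrier [simp]: "A0i z \<in> carrier_mat n n"
 by (auto simp: A0_def A0i_def)

lemma block_diagonal_inverse:
 assumes M: "!!i. 1 <= i ==> i <= k ==> M i \<in> carrier_mat (r i) (r i) & N i \<in> carrier_mat (r i) (r i) & M i * N i = 1\<^sub>m (r i)"
  and c: "!!i. c i * d i = (1 :: complex)"
 shows "Matrix.mat n n (%(a, b). if bl a = bl b then c (bl a) * M (bl a) $$ (loc a, loc b) else 0) *
  Matrix.mat n n (%(a, b). if bl a = bl b then d (bl a) * N (bl a) $$ (loc a, loc b) else 0) = 1\<^sub>m n" (is "?P * ?Q = _")
proof (rule eq_matI)
 have P: "?P \<in> BU" "?Q \<in> BU" by (auto simp: BU_def)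
 fix a b assume "a < dim_row (1\<^sub>m n :: complex mat)" "b < dim_col (1\<^sub>m n :: complex mat)"
 then have ab: "a < n" "b < n" by auto
 show "(?P * ?Q) $$ (a, b) = 1\<^sub>m n $$ (a, b)"
 proof (cases "bl a = bl b")
  case True
  define i where "i = bl a"
  have i: "1 <= i" "i <= k" "loc a < r i" "loc b < r i" using block_bounds[OF ab(1)] block_bounds[OF ab(2)] True by (auto simp: i_def)
  have "(?P * ?Q) $$ (a, b) = (\<Sum>e\<in>{e. e < n & bl e = i}. (c i * M i $$ (loc a, loc e)) * (d i * N i $$ (loc e, loc b)))"
   unfolding BU_mult_diag[OF P ab True] using ab True by (intro sum.cong) (auto simp: i_def)
  also have "... = (\<Sum>x<r i. (c i * M i $$ (loc a, x)) * (d i * N i $$ (x, loc b)))"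
   unfolding sum_block[OF i(1,2)] using i loc_offset by (intro sum.cong) auto
  also have "... = (c i * d i) * (\<Sum>x<r i. M i $$ (loc a, x) * N i $$ (x, loc b))"
   by (simp add: sum_distrib_left mult_ac)
  also have "(\<Sum>x<r i. M i $$ (loc a, x) * N i $$ (x, loc b)) = (M i * N i) $$ (loc a, loc b)"
  proof -
   have "M i \<in> carrier_mat (r i) (r i)" "N i \<in> carrier_mat (r i) (r i)" using M[OF i(1,2)] by auto
   then show ?thesis using i by (simp add: scalar_prod_def atLeast0LessThan)
  qed
  also have "M i * N i = 1\<^sub>m (r i)" using M[OF i(1,2)] by blast
  also have "1\<^sub>m (r i) $$ (loc a, loc b) = (if loc a = loc b then (1 :: complex) else 0)" using i by simp
  also have "loc a = loc b \<longleftrightarrow> a = b"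
   using block_bounds(5)[OF ab(1)] block_bounds(5)[OF ab(2)] True by metis
  finally show ?thesis using ab by (simp add: c)
 next
  case False
  have "?P $$ (a, e) * ?Q $$ (e, b) = 0" if "e < n" for e using False ab that by auto
  then have "(?P * ?Q) $$ (a, b) = 0"
   unfolding mult_entry[OF BU_carrier[OF P(1)] BU_carrier[OF P(2)] ab] by (intro sum.neutral) auto
  then show ?thesis using False ab by auto
 qed
qed auto

lemma A0_inverse: "z ~= 0 ==> A0 z * A0i z = 1\<^sub>m n" "z ~= 0 ==> A0i z * A0 z = 1\<^sub>m n"
 unfolding A0_def A0i_def
 by (rule block_diagonal_inverse; use A A_minv in \<open>auto simp: power_int_minus\<close>)+

lemma AM_carrier: "AM U \<in> carrier_mat n n"
 by (simp add: A_mat_def assemble_def n_def)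

lemma AM_entry:
 assumes ab: "a < n" "b < n"
 shows "AM U $$ (a, b) = (if bl a = bl b then fls_X_intpow (- mu (bl a)) * fls_const (A (bl a) $$ (loc a, loc b))
  else if bl a < bl b then U (bl a) (bl b) $$ (loc a, loc b) else 0)"
proof -
 note B = block_bounds[OF ab(1)] block_bounds[OF ab(2)]
 have "AM U $$ (a, b) = (if bl a = bl b then fls_X_intpow (- mu (bl a)) \<cdot>\<^sub>m map_mat fls_const (A (bl a))
   else if bl a < bl b then U (bl a) (bl b) else 0\<^sub>m (r (bl a)) (r (bl b))) $$ (loc a, loc b)"
  using ab by (simp add: A_mat_def assemble_def n_def Let_def loc_def)
 then show ?thesis using A[of "bl a"] B by auto
qed

lemma AU_carrier [simp]: "AU U z \<in> carrier_mat n n"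
 using AM_carrier[of U] by (simp add: AU_def mat_fun_def)

lemma AU_entry:
 assumes ab: "a < n" "b < n" and z: "z ~= 0"
 shows "AU U z $$ (a, b) = (if bl a = bl b then A0 z $$ (a, b)
  else if bl a < bl b then eval_fls (U (bl a) (bl b) $$ (loc a, loc b)) z else 0)"
proof -
 have "AU U z $$ (a, b) = eval_fls (AM U $$ (a, b)) z"
  using AM_carrier[of U] ab by (simp add: AU_def mat_fun_def)
 then show ?thesis
  using z ab by (auto simp: AM_entry A0_def eval_fls_mult eval_fls_shift)
qed

lemma A0_eq: "z ~= 0 ==> mat_fun (AM (zero_family r)) z = A0 z"
proof (rule eq_matI)
 fix a b assume z: "z ~= 0" and "a < dim_row (A0 z)" "b < dim_col (A0 z)"
 then have ab: "a < n" "b < n" by (auto simp: A0_def)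
 have "AU (zero_family r) z $$ (a, b) = A0 z $$ (a, b)"
  unfolding AU_entry[OF ab z] using ab block_bounds[OF ab(1)] block_bounds[OF ab(2)] by (simp add: zero_family_def A0_def)
 then show "mat_fun (AM (zero_family r)) z $$ (a, b) = A0 z $$ (a, b)" by (simp add: AU_def)
qed (use AM_carrier in \<open>auto simp: mat_fun_def A0_def\<close>)

abbreviation families :: "(nat => nat => complex fls mat) set" where
 "families \<equiv> over_diag_families k r"

lemma conv_field_iff: "f \<in> conv_field \<longleftrightarrow> fls_conv_radius f > 0"
proof
 assume "f \<in> conv_field"
 then obtain a b where ab: "f = fps_to_fls a / fps_to_fls b" "fps_conv_radius a > 0" "fps_conv_radius b > 0"
  by (auto simp: conv_field_def)
 have "(%z. eval_fls (fps_to_fls a) z / eval_fls (fps_to_fls b) z) has_laurent_expansion f"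
  unfolding ab(1) using ab by (intro has_laurent_expansion_divide eval_fls_has_laurent_expansion) auto
 then show "fls_conv_radius f > 0" by (simp add: has_laurent_expansion_def)
next
 assume f: "fls_conv_radius f > 0"
 define b where "b = fls_base_factor_to_fps f"
 define m where "m = fls_subdegree f"
 have rb: "fps_conv_radius b > 0" using f by (simp add: b_def fls_conv_radius_altdef)
 have fb: "f = fps_to_fls b * fls_X_intpow m"
  unfolding b_def m_def using fls_conv_base_factor_to_fps_shift_subdegree[of f]
  by (metis fls_X_intpow_times_conv_shift(2) minus_minus)
 show "f \<in> conv_field"
 proof (cases "m >= 0")
  case True
  have "f = fps_to_fls (b * fps_X ^ nat m) / fps_to_fls 1"
   using True by (simp add: fb fls_times_fps_to_fls fps_to_fls_power fls_X_power_conv_shift_1)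
  moreover have "fps_conv_radius (b * fps_X ^ nat m) > 0"
   using rb by (intro less_le_trans[OF _ fps_conv_radius_mult_ge[OF order_refl]]) auto
  ultimately show ?thesis unfolding conv_field_def by (intro CollectI exI[of _ "b * fps_X ^ nat m"] exI[of _ 1]) auto
 next
  case False
  have "fls_X_intpow m = (1 / fps_to_fls (fps_X ^ nat (- m)) :: complex fls)"
  proof -
   have "fls_X_intpow m * fps_to_fls (fps_X ^ nat (- m)) = (1 :: complex fls)"
    using False by (simp add: fps_to_fls_power fls_X_power_conv_shift_1 fls_shifted_times_simps)
   moreover from this have "fps_to_fls (fps_X ^ nat (- m)) ~= (0 :: complex fls)" by auto
   ultimately show ?thesis by (rule nonzero_eq_divide_eq[THEN iffD2, rotated])
  qed
  then have "f = fps_to_fls b / fps_to_fls (fps_X ^ nat (- m))" by (simp add: fb)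
  then show ?thesis using rb unfolding conv_field_def
   by (intro CollectI exI[of _ b] exI[of _ "fps_X ^ nat (- m)"]) auto
 qed
qed

definition radius :: "(nat => nat => complex fls mat) => real => bool" where
 "radius U \<rho> \<longleftrightarrow> 0 < \<rho> & (\<forall>a<n. \<forall>b<n. bl a < bl b --> fls_conv_radius (U (bl a) (bl b) $$ (loc a, loc b)) >= ereal \<rho>)"

lemma family_entry:
 assumes "U \<in> families" "a < n" "b < n" "bl a < bl b"
 shows "fls_conv_radius (U (bl a) (bl b) $$ (loc a, loc b)) > 0"
proof -
 note B = block_bounds[OF assms(2)] block_bounds[OF assms(3)]
 have U: "U (bl a) (bl b) \<in> carrier_mat (r (bl a)) (r (bl b))" "elements_mat (U (bl a) (bl b)) \<subseteq> conv_field"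
  using assms B by (auto simp: over_diag_families_def)
 have "U (bl a) (bl b) $$ (loc a, loc b) \<in> elements_mat (U (bl a) (bl b))"
  by (rule elements_matI[OF U(1)]) (use B in auto)
 then show ?thesis using U by (auto simp: conv_field_iff)
qed

lemma radius_exists:
 assumes U: "U \<in> families"
 shows "\<exists>\<rho>. radius U \<rho>"
proof -
 define P where "P = {(a, b). a < n & b < n & bl a < bl b}"
 have fin: "finite P" by (rule finite_subset[of _ "{..<n} \<times> {..<n}"]) (auto simp: P_def)
 define R where "R = Min (insert 1 ((%(a, b). fls_conv_radius (U (bl a) (bl b) $$ (loc a, loc b))) ` P))"
 have "R > 0" unfolding R_def using fin family_entry[OF U] by (subst Min_gr_iff) (auto simp: P_def)
 then obtain \<rho> where \<rho>: "0 < ereal \<rho>" "ereal \<rho> < R" using ereal_dense2 by blast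
 have "R <= fls_conv_radius (U (bl a) (bl b) $$ (loc a, loc b))" if "(a, b) \<in> P" for a b
  unfolding R_def using fin that by (intro Min_le) auto
 then have "radius U \<rho>" using \<rho> unfolding radius_def P_def by (auto intro: order.trans[OF less_imp_le])
 then show ?thesis by blast
qed

definition form :: "real => (complex => complex mat) => bool" where
 "form \<rho> M \<longleftrightarrow> hol_mat (annulus 0 \<rho>) M & (\<forall>z \<in> annulus 0 \<rho>. M z \<in> BU & eqd (M z) (A0 z))"

lemma formD: "form \<rho> M ==> z ~= 0 ==> norm z < \<rho> ==> M z \<in> BU"
 "form \<rho> M ==> z ~= 0 ==> norm z < \<rho> ==> eqd (M z) (A0 z)"
 "form \<rho> M ==> z ~= 0 ==> norm z < \<rho> ==> M z \<in> carrier_mat n n"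
 "form \<rho> M ==> hol_mat (annulus 0 \<rho>) M"
 by (auto simp: form_def BU_def)

lemma holomorphic_on_if_const:
 "(P ==> f holomorphic_on S) ==> (\<not> P ==> g holomorphic_on S) ==> (%z. if P then f z else g z) holomorphic_on S"
 by (cases P) auto

lemma hol_A0: "0 \<notin> S ==> hol_mat S A0" and hol_A0i: "0 \<notin> S ==> hol_mat S A0i"
 by (auto simp: hol_mat_def A0_def A0i_def intro!: holomorphic_on_if_const holomorphic_intros)

lemma form_A0: "form \<rho> A0"
 by (auto simp: form_def A0_BU intro: hol_A0)

lemma form_AU:
 assumes "radius U \<rho>"
 shows "form \<rho> (AU U)"
 unfolding form_def
proof (intro conjI ballI)
 show "hol_mat (annulus 0 \<rho>) (AU U)"
  unfolding hol_mat_def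
 proof (intro allI impI)
  fix a b assume ab: "a < n" "b < n"
  have "(%z. if bl a = bl b then A0 z $$ (a, b)
   else if bl a < bl b then eval_fls (U (bl a) (bl b) $$ (loc a, loc b)) z else 0) holomorphic_on annulus 0 \<rho>"
  proof (cases "bl a < bl b")
   case True
   have "eval_fls (U (bl a) (bl b) $$ (loc a, loc b)) holomorphic_on annulus 0 \<rho>"
   proof (rule holomorphic_on_subset[OF holomorphic_on_eval_fls])
    show "annulus 0 \<rho> \<subseteq> eball 0 (fls_conv_radius (U (bl a) (bl b) $$ (loc a, loc b))) - {0}"
    proof
     fix x :: complex assume x: "x \<in> annulus 0 \<rho>"
     then have "ereal (norm x) < ereal \<rho>" by simp
     also have "ereal \<rho> <= fls_conv_radius (U (bl a) (bl b) $$ (loc a, loc b))"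
      using assms ab True by (simp add: radius_def)
     finally show "x \<in> eball 0 (fls_conv_radius (U (bl a) (bl b) $$ (loc a, loc b))) - {0}"
      using x by (simp add: in_eball_iff)
    qed
   qed auto
   then show ?thesis using True by simp
  next
   case False
   then show ?thesis using hol_matD[OF hol_A0 ab, of "annulus 0 \<rho>"] by (cases "bl a = bl b") auto
  qed
  then show "(%z. AU U z $$ (a, b)) holomorphic_on annulus 0 \<rho>"
   by (rule holomorphic_transform) (use AU_entry[OF ab] in auto)
 qed
 show "AU U z \<in> BU" if "z \<in> annulus 0 \<rho>" for z
  unfolding BU_def using AU_entry[of _ _ z U] that by auto
 show "eqd (AU U z) (A0 z)" if "z \<in> annulus 0 \<rho>" for z
  unfolding eqd_def using AU_entry[of _ _ z U] that by auto
qed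

lemma conj_frakG:
 assumes "M \<in> BU" "eqd M (A0 z)" "z ~= 0" "X \<in> frakG k r"
 shows "M * X * A0i z \<in> frakG k r"
proof -
 have X: "X \<in> BU" "eqd X (1\<^sub>m n)" using assms(4) by (auto simp: frakG_iff)
 have "eqd (M * X * A0i z) (A0 z * 1\<^sub>m n * A0i z)"
  by (intro eqd_mult BU_mult X assms A0_BU A0i_BU BU_one eqd_refl)
 also have "A0 z * 1\<^sub>m n * A0i z = 1\<^sub>m n" by (simp only: right_mult_one_mat[OF A0_carrier] A0_inverse[OF assms(3)])
 finally have "eqd (M * X * A0i z) (1\<^sub>m n)" .
 moreover have "M * X * A0i z \<in> BU" by (intro BU_mult X assms A0i_BU)
 ultimately show ?thesis by (simp add: frakG_iff)
qed

definition Mi :: "(complex => complex mat) => complex => complex mat" where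
 "Mi M z = A0i z * minv (M z * A0i z)"

lemma frakG_M_A0i:
 assumes "form \<rho> M" "z ~= 0" "norm z < \<rho>"
 shows "M z * A0i z \<in> frakG k r"
 using conj_frakG[OF formD(1,2)[OF assms] assms(2) frakG_one] formD(3)[OF assms] by simp

lemma Mi:
 assumes "form \<rho> M" "z ~= 0" "norm z < \<rho>"
 shows "Mi M z \<in> carrier_mat n n" "M z * Mi M z = 1\<^sub>m n" "Mi M z * M z = 1\<^sub>m n"
proof -
 note V = frakG_M_A0i[OF assms]
 have M: "M z \<in> carrier_mat n n" by (rule formD(3)[OF assms])
 show c: "Mi M z \<in> carrier_mat n n" unfolding Mi_def by (rule mult_carrier_mat[OF A0i_carrier frakG_minv(1)[OF V]])
 show 1: "M z * Mi M z = 1\<^sub>m n"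
  unfolding Mi_def using frakG_minv[OF V] M by (simp add: assoc_mult_mat[of _ n n _ n _ n, symmetric])
 show "Mi M z * M z = 1\<^sub>m n" by (rule mat_mult_left_right_inverse[OF M c 1])
qed

lemma Mi_frakG:
 assumes "form \<rho> M" "z ~= 0" "norm z < \<rho>" "X \<in> frakG k r"
 shows "Mi M z * X * A0 z \<in> frakG k r"
proof -
 note V = frakG_M_A0i[OF assms(1-3)]
 have Y: "minv (M z * A0i z) * X \<in> frakG k r" by (intro frakG_mult minv_frakG V assms)
 then have Y': "minv (M z * A0i z) * X \<in> BU" "eqd (minv (M z * A0i z) * X) (1\<^sub>m n)" by (auto simp: frakG_iff)
 have "eqd (A0i z * (minv (M z * A0i z) * X) * A0 z) (A0i z * 1\<^sub>m n * A0 z)"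
  by (intro eqd_mult BU_mult Y' A0_BU A0i_BU BU_one eqd_refl)
 also have "A0i z * 1\<^sub>m n * A0 z = 1\<^sub>m n" by (simp only: right_mult_one_mat[OF A0i_carrier] A0_inverse[OF assms(2)])
 finally have "eqd (A0i z * (minv (M z * A0i z) * X) * A0 z) (1\<^sub>m n)" .
 moreover have "A0i z * (minv (M z * A0i z) * X) * A0 z \<in> BU" by (intro BU_mult Y' A0i_BU A0_BU)
 ultimately have "A0i z * (minv (M z * A0i z) * X) * A0 z \<in> frakG k r" by (simp add: frakG_iff)
 also have "A0i z * (minv (M z * A0i z) * X) * A0 z = Mi M z * X * A0 z"
  unfolding Mi_def using frakG_minv(1)[OF V] frakG_carrier[OF assms(4)] by (simp add: assoc_mult_mat[of _ n n _ n _ n])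
 finally show ?thesis .
qed

lemma hol_Mi:
 assumes "form \<rho> M"
 shows "hol_mat (annulus 0 \<rho>) (Mi M)"
 unfolding Mi_def[abs_def]
 by (intro hol_mat_mult hol_A0i hol_mat_minv formD(4)[OF assms])
  (use frakG_M_A0i[OF assms] frakG_minv(1) formD(3)[OF assms] in auto)

end

section \<open>Solutions of the functional equation\<close>

context qdiff
begin

definition sol :: "complex set set => real => (complex => complex mat) => (complex => complex mat) => bool" where
 "sol V eps M F \<longleftrightarrow> (\<forall>z \<in> Pre V Int ball 0 eps. F z \<in> frakG k r) & hol_mat (Pre V Int ball 0 eps) F &
   (\<forall>z \<in> Pre V. norm (q * z) < eps --> F (q * z) * A0 z = M z * F z)"

lemma solD:
 assumes "sol V eps M F"
 shows "!!z. z \<in> Pre V ==> norm z < eps ==> F z \<in> frakG k r" "hol_mat (Pre V Int ball 0 eps) F"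
  "!!z. z \<in> Pre V ==> norm (q * z) < eps ==> F (q * z) * A0 z = M z * F z"
 using assms by (auto simp: sol_def)

lemma sol_subset: "sol V eps M F ==> V' \<subseteq> V ==> eps' <= eps ==> sol V' eps' M F"
 unfolding sol_def using Pre_mono[of V' V]
 by (auto intro!: hol_mat_subset[where S = "Pre V Int ball 0 eps" and S' = "Pre V' Int ball 0 eps'"])

lemma sol_carrier: "sol V eps M F ==> z \<in> Pre V ==> norm z < eps ==> F z \<in> carrier_mat n n"
 by (rule frakG_carrier[OF solD(1)])

lemma sol_mult:
 assumes F: "sol V eps M F" and C: "sol V eps A0 C" and M: "form eps M"
 shows "sol V eps M (%z. F z * C z)"
 unfolding sol_def
proof (intro conjI ballI impI)
 show "F z * C z \<in> frakG k r" if "z \<in> Pre V Int ball 0 eps" for z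
  using solD(1)[OF F] solD(1)[OF C] that by (auto intro: frakG_mult)
 show "hol_mat (Pre V Int ball 0 eps) (%z. F z * C z)"
  by (intro hol_mat_mult solD(2)[OF F] solD(2)[OF C]) (use sol_carrier[OF F] sol_carrier[OF C] in auto)
 fix z assume z: "z \<in> Pre V" "norm (q * z) < eps"
 have z': "norm z < eps" using norm_le_mult_q[of z] z by linarith
 have z0: "z ~= 0" using z by (auto simp: Pre_def)
 note car = sol_carrier[OF F z(1) z'] sol_carrier[OF C z(1) z'] sol_carrier[OF F _ z(2)] sol_carrier[OF C _ z(2)]
  formD(3)[OF M z0 z'] A0_carrier[of z]
 have "F (q * z) * C (q * z) * A0 z = F (q * z) * (C (q * z) * A0 z)" using car z by (simp add: mat_simps)
 also have "... = F (q * z) * A0 z * C z" using car z solD(3)[OF C z] by (simp add: mat_simps)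
 also have "... = M z * (F z * C z)" unfolding solD(3)[OF F z] using car by (simp add: mat_simps)
 finally show "F (q * z) * C (q * z) * A0 z = M z * (F z * C z)" .
qed

lemma sol_quotient:
 assumes F: "sol V eps M F" and F': "sol V eps M F'" and M: "form eps M"
 shows "sol V eps A0 (%z. minv (F z) * F' z)"
 unfolding sol_def
proof (intro conjI ballI impI)
 show "minv (F z) * F' z \<in> frakG k r" if "z \<in> Pre V Int ball 0 eps" for z
  using solD(1)[OF F] solD(1)[OF F'] that by (auto intro: frakG_mult minv_frakG)
 show "hol_mat (Pre V Int ball 0 eps) (%z. minv (F z) * F' z)"
  by (intro hol_mat_mult hol_mat_minv solD(2)[OF F] solD(2)[OF F'])
   (use solD(1)[OF F] frakG_minv(1) sol_carrier[OF F'] in auto)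
 fix z assume z: "z \<in> Pre V" "norm (q * z) < eps"
 have z': "norm z < eps" using norm_le_mult_q[of z] z by linarith
 have z0: "z ~= 0" using z by (auto simp: Pre_def)
 have qz: "q * z \<in> Pre V" using z by simp
 note car = sol_carrier[OF F z(1) z'] sol_carrier[OF F' z(1) z'] sol_carrier[OF F qz z(2)] sol_carrier[OF F' qz z(2)]
  formD(3)[OF M z0 z'] A0_carrier[of z]
 note i = frakG_minv[OF solD(1)[OF F z(1) z']] frakG_minv[OF solD(1)[OF F qz z(2)]]
 have "minv (F (q * z)) * F' (q * z) * A0 z = minv (F (q * z)) * (F' (q * z) * A0 z)" using car i by (simp add: mat_simps)
 also have "... = minv (F (q * z)) * (M z * F' z)" using solD(3)[OF F' z] by simp
 also have "... = minv (F (q * z)) * (M z * (F z * minv (F z)) * F' z)" using car i by (simp add: mat_simps)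
 also have "M z * (F z * minv (F z)) = F (q * z) * A0 z * minv (F z)" using car i solD(3)[OF F z]
  by (simp add: assoc_mult_mat[of _ n n _ n _ n, symmetric])
 also have "minv (F (q * z)) * (F (q * z) * A0 z * minv (F z) * F' z) = (minv (F (q * z)) * F (q * z)) * (A0 z * (minv (F z) * F' z))"
  using car i(1,4) by (simp add: mat_simps)
 also have "... = A0 z * (minv (F z) * F' z)" using car i by (simp add: mat_simps)
 finally show "minv (F (q * z)) * F' (q * z) * A0 z = A0 z * (minv (F z) * F' z)" .
qed

lemma sol_one: "sol V eps A0 (%z. 1\<^sub>m n)"
 unfolding sol_def using frakG_one by (auto simp: hol_mat_def mat_simps)

lemma sol_minv: "sol V eps A0 C ==> sol V eps A0 (%z. minv (C z))"
proof -
 assume C: "sol V eps A0 C"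
 have "sol V eps A0 (%z. minv (C z) * 1\<^sub>m n)" by (rule sol_quotient[OF C sol_one form_A0])
 moreover have "minv (C z) * 1\<^sub>m n = minv (C z)" if "z \<in> Pre V Int ball 0 eps" for z
  using frakG_minv(1)[OF solD(1)[OF C]] that by (simp add: mat_simps)
 ultimately show ?thesis
  unfolding sol_def using hol_mat_cong norm_le_mult_q
  by (auto simp: le_less_trans[OF norm_le_mult_q] intro: hol_mat_cong)
qed

text \<open>Gauge transformations on a punctured disc.\<close>

definition iso_fun :: "real => (complex => complex mat) => (complex => complex mat) => (complex => complex mat) => bool" where
 "iso_fun eps M M' G \<longleftrightarrow> (\<forall>z \<in> annulus 0 eps. G z \<in> frakG k r) & hol_mat (annulus 0 eps) G &
   (\<forall>z. z ~= 0 --> norm (q * z) < eps --> G (q * z) * M z = M' z * G z)"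

lemma iso_fun_carrier: "iso_fun eps M M' G ==> z ~= 0 ==> norm z < eps ==> G z \<in> carrier_mat n n"
 by (auto simp: iso_fun_def intro: frakG_carrier)

lemma sol_iso:
 assumes G: "iso_fun eps M M' G" and F: "sol V eps M F" and M: "form eps M" "form eps M'"
 shows "sol V eps M' (%z. G z * F z)"
 unfolding sol_def
proof (intro conjI ballI impI)
 have sub: "Pre V Int ball 0 eps \<subseteq> annulus 0 eps" by (auto simp: Pre_def)
 show "G z * F z \<in> frakG k r" if "z \<in> Pre V Int ball 0 eps" for z
  using solD(1)[OF F] G that sub by (auto simp: iso_fun_def intro!: frakG_mult)
 show "hol_mat (Pre V Int ball 0 eps) (%z. G z * F z)"
  by (intro hol_mat_mult solD(2)[OF F] hol_mat_subset[OF _ sub])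
   (use G sol_carrier[OF F] iso_fun_carrier[OF G] in \<open>auto simp: iso_fun_def Pre_def\<close>)
 fix z assume z: "z \<in> Pre V" "norm (q * z) < eps"
 have z': "norm z < eps" using norm_le_mult_q[of z] z by linarith
 have z0: "z ~= 0" "q * z ~= 0" using z by (auto simp: Pre_def)
 have qz: "q * z \<in> Pre V" using z by simp
 note car = sol_carrier[OF F z(1) z'] sol_carrier[OF F qz z(2)] iso_fun_carrier[OF G z0(1) z'] iso_fun_carrier[OF G z0(2) z(2)]
  formD(3)[OF M(1) z0(1) z'] formD(3)[OF M(2) z0(1) z'] A0_carrier[of z]
 have e: "G (q * z) * M z = M' z * G z" using G z z0 by (simp add: iso_fun_def)
 have "G (q * z) * F (q * z) * A0 z = G (q * z) * (F (q * z) * A0 z)" using car by (simp add: mat_simps)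
 also have "... = G (q * z) * M z * F z" unfolding solD(3)[OF F z] using car by (simp add: mat_simps)
 also have "... = M' z * (G z * F z)" unfolding e using car by (simp add: mat_simps)
 finally show "G (q * z) * F (q * z) * A0 z = M' z * (G z * F z)" .
qed

text \<open>A solution on a sector is determined near \<open>0\<close>, and extends to the whole preimage of its horizon
 as far as the equation is defined.\<close>

lemma sol_unique:
 assumes V: "openin (Eq_top q) V" and F: "sol V eps M F" "sol V eps M F'" and M: "form eps M"
  and W: "sector q W" "horizon q W = V" "!!z. z \<in> W ==> F z = F' z"
  and z: "z \<in> Pre V" "norm z < eps"
 shows "F z = F' z"
proof -
 obtain m where m: "z / q ^ m \<in> W" using sector_reach[OF W(1,2) z(1)] by blast
 have "l <= m ==> F (z / q ^ (m - l)) = F' (z / q ^ (m - l))" for l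
 proof (induction l)
  case 0 then show ?case using W(3)[OF m] by simp
 next
  case (Suc l)
  define w where "w = z / q ^ (m - l)"
  have qw: "q * w = z / q ^ (m - Suc l)"
  proof -
   have "m - l = Suc (m - Suc l)" using Suc.prems by simp
   then show ?thesis unfolding w_def by simp
  qed
  have w: "w \<in> Pre V" "q * w \<in> Pre V" "norm (q * w) < eps"
  proof -
   show "norm (q * w) < eps" unfolding qw using z norm_divide_q_le[of z "m - Suc l"] by linarith
  qed (use z in \<open>simp_all add: w_def\<close>)
  have w': "norm w < eps" "w ~= 0" using norm_le_mult_q[of w] w by (auto simp: Pre_def)
  have IH: "F w = F' w" using Suc by (simp add: w_def)
  note car = sol_carrier[OF F(1) w(2,3)] sol_carrier[OF F(2) w(2,3)]
  have "F (q * w) = F (q * w) * A0 w * A0i w"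
   using car A0_inverse(1)[OF w'(2)] by (simp add: assoc_mult_mat[of _ n n _ n _ n])
  also have "... = F' (q * w) * A0 w * A0i w"
   using solD(3)[OF F(1) w(1,3)] solD(3)[OF F(2) w(1,3)] IH by simp
  also have "... = F' (q * w)"
   using car A0_inverse(1)[OF w'(2)] by (simp add: assoc_mult_mat[of _ n n _ n _ n])
  finally show ?case by (simp add: qw)
 qed
 from this[of m] show ?thesis by simp
qed

text \<open>The equation is used from \<open>z\<close> to \<open>q z\<close>, and every point of the preimage reaches the sector after divisions by \<open>q\<close>.\<close>

lemma sol_extend_up:
 assumes V: "openin (Eq_top q) V" and M: "form eps M"
  and W: "sector q W" "horizon q W = V" "W \<subseteq> ball 0 eps"
  and F: "hol_mat W F" "!!z. z \<in> W ==> F z \<in> frakG k r"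
  and eq: "!!z. z \<in> W ==> q * z \<in> W ==> F (q * z) * A0 z = M z * F z"
 obtains F' where "sol V eps M F'" "!!z. z \<in> W ==> F' z = F z"
proof -
 define \<Omega> where "\<Omega> = Pre V Int ball 0 eps"
 have WV: "W \<subseteq> Pre V" by (rule sector_subset_Pre[OF W(1,2)])
 have dom: "{w \<in> \<Omega>. q * w \<in> \<Omega>} \<subseteq> annulus 0 eps" by (auto simp: \<Omega>_def Pre_def)
 have dz: "z ~= 0" "norm z < eps" if "z \<in> \<Omega>" for z using that by (auto simp: \<Omega>_def Pre_def)
 obtain F' where F': "!!w. w \<in> W ==> F' w = F w" "hol_mat \<Omega> F'" "!!w. w \<in> \<Omega> ==> F' w \<in> frakG k r"
  "!!w. w \<in> \<Omega> ==> q * w \<in> \<Omega> ==> F' (q * w) = M w * F' w * A0i w"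
 proof (rule functional_extension_holomorphic[of q \<Omega> W M A0i F])
  show "open \<Omega>" using V by (auto simp: \<Omega>_def openin_Eq_iff)
  show "open W" using W by (simp add: sector_def)
  show "W \<subseteq> \<Omega>" using WV W by (auto simp: \<Omega>_def)
  show "\<exists>m. z / q ^ m \<in> W" if "z \<in> \<Omega>" for z using sector_reach[OF W(1,2)] that by (auto simp: \<Omega>_def)
  show "z / q ^ l \<in> \<Omega>" if "z \<in> \<Omega>" for z l
   using that norm_divide_q_le[of z l] by (auto simp: \<Omega>_def)
  show "q ^ l * w \<in> W" if "q ^ m * w \<in> W" "l <= m" for w m l
  proof -
   have "q ^ l * w = (q ^ m * w) / q ^ (m - l)" using that by (simp add: power_diff)
   then show ?thesis using sector_power[OF W(1) that(1), of "m - l"] by simp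
  qed
  show "hol_mat {w \<in> \<Omega>. q * w \<in> \<Omega>} M" "hol_mat {w \<in> \<Omega>. q * w \<in> \<Omega>} A0i"
   by (rule hol_mat_subset[OF formD(4)[OF M] dom], rule hol_A0i) (use dom in auto)
  show "M w \<in> carrier_mat n n" if "w \<in> \<Omega>" for w using formD(3)[OF M dz[OF that]] .
  show "M w * X * A0i w \<in> frakG k r" if "w \<in> \<Omega>" "X \<in> frakG k r" for w X
   by (rule conj_frakG[OF formD(1,2)[OF M dz[OF that(1)] ] _ that(2)]) (use dz that in auto)
  show "F (q * w) = M w * F w * A0i w" if w: "w \<in> W" "q * w \<in> W" for w
  proof -
   have w0: "w ~= 0" using WV w by (auto simp: Pre_def)
   have "F (q * w) = F (q * w) * A0 w * A0i w"
    using frakG_carrier[OF F(2)[OF w(2)]] A0_inverse(1)[OF w0] by (simp add: assoc_mult_mat[of _ n n _ n _ n])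
   then show ?thesis using eq[OF w] by simp
  qed
 qed (use F in auto)
 have "F' (q * z) * A0 z = M z * F' z" if z: "z \<in> Pre V" "norm (q * z) < eps" for z
 proof -
  have z1: "z \<in> \<Omega>" "q * z \<in> \<Omega>" using z norm_le_mult_q[of z] by (auto simp: \<Omega>_def)
  note d = dz[OF z1(1)]
  show ?thesis
   unfolding F'(4)[OF z1] using A0_inverse(2)[OF d(1)] frakG_carrier[OF F'(3)[OF z1(1)]] formD(3)[OF M d]
   by (simp add: assoc_mult_mat[of _ n n _ n _ n])
 qed
 then have "sol V eps M F'" using F'(2,3) by (auto simp: sol_def \<Omega>_def)
 then show thesis using that F'(1) by blast
qed

text \<open>The equation is used from \<open>q z\<close> to \<open>z\<close>, starting on an annulus that contains a fundamental domain.\<close>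

lemma sol_extend_down:
 assumes V: "openin (Eq_top q) V" and M: "form \<rho> M" and r: "0 < r1" "r1 * norm q < R" "R <= norm q * \<rho>"
  and F: "hol_mat (Pre V Int annulus r1 R) F" "!!z. z \<in> Pre V Int annulus r1 R ==> F z \<in> frakG k r"
  and eq: "!!z. z \<in> Pre V ==> r1 < norm z ==> norm (q * z) < R ==> F (q * z) * A0 z = M z * F z"
 obtains F' where "sol V R M F'" "!!z. z \<in> Pre V Int annulus r1 R ==> F' z = F z"
proof -
 define p where "p = 1 / q"
 define \<Omega> where "\<Omega> = Pre V Int ball 0 R"
 define W where "W = Pre V Int annulus r1 R"
 have R: "0 < R" using r by (meson less_trans mult_pos_pos norm_q_pos)
 have small: "norm (w / q) < \<rho>" "w / q ~= 0" if "w \<in> \<Omega>" for w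
 proof -
  have "norm w < norm q * \<rho>" using that r by (auto simp: \<Omega>_def)
  then show "norm (w / q) < \<rho>" by (simp add: norm_divide divide_less_eq mult.commute)
 qed (use that in \<open>auto simp: \<Omega>_def Pre_def\<close>)
 have pp: "z / p ^ m = q ^ m * z" "p ^ m * z = z / q ^ m" "p * z = z / q" for z m
  by (simp_all add: p_def power_one_over)
 have div: "norm (q ^ l * z) <= norm (q ^ m * z)" if "l <= m" for l m z
  using q that by (auto simp: norm_mult norm_power intro!: mult_right_mono power_increasing)
 obtain F' where F': "!!w. w \<in> W ==> F' w = F w" "hol_mat \<Omega> F'" "!!w. w \<in> \<Omega> ==> F' w \<in> frakG k r"
  "!!w. w \<in> \<Omega> ==> p * w \<in> \<Omega> ==> F' (p * w) = Mi M (p * w) * F' w * A0 (p * w)"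
 proof (rule functional_extension_holomorphic[of p \<Omega> W "%w. Mi M (p * w)" "%w. A0 (p * w)" F])
  show "p ~= 0" by (simp add: p_def)
  show "open \<Omega>" using V by (auto simp: \<Omega>_def openin_Eq_iff)
  show "open W" using V by (auto simp: W_def openin_Eq_iff intro!: open_Int open_annulus)
  show "W \<subseteq> \<Omega>" by (auto simp: \<Omega>_def W_def)
  show "\<exists>m. z / p ^ m \<in> W" if z: "z \<in> \<Omega>" for z
  proof -
   have z0: "z ~= 0" using z by (auto simp: \<Omega>_def Pre_def)
   obtain m where "norm q ^ m > r1 / norm z" using real_arch_pow[OF q] by blast
   then have ex: "r1 < norm (q ^ m * z)" using z0 by (simp add: norm_mult norm_power divide_less_eq)
   define m where "m = (LEAST m. r1 < norm (q ^ m * z))"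
   have m: "r1 < norm (q ^ m * z)" unfolding m_def by (rule LeastI[of _ m]) (rule LeastI[of "%m. r1 < norm (q ^ m * z)", OF ex])
   have "norm (q ^ m * z) < R"
   proof (cases m)
    case 0 then show ?thesis using z by (simp add: \<Omega>_def)
   next
    case (Suc l)
    then have "l < m" by simp
    then have "norm (q ^ l * z) <= r1" unfolding m_def using not_less_Least by (metis not_le_imp_less)
    then have "norm q * norm (q ^ l * z) <= norm q * r1" by (intro mult_left_mono) auto
    then have "norm (q ^ m * z) <= r1 * norm q" using Suc by (simp add: norm_mult mult_ac)
    then show ?thesis using r by linarith
   qed
   then have "q ^ m * z \<in> W" using m z by (simp add: W_def \<Omega>_def)
   then show ?thesis unfolding pp by blast
  qed
  show "z / p ^ l \<in> \<Omega>" if "z \<in> \<Omega>" "z / p ^ m \<in> W" "l <= m" for z m l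
   using that(1,2) div[OF that(3), of z] unfolding pp by (auto simp: \<Omega>_def W_def)
  show "p ^ l * w \<in> W" if w: "w \<in> W" "p ^ m * w \<in> W" and l: "l <= m" for w m l
  proof -
   have "norm (w / q ^ m) <= norm (w / q ^ l)"
    using q l by (auto simp: norm_divide norm_power intro!: divide_left_mono power_increasing mult_pos_pos)
   then show ?thesis using w norm_divide_q_le[of w l] unfolding pp by (auto simp: W_def)
  qed
  have h: "hol_mat {w \<in> \<Omega>. p * w \<in> \<Omega>} (%w. N (p * w))" if "hol_mat (annulus 0 \<rho>) N" for N
   by (rule hol_mat_compose_scale[OF that]) (use small in \<open>auto simp: pp\<close>)
  show "hol_mat {w \<in> \<Omega>. p * w \<in> \<Omega>} (%w. Mi M (p * w))" "hol_mat {w \<in> \<Omega>. p * w \<in> \<Omega>} (%w. A0 (p * w))"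
   by (rule h[OF hol_Mi[OF M]], rule h[OF hol_A0]) auto
  show "Mi M (p * w) \<in> carrier_mat n n" if "w \<in> \<Omega>" for w
   unfolding pp by (rule Mi(1)[OF M small(2,1)[OF that]])
  show "Mi M (p * w) * X * A0 (p * w) \<in> frakG k r" if "w \<in> \<Omega>" "X \<in> frakG k r" for w X
   unfolding pp by (rule Mi_frakG[OF M small(2,1)[OF that(1)] that(2)])
  show "F (p * w) = Mi M (p * w) * F w * A0 (p * w)" if w: "w \<in> W" "p * w \<in> W" for w
  proof -
   let ?z = "w / q"
   have qz: "q * ?z = w" by simp
   have w\<Omega>: "w \<in> \<Omega>" using w by (auto simp: \<Omega>_def W_def)
   note s = small(2,1)[OF w\<Omega>]
   have car: "F w \<in> carrier_mat n n" "F ?z \<in> carrier_mat n n"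
    using F(2)[of w] F(2)[of "w / q"] w by (auto simp: W_def pp intro!: frakG_carrier)
   have "F w * A0 ?z = M ?z * F ?z"
    using eq[of ?z] w unfolding qz pp by (auto simp: W_def)
   then have "Mi M ?z * (F w * A0 ?z) = Mi M ?z * (M ?z * F ?z)" by simp
   also have "... = F ?z"
    using Mi[OF M s] formD(3)[OF M s] car by (simp add: assoc_mult_mat[of _ n n _ n _ n, symmetric])
   finally show ?thesis unfolding pp using Mi(1)[OF M s] car by (simp add: assoc_mult_mat[of _ n n _ n _ n])
  qed
 qed (use F in \<open>auto simp: W_def\<close>)
 have "F' (q * z) * A0 z = M z * F' z" if z: "z \<in> Pre V" "norm (q * z) < R" for z
 proof -
  have z1: "q * z \<in> \<Omega>" "p * (q * z) \<in> \<Omega>" using z norm_le_mult_q[of z] by (auto simp: \<Omega>_def pp)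
  have pq: "p * (q * z) = z" by (simp add: p_def)
  have s: "z ~= 0" "norm z < \<rho>" using small[OF z1(1)] by auto
  have "F' z = Mi M z * F' (q * z) * A0 z" using F'(4)[OF z1] by (simp add: pq)
  then have "M z * F' z = M z * (Mi M z * (F' (q * z) * A0 z))"
   using Mi(1)[OF M s] frakG_carrier[OF F'(3)[OF z1(1)]] by (simp add: assoc_mult_mat[of _ n n _ n _ n])
  also have "... = (M z * Mi M z) * (F' (q * z) * A0 z)"
   by (rule assoc_mult_mat[symmetric, of _ n n _ n _ n]) (use Mi(1)[OF M s] formD(3)[OF M s] frakG_carrier[OF F'(3)[OF z1(1)]] in auto)
  also have "... = F' (q * z) * A0 z" using Mi(2)[OF M s] frakG_carrier[OF F'(3)[OF z1(1)]] by simp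
  finally show ?thesis by simp
 qed
 then have "sol V R M F'" using F'(2,3) by (auto simp: sol_def \<Omega>_def)
 then show thesis using that F'(1) by (simp add: W_def)
qed

end

section \<open>The Stokes sheaf\<close>

context qdiff
begin

definition blk :: "complex mat => nat => nat => array" where
 "blk M i j = (%x y. M $$ (offset r i + x, offset r j + y))"

definition Aa :: "nat => array" where "Aa i = (%x y. A i $$ (x, y))"
definition Aa' :: "nat => array" where "Aa' i = (%x y. minv (A i) $$ (x, y))"

lemma Aa_inverse:
 assumes i: "1 <= i" "i <= k"
 shows "inverse_arrays (r i) (Aa i) (Aa' i)"
proof -
 note M = A[OF i, THEN conjunct1] A_minv[OF i]
 have "(A i * minv (A i)) $$ (x, y) = lm (r i) (Aa i) (Aa' i) x y"
  "(minv (A i) * A i) $$ (x, y) = lm (r i) (Aa' i) (Aa i) x y" if "x < r i" "y < r i" for x y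
  using that M(1,2) by (simp_all add: lm_def Aa_def Aa'_def scalar_prod_def atLeast0LessThan)
 then show ?thesis unfolding inverse_arrays_def by (metis M(3,4) index_one_mat(1))
qed

lemma mult_A0_right:
 assumes N: "N \<in> carrier_mat n n" and x: "x < n" and j: "1 <= j" "j <= k" "y < r j"
 shows "(N * A0 w) $$ (x, offset r j + y) = w powi (- mu j) * (\<Sum>c<r j. N $$ (x, offset r j + c) * Aa j c y)"
proof -
 let ?y = "offset r j + y"
 have y: "?y < n" "bl ?y = j" "loc ?y = y" using j index_less block_of_offset loc_offset by auto
 have "(N * A0 w) $$ (x, ?y) = (\<Sum>c<n. N $$ (x, c) * A0 w $$ (c, ?y))"
  by (rule mult_entry[OF N A0_carrier x y(1)])
 also have "... = (\<Sum>c\<in>{c. c < n & bl c = j}. N $$ (x, c) * A0 w $$ (c, ?y))"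
  using y by (intro sum.mono_neutral_right) (auto simp: A0_def)
 also have "... = (\<Sum>c<r j. N $$ (x, offset r j + c) * A0 w $$ (offset r j + c, ?y))"
  by (rule sum_block) (use j in auto)
 also have "... = (\<Sum>c<r j. w powi (- mu j) * (N $$ (x, offset r j + c) * Aa j c y))"
  using j y index_less block_of_offset loc_offset by (intro sum.cong) (auto simp: A0_def Aa_def)
 finally show ?thesis by (simp add: sum_distrib_left)
qed

lemma mult_A0_left:
 assumes N: "N \<in> carrier_mat n n" and y: "y < n" and i: "1 <= i" "i <= k" "x < r i"
 shows "(A0 w * N) $$ (offset r i + x, y) = w powi (- mu i) * (\<Sum>c<r i. Aa i x c * N $$ (offset r i + c, y))"
proof -
 let ?x = "offset r i + x"
 have x: "?x < n" "bl ?x = i" "loc ?x = x" using i index_less block_of_offset loc_offset by auto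
 have "(A0 w * N) $$ (?x, y) = (\<Sum>c<n. A0 w $$ (?x, c) * N $$ (c, y))"
  by (rule mult_entry[OF A0_carrier N x(1) y])
 also have "... = (\<Sum>c\<in>{c. c < n & bl c = i}. A0 w $$ (?x, c) * N $$ (c, y))"
  using x by (intro sum.mono_neutral_right) (auto simp: A0_def)
 also have "... = (\<Sum>c<r i. A0 w $$ (?x, offset r i + c) * N $$ (offset r i + c, y))"
  by (rule sum_block) (use i in auto)
 also have "... = (\<Sum>c<r i. w powi (- mu i) * (Aa i x c * N $$ (offset r i + c, y)))"
  using i x index_less block_of_offset loc_offset by (intro sum.cong) (auto simp: A0_def Aa_def)
 finally show ?thesis by (simp add: sum_distrib_left)
qed

text \<open>The block equation of an automorphism of \<open>A\<^sub>0\<close>: going one step towards \<open>0\<close> multiplies the block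
 \<open>(i, j)\<close> by \<open>z\<close> to the power \<open>\<mu>\<^sub>i - \<mu>\<^sub>j > 0\<close>. This is why automorphisms are flat.\<close>

lemma aut_block_step:
 assumes F: "sol V eps A0 F" and w: "w \<in> Pre V" "norm (q * w) < eps" and ij: "1 <= i" "i < j" "j <= k"
 shows "nrm (r i) (r j) (blk (F w) i j) \<le>
  norm w powi (mu i - mu j) * (nrm (r i) (r i) (Aa' i) * nrm (r j) (r j) (Aa j)) * nrm (r i) (r j) (blk (F (q * w)) i j)"
proof -
 have w': "norm w < eps" "w ~= 0" "q * w \<in> Pre V" using norm_le_mult_q[of w] w by (auto simp: Pre_def)
 note car = sol_carrier[OF F w(1) w'(1)] sol_carrier[OF F w'(3) w(2)]
 have eq: "w powi (- mu j) * rm (r j) (blk (F (q * w)) i j) (Aa j) x y = w powi (- mu i) * lm (r i) (Aa i) (blk (F w) i j) x y"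
  if "x < r i" "y < r j" for x y
  using mult_A0_right[OF car(2), of "offset r i + x" j y w] mult_A0_left[OF car(1), of "offset r j + y" i x w]
   solD(3)[OF F w] ij that index_less[of i x] index_less[of j y] by (simp add: blk_def rm_def lm_def)
 have "blk (F w) i j x y = w powi (mu i - mu j) * lm (r i) (Aa' i) (rm (r j) (blk (F (q * w)) i j) (Aa j)) x y"
  if x: "x < r i" and y: "y < r j" for x y
 proof -
  have "blk (F w) i j x y = lm (r i) (Aa' i) (lm (r i) (Aa i) (blk (F w) i j)) x y"
   using lm_inverse[OF inverse_arrays_sym[OF Aa_inverse] x] ij by simp
  also have "... = lm (r i) (Aa' i) (%x y. w powi (mu i - mu j) * rm (r j) (blk (F (q * w)) i j) (Aa j) x y) x y"
  proof (rule lm_cong_entry)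
   fix x assume "x < r i"
   from eq[OF this y] show "lm (r i) (Aa i) (blk (F w) i j) x y = w powi (mu i - mu j) * rm (r j) (blk (F (q * w)) i j) (Aa j) x y"
    using w'(2) by (simp add: power_int_diff power_int_minus field_simps)
  qed
  also have "... = w powi (mu i - mu j) * lm (r i) (Aa' i) (rm (r j) (blk (F (q * w)) i j) (Aa j)) x y"
   by (simp add: lm_def sum_distrib_left mult_ac)
  finally show ?thesis .
 qed
 then have "nrm (r i) (r j) (blk (F w) i j) =
   nrm (r i) (r j) (%x y. w powi (mu i - mu j) * lm (r i) (Aa' i) (rm (r j) (blk (F (q * w)) i j) (Aa j)) x y)"
  by (rule nrm_cong)
 also have "... = norm w powi (mu i - mu j) * nrm (r i) (r j) (lm (r i) (Aa' i) (rm (r j) (blk (F (q * w)) i j) (Aa j)))"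
  unfolding nrm_scale by (simp add: norm_power_int)
 also have "... <= norm w powi (mu i - mu j) * (nrm (r i) (r i) (Aa' i) * (nrm (r i) (r j) (blk (F (q * w)) i j) * nrm (r j) (r j) (Aa j)))"
  by (intro mult_left_mono order_trans[OF nrm_lm] nrm_rm nrm_nonneg) auto
 finally show ?thesis by (simp add: mult_ac)
qed

lemma antimono_from_bound:
 fixes h :: "nat => real"
 assumes "!!l. l >= L ==> h (Suc l) <= h l" "!!l. l <= L ==> h l <= B"
 shows "h l <= B"
proof (cases "l <= L")
 case False
 then have "L <= l" by simp
 then show ?thesis
 proof (induction l rule: dec_induct)
  case (step l) then show ?case using assms(1)[of l] by simp
 qed (use assms(2) in simp)
qed (use assms(2) in simp)

lemma aut_flat:
 assumes V: "openin (Eq_top q) V" and F: "sol V eps A0 F" and ij: "1 <= i" "i < j" "j <= k" and ab: "a < r i" "b < r j"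
 shows "flat_on q (Pre V Int ball 0 eps) (%z. F z $$ (offset r i + a, offset r j + b))"
 unfolding flat_on_def
proof (intro allI impI)
 fix m :: nat and K :: "complex set" assume K: "compact K & K \<subseteq> Pre V Int ball 0 eps"
 define C where "C = nrm (r i) (r i) (Aa' i) * nrm (r j) (r j) (Aa j)"
 define h where "h = (%z l. nrm (r i) (r j) (blk (F (z / q ^ l)) i j) / norm (z / q ^ l) ^ m)"
 have C0: "0 <= C" by (simp add: C_def nrm_nonneg)
 obtain L where L: "norm q ^ L > \<bar>eps\<bar> * (C * norm q ^ m + 1)" using real_arch_pow[OF q] by blast
 have \<mu>: "mu i - mu j >= 1" using mu[OF ij] by simp
 have Kz: "z \<in> Pre V" "norm z < eps" "z ~= 0" if "z \<in> K" for z using K that by (auto simp: Pre_def)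
 have step: "h z (Suc l) <= h z l" if z: "z \<in> K" and l: "l >= L" for z l
 proof -
  define w where "w = z / q ^ Suc l"
  have qw: "q * w = z / q ^ l" by (simp add: w_def)
  have w: "w \<in> Pre V" "norm (q * w) < eps" "w ~= 0"
   using Kz[OF z] norm_divide_q_le[of z l] Pre_divide_power[of z "Suc l"] unfolding qw w_def by (auto simp del: Pre_divide_power)
  have eps0: "0 < eps" using Kz[OF z] norm_ge_zero[of z] by linarith
  have "norm q ^ L <= norm q ^ Suc l" using q l by (intro power_increasing) auto
  then have big: "eps * (C * norm q ^ m + 1) <= norm q ^ Suc l" using L eps0 by simp
  have "norm w = norm z / norm q ^ Suc l" by (simp add: w_def norm_divide norm_power norm_mult)
  also have "... <= eps / norm q ^ Suc l" using Kz[OF z] by (intro divide_right_mono) auto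
  finally have "norm w <= eps / norm q ^ Suc l" .
  then have "norm w * (C * norm q ^ m + 1) <= eps / norm q ^ Suc l * (C * norm q ^ m + 1)"
   using C0 by (intro mult_right_mono) auto
  also have "... <= 1" using big by (simp add: field_simps del: power_Suc)
  finally have w1: "norm w * (C * norm q ^ m + 1) <= 1" .
  have le1: "norm w <= 1" "norm w * (C * norm q ^ m) <= 1"
  proof -
   have "norm w * 1 <= norm w * (C * norm q ^ m + 1)" "norm w * (C * norm q ^ m) <= norm w * (C * norm q ^ m + 1)"
    using C0 by (intro mult_left_mono; simp)+
   then show "norm w <= 1" "norm w * (C * norm q ^ m) <= 1" using w1 by linarith+
  qed
  have "norm w powi (mu i - mu j) <= norm w powi 1"
   using le1 w \<mu> by (intro power_int_decreasing) auto
  then have "norm w powi (mu i - mu j) * C * norm q ^ m <= norm w * C * norm q ^ m"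
   using C0 by (intro mult_right_mono) auto
  then have c: "norm w powi (mu i - mu j) * C * norm q ^ m <= 1" using le1 by (simp add: mult.assoc)
  have "h z (Suc l) = nrm (r i) (r j) (blk (F w) i j) / norm w ^ m" by (simp add: h_def w_def)
  also have "... <= (norm w powi (mu i - mu j) * C * nrm (r i) (r j) (blk (F (q * w)) i j)) / norm w ^ m"
   unfolding C_def by (intro divide_right_mono aut_block_step[OF F w(1,2) ij]) auto
  also have "... = (norm w powi (mu i - mu j) * C * norm q ^ m) * h z l"
   using w(3) unfolding h_def qw[symmetric] by (simp add: norm_mult power_mult_distrib)
  also have "... <= 1 * h z l"
   by (intro mult_right_mono c) (simp add: h_def nrm_nonneg)
  finally show ?thesis by simp
 qed
 have "\<exists>B. \<forall>z\<in>K. h z l <= B" for l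
 proof -
  have hol: "(%z. F (z / q ^ l) $$ (x, y)) holomorphic_on Pre V Int ball 0 eps" if xy: "x < n" "y < n" for x y
  proof -
   have "hol_mat (Pre V Int ball 0 eps) (%z. F ((1 / q ^ l) * z))"
   proof (rule hol_mat_compose_scale[OF solD(2)[OF F]])
    fix z assume "z \<in> Pre V Int ball 0 eps"
    then show "1 / q ^ l * z \<in> Pre V Int ball 0 eps" using norm_divide_q_le[of z l] by auto
   qed
   from hol_matD[OF this xy] show ?thesis by simp
  qed
  have "continuous_on K (%z. F (z / q ^ l) $$ (x, y))" if xy: "x < n" "y < n" for x y
   by (rule continuous_on_subset[OF holomorphic_on_imp_continuous_on[OF hol[OF xy]]]) (use K in auto)
  then have "continuous_on K (%z. h z l)"
   unfolding h_def nrm_def blk_def using Kz ij index_less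
   by (intro continuous_intros) auto
  then have "compact ((%z. h z l) ` K)" using K by (intro compact_continuous_image) auto
  then have "bounded ((%z. h z l) ` K)" by (rule compact_imp_bounded)
  then obtain B where "\<forall>x \<in> (%z. h z l) ` K. norm x <= B" by (auto simp: bounded_iff)
  then show ?thesis by (intro exI[of _ B]) (auto simp: abs_le_iff)
 qed
 then obtain B where B: "!!l z. z \<in> K ==> h z l <= B l" by metis
 define BB where "BB = (\<Sum>l\<le>L. \<bar>B l\<bar>)"
 have "h z l <= BB" if z: "z \<in> K" for z l
 proof (rule antimono_from_bound[of L "h z"])
  show "h z l <= BB" if "l <= L" for l
  proof -
   have "h z l <= \<bar>B l\<bar>" using B[OF z, of l] by simp
   also have "... <= BB" unfolding BB_def using that by (intro member_le_sum) auto
   finally show ?thesis .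
  qed
 qed (rule step[OF z])
 moreover have "norm (F (z / q ^ l) $$ (offset r i + a, offset r j + b) / (z / q ^ l) ^ m) <= h z l" for z l
  using nrm_entry[OF ab, of "blk (F (z / q ^ l)) i j"]
  by (simp add: h_def norm_divide norm_power blk_def divide_right_mono del: power_divide)
 ultimately have "\<forall>z \<in> K. \<forall>l. norm (F (z / q ^ l) $$ (offset r i + a, offset r j + b) / (z / q ^ l) ^ m) <= BB"
  using order_trans by blast
 then show "bounded ((%z. F z $$ (offset r i + a, offset r j + b) / z ^ m) ` {z / q ^ l |z l. z \<in> K})"
  unfolding bounded_iff by (intro exI[of _ BB]) blast
qed

lemma zero_less_1: "0 < (1 :: real)" by simp

abbreviation cls :: "complex set set => (complex => complex mat) => (complex => complex mat) set" where
 "cls \<equiv> sector_class q"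

abbreviation \<Lambda> :: "complex set set => (complex => complex mat) set monoid" where
 "\<Lambda> \<equiv> Lambda_I q k mu r A"

lemma cls_memberE:
 assumes "G \<in> cls V F"
 obtains W where "sector q W" "horizon q W = V" "!!z. z \<in> W ==> G z = F z"
 using assms unfolding sector_class_def by blast

lemma cls_eqI:
 assumes W: "sector q W" "horizon q W = V" "!!z. z \<in> W ==> F z = G z"
 shows "cls V F = cls V G"
proof -
 have "cls V F \<subseteq> cls V G" if FG: "!!z. z \<in> W ==> F z = G z" for F G
 proof
  fix H assume "H \<in> cls V F"
  then obtain W' where W': "sector q W'" "horizon q W' = V" "!!z. z \<in> W' ==> H z = F z"
   by (auto simp: sector_class_def)
  have "!!z. z \<in> W Int W' ==> H z = G z" using W'(3) FG by auto
  then show "H \<in> cls V G"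
   using sector_Int[OF W(1,2) W'(1,2)] unfolding sector_class_def by blast
 qed
 from this[of F G] this[of G F] W(3) show ?thesis by fastforce
qed

lemma cls_self: "openin (Eq_top q) V ==> F \<in> cls V F"
 unfolding sector_class_def using sector_Pre[of V 1] by auto

lemma cls_eqD:
 assumes "openin (Eq_top q) V" "cls V F = cls V G"
 obtains W where "sector q W" "horizon q W = V" "!!z. z \<in> W ==> F z = G z"
proof -
 have "F \<in> cls V G" using cls_self[OF assms(1), of F] assms(2) by simp
 then show thesis using that by (rule cls_memberE)
qed

lemma sol_stokes_fun:
 assumes V: "openin (Eq_top q) V" and F: "sol V eps A0 F" and eps: "0 < eps"
 shows "stokes_fun q k mu r A V F"
 unfolding stokes_fun_def
proof (intro exI[of _ "Pre V Int ball 0 eps"] conjI ballI allI impI)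
 show "sector q (Pre V Int ball 0 eps)" "horizon q (Pre V Int ball 0 eps) = V" by (rule sector_Pre[OF V eps])+
 show "F z \<in> frakG k r" if "z \<in> Pre V Int ball 0 eps" for z using solD(1)[OF F] that by auto
 fix i j a b assume ij: "1 <= i & i < j & j <= k & a < r i & b < r j"
 then have e: "(%z. block r (F z) i j $$ (a, b)) = (%z. F z $$ (offset r i + a, offset r j + b))"
  by (simp add: block_def)
 show "(%z. block r (F z) i j $$ (a, b)) holomorphic_on Pre V Int ball 0 eps"
  unfolding e using ij by (intro hol_matD[OF solD(2)[OF F]] index_less) auto
 show "flat_on q (Pre V Int ball 0 eps) (%z. block r (F z) i j $$ (a, b))"
  unfolding e using ij by (intro aut_flat[OF V F]) auto
next
 fix z assume z: "z \<in> Pre V Int ball 0 eps" "q * z \<in> Pre V Int ball 0 eps"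
 then have z0: "z ~= 0" by auto
 have i: "F z * minv (F z) = 1\<^sub>m n" "minv (F z) \<in> carrier_mat n n" "F z \<in> carrier_mat n n"
  using frakG_minv[OF solD(1)[OF F]] sol_carrier[OF F] z by auto
 have "F (q * z) * A0 z = A0 z * F z" using solD(3)[OF F] z by auto
 then show "gauge_fun q F (mat_fun (AM (zero_family r))) z = mat_fun (AM (zero_family r)) z"
  using i by (simp add: gauge_fun_def A0_eq[OF z0] mat_simps)
qed

lemma stokes_fun_sol:
 assumes V: "openin (Eq_top q) V" and F: "stokes_fun q k mu r A V F" and eps: "0 < eps"
 obtains F' where "sol V eps A0 F'" "cls V F' = cls V F"
proof -
 obtain W0 where W0: "sector q W0" "horizon q W0 = V" "!!z. z \<in> W0 ==> F z \<in> frakG k r"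
  "!!i j a b. 1 <= i & i < j & j <= k & a < r i & b < r j ==> (%z. block r (F z) i j $$ (a, b)) holomorphic_on W0"
  "!!z. z \<in> W0 ==> q * z \<in> W0 ==> gauge_fun q F (mat_fun (AM (zero_family r))) z = mat_fun (AM (zero_family r)) z"
  using F unfolding stokes_fun_def by blast
 define W where "W = W0 Int (Pre V Int ball 0 eps)"
 have W: "sector q W" "horizon q W = V" unfolding W_def by (rule sector_Int[OF W0(1,2) sector_Pre[OF V eps]])+
 have hol: "hol_mat W F"
  unfolding hol_mat_def
 proof (intro allI impI)
  fix a b assume ab: "a < n" "b < n"
  note B = block_bounds[OF ab(1)] block_bounds[OF ab(2)]
  show "(%z. F z $$ (a, b)) holomorphic_on W"
  proof (cases "bl a < bl b")
   case True
   have "(%z. block r (F z) (bl a) (bl b) $$ (loc a, loc b)) holomorphic_on W0"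
    by (rule W0(4)) (use B True in auto)
   also have "(%z. block r (F z) (bl a) (bl b) $$ (loc a, loc b)) = (%z. F z $$ (a, b))"
    using B by (simp add: block_def)
   finally show ?thesis by (rule holomorphic_on_subset) (simp add: W_def)
  next
   case False
   have "(%z. if a = b then 1 else 0) holomorphic_on W" by simp
   then show ?thesis
    by (rule holomorphic_transform) (use False frakG_entry[OF W0(3) ab] in \<open>auto simp: W_def\<close>)
  qed
 qed
 obtain F' where F': "sol V eps A0 F'" "!!z. z \<in> W ==> F' z = F z"
 proof (rule sol_extend_up[OF V form_A0[of eps] W _ hol])
  show "W \<subseteq> ball 0 eps" by (auto simp: W_def)
  show "F z \<in> frakG k r" if "z \<in> W" for z using W0(3) that by (auto simp: W_def)
  fix z assume z: "z \<in> W" "q * z \<in> W"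
  then have z0: "z ~= 0" and g: "F z \<in> frakG k r" "F (q * z) \<in> frakG k r" using W0(3) by (auto simp: W_def)
  have "F (q * z) * A0 z * minv (F z) = A0 z"
   using W0(5)[of z] z by (simp add: W_def gauge_fun_def A0_eq[OF z0])
  then have "A0 z * F z = F (q * z) * A0 z * minv (F z) * F z" by simp
  also have "... = F (q * z) * A0 z * (minv (F z) * F z)"
   using frakG_minv(1)[OF g(1)] frakG_carrier[OF g(1)] frakG_carrier[OF g(2)] by (simp add: mat_simps)
  also have "... = F (q * z) * A0 z"
   using frakG_minv(3)[OF g(1)] frakG_carrier[OF g(2)] by (simp add: mat_simps)
  finally show "F (q * z) * A0 z = A0 z * F z" by simp
 qed auto
 then show thesis using that cls_eqI[OF W, of F' F] by blast
qed

lemma Lambda_carrier: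
 assumes V: "openin (Eq_top q) V" and eps: "0 < eps"
 shows "carrier (\<Lambda> V) = {cls V F | F. sol V eps A0 F}"
proof -
 have "\<exists>F'. cls V F = cls V F' & sol V eps A0 F'" if "stokes_fun q k mu r A V F" for F
  using stokes_fun_sol[OF V that eps] by metis
 then show ?thesis
  using sol_stokes_fun[OF V _ eps] by (auto simp: Lambda_I_def)
qed

lemma Lambda_mult:
 assumes V: "openin (Eq_top q) V"
 shows "cls V F \<otimes>\<^bsub>\<Lambda> V\<^esub> cls V G = cls V (%z. F z * G z)"
proof -
 have "cls V (%z. F' z * G' z) = cls V (%z. F z * G z)" if "F' \<in> cls V F" "G' \<in> cls V G" for F' G'
 proof -
  from that(1) obtain W where W: "sector q W" "horizon q W = V" "!!z. z \<in> W ==> F' z = F z"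
   by (rule cls_memberE) blast
  from that(2) obtain W' where W': "sector q W'" "horizon q W' = V" "!!z. z \<in> W' ==> G' z = G z"
   by (rule cls_memberE) blast
  show ?thesis by (rule cls_eqI[OF sector_Int[OF W(1,2) W'(1,2)]]) (use W(3) W'(3) in auto)
 qed
 then have "(\<Union>F'\<in>cls V F. \<Union>G'\<in>cls V G. cls V (%z. F' z * G' z)) = (\<Union>F'\<in>cls V F. \<Union>G'\<in>cls V G. cls V (%z. F z * G z))"
  by simp
 also have "... = cls V (%z. F z * G z)" using cls_self[OF V] by blast
 finally show ?thesis by (simp add: Lambda_I_def)
qed

lemma Lambda_one: "\<one>\<^bsub>\<Lambda> V\<^esub> = cls V (%z. 1\<^sub>m n)"
 by (simp add: Lambda_I_def n_def)

lemma Lambda_res_cls: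
 assumes V: "openin (Eq_top q) V" and V': "openin (Eq_top q) V'" "V' \<subseteq> V"
 shows "Lambda_res q V V' (cls V F) = cls V' F"
proof -
 have "cls V' G = cls V' F" if "G \<in> cls V F" for G
 proof -
  from that obtain W where W: "sector q W" "horizon q W = V" "!!z. z \<in> W ==> G z = F z"
   by (rule cls_memberE) blast
  show ?thesis by (rule cls_eqI[OF sector_restrict[OF W(1,2) V'(2,1)]]) (use W(3) in auto)
 qed
 then show ?thesis unfolding Lambda_res_def using cls_self[OF V, of F] by blast
qed

lemma cls_sol_cong:
 assumes "openin (Eq_top q) V" "0 < eps" "!!z. z \<in> Pre V ==> norm z < eps ==> F z = G z"
 shows "cls V F = cls V G"
 by (rule cls_eqI[OF sector_Pre[OF assms(1,2)]]) (use assms(3) in auto)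

lemma Lambda_group:
 assumes V: "openin (Eq_top q) V"
 shows "group (\<Lambda> V)" "!!F eps. 0 < eps ==> sol V eps A0 F ==> inv\<^bsub>\<Lambda> V\<^esub> cls V F = cls V (%z. minv (F z))"
proof -
 note C = Lambda_carrier[OF V zero_less_1]
 have linv: "cls V (%z. minv (F z)) \<otimes>\<^bsub>\<Lambda> V\<^esub> cls V F = \<one>\<^bsub>\<Lambda> V\<^esub>" if "0 < eps" "sol V eps A0 F" for F eps
  unfolding Lambda_mult[OF V] Lambda_one
  by (rule cls_sol_cong[OF V that(1)]) (use frakG_minv(3)[OF solD(1)[OF that(2)]] in auto)
 show g: "group (\<Lambda> V)"
 proof (rule groupI)
  show "x \<otimes>\<^bsub>\<Lambda> V\<^esub> y \<in> carrier (\<Lambda> V)" if "x \<in> carrier (\<Lambda> V)" "y \<in> carrier (\<Lambda> V)" for x y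
   using that unfolding C by (auto simp: Lambda_mult[OF V] intro!: sol_mult form_A0)
  show "\<one>\<^bsub>\<Lambda> V\<^esub> \<in> carrier (\<Lambda> V)" unfolding C Lambda_one using sol_one by blast
  show "x \<otimes>\<^bsub>\<Lambda> V\<^esub> y \<otimes>\<^bsub>\<Lambda> V\<^esub> z = x \<otimes>\<^bsub>\<Lambda> V\<^esub> (y \<otimes>\<^bsub>\<Lambda> V\<^esub> z)"
   if xyz: "x \<in> carrier (\<Lambda> V)" "y \<in> carrier (\<Lambda> V)" "z \<in> carrier (\<Lambda> V)" for x y z
  proof -
   obtain F G H where FGH: "x = cls V F" "y = cls V G" "z = cls V H" "sol V 1 A0 F" "sol V 1 A0 G" "sol V 1 A0 H"
    using xyz unfolding C by blast
   show ?thesis unfolding FGH(1-3) Lambda_mult[OF V]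
    by (rule cls_sol_cong[OF V zero_less_1])
     (simp add: assoc_mult_mat[OF sol_carrier[OF FGH(4)] sol_carrier[OF FGH(5)] sol_carrier[OF FGH(6)]])
  qed
  show "\<one>\<^bsub>\<Lambda> V\<^esub> \<otimes>\<^bsub>\<Lambda> V\<^esub> x = x" if x: "x \<in> carrier (\<Lambda> V)" for x
  proof -
   obtain F where F: "x = cls V F" "sol V 1 A0 F" using x unfolding C by blast
   show ?thesis unfolding F(1) Lambda_mult[OF V] Lambda_one
    by (rule cls_sol_cong[OF V zero_less_1]) (simp add: left_mult_one_mat[OF sol_carrier[OF F(2)]])
  qed
  show "\<exists>y\<in>carrier (\<Lambda> V). y \<otimes>\<^bsub>\<Lambda> V\<^esub> x = \<one>\<^bsub>\<Lambda> V\<^esub>" if x: "x \<in> carrier (\<Lambda> V)" for x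
  proof -
   obtain F where F: "x = cls V F" "sol V 1 A0 F" using x unfolding C by blast
   show ?thesis
    using linv[OF zero_less_1 F(2)] sol_minv[OF F(2)] unfolding F(1) C by blast
  qed
 qed
 fix F eps assume F: "0 < eps" "sol V eps A0 F"
 show "inv\<^bsub>\<Lambda> V\<^esub> cls V F = cls V (%z. minv (F z))"
  by (rule group.inv_equality[OF g linv[OF F]])
   (use Lambda_carrier[OF V F(1)] F(2) sol_minv[OF F(2)] in blast)+
qed

end

section \<open>Trivialised cocycles\<close>

context qdiff
begin

lemma radius_subset: "radius U \<rho> ==> 0 < \<rho>' ==> \<rho>' <= \<rho> ==> radius U \<rho>'"
 unfolding radius_def by (metis ereal_less_eq(3) order_trans)

lemma radius_pos: "radius U \<rho> ==> 0 < \<rho>"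
 by (simp add: radius_def)

lemma iso_fun_subset: "iso_fun eps M M' G ==> eps' <= eps ==> iso_fun eps' M M' G"
 unfolding iso_fun_def by (auto intro: hol_mat_subset[where S = "annulus 0 eps"])

lemma iso_funD:
 assumes "iso_fun eps M M' G"
 shows "!!z. z ~= 0 ==> norm z < eps ==> G z \<in> frakG k r" "hol_mat (annulus 0 eps) G"
  "!!z. z ~= 0 ==> norm (q * z) < eps ==> G (q * z) * M z = M' z * G z"
 using assms by (auto simp: iso_fun_def)

lemma iso_fun_refl: "form eps M ==> iso_fun eps M M (%z. 1\<^sub>m n)"
 unfolding iso_fun_def
proof (intro conjI ballI allI impI)
 fix z assume M: "form eps M" and z: "z ~= 0" "norm (q * z) < eps"
 have "norm z < eps" using z norm_le_mult_q[of z] by linarith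
 then show "1\<^sub>m n * M z = M z * 1\<^sub>m n" using formD(3)[OF M z(1)] by (simp add: mat_simps)
qed (auto simp: hol_mat_def frakG_one)

lemma iso_fun_mult:
 assumes G: "iso_fun eps M M' G" and H: "iso_fun eps M' M'' H"
  and M: "form eps M" "form eps M'" "form eps M''"
 shows "iso_fun eps M M'' (%z. H z * G z)"
 unfolding iso_fun_def
proof (intro conjI ballI allI impI)
 show "H z * G z \<in> frakG k r" if "z \<in> annulus 0 eps" for z
  using iso_funD(1)[OF G] iso_funD(1)[OF H] that by (auto intro!: frakG_mult)
 show "hol_mat (annulus 0 eps) (%z. H z * G z)"
  by (intro hol_mat_mult iso_funD(2)[OF G] iso_funD(2)[OF H]) (use iso_fun_carrier[OF G] iso_fun_carrier[OF H] in auto)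
 fix z assume z: "z ~= 0" "norm (q * z) < eps"
 have z': "norm z < eps" "q * z ~= 0" using z norm_le_mult_q[of z] by auto
 note car = iso_fun_carrier[OF G z(1) z'(1)] iso_fun_carrier[OF H z(1) z'(1)] iso_fun_carrier[OF G z'(2) z(2)]
  iso_fun_carrier[OF H z'(2) z(2)] formD(3)[OF M(1) z(1) z'(1)] formD(3)[OF M(2) z(1) z'(1)] formD(3)[OF M(3) z(1) z'(1)]
 have "H (q * z) * G (q * z) * M z = H (q * z) * (G (q * z) * M z)" using car by (simp add: mat_simps)
 also have "... = H (q * z) * M' z * G z" unfolding iso_funD(3)[OF G z] using car by (simp add: mat_simps)
 also have "... = M'' z * (H z * G z)" unfolding iso_funD(3)[OF H z] using car by (simp add: mat_simps)
 finally show "H (q * z) * G (q * z) * M z = M'' z * (H z * G z)" .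
qed

lemma cancel_inverses:
 fixes P :: "complex mat"
 assumes "P \<in> carrier_mat n n" "P' \<in> carrier_mat n n" "P * P' = 1\<^sub>m n" "X \<in> carrier_mat n n"
 shows "P * (P' * X) = X"
 using assoc_mult_mat[OF assms(1,2,4)] left_mult_one_mat[OF assms(4)] assms(3) by simp

lemma iso_fun_minv:
 assumes G: "iso_fun eps M M' G" and M: "form eps M" "form eps M'"
 shows "iso_fun eps M' M (%z. minv (G z))"
 unfolding iso_fun_def
proof (intro conjI ballI allI impI)
 show "minv (G z) \<in> frakG k r" if "z \<in> annulus 0 eps" for z
  using iso_funD(1)[OF G] that by (auto intro!: minv_frakG)
 show "hol_mat (annulus 0 eps) (%z. minv (G z))"
  by (intro hol_mat_minv iso_funD(2)[OF G]) (use iso_funD(1)[OF G] in auto)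
 fix z assume z: "z ~= 0" "norm (q * z) < eps"
 have z': "norm z < eps" "q * z ~= 0" using z norm_le_mult_q[of z] by auto
 note car = iso_fun_carrier[OF G z(1) z'(1)] iso_fun_carrier[OF G z'(2) z(2)]
  formD(3)[OF M(1) z(1) z'(1)] formD(3)[OF M(2) z(1) z'(1)]
 note i = frakG_minv[OF iso_funD(1)[OF G z(1) z'(1)]] frakG_minv[OF iso_funD(1)[OF G z'(2) z(2)]]
 have "M' z = M' z * G z * minv (G z)" using car i(1,2) by (simp add: mat_simps)
 also have "... = G (q * z) * (M z * minv (G z))" unfolding iso_funD(3)[OF G z, symmetric] using car i(1) by (simp add: mat_simps)
 finally have "minv (G (q * z)) * M' z = minv (G (q * z)) * (G (q * z) * (M z * minv (G z)))" by simp
 also have "... = M z * minv (G z)"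
  by (rule cancel_inverses) (use car i in \<open>auto intro!: mult_carrier_mat[of _ n n]\<close>)
 finally show "minv (G (q * z)) * M' z = M z * minv (G z)" .
qed

definition iso_families :: "(nat => nat => complex fls mat) => (nat => nat => complex fls mat) => bool" where
 "iso_families U U' \<longleftrightarrow> (\<exists>eps G. radius U eps & radius U' eps & iso_fun eps (AU U) (AU U') G)"

lemma iso_families_refl: "U \<in> families ==> iso_families U U"
 unfolding iso_families_def using radius_exists iso_fun_refl[OF form_AU] by blast

lemma iso_families_sym: "iso_families U U' ==> iso_families U' U"
 unfolding iso_families_def using iso_fun_minv[OF _ form_AU form_AU] by blast

lemma iso_families_trans:
 assumes "iso_families U U'" "iso_families U' U''"
 shows "iso_families U U''"
proof -
 obtain e1 e2 G H where e: "radius U e1" "radius U' e1" "iso_fun e1 (AU U) (AU U') G"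
  "radius U' e2" "radius U'' e2" "iso_fun e2 (AU U') (AU U'') H"
  using assms unfolding iso_families_def by blast
 define e where "e = min e1 e2"
 have le: "0 < e" "e <= e1" "e <= e2" using radius_pos[OF e(1)] radius_pos[OF e(4)] by (auto simp: e_def)
 have r: "radius U e" "radius U' e" "radius U'' e" using radius_subset e le by blast+
 have "iso_fun e (AU U) (AU U'') (%z. H z * G z)"
  by (rule iso_fun_mult[OF iso_fun_subset[OF e(3) le(2)] iso_fun_subset[OF e(6) le(3)]]) (rule form_AU, rule r)+
 then show ?thesis unfolding iso_families_def using r by blast
qed

type_synonym stokes_data = "(sum_div, complex set, (complex => complex mat) set) cech_data"

abbreviation cocycles :: "stokes_data set" where
 "cocycles \<equiv> cech_cocycles (Eq_top q) \<Lambda> (Lambda_res q)"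

abbreviation cohomologous :: "(stokes_data \<times> stokes_data) set" where
 "cohomologous \<equiv> cech_rel (Eq_top q) \<Lambda> (Lambda_res q)"

text \<open>A cocycle is trivialised by \<open>U\<close> if it is the coboundary of solutions of \<open>F[A\<^sub>0] = A\<^sub>U\<close>, all defined
 up to the same radius.\<close>

definition trivialised :: "stokes_data => (nat => nat => complex fls mat) => bool" where
 "trivialised = (%(I, V, g) U. \<exists>eps f. radius U eps & (\<forall>a\<in>I. sol (V a) eps (AU U) (f a)) &
   (\<forall>a\<in>I. \<forall>b\<in>I. g a b = cls (V a Int V b) (%z. minv (f a z) * f b z)))"

lemma openin_Int_cover:
 "open_covering (Eq_top q) I V ==> a \<in> I ==> b \<in> I ==> openin (Eq_top q) (V a Int V b)"
 by (auto simp: open_covering_def)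

lemma sol_sol_step:
 assumes H: "sol V eps M' H" and F: "sol V eps M F" and M: "form eps M" "form eps M'"
  and z: "z \<in> Pre V" "norm (q * z) < eps"
 shows "H (q * z) * minv (F (q * z)) * M z = M' z * (H z * minv (F z))"
proof -
 have z': "norm z < eps" "q * z \<in> Pre V" "z ~= 0" using z norm_le_mult_q[of z] by (auto simp: Pre_def)
 note car = sol_carrier[OF F z(1) z'(1)] sol_carrier[OF F z'(2) z(2)] sol_carrier[OF H z(1) z'(1)] sol_carrier[OF H z'(2) z(2)]
  formD(3)[OF M(1) z'(3,1)] formD(3)[OF M(2) z'(3,1)] A0_carrier[of z]
 note i = frakG_minv[OF solD(1)[OF F z(1) z'(1)]] frakG_minv[OF solD(1)[OF F z'(2) z(2)]]
 have "M z = M z * F z * minv (F z)" using car i(1,2) by (simp add: mat_simps)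
 also have "... = F (q * z) * (A0 z * minv (F z))" unfolding solD(3)[OF F z, symmetric] using car i(1) by (simp add: mat_simps)
 finally have "minv (F (q * z)) * M z = minv (F (q * z)) * (F (q * z) * (A0 z * minv (F z)))" by simp
 also have "... = A0 z * minv (F z)"
  by (rule cancel_inverses) (use car i in \<open>auto intro!: mult_carrier_mat[of _ n n]\<close>)
 finally have 1: "minv (F (q * z)) * M z = A0 z * minv (F z)" .
 have "H (q * z) * minv (F (q * z)) * M z = H (q * z) * (A0 z * minv (F z))"
  unfolding 1[symmetric] using car i(4) by (simp add: mat_simps)
 also have "... = H (q * z) * A0 z * minv (F z)" using car i(1) by (simp add: mat_simps)
 also have "... = M' z * (H z * minv (F z))" unfolding solD(3)[OF H z] using car i(1) by (simp add: mat_simps)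
 finally show ?thesis .
qed

text \<open>On the members of a common refinement the products \<open>f' c\<^sup>* f\<^sup>*\<close> (stars for inverses) agree on overlaps, and they glue to a transformation on a punctured disc.\<close>

lemma cohomologous_imp_iso:
 assumes t: "trivialised d U" "trivialised d' U'" and rel: "(d, d') \<in> cohomologous"
 shows "iso_families U U'"
proof -
 obtain I V g where d: "d = (I, V, g)" by (cases d)
 obtain I' V' g' where d': "d' = (I', V', g')" by (cases d')
 have "\<exists>(J :: sum_div set) W \<tau> \<tau>' c. open_covering (Eq_top q) J W &
  (\<forall>a\<in>J. \<tau> a \<in> I & W a \<subseteq> V (\<tau> a) & \<tau>' a \<in> I' & W a \<subseteq> V' (\<tau>' a) & c a \<in> carrier (\<Lambda> (W a))) &
  (\<forall>a\<in>J. \<forall>b\<in>J. Lambda_res q (V' (\<tau>' a) Int V' (\<tau>' b)) (W a Int W b) (g' (\<tau>' a) (\<tau>' b)) =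
    inv\<^bsub>\<Lambda> (W a Int W b)\<^esub> (Lambda_res q (W a) (W a Int W b) (c a)) \<otimes>\<^bsub>\<Lambda> (W a Int W b)\<^esub> Lambda_res q (V (\<tau> a) Int V (\<tau> b)) (W a Int W b) (g (\<tau> a) (\<tau> b))
     \<otimes>\<^bsub>\<Lambda> (W a Int W b)\<^esub> Lambda_res q (W b) (W a Int W b) (c b))"
  using rel unfolding d d' cech_rel_def Let_def by simp
 then obtain J :: "sum_div set" and W \<tau> \<tau>' c where J: "open_covering (Eq_top q) J W"
  "!!a. a \<in> J ==> \<tau> a \<in> I & W a \<subseteq> V (\<tau> a) & \<tau>' a \<in> I' & W a \<subseteq> V' (\<tau>' a) & c a \<in> carrier (\<Lambda> (W a))"
  "!!a b. a \<in> J ==> b \<in> J ==>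
    Lambda_res q (V' (\<tau>' a) Int V' (\<tau>' b)) (W a Int W b) (g' (\<tau>' a) (\<tau>' b)) =
    inv\<^bsub>\<Lambda> (W a Int W b)\<^esub> (Lambda_res q (W a) (W a Int W b) (c a)) \<otimes>\<^bsub>\<Lambda> (W a Int W b)\<^esub> Lambda_res q (V (\<tau> a) Int V (\<tau> b)) (W a Int W b) (g (\<tau> a) (\<tau> b))
     \<otimes>\<^bsub>\<Lambda> (W a Int W b)\<^esub> Lambda_res q (W b) (W a Int W b) (c b)"
  by (elim exE conjE) blast
 have cov: "open_covering (Eq_top q) I V" "open_covering (Eq_top q) I' V'"
  using rel unfolding d d' cech_rel_def cech_cocycles_def by blast+
 obtain e1 f where f: "radius U e1" "!!a. a \<in> I ==> sol (V a) e1 (AU U) (f a)"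
  "!!a b. a \<in> I ==> b \<in> I ==> g a b = cls (V a Int V b) (%z. minv (f a z) * f b z)"
  using t(1) unfolding d trivialised_def prod.case by blast
 obtain e2 f' where f': "radius U' e2" "!!a. a \<in> I' ==> sol (V' a) e2 (AU U') (f' a)"
  "!!a b. a \<in> I' ==> b \<in> I' ==> g' a b = cls (V' a Int V' b) (%z. minv (f' a z) * f' b z)"
  using t(2) unfolding d' trivialised_def prod.case by blast
 define e where "e = min e1 e2"
 have e: "0 < e" "e <= e1" "e <= e2" using radius_pos[OF f(1)] radius_pos[OF f'(1)] by (auto simp: e_def)
 have rad: "radius U e" "radius U' e" using radius_subset f(1) f'(1) e by blast+
 note fM = form_AU[OF rad(1)] form_AU[OF rad(2)]
 have opW: "openin (Eq_top q) (W a)" if "a \<in> J" for a using J(1) that by (simp add: open_covering_def)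
 have "\<exists>C. sol (W a) e A0 C & c a = cls (W a) C" if "a \<in> J" for a
  using J(2)[OF that] Lambda_carrier[OF opW[OF that] e(1)] by blast
 then obtain C where C: "!!a. a \<in> J ==> sol (W a) e A0 (C a)" "!!a. a \<in> J ==> c a = cls (W a) (C a)" by metis
 define F where "F a = f (\<tau> a)" for a
 define F' where "F' a = f' (\<tau>' a)" for a
 have F: "sol (W a) e (AU U) (F a)" if "a \<in> J" for a
  unfolding F_def by (rule sol_subset[OF f(2)]) (use J(2)[OF that] e in auto)
 have F': "sol (W a) e (AU U') (F' a)" if "a \<in> J" for a
  unfolding F'_def by (rule sol_subset[OF f'(2)]) (use J(2)[OF that] e in auto)
 define H where "H a z = F' a z * minv (C a z)" for a z
 have H: "sol (W a) e (AU U') (H a)" if "a \<in> J" for a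
  unfolding H_def[abs_def] by (rule sol_mult[OF F'[OF that] sol_minv[OF C(1)[OF that]] fM(2)])
 define G where "G a z = H a z * minv (F a z)" for a z
 have Gfrak: "G a z \<in> frakG k r" if "a \<in> J" "z \<in> Pre (W a)" "norm z < e" for a z
  unfolding G_def by (intro frakG_mult minv_frakG solD(1)[OF H] solD(1)[OF F] that)
 have glue: "G a z = G b z" if ab: "a \<in> J" "b \<in> J" and z: "z \<in> Pre (W a)" "z \<in> Pre (W b)" "norm z < e" for a b z
 proof -
  define T where "T = W a Int W b"
  have opT: "openin (Eq_top q) T" unfolding T_def using opW ab by auto
  have sub: "T \<subseteq> W a" "T \<subseteq> W b" by (auto simp: T_def)
  have IJ: "\<tau> a \<in> I" "\<tau> b \<in> I" "\<tau>' a \<in> I'" "\<tau>' b \<in> I'" "T \<subseteq> V (\<tau> a) Int V (\<tau> b)" "T \<subseteq> V' (\<tau>' a) Int V' (\<tau>' b)"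
   using J(2)[OF ab(1)] J(2)[OF ab(2)] by (auto simp: T_def)
  have s: "sol T e A0 (C a)" "sol T e A0 (C b)" "sol T e (AU U) (F a)" "sol T e (AU U) (F b)"
   "sol T e (AU U') (F' a)" "sol T e (AU U') (F' b)"
   using sol_subset[OF C(1)] sol_subset[OF F] sol_subset[OF F'] ab sub by blast+
  have "cls T (%z. minv (F' a z) * F' b z) = Lambda_res q (V' (\<tau>' a) Int V' (\<tau>' b)) T (g' (\<tau>' a) (\<tau>' b))"
   unfolding f'(3)[OF IJ(3,4)] F'_def
   by (rule Lambda_res_cls[symmetric, OF openin_Int_cover[OF cov(2) IJ(3,4)] opT IJ(6)])
  also have "... = inv\<^bsub>\<Lambda> T\<^esub> (Lambda_res q (W a) T (c a)) \<otimes>\<^bsub>\<Lambda> T\<^esub> Lambda_res q (V (\<tau> a) Int V (\<tau> b)) T (g (\<tau> a) (\<tau> b))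
     \<otimes>\<^bsub>\<Lambda> T\<^esub> Lambda_res q (W b) T (c b)"
   unfolding T_def by (rule J(3)[OF ab])
  also have "Lambda_res q (V (\<tau> a) Int V (\<tau> b)) T (g (\<tau> a) (\<tau> b)) = cls T (%z. minv (F a z) * F b z)"
   unfolding f(3)[OF IJ(1,2)] F_def by (rule Lambda_res_cls[OF openin_Int_cover[OF cov(1) IJ(1,2)] opT IJ(5)])
  also have "Lambda_res q (W a) T (c a) = cls T (C a)"
   unfolding C(2)[OF ab(1)] by (rule Lambda_res_cls[OF opW[OF ab(1)] opT sub(1)])
  also have "Lambda_res q (W b) T (c b) = cls T (C b)"
   unfolding C(2)[OF ab(2)] by (rule Lambda_res_cls[OF opW[OF ab(2)] opT sub(2)])
  also have "inv\<^bsub>\<Lambda> T\<^esub> cls T (C a) = cls T (%z. minv (C a z))"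
   by (rule Lambda_group(2)[OF opT e(1) s(1)])
  finally have eq: "cls T (%z. minv (F' a z) * F' b z) = cls T (%z. minv (C a z) * (minv (F a z) * F b z) * C b z)"
   by (simp only: Lambda_mult[OF opT])
  obtain S where S: "sector q S" "horizon q S = T"
   "!!z. z \<in> S ==> minv (F' a z) * F' b z = minv (C a z) * (minv (F a z) * F b z) * C b z"
   by (rule cls_eqD[OF opT eq]) blast
  have zT: "z \<in> Pre T" using z by (simp add: T_def)
  have E: "minv (F' a z) * F' b z = minv (C a z) * (minv (F a z) * F b z) * C b z"
   by (rule sol_unique[OF opT sol_quotient[OF s(5,6) fM(2)]
     sol_mult[OF sol_mult[OF sol_minv[OF s(1)] sol_quotient[OF s(3,4) fM(1)] form_A0] s(2) form_A0] form_A0 S zT z(3)])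
  note car = sol_carrier[OF s(1) zT z(3)] sol_carrier[OF s(2) zT z(3)] sol_carrier[OF s(3) zT z(3)]
   sol_carrier[OF s(4) zT z(3)] sol_carrier[OF s(5) zT z(3)] sol_carrier[OF s(6) zT z(3)]
  note ia = frakG_minv[OF solD(1)[OF s(1) zT z(3)]] and ib = frakG_minv[OF solD(1)[OF s(2) zT z(3)]]
   and ic = frakG_minv[OF solD(1)[OF s(3) zT z(3)]] and id = frakG_minv[OF solD(1)[OF s(4) zT z(3)]]
   and ie = frakG_minv[OF solD(1)[OF s(5) zT z(3)]]
  have "F' b z = F' a z * (minv (F' a z) * F' b z)"
   by (rule cancel_inverses[symmetric]) (use car ie in auto)
  also have "... = F' a z * (minv (C a z) * (minv (F a z) * (F b z * C b z)))"
   unfolding E using car ia(1) ic(1) by (simp add: mat_simps)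
  finally have "G b z = F' a z * (minv (C a z) * (minv (F a z) * (F b z * C b z))) * minv (C b z) * minv (F b z)"
   by (simp add: G_def H_def)
  also have "... = F' a z * (minv (C a z) * (minv (F a z) * (F b z * (C b z * (minv (C b z) * minv (F b z))))))"
   using car ia(1) ib(1) ic(1) id(1) by (simp add: mat_simps)
  also have "C b z * (minv (C b z) * minv (F b z)) = minv (F b z)"
   by (rule cancel_inverses) (use car ib id in auto)
  also have "F' a z * (minv (C a z) * (minv (F a z) * (F b z * minv (F b z)))) = G a z"
   using car ia(1) ic(1) id(2) by (simp add: G_def H_def mat_simps)
  finally show ?thesis by simp
 qed
 define idx where "idx z = (SOME a. a \<in> J & z \<in> Pre (W a))" for z
 have idx: "idx z \<in> J & z \<in> Pre (W (idx z))" if "z ~= 0" for z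
 proof -
  have "Eq_proj q z \<in> topspace (Eq_top q)" using that by (simp add: topspace_Eq_top carrier_Eq)
  then obtain a where "a \<in> J" "Eq_proj q z \<in> W a" using J(1) by (auto simp: open_covering_def)
  then have "\<exists>a. a \<in> J & z \<in> Pre (W a)" using that by (auto simp: Pre_def)
  then show ?thesis unfolding idx_def by (rule someI_ex)
 qed
 define GG where "GG z = G (idx z) z" for z
 have GG: "GG z = G a z" if "a \<in> J" "z \<in> Pre (W a)" "norm z < e" for a z
 proof -
  have z: "z ~= 0" using that by (auto simp: Pre_def)
  show ?thesis unfolding GG_def by (rule glue) (use idx[OF z] that in auto)
 qed
 have "iso_fun e (AU U) (AU U') GG"
  unfolding iso_fun_def
 proof (intro conjI ballI allI impI)
  show "GG z \<in> frakG k r" if "z \<in> annulus 0 e" for z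
   using idx[of z] Gfrak that by (auto simp: GG_def)
  have "annulus 0 e = (\<Union>a\<in>J. Pre (W a) Int ball 0 e)"
   using idx by (auto simp: Pre_def)
  moreover have "hol_mat (\<Union>a\<in>J. Pre (W a) Int ball 0 e) GG"
  proof (rule hol_mat_UN)
   fix a assume a: "a \<in> J"
   show "open (Pre (W a) Int ball 0 e)" using opW[OF a] by (auto simp: openin_Eq_iff)
   have "hol_mat (Pre (W a) Int ball 0 e) (%z. H a z * minv (F a z))"
    by (intro hol_mat_mult hol_mat_minv solD(2)[OF H[OF a]] solD(2)[OF F[OF a]])
     (use solD(1)[OF F[OF a]] frakG_minv(1) sol_carrier[OF H[OF a]] in auto)
   then show "hol_mat (Pre (W a) Int ball 0 e) GG"
    by (rule hol_mat_cong) (use GG[OF a] in \<open>auto simp: G_def\<close>)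
  qed
  ultimately show "hol_mat (annulus 0 e) GG" by simp
  fix z assume z: "z ~= 0" "norm (q * z) < e"
  have z': "norm z < e" using norm_le_mult_q[of z] z by linarith
  define a where "a = idx z"
  have a: "a \<in> J" "z \<in> Pre (W a)" using idx[OF z(1)] by (auto simp: a_def)
  show "GG (q * z) * AU U z = AU U' z * GG z"
   using sol_sol_step[OF H[OF a(1)] F[OF a(1)] fM a(2) z(2)] GG[OF a z'] GG[of a "q * z"] a z by (simp add: G_def)
 qed
 then show ?thesis unfolding iso_families_def using rad by blast
qed

text \<open>The index set of a common refinement is a product of index sets, which has to be coded inside the index type.\<close>

definition pair_div :: "sum_div \<times> sum_div => sum_div" where
 "pair_div = (%(D, D') i j. if even i then D (i div 2) j else D' (i div 2) j)"

lemma inj_pair_div: "inj pair_div"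
proof (rule injI, clarify)
 fix D1 D2 E1 E2 assume eq: "pair_div (D1, D2) = pair_div (E1, E2)"
 have "D1 i j = E1 i j" "D2 i j = E2 i j" for i j
  using fun_cong[OF fun_cong[OF eq, of "2 * i"], of j] fun_cong[OF fun_cong[OF eq, of "Suc (2 * i)"], of j]
  by (simp_all add: pair_div_def)
 then show "D1 = E1 & D2 = E2" by (auto simp: fun_eq_iff)
qed

text \<open>On the common refinement by intersections, the transformation \<open>G\<close> compares the trivialisations of both cocycles.\<close>

lemma iso_imp_cohomologous:
 assumes t: "trivialised d U" "trivialised d' U'" and iso: "iso_families U U'"
  and coc: "d \<in> cocycles" "d' \<in> cocycles"
 shows "(d, d') \<in> cohomologous"
proof -
 obtain I V g where d: "d = (I, V, g)" by (cases d)
 obtain I' V' g' where d': "d' = (I', V', g')" by (cases d')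
 have cov: "open_covering (Eq_top q) I V" "open_covering (Eq_top q) I' V'"
  using coc unfolding d d' cech_cocycles_def by blast+
 obtain e1 f where f: "radius U e1" "!!a. a \<in> I ==> sol (V a) e1 (AU U) (f a)"
  "!!a b. a \<in> I ==> b \<in> I ==> g a b = cls (V a Int V b) (%z. minv (f a z) * f b z)"
  using t(1) unfolding d trivialised_def prod.case by blast
 obtain e2 f' where f': "radius U' e2" "!!a. a \<in> I' ==> sol (V' a) e2 (AU U') (f' a)"
  "!!a b. a \<in> I' ==> b \<in> I' ==> g' a b = cls (V' a Int V' b) (%z. minv (f' a z) * f' b z)"
  using t(2) unfolding d' trivialised_def prod.case by blast
 obtain e3 G where G: "radius U e3" "iso_fun e3 (AU U) (AU U') G" using iso unfolding iso_families_def by blast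
 define e where "e = min (min e1 e2) e3"
 have e: "0 < e" "e <= e1" "e <= e2" "e <= e3"
  using radius_pos[OF f(1)] radius_pos[OF f'(1)] radius_pos[OF G(1)] by (auto simp: e_def)
 have rad: "radius U e" "radius U' e" using radius_subset f(1) f'(1) e by blast+
 note fM = form_AU[OF rad(1)] form_AU[OF rad(2)]
 note Ge = iso_fun_subset[OF G(2) e(4)]
 note Gi = iso_fun_minv[OF Ge fM]
 define J where "J = pair_div ` (I \<times> I')"
 define \<tau> where "\<tau> x = fst (inv_into UNIV pair_div x)" for x
 define \<tau>' where "\<tau>' x = snd (inv_into UNIV pair_div x)" for x
 define W where "W x = V (\<tau> x) Int V' (\<tau>' x)" for x
 define C where "C x z = minv (f (\<tau> x) z) * (minv (G z) * f' (\<tau>' x) z)" for x z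
 define c where "c x = cls (W x) (C x)" for x
 have \<tau>: "\<tau> (pair_div (a, b)) = a" "\<tau>' (pair_div (a, b)) = b" for a b
  by (simp_all add: \<tau>_def \<tau>'_def inv_f_f[OF inj_pair_div])
 have JI: "\<tau> x \<in> I" "\<tau>' x \<in> I'" if "x \<in> J" for x using that by (auto simp: J_def \<tau>)
 have opW: "openin (Eq_top q) (W x)" if "x \<in> J" for x
  unfolding W_def using cov JI[OF that] by (auto simp: open_covering_def)
 have Fs: "sol T e (AU U) (f (\<tau> x))" if "x \<in> J" "T \<subseteq> W x" for x T
  by (rule sol_subset[OF f(2)]) (use JI that e in \<open>auto simp: W_def\<close>)
 have Fs': "sol T e (AU U') (f' (\<tau>' x))" if "x \<in> J" "T \<subseteq> W x" for x T
  by (rule sol_subset[OF f'(2)]) (use JI that e in \<open>auto simp: W_def\<close>)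
 have Cs: "sol T e A0 (C x)" if "x \<in> J" "T \<subseteq> W x" for x T
  unfolding C_def[abs_def]
  by (rule sol_quotient[OF Fs[OF that] sol_iso[OF Gi Fs'[OF that] fM(2,1)] fM(1)])
 have "open_covering (Eq_top q) J W"
  unfolding open_covering_def
 proof (intro conjI ballI)
  have "(\<Union>x\<in>J. W x) = (\<Union>a\<in>I. V a) Int (\<Union>b\<in>I'. V' b)" by (auto simp: J_def W_def \<tau>)
  then show "(\<Union>x\<in>J. W x) = topspace (Eq_top q)" using cov by (simp add: open_covering_def)
 qed (rule opW)
 moreover have "\<tau> x \<in> I & W x \<subseteq> V (\<tau> x) & \<tau>' x \<in> I' & W x \<subseteq> V' (\<tau>' x) & c x \<in> carrier (\<Lambda> (W x))" if x: "x \<in> J" for x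
  using JI[OF x] Lambda_carrier[OF opW[OF x] e(1)] Cs[OF x order_refl] by (auto simp: W_def c_def)
 moreover have "Lambda_res q (V' (\<tau>' x) Int V' (\<tau>' y)) T (g' (\<tau>' x) (\<tau>' y)) =
    inv\<^bsub>\<Lambda> T\<^esub> (Lambda_res q (W x) T (c x)) \<otimes>\<^bsub>\<Lambda> T\<^esub> Lambda_res q (V (\<tau> x) Int V (\<tau> y)) T (g (\<tau> x) (\<tau> y))
     \<otimes>\<^bsub>\<Lambda> T\<^esub> Lambda_res q (W y) T (c y)"
  if xy: "x \<in> J" "y \<in> J" and T: "T = W x Int W y" for x y T
 proof -
  have opT: "openin (Eq_top q) T" unfolding T using opW xy by auto
  have sub: "T \<subseteq> W x" "T \<subseteq> W y" "T \<subseteq> V (\<tau> x) Int V (\<tau> y)" "T \<subseteq> V' (\<tau>' x) Int V' (\<tau>' y)" by (auto simp: T W_def)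
  note sC = Cs[OF xy(1) sub(1)] Cs[OF xy(2) sub(2)] and sF = Fs[OF xy(1) sub(1)] Fs[OF xy(2) sub(2)]
   and sF' = Fs'[OF xy(1) sub(1)] Fs'[OF xy(2) sub(2)]
  have 1: "Lambda_res q (V' (\<tau>' x) Int V' (\<tau>' y)) T (g' (\<tau>' x) (\<tau>' y)) = cls T (%z. minv (f' (\<tau>' x) z) * f' (\<tau>' y) z)"
   unfolding f'(3)[OF JI(2)[OF xy(1)] JI(2)[OF xy(2)]]
   by (rule Lambda_res_cls[OF openin_Int_cover[OF cov(2)] opT sub(4)]) (rule JI xy)+
  have 2: "Lambda_res q (V (\<tau> x) Int V (\<tau> y)) T (g (\<tau> x) (\<tau> y)) = cls T (%z. minv (f (\<tau> x) z) * f (\<tau> y) z)"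
   unfolding f(3)[OF JI(1)[OF xy(1)] JI(1)[OF xy(2)]]
   by (rule Lambda_res_cls[OF openin_Int_cover[OF cov(1)] opT sub(3)]) (rule JI xy)+
  have 3: "Lambda_res q (W x) T (c x) = cls T (C x)" "Lambda_res q (W y) T (c y) = cls T (C y)"
   unfolding c_def using Lambda_res_cls[OF opW opT] xy sub by blast+
  have 4: "inv\<^bsub>\<Lambda> T\<^esub> cls T (C x) = cls T (%z. minv (C x z))"
   by (rule Lambda_group(2)[OF opT e(1) sC(1)])
  show ?thesis unfolding 1 2 3 4 Lambda_mult[OF opT]
  proof (rule cls_sol_cong[OF opT e(1)])
   fix z assume z: "z \<in> Pre T" "norm z < e"
   have z0: "z ~= 0" using z by (auto simp: Pre_def)
   note car = sol_carrier[OF sF(1) z] sol_carrier[OF sF(2) z] sol_carrier[OF sF'(1) z] sol_carrier[OF sF'(2) z]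
    iso_fun_carrier[OF Ge z0 z(2)] sol_carrier[OF sC(1) z]
   note iF = frakG_minv[OF solD(1)[OF sF(1) z]] and iF2 = frakG_minv[OF solD(1)[OF sF(2) z]] and iF' = frakG_minv[OF solD(1)[OF sF'(1) z]]
    and iG = frakG_minv[OF iso_funD(1)[OF Ge z0 z(2)]] and iC = frakG_minv[OF solD(1)[OF sC(1) z]]
   let ?P = "minv (f' (\<tau>' x) z) * (G z * f (\<tau> x) z)"
   have "C x z * ?P = minv (f (\<tau> x) z) * (minv (G z) * (f' (\<tau>' x) z * (minv (f' (\<tau>' x) z) * (G z * f (\<tau> x) z))))"
    unfolding C_def using car iF(1) iF'(1) iG(1) by (simp add: mat_simps)
   also have "f' (\<tau>' x) z * (minv (f' (\<tau>' x) z) * (G z * f (\<tau> x) z)) = G z * f (\<tau> x) z"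
    by (rule cancel_inverses) (use car iF' in \<open>auto intro!: mult_carrier_mat[of _ n n]\<close>)
   also have "minv (G z) * (G z * f (\<tau> x) z) = f (\<tau> x) z"
    by (rule cancel_inverses) (use car iG in auto)
   also have "minv (f (\<tau> x) z) * f (\<tau> x) z = 1\<^sub>m n" by (rule iF(3))
   finally have inv: "minv (C x z) = ?P"
    using inverse_mat_unique[OF car(6) _ iC(1) _ iC(3), of ?P] car iF'(1) by (auto intro!: mult_carrier_mat[of _ n n])
   have "minv (C x z) * (minv (f (\<tau> x) z) * f (\<tau> y) z) * C y z =
     minv (f' (\<tau>' x) z) * (G z * (f (\<tau> x) z * (minv (f (\<tau> x) z) * (f (\<tau> y) z * (minv (f (\<tau> y) z) * (minv (G z) * f' (\<tau>' y) z))))))"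
    unfolding inv unfolding C_def using car iF(1) iF2(1) iF'(1) iG(1) by (simp add: mat_simps)
   also have "f (\<tau> y) z * (minv (f (\<tau> y) z) * (minv (G z) * f' (\<tau>' y) z)) = minv (G z) * f' (\<tau>' y) z"
    by (rule cancel_inverses) (use car iF2 iG(1) in \<open>auto intro!: mult_carrier_mat[of _ n n]\<close>)
   also have "f (\<tau> x) z * (minv (f (\<tau> x) z) * (minv (G z) * f' (\<tau>' y) z)) = minv (G z) * f' (\<tau>' y) z"
    by (rule cancel_inverses) (use car iF iG(1) in \<open>auto intro!: mult_carrier_mat[of _ n n]\<close>)
   also have "G z * (minv (G z) * f' (\<tau>' y) z) = f' (\<tau>' y) z"
    by (rule cancel_inverses) (use car iG in auto)
   finally show "minv (f' (\<tau>' x) z) * f' (\<tau>' y) z = minv (C x z) * (minv (f (\<tau> x) z) * f (\<tau> y) z) * C y z" by simp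
  qed
 qed
 ultimately have "\<exists>(J :: sum_div set) W \<tau> \<tau>' c. open_covering (Eq_top q) J W &
  (\<forall>a\<in>J. \<tau> a \<in> I & W a \<subseteq> V (\<tau> a) & \<tau>' a \<in> I' & W a \<subseteq> V' (\<tau>' a) & c a \<in> carrier (\<Lambda> (W a))) &
  (\<forall>a\<in>J. \<forall>b\<in>J. Lambda_res q (V' (\<tau>' a) Int V' (\<tau>' b)) (W a Int W b) (g' (\<tau>' a) (\<tau>' b)) =
    inv\<^bsub>\<Lambda> (W a Int W b)\<^esub> (Lambda_res q (W a) (W a Int W b) (c a)) \<otimes>\<^bsub>\<Lambda> (W a Int W b)\<^esub> Lambda_res q (V (\<tau> a) Int V (\<tau> b)) (W a Int W b) (g (\<tau> a) (\<tau> b))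
     \<otimes>\<^bsub>\<Lambda> (W a Int W b)\<^esub> Lambda_res q (W b) (W a Int W b) (c b))"
  by (intro exI[of _ J] exI[of _ W] exI[of _ \<tau>] exI[of _ \<tau>'] exI[of _ c] conjI ballI) (simp_all only:)
 then show ?thesis
  using coc unfolding d d' cech_rel_def Let_def by simp
qed

end

section \<open>Analytic isoformal classes\<close>

definition moderate :: "(complex => complex) => bool" where
 "moderate f \<longleftrightarrow> (\<exists>N B \<delta>. 0 < \<delta> & 0 <= B & (\<forall>z. z ~= 0 --> norm z < \<delta> --> norm (f z) * norm z ^ N <= B))"

lemma moderateE:
 assumes "moderate f"
 obtains N B \<delta> where "0 < \<delta>" "0 <= B" "!!z. z ~= 0 ==> norm z < \<delta> ==> norm (f z) * norm z ^ N <= B"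
 using assms unfolding moderate_def by blast

lemma moderate_higher_power:
 fixes z :: complex
 assumes "c * norm z ^ N <= B" "norm z <= 1" "N <= M" "0 <= c"
 shows "c * norm z ^ M <= B"
proof -
 have "c * norm z ^ M <= c * norm z ^ N" using assms by (intro mult_left_mono power_decreasing) auto
 then show ?thesis using assms(1) by linarith
qed

lemma moderate_add:
 assumes "moderate f" "moderate g"
 shows "moderate (%z. f z + g z)"
proof -
 obtain N B \<delta> where f: "0 < \<delta>" "0 <= B" "!!z. z ~= 0 ==> norm z < \<delta> ==> norm (f z) * norm z ^ N <= B"
  using assms(1) by (rule moderateE) blast
 obtain N' B' \<delta>' where g: "0 < \<delta>'" "0 <= B'" "!!z. z ~= 0 ==> norm z < \<delta>' ==> norm (g z) * norm z ^ N' <= B'"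
  using assms(2) by (rule moderateE) blast
 have "norm (f z + g z) * norm z ^ max N N' <= B + B'" if z: "z ~= 0" "norm z < min 1 (min \<delta> \<delta>')" for z
 proof -
  have "norm (f z) * norm z ^ max N N' <= B" "norm (g z) * norm z ^ max N N' <= B'"
   using z by (intro moderate_higher_power[OF f(3)] moderate_higher_power[OF g(3)]; simp)+
  moreover have "norm (f z + g z) * norm z ^ max N N' <= (norm (f z) + norm (g z)) * norm z ^ max N N'"
   by (intro mult_right_mono norm_triangle_ineq) auto
  ultimately show ?thesis by (simp add: distrib_right)
 qed
 then show ?thesis unfolding moderate_def using f g
  by (intro exI[of _ "max N N'"] exI[of _ "B + B'"] exI[of _ "min 1 (min \<delta> \<delta>')"]) auto
qed

lemma moderate_mult:
 assumes "moderate f" "moderate g"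
 shows "moderate (%z. f z * g z)"
proof -
 obtain N B \<delta> where f: "0 < \<delta>" "0 <= B" "!!z. z ~= 0 ==> norm z < \<delta> ==> norm (f z) * norm z ^ N <= B"
  using assms(1) by (rule moderateE) blast
 obtain N' B' \<delta>' where g: "0 < \<delta>'" "0 <= B'" "!!z. z ~= 0 ==> norm z < \<delta>' ==> norm (g z) * norm z ^ N' <= B'"
  using assms(2) by (rule moderateE) blast
 have "norm (f z * g z) * norm z ^ (N + N') <= B * B'" if z: "z ~= 0" "norm z < min \<delta> \<delta>'" for z
 proof -
  have "norm (f z * g z) * norm z ^ (N + N') = (norm (f z) * norm z ^ N) * (norm (g z) * norm z ^ N')"
   by (simp add: norm_mult power_add)
  also have "... <= B * B'" using z f(2) by (intro mult_mono f(3) g(3)) auto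
  finally show ?thesis .
 qed
 then show ?thesis unfolding moderate_def using f g
  by (intro exI[of _ "N + N'"] exI[of _ "B * B'"] exI[of _ "min \<delta> \<delta>'"]) auto
qed

lemma moderate_const: "moderate (%z. c)"
 unfolding moderate_def by (intro exI[of _ 0] exI[of _ "norm c"] exI[of _ 1]) auto

lemma moderate_sum: "(!!i. i \<in> I ==> moderate (f i)) ==> moderate (%z. \<Sum>i\<in>I. f i z)"
 by (induction I rule: infinite_finite_induct) (auto intro: moderate_add moderate_const)

lemma moderate_uminus: "moderate f ==> moderate (%z. - f z)"
 by (simp add: moderate_def)

lemma moderate_scale:
 assumes "moderate f" "c ~= 0"
 shows "moderate (%z. f (c * z))"
proof -
 obtain N B \<delta> where f: "0 < \<delta>" "0 <= B" "!!z. z ~= 0 ==> norm z < \<delta> ==> norm (f z) * norm z ^ N <= B"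
  using assms(1) by (rule moderateE) blast
 have "norm (f (c * z)) * norm z ^ N <= B / norm c ^ N" if z: "z ~= 0" "norm z < \<delta> / norm c" for z
  using f(3)[of "c * z"] z assms(2) by (simp add: norm_mult power_mult_distrib field_simps)
 then show ?thesis unfolding moderate_def using f assms(2)
  by (intro exI[of _ N] exI[of _ "B / norm c ^ N"] exI[of _ "\<delta> / norm c"]) auto
qed

lemma moderate_powi: "moderate (%z. z powi m)"
 unfolding moderate_def
proof (intro exI[of _ "nat \<bar>m\<bar>"] exI[of _ 1] conjI allI impI)
 fix z :: complex assume z: "z ~= 0" "norm z < 1"
 have "norm (z powi m) * norm z ^ nat \<bar>m\<bar> = norm z powi (m + \<bar>m\<bar>)"
  using z by (simp add: norm_power_int power_int_add) (simp add: power_int_def)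
 also have "... <= norm z powi 0" using z by (intro power_int_decreasing) auto
 finally show "norm (z powi m) * norm z ^ nat \<bar>m\<bar> <= 1" by simp
qed auto

lemma moderate_eval_fls:
 assumes "fls_conv_radius F > 0"
 shows "moderate (eval_fls F)"
proof -
 define b where "b = fls_base_factor_to_fps F"
 have "fps_conv_radius b > 0" using assms by (simp add: b_def fls_conv_radius_altdef)
 then have "isCont (eval_fps b) 0"
  by (intro continuous_eval_fps) (auto simp: zero_ereal_def)
 then have "\<forall>e>0. \<exists>\<delta>>0. \<forall>z. dist z 0 < \<delta> --> dist (eval_fps b z) (eval_fps b 0) < e"
  unfolding continuous_at_eps_delta .
 from this[rule_format, of 1]
 obtain \<delta> where \<delta>: "\<delta> > 0" "!!z. norm z < \<delta> ==> dist (eval_fps b z) (eval_fps b 0) < 1" by auto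
 have "norm (eval_fps b z) <= norm (eval_fps b 0) + 1" if "norm z < \<delta>" for z
  using \<delta>(2)[OF that] norm_triangle_ineq2[of "eval_fps b z" "eval_fps b 0"] by (simp add: dist_norm)
 then have "moderate (eval_fps b)"
  unfolding moderate_def using \<delta>(1) by (intro exI[of _ 0] exI[of _ "norm (eval_fps b 0) + 1"] exI[of _ \<delta>]) auto
 then have "moderate (%z. eval_fps b z * z powi fls_subdegree F)" by (intro moderate_mult moderate_powi)
 then show ?thesis by (simp add: eval_fls_def[abs_def] b_def)
qed

lemma moderate_imp_fls:
 assumes "moderate f" and hol: "f holomorphic_on annulus 0 eps" and eps: "0 < eps"
 shows "\<exists>F. fls_conv_radius F >= ereal eps & (\<forall>z \<in> annulus 0 eps. eval_fls F z = f z)"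
proof -
 obtain N B \<delta> where f: "0 < \<delta>" "0 <= B" "!!z. z ~= 0 ==> norm z < \<delta> ==> norm (f z) * norm z ^ N <= B"
  using assms(1) by (rule moderateE) blast
 define g where "g z = f z * z ^ Suc N" for z
 have e: "ball 0 eps - {0} = annulus 0 eps" by auto
 have e': "eball 0 (ereal eps) - {0 :: complex} = annulus 0 eps" by auto
 have iso: "isolated_singularity_at f 0"
  by (rule isolated_singularity_at_holomorphic[of _ "ball 0 eps"]) (use hol eps e in auto)
 have "g \<midarrow>0\<rightarrow> 0"
 proof (rule Lim_null_comparison)
  show "eventually (%z. norm (g z) <= B * norm z) (at 0)"
   unfolding eventually_at
  proof (intro exI[of _ \<delta>] conjI ballI impI)
   fix z :: complex assume "z ~= 0 & dist z 0 < \<delta>"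
   then have "norm (f z) * norm z ^ N * norm z <= B * norm z" by (intro mult_right_mono f(3)) auto
   then show "norm (g z) <= B * norm z" by (simp add: g_def norm_mult norm_power mult_ac)
  qed (rule f(1))
  show "(%z. B * norm z) \<midarrow>0\<rightarrow> 0" by (auto intro!: tendsto_eq_intros)
 qed
 then have ness: "not_essential g 0" by (auto simp: not_essential_def)
 have iso': "isolated_singularity_at g 0"
 proof (rule isolated_singularity_at_holomorphic)
  show "g holomorphic_on ball 0 eps - {0}"
   unfolding g_def e by (intro holomorphic_on_mult hol holomorphic_on_power holomorphic_on_ident)
 qed (use eps in auto)
 have "not_essential (%z. g z / z ^ Suc N) 0"
 proof (rule not_essential_divide[OF ness _ iso'])
  show "not_essential (%z::complex. z ^ Suc N) 0"
   by (rule not_essential_holomorphic[where A = UNIV]) (auto intro!: holomorphic_intros)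
  show "isolated_singularity_at (%z::complex. z ^ Suc N) 0"
   by (rule isolated_singularity_at_holomorphic[of _ UNIV]) (auto intro!: holomorphic_intros)
 qed
 moreover have "eventually (%z. g z / z ^ Suc N = f z) (at 0)"
  unfolding eventually_at by (intro exI[of _ 1]) (auto simp: g_def)
 ultimately have "not_essential f 0" using not_essential_cong[of "%z. g z / z ^ Suc N" f 0 0] by simp
 then have L: "f has_laurent_expansion laurent_expansion f 0"
  by (rule not_essential_has_laurent_expansion_0[OF iso])
 show ?thesis
  using fls_conv_radius_ge[OF L, of "ereal eps"] eval_fls_eqI[OF L, of "ereal eps"] hol unfolding e'
  by (intro exI[of _ "laurent_expansion f 0"]) auto
qed

lemma annulus_subset_eball:
 assumes "ereal R <= C"
 shows "annulus 0 R \<subseteq> eball 0 C - {0 :: complex}"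
proof
 fix x :: complex assume "x \<in> annulus 0 R"
 then have x: "x ~= 0" "ereal (norm x) < ereal R" by auto
 then have "ereal (norm x) < C" using assms less_le_trans by blast
 then show "x \<in> eball 0 C - {0}" using x by (simp add: in_eball_iff)
qed

context q_base
begin

lemma sigma_fls_eval:
 assumes R: "fls_conv_radius f >= ereal R" "0 < R"
 shows "fls_conv_radius (sigma_fls q f) >= ereal (R / norm q)"
  "!!z. z ~= 0 ==> norm (q * z) < R ==> eval_fls (sigma_fls q f) z = eval_fls f (q * z)"
proof -
 have "fls_conv_radius f > 0" using R by (metis ereal_less(2) less_le_trans)
 then have "eval_fls f has_laurent_expansion f" by (rule eval_fls_has_laurent_expansion)
 moreover have "(%z. q * z) has_laurent_expansion fps_to_fls (fps_const q * fps_X)"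
  by (intro has_laurent_expansion_fps fps_expansion_intros)
 ultimately have "(eval_fls f \<circ> (%z. q * z)) has_laurent_expansion fls_compose_fps f (fps_const q * fps_X)"
  by (rule has_laurent_expansion_compose) auto
 then have L: "(%z. eval_fls f (q * z)) has_laurent_expansion sigma_fls q f" by (simp add: sigma_fls_def o_def)
 have e': "eball 0 (ereal (R / norm q)) - {0 :: complex} = annulus 0 (R / norm q)" by auto
 have hol: "(%z. eval_fls f (q * z)) holomorphic_on eball 0 (ereal (R / norm q)) - {0}"
 proof -
  have "eval_fls f holomorphic_on annulus 0 R"
  proof (rule holomorphic_on_subset[OF holomorphic_on_eval_fls])
   show "annulus 0 R \<subseteq> eball 0 (fls_conv_radius f) - {0}"
    by (rule annulus_subset_eball[OF R(1)])
  qed auto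
  then show ?thesis unfolding e'
   by (rule holomorphic_on_compose_gen[of "%z. q * z" _ "eval_fls f", unfolded o_def, rotated])
    (auto intro!: holomorphic_intros simp: norm_mult field_simps)
 qed
 show "fls_conv_radius (sigma_fls q f) >= ereal (R / norm q)" by (rule fls_conv_radius_ge[OF L hol])
 show "eval_fls (sigma_fls q f) z = eval_fls f (q * z)" if "z ~= 0" "norm (q * z) < R" for z
  by (rule eval_fls_eqI[OF L hol]) (use that in \<open>auto simp: norm_mult field_simps in_eball_iff\<close>)
qed

end

lemma eval_fls_sum:
 assumes "!!i. i \<in> I ==> ereal R <= fls_conv_radius (f i)"
 shows "ereal R <= fls_conv_radius (\<Sum>i\<in>I. f i)"
  "z ~= 0 ==> norm z < R ==> eval_fls (\<Sum>i\<in>I. f i) z = (\<Sum>i\<in>I. eval_fls (f i) z)"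
proof -
 have "ereal R <= fls_conv_radius (\<Sum>i\<in>I. f i) &
  (z ~= 0 --> norm z < R --> eval_fls (\<Sum>i\<in>I. f i) z = (\<Sum>i\<in>I. eval_fls (f i) z))"
  using assms
 proof (induction I rule: infinite_finite_induct)
  case (insert i I)
  then have IH: "ereal R <= fls_conv_radius (f i)" "ereal R <= fls_conv_radius (\<Sum>i\<in>I. f i)"
   "z ~= 0 --> norm z < R --> eval_fls (\<Sum>i\<in>I. f i) z = (\<Sum>i\<in>I. eval_fls (f i) z)" by auto
  then have "eval_fls (f i + (\<Sum>i\<in>I. f i)) z = eval_fls (f i) z + eval_fls (\<Sum>i\<in>I. f i) z" if "z ~= 0" "norm z < R"
   using that by (intro eval_fls_add) (auto intro: less_le_trans[of "ereal (norm z)" "ereal R"])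
  then show ?case using insert.hyps IH by (auto intro: fls_conv_radius_add_ge)
 qed auto
 then show "ereal R <= fls_conv_radius (\<Sum>i\<in>I. f i)"
  "z ~= 0 ==> norm z < R ==> eval_fls (\<Sum>i\<in>I. f i) z = (\<Sum>i\<in>I. eval_fls (f i) z)" by auto
qed

lemma fls_eqI_eval:
 assumes "0 < R" "ereal R <= fls_conv_radius f" "ereal R <= fls_conv_radius g"
  "!!z. z ~= 0 ==> norm z < R ==> eval_fls f z = eval_fls g z"
 shows "f = g"
proof (rule has_laurent_expansion_unique)
 have pos: "fls_conv_radius f > 0" "fls_conv_radius g > 0" using assms(1-3) by (auto intro: less_le_trans[of 0 "ereal R"])
 show "eval_fls f has_laurent_expansion f" by (rule eval_fls_has_laurent_expansion[OF pos(1)])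
 have "eventually (%z. eval_fls g z = eval_fls f z) (at 0)"
  unfolding eventually_at using assms by (intro exI[of _ R]) auto
 then show "eval_fls f has_laurent_expansion g"
  using pos by (simp add: has_laurent_expansion_def)
qed

context qdiff
begin

definition mat_radius :: "complex fls mat => real => bool" where
 "mat_radius M R \<longleftrightarrow> (\<forall>a<n. \<forall>b<n. ereal R <= fls_conv_radius (M $$ (a, b)))"

lemma mat_radius_subset: "mat_radius M R ==> R' <= R ==> mat_radius M R'"
 unfolding mat_radius_def by (meson ereal_less_eq(3) order_trans)

lemma mat_radius_exists:
 assumes "!!a b. a < n ==> b < n ==> fls_conv_radius (M $$ (a, b)) > 0"
 shows "\<exists>R>0. mat_radius M R"
proof -
 define R where "R = Min (insert 1 ((%(a, b). fls_conv_radius (M $$ (a, b))) ` ({..<n} \<times> {..<n})))"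
 have "R > 0" unfolding R_def using assms by (subst Min_gr_iff) auto
 then obtain \<rho> where \<rho>: "0 < ereal \<rho>" "ereal \<rho> < R" using ereal_dense2 by blast
 have "R <= fls_conv_radius (M $$ (a, b))" if "a < n" "b < n" for a b
  unfolding R_def using that by (intro Min_le) auto
 then have "mat_radius M \<rho>" using \<rho> unfolding mat_radius_def by (auto intro: order.trans[OF less_imp_le])
 then show ?thesis using \<rho> by auto
qed

lemma mat_fun_mult:
 assumes M: "M \<in> carrier_mat n n" "mat_radius M R" and N: "N \<in> carrier_mat n n" "mat_radius N R"
 shows "mat_radius (M * N) R"
  "z ~= 0 ==> norm z < R ==> mat_fun (M * N) z = mat_fun M z * mat_fun N z"
proof -
 have rad: "ereal R <= fls_conv_radius (M $$ (a, c) * N $$ (c, b))" if "a < n" "b < n" "c < n" for a b c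
  using M(2) N(2) that by (auto simp: mat_radius_def intro: fls_conv_radius_mult_ge)
 show "mat_radius (M * N) R"
  unfolding mat_radius_def using rad by (auto simp: mult_entry[OF M(1) N(1)] intro!: eval_fls_sum(1))
 assume z: "z ~= 0" "norm z < R"
 have car: "mat_fun M z \<in> carrier_mat n n" "mat_fun N z \<in> carrier_mat n n" using M N by (auto simp: mat_fun_def)
 show "mat_fun (M * N) z = mat_fun M z * mat_fun N z"
 proof (rule eq_matI)
  fix a b assume "a < dim_row (mat_fun M z * mat_fun N z)" "b < dim_col (mat_fun M z * mat_fun N z)"
  then have ab: "a < n" "b < n" using car by auto
  have "mat_fun (M * N) z $$ (a, b) = eval_fls (\<Sum>c<n. M $$ (a, c) * N $$ (c, b)) z"
   using ab M N by (simp add: mat_fun_def mult_entry[OF M(1) N(1), symmetric])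
  also have "... = (\<Sum>c<n. eval_fls (M $$ (a, c) * N $$ (c, b)) z)"
   by (rule eval_fls_sum(2)[OF _ z]) (use rad ab in auto)
  also have "... = (\<Sum>c<n. mat_fun M z $$ (a, c) * mat_fun N z $$ (c, b))"
  proof (rule sum.cong)
   fix c assume "c \<in> {..<n}"
   then have "ereal R <= fls_conv_radius (M $$ (a, c))" "ereal R <= fls_conv_radius (N $$ (c, b))" "c < n"
    using M(2) N(2) ab by (auto simp: mat_radius_def)
   then show "eval_fls (M $$ (a, c) * N $$ (c, b)) z = mat_fun M z $$ (a, c) * mat_fun N z $$ (c, b)"
    using z ab M(1) N(1) by (subst eval_fls_mult) (auto simp: mat_fun_def intro: less_le_trans[of "ereal (norm z)" "ereal R"])
  qed simp
  finally show "mat_fun (M * N) z $$ (a, b) = (mat_fun M z * mat_fun N z) $$ (a, b)"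
   by (simp add: mult_entry[OF car ab])
 qed (use M N car in \<open>auto simp: mat_fun_def\<close>)
qed

lemma mat_fun_sigma:
 assumes F: "F \<in> carrier_mat n n" "mat_radius F R" "0 < R"
 shows "mat_radius (map_mat (sigma_fls q) F) (R / norm q)"
  "z ~= 0 ==> norm (q * z) < R ==> mat_fun (map_mat (sigma_fls q) F) z = mat_fun F (q * z)"
 using sigma_fls_eval[OF _ F(3)] F by (auto simp: mat_radius_def mat_fun_def intro!: eq_matI)

lemma AM_radius:
 assumes "radius U \<rho>"
 shows "mat_radius (AM U) \<rho>"
 unfolding mat_radius_def
proof (intro allI impI)
 fix a b assume ab: "a < n" "b < n"
 have *: "ereal \<rho> <= fls_conv_radius (fls_X_intpow m * fls_const c)" for m and c :: complex
 proof (rule fls_conv_radius_mult_ge)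
  show "ereal \<rho> <= fls_conv_radius (fls_X_intpow m :: complex fls)"
   by simp
 qed simp
 show "ereal \<rho> <= fls_conv_radius (AM U $$ (a, b))"
  using assms ab *[of "- mu (bl a)" "A (bl a) $$ (loc a, loc b)"] unfolding AM_entry[OF ab] radius_def by auto
qed

lemma isoformal_imp_iso:
 assumes U: "U \<in> families" "U' \<in> families"
  and F: "F \<in> frakG k r" "elements_mat F \<subseteq> conv_field" "AM U' = gauge_fls q F (AM U)"
 shows "iso_families U U'"
proof -
 have Fc: "F \<in> carrier_mat n n" by (rule frakG_carrier[OF F(1)])
 have "fls_conv_radius (F $$ (a, b)) > 0" if "a < n" "b < n" for a b
  using elements_matI[OF Fc that refl] F(2) by (auto simp: conv_field_iff)
 then obtain R where R: "0 < R" "mat_radius F R" using mat_radius_exists by blast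
 obtain \<rho> \<rho>' where \<rho>: "radius U \<rho>" "radius U' \<rho>'" using radius_exists U by meson
 define e where "e = min R (min \<rho> \<rho>')"
 have e: "0 < e" "e <= R" "e <= \<rho>" "e <= \<rho>'" using R radius_pos[OF \<rho>(1)] radius_pos[OF \<rho>(2)] by (auto simp: e_def)
 have rad: "radius U e" "radius U' e" using radius_subset \<rho> e by blast+
 note Fe = mat_radius_subset[OF R(2) e(2)]
 have eq: "AM U' * F = map_mat (sigma_fls q) F * AM U"
 proof -
  have "AM U' * F = map_mat (sigma_fls q) F * AM U * (minv F * F)"
   unfolding F(3) gauge_fls_def using Fc frakG_minv(1)[OF F(1)] AM_carrier[of U]
   by (simp add: assoc_mult_mat[of _ n n _ n _ n] mult_carrier_mat[of _ n n _ n])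
  also have "... = map_mat (sigma_fls q) F * AM U"
   unfolding frakG_minv(3)[OF F(1)] using Fc AM_carrier[of U] by (simp add: right_mult_one_mat[of _ n n] mult_carrier_mat[of _ n n _ n])
  finally show ?thesis .
 qed
 define G where "G z = mat_fun F z" for z
 have Gc: "G z \<in> carrier_mat n n" for z using Fc by (simp add: G_def mat_fun_def)
 have "iso_fun e (AU U) (AU U') G"
  unfolding iso_fun_def
 proof (intro conjI ballI allI impI)
  show "G z \<in> frakG k r" for z
  proof (rule frakG_I[OF Gc])
   fix a b assume "a < n" "b < n" "bl b <= bl a"
   then show "G z $$ (a, b) = (if a = b then 1 else 0)"
    using frakG_entry[OF F(1)] Fc by (auto simp: G_def mat_fun_def)
  qed
  show "hol_mat (annulus 0 e) G" unfolding hol_mat_def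
  proof (intro allI impI)
   fix a b assume ab: "a < n" "b < n"
   have "eval_fls (F $$ (a, b)) holomorphic_on annulus 0 e"
   proof (rule holomorphic_on_subset[OF holomorphic_on_eval_fls])
    show "annulus 0 e \<subseteq> eball 0 (fls_conv_radius (F $$ (a, b))) - {0}"
     by (rule annulus_subset_eball) (use Fe ab in \<open>auto simp: mat_radius_def\<close>)
   qed auto
   then show "(%z. G z $$ (a, b)) holomorphic_on annulus 0 e" using ab Fc by (simp add: G_def mat_fun_def)
  qed
  fix z assume z: "z ~= 0" "norm (q * z) < e"
  have z': "norm z < e / norm q" "norm z < e"
   using z le_less_trans[OF norm_le_mult_q z(2)] q q0 by (auto simp: norm_mult field_simps)
  have eq1: "e / norm q <= e" using q e(1) by (simp add: divide_le_eq mult_le_cancel_left1)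
  have "mat_fun (map_mat (sigma_fls q) F * AM U) z = mat_fun (map_mat (sigma_fls q) F) z * mat_fun (AM U) z"
   by (rule mat_fun_mult(2)[OF _ mat_fun_sigma(1)[OF Fc Fe e(1)] AM_carrier mat_radius_subset[OF AM_radius[OF rad(1)] eq1] z(1) z'(1)])
    (use Fc in auto)
  also have "mat_fun (map_mat (sigma_fls q) F) z = G (q * z)"
   unfolding G_def by (rule mat_fun_sigma(2)[OF Fc Fe e(1) z])
  finally have 1: "G (q * z) * AU U z = mat_fun (AM U' * F) z" by (simp add: AU_def eq)
  show "G (q * z) * AU U z = AU U' z * G z"
   unfolding 1 unfolding AU_def G_def by (rule mat_fun_mult(2)[OF AM_carrier AM_radius[OF rad(2)] Fc Fe z(1) z'(2)])
 qed
 then show ?thesis unfolding iso_families_def using rad by blast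
qed

end

context qdiff
begin

definition rest_right :: "complex mat => complex mat => nat => nat => array" where
 "rest_right X M i j x y =
  (\<Sum>c | c < n & i <= bl c & bl c < j. X $$ (offset r i + x, c) * M $$ (c, offset r j + y))"

definition rest_left :: "complex mat => complex mat => nat => nat => array" where
 "rest_left M X i j x y =
  (\<Sum>c | c < n & i < bl c & bl c <= j. M $$ (offset r i + x, c) * X $$ (c, offset r j + y))"

lemma index_props:
 assumes "1 <= i" "i <= k" "x < r i"
 shows "offset r i + x < n" "bl (offset r i + x) = i" "loc (offset r i + x) = x"
 using assms index_less block_of_offset loc_offset by auto

text \<open>The block itself meets only the diagonal block of the right factor; the other terms involve blocks of smaller gap.\<close>

lemma block_mult_right:
 assumes X: "X \<in> BU" and M: "M \<in> BU" "eqd M (A0 w)"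
  and ij: "1 <= i" "i < j" "j <= k" and xy: "x < r i" "y < r j"
 shows "(X * M) $$ (offset r i + x, offset r j + y) =
  w powi (- mu j) * rm (r j) (blk X i j) (Aa j) x y + rest_right X M i j x y"
proof -
 let ?x = "offset r i + x" and ?y = "offset r j + y"
 have x: "?x < n" "bl ?x = i" and y: "?y < n" "bl ?y = j" using index_props ij xy by auto
 note car = BU_carrier[OF X] BU_carrier[OF M(1)]
 have z: "X $$ (?x, c) * M $$ (c, ?y) = 0" if "c < n" "\<not> (i <= bl c & bl c <= j)" for c
  using X M(1) that x y by (auto simp: BU_def)
 have "(X * M) $$ (?x, ?y) = (\<Sum>c<n. X $$ (?x, c) * M $$ (c, ?y))"
  by (rule mult_entry[OF car x(1) y(1)])
 also have "... = (\<Sum>c\<in>{c. c < n & bl c = j} \<union> {c. c < n & i <= bl c & bl c < j}. X $$ (?x, c) * M $$ (c, ?y))"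
 proof (intro sum.mono_neutral_right ballI)
  fix c assume "c \<in> {..<n} - ({c. c < n & bl c = j} \<union> {c. c < n & i <= bl c & bl c < j})"
  then have "c < n" "\<not> (i <= bl c & bl c <= j)" by auto
  then show "X $$ (?x, c) * M $$ (c, ?y) = 0" by (rule z)
 qed auto
 also have "... = (\<Sum>c\<in>{c. c < n & bl c = j}. X $$ (?x, c) * M $$ (c, ?y)) + rest_right X M i j x y"
  unfolding rest_right_def by (rule sum.union_disjoint) auto
 also have "(\<Sum>c\<in>{c. c < n & bl c = j}. X $$ (?x, c) * M $$ (c, ?y)) =
   (\<Sum>c\<in>{c. c < n & bl c = j}. X $$ (?x, c) * A0 w $$ (c, ?y))"
  using M(2) y by (intro sum.cong) (auto simp: eqd_def)
 also have "... = (\<Sum>c<n. X $$ (?x, c) * A0 w $$ (c, ?y))"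
  using y by (intro sum.mono_neutral_left) (auto simp: A0_def)
 also have "... = (X * A0 w) $$ (?x, ?y)"
  by (rule mult_entry[OF car(1) A0_carrier x(1) y(1), symmetric])
 also have "... = w powi (- mu j) * rm (r j) (blk X i j) (Aa j) x y"
  using mult_A0_right[OF car(1) x(1), of j y w] ij xy by (simp add: rm_def blk_def)
 finally show ?thesis .
qed

lemma block_mult_left:
 assumes X: "X \<in> BU" and M: "M \<in> BU" "eqd M (A0 w)"
  and ij: "1 <= i" "i < j" "j <= k" and xy: "x < r i" "y < r j"
 shows "(M * X) $$ (offset r i + x, offset r j + y) =
  w powi (- mu i) * lm (r i) (Aa i) (blk X i j) x y + rest_left M X i j x y"
proof -
 let ?x = "offset r i + x" and ?y = "offset r j + y"
 have x: "?x < n" "bl ?x = i" and y: "?y < n" "bl ?y = j" using index_props ij xy by auto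
 note car = BU_carrier[OF X] BU_carrier[OF M(1)]
 have z: "M $$ (?x, c) * X $$ (c, ?y) = 0" if "c < n" "\<not> (i <= bl c & bl c <= j)" for c
  using X M(1) that x y by (auto simp: BU_def)
 have "(M * X) $$ (?x, ?y) = (\<Sum>c<n. M $$ (?x, c) * X $$ (c, ?y))"
  by (rule mult_entry[OF car(2,1) x(1) y(1)])
 also have "... = (\<Sum>c\<in>{c. c < n & bl c = i} \<union> {c. c < n & i < bl c & bl c <= j}. M $$ (?x, c) * X $$ (c, ?y))"
 proof (intro sum.mono_neutral_right ballI)
  fix c assume "c \<in> {..<n} - ({c. c < n & bl c = i} \<union> {c. c < n & i < bl c & bl c <= j})"
  then have "c < n" "\<not> (i <= bl c & bl c <= j)" by auto
  then show "M $$ (?x, c) * X $$ (c, ?y) = 0" by (rule z)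
 qed auto
 also have "... = (\<Sum>c\<in>{c. c < n & bl c = i}. M $$ (?x, c) * X $$ (c, ?y)) + rest_left M X i j x y"
  unfolding rest_left_def by (rule sum.union_disjoint) auto
 also have "(\<Sum>c\<in>{c. c < n & bl c = i}. M $$ (?x, c) * X $$ (c, ?y)) =
   (\<Sum>c\<in>{c. c < n & bl c = i}. A0 w $$ (?x, c) * X $$ (c, ?y))"
  using M(2) x by (intro sum.cong) (auto simp: eqd_def)
 also have "... = (\<Sum>c<n. A0 w $$ (?x, c) * X $$ (c, ?y))"
  using x by (intro sum.mono_neutral_left) (auto simp: A0_def)
 also have "... = (A0 w * X) $$ (?x, ?y)"
  by (rule mult_entry[OF A0_carrier car(1) x(1) y(1), symmetric])
 also have "... = w powi (- mu i) * lm (r i) (Aa i) (blk X i j) x y"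
  using mult_A0_left[OF car(1) y(1), of i x w] ij xy by (simp add: lm_def blk_def)
 finally show ?thesis .
qed

definition block_remainder where
 "block_remainder M M' G i j z x y = rest_right (G (q * z)) (M z) i j x y - rest_left (M' z) (G z) i j x y"

lemma iso_block_step:
 assumes G: "iso_fun eps M M' G" and M: "form eps M" "form eps M'" and z: "z ~= 0" "norm (q * z) < eps"
  and ij: "1 <= i" "i < j" "j <= k" and xy: "x < r i" "y < r j"
 shows "blk (G z) i j x y =
  z powi (mu i - mu j) * lm (r i) (Aa' i) (rm (r j) (blk (G (q * z)) i j) (Aa j)) x y +
  z powi mu i * lm (r i) (Aa' i) (block_remainder M M' G i j z) x y"
proof -
 have z': "norm z < eps" "q * z ~= 0" using norm_le_mult_q[of z] z by auto
 have B: "G z \<in> BU" "G (q * z) \<in> BU" using iso_funD(1)[OF G] z z' by (auto simp: frakG_iff)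
 note Mz = formD(1,2)[OF M(1) z(1) z'(1)] formD(1,2)[OF M(2) z(1) z'(1)]
 have eq: "lm (r i) (Aa i) (blk (G z) i j) x y = z powi (mu i - mu j) * rm (r j) (blk (G (q * z)) i j) (Aa j) x y +
   z powi mu i * block_remainder M M' G i j z x y" if x: "x < r i" for x
 proof -
  have "z powi (- mu j) * rm (r j) (blk (G (q * z)) i j) (Aa j) x y + rest_right (G (q * z)) (M z) i j x y =
   z powi (- mu i) * lm (r i) (Aa i) (blk (G z) i j) x y + rest_left (M' z) (G z) i j x y"
   using iso_funD(3)[OF G z] block_mult_right[OF B(2) Mz(1,2) ij x xy(2)] block_mult_left[OF B(1) Mz(3,4) ij x xy(2)] by simp
  then have "z powi (- mu i) * lm (r i) (Aa i) (blk (G z) i j) x y =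
    z powi (- mu j) * rm (r j) (blk (G (q * z)) i j) (Aa j) x y + block_remainder M M' G i j z x y"
   by (simp add: block_remainder_def algebra_simps)
  then have "z powi mu i * (z powi (- mu i) * lm (r i) (Aa i) (blk (G z) i j) x y) =
    z powi mu i * (z powi (- mu j) * rm (r j) (blk (G (q * z)) i j) (Aa j) x y + block_remainder M M' G i j z x y)" by simp
  then show ?thesis using z(1) by (simp add: power_int_diff power_int_minus field_simps)
 qed
 have "blk (G z) i j x y = lm (r i) (Aa' i) (lm (r i) (Aa i) (blk (G z) i j)) x y"
  using lm_inverse[OF inverse_arrays_sym[OF Aa_inverse] xy(1)] ij by simp
 also have "... = lm (r i) (Aa' i) (%x y. z powi (mu i - mu j) * rm (r j) (blk (G (q * z)) i j) (Aa j) x y +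
   z powi mu i * block_remainder M M' G i j z x y) x y"
  by (rule lm_cong_entry) (rule eq)
 finally show ?thesis by (simp add: lm_def sum_distrib_left sum.distrib algebra_simps)
qed

end

lemma moderate_cong:
 assumes "moderate f" "0 < eps" "!!z. z ~= 0 ==> norm z < eps ==> f z = g z"
 shows "moderate g"
proof -
 obtain N B \<delta> where f: "0 < \<delta>" "0 <= B" "!!z. z ~= 0 ==> norm z < \<delta> ==> norm (f z) * norm z ^ N <= B"
  using assms(1) by (rule moderateE) blast
 have "norm (g z) * norm z ^ N <= B" if "z ~= 0" "norm z < min \<delta> eps" for z
  using f(3)[of z] assms(3)[of z] that by simp
 moreover have "0 < min \<delta> eps" using f(1) assms(2) by simp
 ultimately show ?thesis unfolding moderate_def using f(2) by blast
qed

lemma moderate_norm_sum: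
 assumes "!!i. i \<in> I ==> moderate (f i)"
 shows "moderate (%z. of_real (\<Sum>i\<in>I. norm (f i z)))"
proof -
 have "moderate (%z. complex_of_real (norm (f i z)))" if "i \<in> I" for i
  using assms[OF that] by (simp add: moderate_def)
 then show ?thesis unfolding of_real_sum by (rule moderate_sum)
qed

context q_base
begin

lemma moderate_by_iteration:
 fixes h :: "complex => real"
 assumes h: "!!z. 0 <= h z" and s: "0 < s"
  and bdd: "!!z. s / norm q <= norm z ==> norm z <= s ==> h z <= K"
  and step: "!!z. z ~= 0 ==> norm (q * z) <= s ==> h z * norm z ^ Suc N <= h (q * z) * norm z ^ Suc N + B" and B: "0 <= B"
 shows "moderate (%z. of_real (h z))"
proof -
 define K' where "K' = max (K * s ^ Suc N) (B / (1 - 1 / norm q))"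
 have q1: "0 < 1 - 1 / norm q" using q by simp
 have K: "0 <= K"
  using bdd[of "of_real s"] h[of "of_real s"] s q by (simp add: field_simps)
 have K': "B <= K' * (1 - 1 / norm q)" "K * s ^ Suc N <= K'"
  using q1 mult_right_mono[of "B / (1 - 1 / norm q)" K' "1 - 1 / norm q"] by (auto simp: K'_def)
 have K'0: "0 <= K'" using K s order_trans[OF _ K'(2)] by simp
 have main: "h z * norm z ^ Suc N <= K'" if "s / norm q <= norm (q ^ m * z)" "norm (q ^ m * z) <= s" for m z
  using that
 proof (induction m arbitrary: z)
  case 0
  then have "h z * norm z ^ Suc N <= K * s ^ Suc N"
   using bdd[of z] K by (intro mult_mono power_mono) auto
  then show ?case using K'(2) by linarith
 next
  case (Suc m)
  have IH: "h (q * z) * norm (q * z) ^ Suc N <= K'" using Suc.IH[of "q * z"] Suc.prems by (simp add: mult_ac)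
  have "0 < s / norm q" using s q by (intro divide_pos_pos) auto
  then have z0: "z ~= 0" using Suc.prems(1) by auto
  have "norm (q * z) * 1 <= norm (q * z) * norm q ^ m" using q by (intro mult_left_mono one_le_power) auto
  also have "... = norm (q ^ Suc m * z)" by (simp add: norm_mult norm_power mult_ac)
  finally have "norm (q * z) <= s" using Suc.prems(2) by simp
  from step[OF z0 this] have "h z * norm z ^ Suc N <= h (q * z) * norm z ^ Suc N + B" .
  also have "h (q * z) * norm z ^ Suc N = h (q * z) * norm (q * z) ^ Suc N / norm q ^ Suc N"
   using q by (simp add: norm_mult power_mult_distrib)
  also have "... <= K' / norm q ^ Suc N" using IH by (intro divide_right_mono) auto
  also have "... <= K' / norm q ^ 1"
   using q K'0 by (intro divide_left_mono power_increasing mult_pos_pos) auto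
  also have "K' / norm q ^ 1 + B <= K'" using K'(1) by (simp add: algebra_simps)
  finally show ?case by simp
 qed
 have "h z * norm z ^ Suc N <= K'" if z: "z ~= 0" "norm z < s" for z
 proof -
  define P where "P = (%m. s < norm (q ^ m * z))"
  obtain m where "s / norm z < norm q ^ m" using real_arch_pow[OF q] by blast
  then have Pm: "P m" using z by (simp add: P_def norm_mult norm_power field_simps)
  define l where "l = (LEAST m. P m)"
  have l: "P l" unfolding l_def by (rule LeastI[of P, OF Pm])
  have "l ~= 0" using l z by (auto simp: P_def intro!: Nat.gr0I)
  then obtain l' where l': "l = Suc l'" using not0_implies_Suc by blast
  have "\<not> P l'" using not_less_Least[of l' P] l' by (simp add: l_def)
  then have 1: "norm (q ^ l' * z) <= s" by (simp add: P_def)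
  have 2: "s / norm q <= norm (q ^ l' * z)" using l q0 unfolding l' P_def by (simp add: norm_mult field_simps)
  show ?thesis by (rule main[OF 2 1])
 qed
 then show ?thesis unfolding moderate_def using s K'0 h
  by (intro exI[of _ "Suc N"] exI[of _ K'] exI[of _ s]) simp
qed

end

context qdiff
begin

lemma moderate_AU:
 assumes U: "radius U \<rho>" and ab: "a < n" "b < n"
 shows "moderate (%z. AU U z $$ (a, b))"
proof -
 have "ereal \<rho> <= fls_conv_radius (AM U $$ (a, b))" using AM_radius[OF U] ab by (simp add: mat_radius_def)
 then have "fls_conv_radius (AM U $$ (a, b)) > 0" using radius_pos[OF U] by (auto intro: less_le_trans[of 0 "ereal \<rho>"])
 then show ?thesis using moderate_eval_fls AM_carrier[of U] ab by (simp add: AU_def mat_fun_def)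
qed

lemma moderate_sub: "moderate f ==> moderate g ==> moderate (%z. f z - g z)"
 using moderate_add[of f "%z. - g z"] moderate_uminus[of g] by simp

text \<open>By induction on the gap: in the block equation the contribution of smaller gaps is moderate, and the coefficient of the block itself is \<open>z\<close> to a positive power, hence small.\<close>

lemma moderate_iso_fun:
 assumes G: "iso_fun eps (AU U) (AU U') G" and U: "radius U eps" "radius U' eps"
 shows "a < n ==> b < n ==> moderate (%z. G z $$ (a, b))"
proof (induction "bl b - bl a" arbitrary: a b rule: less_induct)
 case less
 note ab = less.prems
 have eps: "0 < eps" by (rule radius_pos[OF U(1)])
 note M = form_AU[OF U(1)] form_AU[OF U(2)]
 show ?case
 proof (cases "bl a < bl b")
  case False
  show ?thesis
   by (rule moderate_cong[OF moderate_const[of "if a = b then 1 else 0"] eps])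
    (use frakG_entry[OF iso_funD(1)[OF G] ab] False in auto)
 next
  case True
  define i where "i = bl a"
  define j where "j = bl b"
  note B = block_bounds[OF ab(1)] block_bounds[OF ab(2)]
  have ij: "1 <= i" "i < j" "j <= k" "i <= k" "1 <= j" using B True by (auto simp: i_def j_def)
  have IH: "moderate (%z. G z $$ (c, d))" if "c < n" "d < n" "i <= bl c" "bl d <= j" "i < bl c \<or> bl d < j" for c d
   by (rule less.hyps) (use that ij in \<open>auto simp: i_def j_def\<close>)
  define R where "R = block_remainder (AU U) (AU U') G i j"
  have modR: "moderate (%z. z powi mu i * lm (r i) (Aa' i) (R z) x y)" if xy: "x < r i" "y < r j" for x y
  proof -
   have "moderate (%z. R z x y)" if x: "x < r i" for x
    unfolding R_def block_remainder_def rest_right_def rest_left_def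
   proof (intro moderate_sub moderate_sum)
    fix c assume c: "c \<in> {c. c < n & i <= bl c & bl c < j}"
    then have "moderate (%z. G z $$ (offset r i + x, c))" by (intro IH) (use index_props ij x in auto)
    from moderate_scale[OF this, of q]
    show "moderate (%z. G (q * z) $$ (offset r i + x, c) * AU U z $$ (c, offset r j + y))"
     using c index_props ij xy q0 by (intro moderate_mult moderate_AU[OF U(1)]) auto
   next
    fix c assume c: "c \<in> {c. c < n & i < bl c & bl c <= j}"
    have "moderate (%z. G z $$ (c, offset r j + y))" by (rule IH) (use c index_props ij xy in auto)
    then show "moderate (%z. AU U' z $$ (offset r i + x, c) * G z $$ (c, offset r j + y))"
     using c index_props ij x by (intro moderate_mult moderate_AU[OF U(2)]) auto
   qed
   then show ?thesis unfolding lm_def by (intro moderate_mult moderate_powi moderate_sum moderate_const) auto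
  qed
  define \<rho> where "\<rho> z = nrm (r i) (r j) (%x y. z powi mu i * lm (r i) (Aa' i) (R z) x y)" for z
  have "moderate (%z. complex_of_real (\<rho> z))"
   unfolding \<rho>_def nrm_def of_real_sum
   by (intro moderate_sum moderate_norm_sum[of "{x}" for x, simplified]) (use modR in auto)
  then obtain N B \<delta> where R: "0 < \<delta>" "0 <= B" "!!z. z ~= 0 ==> norm z < \<delta> ==> norm (complex_of_real (\<rho> z)) * norm z ^ N <= B"
   by (rule moderateE) blast
  have \<rho>0: "0 <= \<rho> z" for z by (simp add: \<rho>_def nrm_nonneg)
  define C where "C = nrm (r i) (r i) (Aa' i) * nrm (r j) (r j) (Aa j)"
  have C0: "0 <= C" by (simp add: C_def nrm_nonneg)
  define h where "h z = nrm (r i) (r j) (blk (G z) i j)" for z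
  define s where "s = min (min (eps / 2) (\<delta> / 2)) (1 / (C + 1))"
  have s: "0 < s" "s < eps" "s < \<delta>" "s * (C + 1) <= 1" "s <= 1"
  proof -
   have c: "s <= eps / 2" "s <= \<delta> / 2" "s <= 1 / (C + 1)" unfolding s_def by linarith+
   show "0 < s" unfolding s_def using eps R(1) C0 by simp
   show "s < eps" "s < \<delta>" using c eps R(1) by linarith+
   show "s * (C + 1) <= 1" using c(3) C0 by (simp add: pos_le_divide_eq)
   have "1 / (C + 1) <= 1" using C0 by simp
   then show "s <= 1" using c(3) by linarith
  qed
  have "\<mu>' >= 1 ==> norm z <= s ==> z ~= 0 ==> norm z powi \<mu>' * C <= 1" for \<mu>' and z :: complex
  proof -
   assume "\<mu>' >= 1" and z: "norm z <= s" "z ~= 0"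
   then have "norm z powi \<mu>' <= norm z powi 1" using s by (intro power_int_decreasing) auto
   then have "norm z powi \<mu>' * C <= s * C" using C0 z by (intro mult_right_mono) auto
   then show ?thesis using s(1,4) by (simp add: algebra_simps)
  qed
  note small = this[of "mu i - mu j"]
  have step: "h z <= h (q * z) + \<rho> z" if z: "z ~= 0" "norm (q * z) <= s" for z
  proof -
   have z': "norm (q * z) < eps" "norm z <= s" using z s norm_le_mult_q[of z] by linarith+
   have "h z = nrm (r i) (r j) (%x y. z powi (mu i - mu j) * lm (r i) (Aa' i) (rm (r j) (blk (G (q * z)) i j) (Aa j)) x y +
     z powi mu i * lm (r i) (Aa' i) (R z) x y)"
    unfolding h_def R_def by (rule nrm_cong) (rule iso_block_step[OF G M z(1) z'(1) ij(1-3)])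
   also have "... <= norm (z powi (mu i - mu j)) * nrm (r i) (r j) (lm (r i) (Aa' i) (rm (r j) (blk (G (q * z)) i j) (Aa j))) + \<rho> z"
    unfolding \<rho>_def nrm_scale[symmetric] by (rule nrm_add)
   also have "nrm (r i) (r j) (lm (r i) (Aa' i) (rm (r j) (blk (G (q * z)) i j) (Aa j))) \<le>
     nrm (r i) (r i) (Aa' i) * (h (q * z) * nrm (r j) (r j) (Aa j))"
    unfolding h_def by (intro order_trans[OF nrm_lm] mult_left_mono nrm_rm nrm_nonneg)
   also have "norm (z powi (mu i - mu j)) * (nrm (r i) (r i) (Aa' i) * (h (q * z) * nrm (r j) (r j) (Aa j))) =
     (norm z powi (mu i - mu j) * C) * h (q * z)" by (simp add: C_def norm_power_int mult_ac)
   also have "... <= 1 * h (q * z)"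
    using small[OF _ z'(2) z(1)] mu[OF ij(1-3)] by (intro mult_right_mono) (auto simp: h_def nrm_nonneg)
   finally show ?thesis by (simp add: mult_left_mono)
  qed
  define S where "S = {z :: complex. s / norm q <= norm z & norm z <= s}"
  have "compact S"
  proof -
   have "S = cball 0 s - ball 0 (s / norm q)" by (auto simp: S_def)
   then show ?thesis by (metis compact_cball compact_diff open_ball)
  qed
  moreover have "continuous_on S h"
  proof -
   have "continuous_on S (%z. G z $$ (a, b))" if "a < n" "b < n" for a b
    by (rule continuous_on_subset[OF holomorphic_on_imp_continuous_on[OF hol_matD[OF iso_funD(2)[OF G] that]]])
     (use s q in \<open>auto simp: S_def divide_le_eq\<close>)
   then show ?thesis unfolding h_def nrm_def blk_def using ij index_less by (intro continuous_intros) auto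
  qed
  ultimately have "bounded (h ` S)" by (intro compact_imp_bounded compact_continuous_image)
  then obtain K where K: "!!z. z \<in> S ==> h z <= K" by (force simp: bounded_iff abs_le_iff)
  have "moderate (%z. of_real (h z))"
  proof (rule moderate_by_iteration[OF _ s(1)])
   show "0 <= h z" for z by (simp add: h_def nrm_nonneg)
   show "h z <= K" if "s / norm q <= norm z" "norm z <= s" for z using K that by (simp add: S_def)
   show "h z * norm z ^ Suc N <= h (q * z) * norm z ^ Suc N + B" if z: "z ~= 0" "norm (q * z) <= s" for z
   proof -
    have z': "norm z < \<delta>" "norm z <= 1" using z s norm_le_mult_q[of z] by linarith+
    have "norm (complex_of_real (\<rho> z)) * norm z ^ Suc N <= B"
     by (rule moderate_higher_power[OF R(3)[OF z(1) z'(1)] z'(2)]) auto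
    then have "\<rho> z * norm z ^ Suc N <= B" using \<rho>0 by (simp del: power_Suc)
    moreover have "h z * norm z ^ Suc N <= (h (q * z) + \<rho> z) * norm z ^ Suc N"
     by (intro mult_right_mono step z) auto
    ultimately show ?thesis by (simp add: distrib_right del: power_Suc)
   qed
  qed (use R in auto)
  then obtain N B \<delta> where H: "0 < \<delta>" "0 <= B" "!!z. z ~= 0 ==> norm z < \<delta> ==> norm (complex_of_real (h z)) * norm z ^ N <= B"
   by (rule moderateE) blast
  have "norm (G z $$ (a, b)) <= norm (complex_of_real (h z))" for z
  proof -
   have "norm (blk (G z) i j (loc a) (loc b)) <= h z"
    unfolding h_def by (rule nrm_entry) (use B in \<open>auto simp: i_def j_def\<close>)
   then show ?thesis using B by (simp add: blk_def i_def j_def)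
  qed
  then have "norm (G z $$ (a, b)) * norm z ^ N <= B" if "z ~= 0" "norm z < \<delta>" for z
   using H(3)[OF that] by (meson mult_right_mono norm_ge_zero order_trans zero_le_power)
  then show ?thesis unfolding moderate_def using H(1,2) by blast
 qed
qed

lemma iso_imp_isoformal:
 assumes U: "U \<in> families" "U' \<in> families" and iso: "iso_families U U'"
 shows "(AM U, AM U') \<in> isoformal_rel q k mu r A"
proof -
 obtain eps G where rad: "radius U eps" "radius U' eps" and G: "iso_fun eps (AU U) (AU U') G"
  using iso unfolding iso_families_def by blast
 have eps: "0 < eps" by (rule radius_pos[OF rad(1)])
 have "\<exists>F. fls_conv_radius F >= ereal eps & (\<forall>z \<in> annulus 0 eps. eval_fls F z = G z $$ (a, b))" if "a < n" "b < n" for a b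
  by (rule moderate_imp_fls[OF moderate_iso_fun[OF G rad that] hol_matD[OF iso_funD(2)[OF G] that] eps])
 note ex = this
 define f where "f a b = (SOME F. fls_conv_radius F >= ereal eps & (\<forall>z \<in> annulus 0 eps. eval_fls F z = G z $$ (a, b)))" for a b
 have f: "fls_conv_radius (f a b) >= ereal eps" "z \<in> annulus 0 eps ==> eval_fls (f a b) z = G z $$ (a, b)"
  if "a < n" "b < n" for a b z
  using someI_ex[OF ex[OF that]] unfolding f_def[symmetric] by blast+
 define F where "F = Matrix.mat n n (%(a, b). f a b)"
 have Fc: "F \<in> carrier_mat n n" by (simp add: F_def)
 have FR: "mat_radius F eps" using f(1) by (simp add: mat_radius_def F_def)
 have Fz: "mat_fun F z = G z" if "z ~= 0" "norm z < eps" for z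
  using f(2)[of _ _ z] that iso_funD(1)[OF G that, THEN frakG_carrier] by (intro eq_matI) (auto simp: mat_fun_def F_def)
 have FG: "F \<in> frakG k r"
 proof (rule frakG_I[OF Fc])
  fix a b assume ab: "a < n" "b < n" "bl b <= bl a"
  have "f a b = (if a = b then 1 else 0)"
  proof (rule fls_eqI_eval[OF eps f(1)[OF ab(1,2)]])
   fix z :: complex assume z: "z ~= 0" "norm z < eps"
   show "eval_fls (f a b) z = eval_fls (if a = b then 1 else 0) z"
    using f(2)[OF ab(1,2), of z] z frakG_entry[OF iso_funD(1)[OF G z] ab] by auto
  qed auto
  then show "F $$ (a, b) = (if a = b then 1 else 0)" using ab by (simp add: F_def)
 qed
 have el: "elements_mat F \<subseteq> conv_field"
  using less_le_trans[of 0 "ereal eps", OF _ f(1)] eps by (auto simp: elements_mat_def F_def conv_field_iff)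
 have sF: "map_mat (sigma_fls q) F \<in> carrier_mat n n" using Fc by simp
 note sR = mat_fun_sigma(1)[OF Fc FR eps]
 have e1: "eps / norm q <= eps" "0 < eps / norm q" using q eps by (auto simp: divide_le_eq mult_le_cancel_left1)
 note AR = mat_radius_subset[OF AM_radius[OF rad(1)] e1(1)] mat_radius_subset[OF AM_radius[OF rad(2)] e1(1)]
 note FR' = mat_radius_subset[OF FR e1(1)]
 have eq: "AM U' * F = map_mat (sigma_fls q) F * AM U"
 proof (rule eq_matI)
  fix a b assume "a < dim_row (map_mat (sigma_fls q) F * AM U)" "b < dim_col (map_mat (sigma_fls q) F * AM U)"
  then have ab: "a < n" "b < n" using Fc AM_carrier[of U] by auto
  show "(AM U' * F) $$ (a, b) = (map_mat (sigma_fls q) F * AM U) $$ (a, b)"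
  proof (rule fls_eqI_eval[OF e1(2)])
   show "ereal (eps / norm q) <= fls_conv_radius ((AM U' * F) $$ (a, b))"
    using mat_fun_mult(1)[OF AM_carrier AR(2) Fc FR'] ab by (simp add: mat_radius_def)
   show "ereal (eps / norm q) <= fls_conv_radius ((map_mat (sigma_fls q) F * AM U) $$ (a, b))"
    using mat_fun_mult(1)[OF sF sR AM_carrier AR(1)] ab by (simp add: mat_radius_def)
   fix z :: complex assume z: "z ~= 0" "norm z < eps / norm q"
   then have qz: "norm (q * z) < eps" using q0 by (simp add: norm_mult field_simps)
   have zz: "norm z < eps" using z e1 by linarith
   have "mat_fun (AM U' * F) z = AU U' z * G z"
    unfolding mat_fun_mult(2)[OF AM_carrier AR(2) Fc FR' z] Fz[OF z(1) zz] AU_def ..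
   also have "... = G (q * z) * AU U z" by (rule iso_funD(3)[OF G z(1) qz, symmetric])
   also have "... = mat_fun (map_mat (sigma_fls q) F * AM U) z"
    unfolding mat_fun_mult(2)[OF sF sR AM_carrier AR(1) z] mat_fun_sigma(2)[OF Fc FR eps z(1) qz]
    using Fz[of "q * z"] qz z q0 by (simp add: AU_def)
   finally have "mat_fun (AM U' * F) z $$ (a, b) = mat_fun (map_mat (sigma_fls q) F * AM U) z $$ (a, b)" by simp
   then show "eval_fls ((AM U' * F) $$ (a, b)) z = eval_fls ((map_mat (sigma_fls q) F * AM U) $$ (a, b)) z"
    using ab Fc AM_carrier[of U] AM_carrier[of U'] by (simp add: mat_fun_def)
  qed
 qed (use Fc AM_carrier[of U] AM_carrier[of U'] in auto)
 have "gauge_fls q F (AM U) = (AM U' * F) * minv F" unfolding gauge_fls_def eq ..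
 also have "... = AM U' * (F * minv F)"
  by (rule assoc_mult_mat[OF AM_carrier Fc frakG_minv(1)[OF FG]])
 also have "... = AM U'" unfolding frakG_minv(2)[OF FG] by (rule right_mult_one_mat[OF AM_carrier])
 finally have g: "AM U' = gauge_fls q F (AM U)" by simp
 show ?thesis
  unfolding isoformal_rel_def by (intro CollectI exI[of _ U] exI[of _ U'] conjI refl U bexI[of _ F] el g FG)
qed

lemma isoformal_iff:
 assumes "U \<in> families" "U' \<in> families"
 shows "(AM U, AM U') \<in> isoformal_rel q k mu r A \<longleftrightarrow> iso_families U U'"
proof
 assume "(AM U, AM U') \<in> isoformal_rel q k mu r A"
 then obtain U1 U1' F where "AM U = AM U1" "AM U' = AM U1'" "F \<in> frakG k r" "elements_mat F \<subseteq> conv_field"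
  "AM U1' = gauge_fls q F (AM U1)" unfolding isoformal_rel_def by blast
 then show "iso_families U U'" using isoformal_imp_iso[OF assms] by simp
qed (rule iso_imp_isoformal[OF assms])

end

section \<open>Every cocycle is the cocycle of a matrix\<close>

context qdiff
begin

text \<open>The inductive step in solving \<open>f\<^sub>b = f\<^sub>a \<gamma>\<^sub>a\<^sub>b\<close> in the unipotent group is an additive
 Cousin problem for each entry of the next block column. A domain has to shrink at every step.\<close>

definition annuli :: "real => real => nat => complex set" where
 "annuli s t m = annulus (s * 3 ^ m) (t / 2 ^ m)"

lemma annuli_Suc: "0 < s ==> 0 < t ==> annuli s t (Suc m) \<subseteq> annuli s t m"
 by (auto simp: annuli_def field_simps intro: le_less_trans[rotated] less_le_trans)

lemma unipotent_Cousin_row: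
 fixes \<gamma> :: "'i => 'i => complex => complex mat" and W :: "'i => complex set"
 assumes W: "!!a. a \<in> I ==> open (W a)" "- {0} \<subseteq> (\<Union>a\<in>I. W a)" and st: "0 < s" "0 < t" "s * 3 ^ K < t / 2 ^ K"
  and \<gamma>: "!!a b z. a \<in> I ==> b \<in> I ==> z \<in> W a Int W b Int annuli s t 0 ==> \<gamma> a b z \<in> frakG k r"
   "!!a b. a \<in> I ==> b \<in> I ==> hol_mat (W a Int W b Int annuli s t 0) (\<gamma> a b)"
   "!!a b c z. a \<in> I ==> b \<in> I ==> c \<in> I ==> z \<in> W a Int W b Int W c Int annuli s t 0 ==> \<gamma> a b z * \<gamma> b c z = \<gamma> a c z"
  and x: "x < n"
 shows "m <= K ==> \<exists>v. (\<forall>a\<in>I. \<forall>c<n. v a c holomorphic_on W a Int annuli s t m) &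
  (\<forall>a\<in>I. \<forall>c<n. bl c <= bl x --> (\<forall>z. v a c z = (if c = x then 1 else 0))) &
  (\<forall>a\<in>I. \<forall>b\<in>I. \<forall>y<n. bl y <= m --> (\<forall>z \<in> W a Int W b Int annuli s t m.
    v b y z = (\<Sum>c<n. v a c z * \<gamma> a b z $$ (c, y))))"
proof (induction m)
 case 0
 show ?case
 proof (intro exI[of _ "%a c z. if c = x then 1 else 0"] conjI ballI allI impI)
  fix a b y z assume "y < n" "bl y <= 0"
  then show "(if y = x then 1 else 0) = (\<Sum>c<n. (if c = x then 1 else 0) * \<gamma> a b z $$ (c, y))"
   using block_bounds[of y] by simp
 qed auto
next
 case (Suc m)
 let ?\<Omega> = "annuli s t m" and ?\<Omega>' = "annuli s t (Suc m)"
 have sub: "?\<Omega>' \<subseteq> ?\<Omega>" by (rule annuli_Suc[OF st(1,2)])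
 have sub0: "annuli s t l \<subseteq> annuli s t 0" for l
  by (induction l) (use annuli_Suc[OF st(1,2)] in blast)+
 from Suc.IH[OF Suc_leD[OF Suc.prems]]
 obtain v where v0: "\<forall>a\<in>I. \<forall>c<n. v a c holomorphic_on W a Int ?\<Omega>"
  "\<forall>a\<in>I. \<forall>c<n. bl c <= bl x --> (\<forall>z. v a c z = (if c = x then 1 else 0))"
  "\<forall>a\<in>I. \<forall>b\<in>I. \<forall>y<n. bl y <= m --> (\<forall>z \<in> W a Int W b Int ?\<Omega>. v b y z = (\<Sum>c<n. v a c z * \<gamma> a b z $$ (c, y)))"
  by (elim exE conjE) (rule that)
 have v1: "v a c holomorphic_on W a Int ?\<Omega>" if "a \<in> I" "c < n" for a c
  using v0(1) that by blast
 have v2: "v a c z = (if c = x then 1 else 0)" if "a \<in> I" "c < n" "bl c <= bl x" for a c z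
  using v0(2) that by blast
 have v3: "v b y z = (\<Sum>c<n. v a c z * \<gamma> a b z $$ (c, y))"
  if "a \<in> I" "b \<in> I" "y < n" "bl y <= m" "z \<in> W a Int W b Int ?\<Omega>" for a b y z
  using v0(3) that by blast
 define C where "C y a b z = (\<Sum>c | c < n & bl c < bl y. v a c z * \<gamma> a b z $$ (c, y))" for y a b z
 \<comment> \<open>the equation for one entry, when all entries further left are known\<close>
 have expand: "(\<Sum>c<n. u c * \<gamma> a b z $$ (c, y)) = u y + (\<Sum>c | c < n & bl c < bl y. u c * \<gamma> a b z $$ (c, y))"
  if "a \<in> I" "b \<in> I" "y < n" "z \<in> W a Int W b Int annuli s t 0" for u :: "nat => complex" and a b y z
 proof -
  have g: "\<gamma> a b z $$ (c, y) = (if c = y then 1 else 0)" if "c < n" "\<not> bl c < bl y" for c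
   using frakG_entry[OF \<gamma>(1)[OF \<open>a \<in> I\<close> \<open>b \<in> I\<close> \<open>z \<in> _\<close>] that(1) \<open>y < n\<close>] that by simp
  have "(\<Sum>c<n. u c * \<gamma> a b z $$ (c, y)) =
    (\<Sum>c\<in>{y} \<union> {c. c < n & bl c < bl y}. u c * \<gamma> a b z $$ (c, y))"
   using g \<open>y < n\<close> by (intro sum.mono_neutral_right) auto
  also have "... = u y * \<gamma> a b z $$ (y, y) + (\<Sum>c | c < n & bl c < bl y. u c * \<gamma> a b z $$ (c, y))"
   by (subst sum.union_disjoint) auto
  finally show ?thesis using g[of y] \<open>y < n\<close> by simp
 qed
 have "cousin_solvable I (%a. W a Int ?\<Omega>) (C y) ?\<Omega>'" if y: "y < n" "bl y = Suc m" for y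
 proof -
  have data: "cousin_data I (%a. W a Int ?\<Omega>) (C y)"
   unfolding cousin_data_def
  proof (intro conjI ballI)
   show "open (W a Int ?\<Omega>)" if "a \<in> I" for a
    unfolding annuli_def by (intro open_Int W open_annulus that)
   show "C y a b holomorphic_on W a Int ?\<Omega> Int (W b Int ?\<Omega>)" if ab: "a \<in> I" "b \<in> I" for a b
    unfolding C_def
   proof (intro holomorphic_on_sum holomorphic_on_mult)
    fix c assume c: "c \<in> {c. c < n & bl c < bl y}"
    show "v a c holomorphic_on W a Int ?\<Omega> Int (W b Int ?\<Omega>)"
     by (rule holomorphic_on_subset[OF v1]) (use ab c in auto)
    show "(%z. \<gamma> a b z $$ (c, y)) holomorphic_on W a Int ?\<Omega> Int (W b Int ?\<Omega>)"
     by (rule holomorphic_on_subset[OF hol_matD[OF \<gamma>(2)[OF ab]]]) (use c y sub0[of m] in auto)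
   qed
   fix a b c z assume abc: "a \<in> I" "b \<in> I" "c \<in> I" and z': "z \<in> W a Int ?\<Omega> Int (W b Int ?\<Omega>) Int (W c Int ?\<Omega>)"
   then have z: "z \<in> W a Int W b Int ?\<Omega>" "z \<in> W a Int W b Int annuli s t 0" "z \<in> W b Int W c Int annuli s t 0"
    "z \<in> W a Int W c Int annuli s t 0" "z \<in> W a Int W b Int W c Int annuli s t 0" using sub0[of m] by auto
   let ?E = "{e. e < n & bl e < bl y}"
   define u where "u e = (if bl e < bl y then v a e z else 0)" for e
   note car = frakG_carrier[OF \<gamma>(1)[OF abc(1,2) z(2)]] frakG_carrier[OF \<gamma>(1)[OF abc(2,3) z(3)]]
   \<comment> \<open>both sides are the entry \<open>y\<close> of the row \<open>u \<gamma>\<^sub>a\<^sub>b \<gamma>\<^sub>b\<^sub>c = u \<gamma>\<^sub>a\<^sub>c\<close>\<close>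
   have vb: "v b e z = (\<Sum>d<n. u d * \<gamma> a b z $$ (d, e))" if e: "e \<in> ?E" for e
   proof -
    have "v b e z = (\<Sum>d<n. v a d z * \<gamma> a b z $$ (d, e))"
     by (rule v3[OF abc(1,2) _ _ z(1)]) (use e y in auto)
    also have "... = (\<Sum>d<n. u d * \<gamma> a b z $$ (d, e))"
    proof (rule sum.cong)
     fix d assume d: "d \<in> {..<n}"
     show "v a d z * \<gamma> a b z $$ (d, e) = u d * \<gamma> a b z $$ (d, e)"
     proof (cases "bl d < bl y")
      case False
      then have "bl e <= bl d" "d ~= e" using e by auto
      then show ?thesis using frakG_entry[OF \<gamma>(1)[OF abc(1,2) z(2)], of d e] d e by simp
     qed (simp add: u_def)
    qed simp
    finally show ?thesis .
   qed
   have uy: "u y = 0" by (simp add: u_def)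
   have Cu: "C y a f z = (\<Sum>d<n. u d * \<gamma> a f z $$ (d, y))" if f: "f \<in> I" "z \<in> W a Int W f Int annuli s t 0" for f
    unfolding expand[OF abc(1) f(1) y(1) f(2)] C_def by (simp add: uy) (rule sum.cong, auto simp: u_def)
   have "C y a c z = (\<Sum>d<n. u d * (\<gamma> a b z * \<gamma> b c z) $$ (d, y))"
    unfolding Cu[OF abc(3) z(4)] \<gamma>(3)[OF abc z(5)] ..
   also have "... = (\<Sum>d<n. \<Sum>e<n. u d * \<gamma> a b z $$ (d, e) * \<gamma> b c z $$ (e, y))"
    using y by (intro sum.cong) (simp_all add: mult_entry[OF car] sum_distrib_left mult.assoc)
   also have "... = (\<Sum>e<n. (\<Sum>d<n. u d * \<gamma> a b z $$ (d, e)) * \<gamma> b c z $$ (e, y))"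
    by (subst sum.swap) (simp add: sum_distrib_right)
   also have "... = (\<Sum>d<n. u d * \<gamma> a b z $$ (d, y)) + (\<Sum>e\<in>?E. (\<Sum>d<n. u d * \<gamma> a b z $$ (d, e)) * \<gamma> b c z $$ (e, y))"
    by (rule expand[OF abc(2,3) y(1) z(3)])
   also have "(\<Sum>e\<in>?E. (\<Sum>d<n. u d * \<gamma> a b z $$ (d, e)) * \<gamma> b c z $$ (e, y)) = C y b c z"
    unfolding C_def by (intro sum.cong) (simp_all add: vb)
   finally show "C y a b z + C y b c z = C y a c z" using Cu[OF abc(2) z(2)] by simp
  qed
  have "cousin_solvable I (%a. W a Int ?\<Omega>) (C y) {z. s * 3 ^ Suc m < norm z & norm z < t / 2 ^ Suc m}"
  proof (rule cousin_annulus[OF data])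
   show "0 < s * 3 ^ Suc m" using st by simp
   have "s * 3 ^ Suc m <= s * 3 ^ K" using st Suc.prems by (intro mult_left_mono power_increasing) auto
   also have "... < t / 2 ^ K" by (rule st(3))
   also have "... <= t / 2 ^ Suc m" using st Suc.prems by (intro divide_left_mono power_increasing) auto
   finally show "s * 3 ^ Suc m < t / 2 ^ Suc m" .
   show "{z. s * 3 ^ Suc m / 3 < norm z & norm z < 2 * (t / 2 ^ Suc m)} \<subseteq> (\<Union>a\<in>I. W a Int ?\<Omega>)"
   proof
    fix z :: complex assume z: "z \<in> {z. s * 3 ^ Suc m / 3 < norm z & norm z < 2 * (t / 2 ^ Suc m)}"
    then have "0 < s * 3 ^ m" "s * 3 ^ m < norm z" "norm z < t / 2 ^ m" using st by auto
    then have "z ~= 0" "z \<in> ?\<Omega>" by (auto simp: annuli_def)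
    then show "z \<in> (\<Union>a\<in>I. W a Int ?\<Omega>)" using W(2) by auto
   qed
  qed
  then show ?thesis by (simp only: annuli_def)
 qed
 define Q where "Q y f \<longleftrightarrow> (\<forall>a\<in>I. f a holomorphic_on (W a Int ?\<Omega>) Int ?\<Omega>') &
   (\<forall>a\<in>I. \<forall>b\<in>I. \<forall>z \<in> (W a Int ?\<Omega>) Int (W b Int ?\<Omega>) Int ?\<Omega>'. f b z = f a z + C y a b z)" for y f
 have "\<exists>f. Q y f" if "y < n" "bl y = Suc m" for y
  using \<open>\<And>y. y < n \<Longrightarrow> bl y = Suc m \<Longrightarrow> cousin_solvable I (\<lambda>a. W a Int ?\<Omega>) (C y) ?\<Omega>'\<close>[OF that]
  unfolding Q_def cousin_solvable_def by (rule conjunct2)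
 then obtain h where hQ: "!!y. y < n ==> bl y = Suc m ==> Q y (h y)" by metis
 have h1: "h y a holomorphic_on (W a Int ?\<Omega>) Int ?\<Omega>'" if "y < n" "bl y = Suc m" "a \<in> I" for y a
  using hQ[OF that(1,2)] that(3) unfolding Q_def by blast
 have h2: "h y b z = h y a z + C y a b z"
  if "y < n" "bl y = Suc m" "a \<in> I" "b \<in> I" "z \<in> (W a Int ?\<Omega>) Int (W b Int ?\<Omega>) Int ?\<Omega>'" for y a b z
  using hQ[OF that(1,2)] that(3-) unfolding Q_def by blast
 define w where "w a c = (if bl c = Suc m & bl x < bl c then h c a else v a c)" for a c
 have w1: "w a c holomorphic_on W a Int ?\<Omega>'" if "a \<in> I" "c < n" for a c
 proof (cases "bl c = Suc m & bl x < bl c")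
  case True
  then have "w a c = h c a" by (simp add: w_def)
  moreover have "h c a holomorphic_on W a Int ?\<Omega>'"
   by (rule holomorphic_on_subset[OF h1]) (use True that sub in auto)
  ultimately show ?thesis by simp
 next
  case False
  then have "w a c = v a c" unfolding w_def by (rule if_not_P)
  moreover have "v a c holomorphic_on W a Int ?\<Omega>'"
   by (rule holomorphic_on_subset[OF v1[OF that]]) (use sub in auto)
  ultimately show ?thesis by simp
 qed
 have w2: "w a c z = (if c = x then 1 else 0)" if "a \<in> I" "c < n" "bl c <= bl x" for a c z
  using v2[OF that] that by (simp add: w_def)
 have w3: "w b y z = (\<Sum>c<n. w a c z * \<gamma> a b z $$ (c, y))"
  if ab: "a \<in> I" "b \<in> I" and y: "y < n" "bl y <= Suc m" and z: "z \<in> W a Int W b Int ?\<Omega>'" for a b y z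
 proof -
  have z0: "z \<in> W a Int W b Int annuli s t 0" "z \<in> W a Int W b Int ?\<Omega>" using z sub sub0[of m] by auto
  have low: "w a c z = v a c z" if "bl c < bl y" for c using that y by (auto simp: w_def)
  have sumv: "(\<Sum>c | c < n & bl c < bl y. w a c z * \<gamma> a b z $$ (c, y)) = C y a b z"
   unfolding C_def by (intro sum.cong) (auto simp: low)
  show ?thesis
  proof (cases "bl x < bl y")
   case False
   have "C y a b z = 0"
    unfolding C_def by (intro sum.neutral) (use False v2[OF ab(1)] in auto)
   then show ?thesis
    unfolding expand[OF ab y(1) z0(1)] sumv using w2[OF ab(1) y(1)] w2[OF ab(2) y(1)] False by simp
  next
   case True
   show ?thesis
   proof (cases "bl y = Suc m")
    case True
    have "w b y = h y b" "w a y = h y a" using True \<open>bl x < bl y\<close> by (auto simp: w_def)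
    moreover have "h y b z = h y a z + C y a b z" by (rule h2) (use True y ab z sub in auto)
    ultimately show ?thesis unfolding expand[OF ab y(1) z0(1)] sumv by simp
   next
    case False
    then have "w b y = v b y" "w a y = v a y" by (auto simp: w_def)
    moreover have "v b y z = v a y z + C y a b z"
     using v3[OF ab y(1) _ z0(2)] False y(2) unfolding expand[OF ab y(1) z0(1)] C_def by simp
    ultimately show ?thesis unfolding expand[OF ab y(1) z0(1)] sumv by simp
   qed
  qed
 qed
 show ?case
  by (intro exI[of _ w] conjI ballI allI impI w1 w2 w3)
qed

lemma unipotent_Cousin:
 fixes \<gamma> :: "'i => 'i => complex => complex mat" and W :: "'i => complex set"
 assumes W: "!!a. a \<in> I ==> open (W a)" "- {0} \<subseteq> (\<Union>a\<in>I. W a)" and r: "0 < r1" "r1 < r2"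
  and \<gamma>: "!!a b z. a \<in> I ==> b \<in> I ==> z \<in> W a Int W b Int annulus 0 (r2 * 2 ^ k) ==> \<gamma> a b z \<in> frakG k r"
   "!!a b. a \<in> I ==> b \<in> I ==> hol_mat (W a Int W b Int annulus 0 (r2 * 2 ^ k)) (\<gamma> a b)"
   "!!a b c z. a \<in> I ==> b \<in> I ==> c \<in> I ==> z \<in> W a Int W b Int W c Int annulus 0 (r2 * 2 ^ k) ==> \<gamma> a b z * \<gamma> b c z = \<gamma> a c z"
 obtains f where "!!a. a \<in> I ==> hol_mat (W a Int annulus r1 r2) (f a)" "!!a z. a \<in> I ==> f a z \<in> frakG k r"
  "!!a b z. a \<in> I ==> b \<in> I ==> z \<in> W a Int W b Int annulus r1 r2 ==> f b z = f a z * \<gamma> a b z"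
proof -
 define s where "s = r1 / 3 ^ k"
 define t where "t = r2 * 2 ^ k"
 have st: "0 < s" "0 < t" "s * 3 ^ k < t / 2 ^ k" using r by (auto simp: s_def t_def)
 have k: "annuli s t k = annulus r1 r2" by (auto simp: annuli_def s_def t_def)
 have 0: "annuli s t 0 \<subseteq> annulus 0 (r2 * 2 ^ k)" using st by (auto simp: annuli_def t_def)
 define P where "P x v \<longleftrightarrow> (\<forall>a\<in>I. \<forall>c<n. v a c holomorphic_on W a Int annuli s t k) &
  (\<forall>a\<in>I. \<forall>c<n. bl c <= bl x --> (\<forall>z. v a c z = (if c = x then 1 else 0))) &
  (\<forall>a\<in>I. \<forall>b\<in>I. \<forall>y<n. bl y <= k --> (\<forall>z \<in> W a Int W b Int annuli s t k.
    v b y z = (\<Sum>c<n. v a c z * \<gamma> a b z $$ (c, y))))" for x and v :: "'i => nat => complex => complex"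
 have "\<exists>v. P x v" if "x < n" for x
  unfolding P_def
 proof (rule unipotent_Cousin_row[OF W st, of \<gamma>])
  show "\<gamma> a b z \<in> frakG k r" if "a \<in> I" "b \<in> I" "z \<in> W a Int W b Int annuli s t 0" for a b z
   by (rule \<gamma>(1)) (use that 0 in auto)
  show "hol_mat (W a Int W b Int annuli s t 0) (\<gamma> a b)" if "a \<in> I" "b \<in> I" for a b
   by (rule hol_mat_subset[OF \<gamma>(2)[OF that]]) (use 0 in auto)
  show "\<gamma> a b z * \<gamma> b c z = \<gamma> a c z" if "a \<in> I" "b \<in> I" "c \<in> I" "z \<in> W a Int W b Int W c Int annuli s t 0" for a b c z
   by (rule \<gamma>(3)) (use that 0 in auto)
 qed (use that in auto)
 then obtain v where vP: "!!x. x < n ==> P x (v x)" by metis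
 have v1: "v x a c holomorphic_on W a Int annulus r1 r2" if "x < n" "a \<in> I" "c < n" for x a c
  using vP[OF that(1)] that unfolding P_def k by blast
 have v2: "v x a c z = (if c = x then 1 else 0)" if "x < n" "a \<in> I" "c < n" "bl c <= bl x" for x a c z
  using vP[OF that(1)] that unfolding P_def by blast
 have v3: "v x b y z = (\<Sum>c<n. v x a c z * \<gamma> a b z $$ (c, y))"
  if "x < n" "a \<in> I" "b \<in> I" "y < n" "bl y <= k" "z \<in> W a Int W b Int annulus r1 r2" for x a b y z
  using vP[OF that(1)] that unfolding P_def k by blast
 define f where "f a z = Matrix.mat n n (%(x, c). v x a c z)" for a z
 have fG: "f a z \<in> frakG k r" if "a \<in> I" for a z
  by (rule frakG_I) (use v2[OF _ that] in \<open>auto simp: f_def\<close>)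
 show thesis
 proof (rule that[of f])
  show "hol_mat (W a Int annulus r1 r2) (f a)" if "a \<in> I" for a
   using v1[OF _ that] by (simp add: hol_mat_def f_def)
  show "f b z = f a z * \<gamma> a b z" if ab: "a \<in> I" "b \<in> I" and z: "z \<in> W a Int W b Int annulus r1 r2" for a b z
  proof -
   have "norm z < r2 * 1" using z by simp
   also have "r2 * 1 <= r2 * 2 ^ k" using r by (intro mult_left_mono) auto
   finally have z': "z \<in> W a Int W b Int annulus 0 (r2 * 2 ^ k)" using z r by auto
   note car = frakG_carrier[OF fG[OF ab(1), of z]] frakG_carrier[OF \<gamma>(1)[OF ab z']]
   show ?thesis
   proof (rule eq_matI)
    fix x y assume "x < dim_row (f a z * \<gamma> a b z)" "y < dim_col (f a z * \<gamma> a b z)"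
    then have xy: "x < n" "y < n" using car by auto
    have "(f a z * \<gamma> a b z) $$ (x, y) = (\<Sum>c<n. v x a c z * \<gamma> a b z $$ (c, y))"
     unfolding mult_entry[OF car xy] using xy by (intro sum.cong) (simp_all add: f_def)
    also have "... = v x b y z" using v3[OF xy(1) ab xy(2) _ z] block_bounds[OF xy(2)] by simp
    finally show "f b z $$ (x, y) = (f a z * \<gamma> a b z) $$ (x, y)" using xy by (simp add: f_def)
   qed (use car in \<open>auto simp: f_def\<close>)
  qed
 qed (rule fG)
qed

end

context qdiff
begin

text \<open>On the diagonal blocks and below, both sides agree automatically.\<close>

lemma eq_from_blocks:
 assumes F: "F' \<in> frakG k r" "F \<in> frakG k r" and N: "N \<in> BU" "eqd N (A0 z)" and M: "M \<in> BU" "eqd M (A0 z)"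
  and eq: "!!i j x y. 1 <= i ==> i < j ==> j <= k ==> x < r i ==> y < r j ==>
   z powi (- mu j) * rm (r j) (blk F' i j) (Aa j) x y + rest_right F' N i j x y =
   z powi (- mu i) * lm (r i) (Aa i) (blk F i j) x y + rest_left M F i j x y"
 shows "F' * N = M * F"
proof (rule eq_matI)
 have FB: "F' \<in> BU" "F \<in> BU" "eqd F' (1\<^sub>m n)" "eqd F (1\<^sub>m n)" using F by (auto simp: frakG_iff)
 note car = BU_carrier[OF FB(1)] BU_carrier[OF N(1)] BU_carrier[OF M(1)] BU_carrier[OF FB(2)]
 fix a b assume "a < dim_row (M * F)" "b < dim_col (M * F)"
 then have ab: "a < n" "b < n" using car by auto
 note B = block_bounds[OF ab(1)] block_bounds[OF ab(2)]
 show "(F' * N) $$ (a, b) = (M * F) $$ (a, b)"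
 proof (cases "bl a < bl b")
  case True
  have xy: "loc a < r (bl a)" "loc b < r (bl b)" "1 <= bl a" "bl b <= k" using B by auto
  have "(F' * N) $$ (offset r (bl a) + loc a, offset r (bl b) + loc b) = (M * F) $$ (offset r (bl a) + loc a, offset r (bl b) + loc b)"
   unfolding block_mult_right[OF FB(1) N xy(3) True xy(4,1,2)] block_mult_left[OF FB(2) M xy(3) True xy(4,1,2)]
   by (rule eq[OF xy(3) True xy(4,1,2)])
  then show ?thesis using B by simp
 next
  case False
  have BU2: "F' * N \<in> BU" "M * F \<in> BU" by (intro BU_mult FB N M)+
  show ?thesis
  proof (cases "bl a = bl b")
   case True
   have "eqd (F' * N) (1\<^sub>m n * A0 z)" "eqd (M * F) (A0 z * 1\<^sub>m n)"
    by (intro eqd_mult FB N M A0_BU BU_one)+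
   then have "(F' * N) $$ (a, b) = A0 z $$ (a, b)" "(M * F) $$ (a, b) = A0 z $$ (a, b)"
    using ab True by (simp_all add: eqd_def left_mult_one_mat[OF A0_carrier] right_mult_one_mat[OF A0_carrier])
   then show ?thesis by simp
  next
   case 2: False
   then show ?thesis using BU2 ab False by (auto simp: BU_def)
  qed
 qed
qed (use frakG_carrier[OF F(1)] frakG_carrier[OF F(2)] BU_carrier[OF N(1)] BU_carrier[OF M(1)] in auto)

text \<open>Below the gap \<open>j - i\<close> the block equation involves the unknown entries only through known ones;
 so \<open>F\<close> and \<open>U\<close> are found block diagonal by block diagonal, by splitting off principal parts.\<close>

definition block_eq where
 "block_eq F N U i j z x y \<longleftrightarrow>
  z powi (- mu j) * rm (r j) (blk (F (q * z)) i j) (Aa j) x y + rest_right (F (q * z)) (N z) i j x y =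
  z powi (- mu i) * lm (r i) (Aa i) (blk (F z) i j) x y + rest_left (AU U z) (F z) i j x y"

definition good_family :: "(nat => nat => complex fls mat) => real => bool" where
 "good_family U R \<longleftrightarrow> (\<forall>i j. 1 <= i --> i < j --> j <= k --> U i j \<in> carrier_mat (r i) (r j) &
  (\<forall>x<r i. \<forall>y<r j. fls_conv_radius (U i j $$ (x, y)) >= ereal R))"

lemma good_family:
 assumes "good_family U R" "0 < R"
 shows "U \<in> families" "radius U R"
proof -
 show "radius U R"
  unfolding radius_def
 proof (intro conjI allI impI)
  fix a b assume ab: "a < n" "b < n" "bl a < bl b"
  show "ereal R <= fls_conv_radius (U (bl a) (bl b) $$ (loc a, loc b))"
   using assms(1) block_bounds[OF ab(1)] block_bounds[OF ab(2)] ab(3) unfolding good_family_def by auto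
 qed (rule assms(2))
 show "U \<in> families"
  unfolding over_diag_families_def
 proof (intro CollectI allI impI conjI subsetI)
  fix i j f assume ij: "1 <= i & i < j & j <= k"
  then have U: "U i j \<in> carrier_mat (r i) (r j)" "!!x y. x < r i ==> y < r j ==> fls_conv_radius (U i j $$ (x, y)) >= ereal R"
   using assms(1) by (auto simp: good_family_def)
  show "U i j \<in> carrier_mat (r i) (r j)" by (rule U(1))
  assume "f \<in> elements_mat (U i j)"
  then obtain x y where "x < r i" "y < r j" "f = U i j $$ (x, y)" using U(1) by (auto simp: elements_mat_def)
  then have "ereal R <= fls_conv_radius f" using U(2) by simp
  then show "f \<in> conv_field" using assms(2) less_le_trans[of 0 "ereal R"] by (simp add: conv_field_iff)
 qed
qed

lemma normal_form_step:
 assumes r12: "0 <= r1" "r1 < r2"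
  and N: "hol_mat (annulus r1 r2) N"
 shows "\<exists>F U. hol_mat {z. r1 < norm z} F & (\<forall>z. F z \<in> frakG k r) & good_family U r2 &
  (\<forall>i j x y. \<forall>z \<in> annulus r1 r2. 1 <= i --> i < j --> j <= k --> j - i <= d --> x < r i --> y < r j --> block_eq F N U i j z x y)"
proof (induction d)
 case 0
 have "good_family (zero_family r) r2" by (simp add: good_family_def zero_family_def)
 then show ?case using frakG_one by (intro exI[of _ "%z. 1\<^sub>m n"] exI[of _ "zero_family r"]) (auto simp: hol_mat_def)
next
 case (Suc d)
 then obtain F U where F: "hol_mat {z. r1 < norm z} F" "!!z. F z \<in> frakG k r" and U: "good_family U r2"
  and eq: "!!i j x y z. z \<in> annulus r1 r2 ==> 1 <= i ==> i < j ==> j <= k ==> j - i <= d ==> x < r i ==> y < r j ==> block_eq F N U i j z x y"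
  by auto
 define S where "S i j x y z = (\<Sum>c | c < n & i < bl c & bl c < j. AU U z $$ (offset r i + x, c) * F z $$ (c, offset r j + y))" for i j x y z
 define Y where "Y i j x y z = rest_right (F (q * z)) (N z) i j x y - S i j x y z" for i j x y z
 define PP where "PP i j \<phi> u \<longleftrightarrow> (\<forall>x<r i. \<forall>y<r j. \<phi> x y holomorphic_on {z. r1 < norm z}) &
   (\<forall>x<r i. \<forall>y<r j. fls_conv_radius (u x y) >= ereal r2) &
   (\<forall>z \<in> annulus r1 r2. \<forall>x<r i. \<forall>y<r j.
    z powi (- mu j) * rm (r j) (%x y. \<phi> x y (q * z)) (Aa j) x y - z powi (- mu i) * lm (r i) (Aa i) (%x y. \<phi> x y z) x y + Y i j x y z
     = eval_fls (u x y) z)" for i j \<phi> u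
 have hF: "(%z. F z $$ (a, b)) holomorphic_on annulus r1 r2" if "a < n" "b < n" for a b
  by (rule holomorphic_on_subset[OF hol_matD[OF F(1) that]]) auto
 have hFq: "(%z. F (q * z) $$ (a, b)) holomorphic_on annulus r1 r2" if "a < n" "b < n" for a b
 proof -
  have "hol_mat (annulus r1 r2) (%z. F (q * z))"
  proof (rule hol_mat_compose_scale[OF F(1)])
   fix z assume "z \<in> annulus r1 r2"
   then show "q * z \<in> {z. r1 < norm z}" using norm_le_mult_q[of z] by simp
  qed
  then show ?thesis using that by (rule hol_matD)
 qed
 have r2: "0 < r2" using r12 by simp
 note Ug = good_family[OF U r2]
 have hU: "(%z. AU U z $$ (a, b)) holomorphic_on annulus r1 r2" if "a < n" "b < n" for a b
  by (rule holomorphic_on_subset[OF hol_matD[OF formD(4)[OF form_AU[OF Ug(2)]] that]]) (use r12 in auto)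
 have "\<exists>\<phi> u. PP i j \<phi> u" if ij: "1 <= i" "i < j" "j <= k" for i j
  unfolding PP_def
 proof (rule principal_part_solution[OF Aa_inverse])
  show "mu j < mu i" by (rule mu[OF ij])
  fix x y assume xy: "x < r i" "y < r j"
  have X: "offset r i + x < n" "offset r j + y < n" using index_props ij xy by auto
  show "Y i j x y holomorphic_on annulus r1 r2"
   unfolding Y_def S_def rest_right_def
   by (intro holomorphic_on_diff holomorphic_on_sum holomorphic_on_mult hFq hF hU hol_matD[OF N]) (use X in auto)
 qed (use ij r12 in auto)
 then obtain \<phi> u where PP: "!!i j. 1 <= i ==> i < j ==> j <= k ==> PP i j (\<phi> i j) (u i j)" by metis
 define new where "new i j \<longleftrightarrow> i < j & j - i = Suc d" for i j :: nat
 define F' where "F' z = Matrix.mat n n (%(a, b). if new (bl a) (bl b) then \<phi> (bl a) (bl b) (loc a) (loc b) z else F z $$ (a, b))" for z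
 define U' where "U' i j = (if new i j then Matrix.mat (r i) (r j) (%(x, y). u i j x y) else U i j)" for i j
 have F'_entry: "F' z $$ (a, b) = (if new (bl a) (bl b) then \<phi> (bl a) (bl b) (loc a) (loc b) z else F z $$ (a, b))"
  if "a < n" "b < n" for a b z using that by (simp add: F'_def)
 have F'h: "hol_mat {z. r1 < norm z} F'"
  unfolding hol_mat_def
 proof (intro allI impI)
  fix a b assume ab: "a < n" "b < n"
  note B = block_bounds[OF ab(1)] block_bounds[OF ab(2)]
  show "(%z. F' z $$ (a, b)) holomorphic_on {z. r1 < norm z}"
  proof (cases "new (bl a) (bl b)")
   case True
   then have "PP (bl a) (bl b) (\<phi> (bl a) (bl b)) (u (bl a) (bl b))" using B by (intro PP) (auto simp: new_def)
   then have "\<phi> (bl a) (bl b) (loc a) (loc b) holomorphic_on {z. r1 < norm z}" using B unfolding PP_def by auto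
   then show ?thesis using True ab by (simp add: F'_entry)
  qed (use hol_matD[OF F(1) ab] ab in \<open>simp add: F'_entry\<close>)
 qed
 have F'g: "F' z \<in> frakG k r" for z
 proof (rule frakG_I)
  fix a b assume ab: "a < n" "b < n" "bl b <= bl a"
  then have "\<not> new (bl a) (bl b)" by (simp add: new_def)
  then show "F' z $$ (a, b) = (if a = b then 1 else 0)" using frakG_entry[OF F(2) ab] ab by (simp add: F'_entry)
 qed (simp add: F'_def)
 have U'g: "good_family U' r2"
  unfolding good_family_def
 proof (intro allI impI)
  fix i j assume ij: "1 <= i" "i < j" "j <= k"
  show "U' i j \<in> carrier_mat (r i) (r j) & (\<forall>x<r i. \<forall>y<r j. ereal r2 <= fls_conv_radius (U' i j $$ (x, y)))"
  proof (cases "new i j")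
   case True
   then show ?thesis using PP[OF ij] by (simp add: U'_def PP_def)
  next
   case False
   then show ?thesis using U ij by (simp add: U'_def good_family_def)
  qed
 qed
 have old: "F' z $$ (a, b) = F z $$ (a, b)" if "a < n" "b < n" "bl b - bl a <= d" for a b z
  using that by (simp add: F'_entry new_def)
 have oldU: "AU U' z $$ (a, b) = AU U z $$ (a, b)" if "a < n" "b < n" "bl b - bl a <= d" "z ~= 0" for a b z
  using that by (simp add: AU_entry U'_def new_def)
 have RR: "rest_right (F' w) M i j x y = rest_right (F w) M i j x y"
  if "1 <= i" "i < j" "j <= k" "j - i <= Suc d" "x < r i" "y < r j" for w M i j x y
  unfolding rest_right_def
 proof (rule sum.cong)
  fix c assume "c \<in> {c. c < n & i <= bl c & bl c < j}"
  then have "F' w $$ (offset r i + x, c) = F w $$ (offset r i + x, c)"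
   by (intro old) (use that index_props[of i x] in auto)
  then show "F' w $$ (offset r i + x, c) * M $$ (c, offset r j + y) = F w $$ (offset r i + x, c) * M $$ (c, offset r j + y)" by simp
 qed simp
 have "block_eq F' N U' i j z x y" if z: "z \<in> annulus r1 r2" and ij: "1 <= i" "i < j" "j <= k" and d: "j - i <= Suc d"
  and xy: "x < r i" "y < r j" for i j x y z
 proof -
  have z0: "z ~= 0" using z r12 by auto
  have ik: "i <= k" "1 <= j" using ij by auto
  note P = index_props[OF ij(1) ik(1)] index_props[OF ik(2) ij(3)]
  note Px = P(1-3)[OF xy(1)] P(4-6)[OF xy(2)]
  show ?thesis
  proof (cases "j - i <= d")
   case True
   have b: "blk (F' w) i j x y = blk (F w) i j x y" if "x < r i" "y < r j" for x y w
    unfolding blk_def by (rule old) (use P that True in auto)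
   have "rest_left (AU U' z) (F' z) i j x y = rest_left (AU U z) (F z) i j x y"
    unfolding rest_left_def
   proof (rule sum.cong)
    fix c assume c: "c \<in> {c. c < n & i < bl c & bl c <= j}"
    have "F' z $$ (c, offset r j + y) = F z $$ (c, offset r j + y)" by (rule old) (use c Px True in auto)
    moreover have "AU U' z $$ (offset r i + x, c) = AU U z $$ (offset r i + x, c)" by (rule oldU) (use c Px True z0 in auto)
    ultimately show "AU U' z $$ (offset r i + x, c) * F' z $$ (c, offset r j + y) = AU U z $$ (offset r i + x, c) * F z $$ (c, offset r j + y)" by simp
   qed simp
   moreover have "rm (r j) (blk (F' (q * z)) i j) (Aa j) x y = rm (r j) (blk (F (q * z)) i j) (Aa j) x y"
    by (rule rm_cong_entry) (rule b[OF xy(1)])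
   moreover have "lm (r i) (Aa i) (blk (F' z) i j) x y = lm (r i) (Aa i) (blk (F z) i j) x y"
    by (rule lm_cong_entry) (rule b[OF _ xy(2)])
   ultimately show ?thesis using eq[OF z ij True xy] RR[OF ij d xy] unfolding block_eq_def by simp
  next
   case False
   then have new: "new i j" using ij d by (simp add: new_def)
   have b: "blk (F' w) i j x y = \<phi> i j x y w" if "x < r i" "y < r j" for x y w
    unfolding blk_def using P that new by (simp add: F'_entry)
   have "rest_left (AU U' z) (F' z) i j x y =
     (\<Sum>c\<in>{c. c < n & bl c = j} \<union> {c. c < n & i < bl c & bl c < j}. AU U' z $$ (offset r i + x, c) * F' z $$ (c, offset r j + y))"
    unfolding rest_left_def by (rule sum.cong) (use ij in auto)
   also have "... = (\<Sum>c\<in>{c. c < n & bl c = j}. AU U' z $$ (offset r i + x, c) * F' z $$ (c, offset r j + y)) +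
     (\<Sum>c\<in>{c. c < n & i < bl c & bl c < j}. AU U' z $$ (offset r i + x, c) * F' z $$ (c, offset r j + y))"
    by (rule sum.union_disjoint) auto
   also have "(\<Sum>c\<in>{c. c < n & i < bl c & bl c < j}. AU U' z $$ (offset r i + x, c) * F' z $$ (c, offset r j + y)) = S i j x y z"
    unfolding S_def
   proof (rule sum.cong)
    fix c assume c: "c \<in> {c. c < n & i < bl c & bl c < j}"
    have "F' z $$ (c, offset r j + y) = F z $$ (c, offset r j + y)" by (rule old) (use c Px d in auto)
    moreover have "AU U' z $$ (offset r i + x, c) = AU U z $$ (offset r i + x, c)" by (rule oldU) (use c Px d z0 in auto)
    ultimately show "AU U' z $$ (offset r i + x, c) * F' z $$ (c, offset r j + y) = AU U z $$ (offset r i + x, c) * F z $$ (c, offset r j + y)" by simp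
   qed simp
   also have "(\<Sum>c\<in>{c. c < n & bl c = j}. AU U' z $$ (offset r i + x, c) * F' z $$ (c, offset r j + y)) =
     (\<Sum>c\<in>{c. c < n & bl c = j}. if c = offset r j + y then AU U' z $$ (offset r i + x, c) else 0)"
   proof (rule sum.cong)
    fix c assume c: "c \<in> {c. c < n & bl c = j}"
    then show "AU U' z $$ (offset r i + x, c) * F' z $$ (c, offset r j + y) = (if c = offset r j + y then AU U' z $$ (offset r i + x, c) else 0)"
     using frakG_entry[OF F'g, of c "offset r j + y"] Px by simp
   qed simp
   also have "... = AU U' z $$ (offset r i + x, offset r j + y)"
    using Px by (subst sum.delta) auto
   also have "... = eval_fls (u i j x y) z"
    unfolding AU_entry[OF Px(1,4) z0] using Px ij new xy by (simp add: U'_def)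
   finally have RL: "rest_left (AU U' z) (F' z) i j x y = eval_fls (u i j x y) z + S i j x y z" .
   have 1: "rm (r j) (blk (F' (q * z)) i j) (Aa j) x y = rm (r j) (%x y. \<phi> i j x y (q * z)) (Aa j) x y"
    by (rule rm_cong_entry) (rule b[OF xy(1)])
   have 2: "lm (r i) (Aa i) (blk (F' z) i j) x y = lm (r i) (Aa i) (%x y. \<phi> i j x y z) x y"
    by (rule lm_cong_entry) (rule b[OF _ xy(2)])
   have "z powi (- mu j) * rm (r j) (%x y. \<phi> i j x y (q * z)) (Aa j) x y - z powi (- mu i) * lm (r i) (Aa i) (%x y. \<phi> i j x y z) x y + Y i j x y z
     = eval_fls (u i j x y) z"
    using PP[OF ij] z xy unfolding PP_def by blast
   then show ?thesis unfolding block_eq_def RL 1 2 RR[OF ij d xy] Y_def by (simp add: algebra_simps)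
  qed
 qed
 then show ?case using F'h F'g U'g by (intro exI[of _ F'] exI[of _ U']) blast
qed

lemma normal_form:
 assumes r12: "0 <= r1" "r1 < r2"
  and N: "hol_mat (annulus r1 r2) N" "!!z. z \<in> annulus r1 r2 ==> N z \<in> BU" "!!z. z \<in> annulus r1 r2 ==> eqd (N z) (A0 z)"
 obtains F U where "hol_mat {z. r1 < norm z} F" "!!z. F z \<in> frakG k r" "U \<in> families" "radius U r2"
  "!!z. z \<in> annulus r1 r2 ==> F (q * z) * N z = AU U z * F z"
proof -
 obtain F U where F: "hol_mat {z. r1 < norm z} F" "!!z. F z \<in> frakG k r" and U: "good_family U r2"
  and eq: "!!i j x y z. z \<in> annulus r1 r2 ==> 1 <= i ==> i < j ==> j <= k ==> j - i <= k ==> x < r i ==> y < r j ==> block_eq F N U i j z x y"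
  using normal_form_step[OF r12 N(1), of k] by auto
 have r2: "0 < r2" using r12 by simp
 note Ug = good_family[OF U r2]
 show thesis
 proof (rule that[OF F Ug])
  fix z assume z: "z \<in> annulus r1 r2"
  then have z0: "z ~= 0" "norm z < r2" using r12 by auto
  show "F (q * z) * N z = AU U z * F z"
  proof (rule eq_from_blocks[OF F(2) F(2) N(2,3)[OF z] formD(1,2)[OF form_AU[OF Ug(2)] z0]])
   fix i j x y assume a: "1 <= i" "i < j" "j <= k" "x < r i" "y < r j"
   have "block_eq F N U i j z x y" by (rule eq[OF z a(1-3) _ a(4,5)]) (use a in auto)
   then show "z powi (- mu j) * rm (r j) (blk (F (q * z)) i j) (Aa j) x y + rest_right (F (q * z)) (N z) i j x y =
    z powi (- mu i) * lm (r i) (Aa i) (blk (F z) i j) x y + rest_left (AU U z) (F z) i j x y"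
    unfolding block_eq_def .
  qed
 qed
qed

end

context qdiff
begin

lemma sol_unique_down:
 assumes F: "sol V R A0 F" "sol V R A0 F'" and r1: "0 < r1" "r1 * norm q < R"
  and eq: "!!z. z \<in> Pre V ==> r1 < norm z ==> norm z < R ==> F z = F' z"
  and z: "z \<in> Pre V" "norm z < R"
 shows "F z = F' z"
proof -
 have "r1 < norm (q ^ m * z) ==> z \<in> Pre V ==> norm z < R ==> F z = F' z" for m z
 proof (induction m arbitrary: z)
  case 0 then show ?case using eq[of z] by simp
 next
  case (Suc m)
  show ?case
  proof (cases "r1 < norm z")
   case True then show ?thesis using eq Suc.prems by simp
  next
   case False
   have "norm (q * z) = norm q * norm z" by (rule norm_mult)
   also have "... <= norm q * r1" using False by (intro mult_left_mono) auto
   also have "... = r1 * norm q" by (rule mult.commute)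
   also have "... < R" by (rule r1(2))
   finally have qz: "norm (q * z) < R" .
   have IH: "F (q * z) = F' (q * z)"
    by (rule Suc.IH) (use Suc.prems qz in \<open>simp_all add: mult_ac\<close>)
   have z0: "z ~= 0" using Suc.prems by (auto simp: Pre_def)
   note car = sol_carrier[OF F(1) Suc.prems(2,3)] sol_carrier[OF F(2) Suc.prems(2,3)]
   have "A0 z * F z = A0 z * F' z"
    using solD(3)[OF F(1) Suc.prems(2) qz] solD(3)[OF F(2) Suc.prems(2) qz] IH by simp
   then have "A0i z * (A0 z * F z) = A0i z * (A0 z * F' z)" by simp
   then show ?thesis
    unfolding cancel_inverses[OF A0i_carrier A0_carrier A0_inverse(2)[OF z0] car(1)]
     cancel_inverses[OF A0i_carrier A0_carrier A0_inverse(2)[OF z0] car(2)] .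
  qed
 qed
 moreover have "\<exists>m. r1 < norm (q ^ m * z)"
 proof -
  have "z ~= 0" using z by (auto simp: Pre_def)
  moreover obtain m where "norm q ^ m > r1 / norm z" using real_arch_pow[OF q] by blast
  ultimately show ?thesis by (auto simp: norm_mult norm_power divide_less_eq)
 qed
 ultimately show ?thesis using z by blast
qed

lemma cocycle_representatives:
 assumes coc: "(I, V, g) \<in> cocycles" and eps: "0 < eps"
 obtains \<gamma> where "!!a b. a \<in> I ==> b \<in> I ==> g a b = cls (V a Int V b) (\<gamma> a b)"
  "!!a b. a \<in> I ==> b \<in> I ==> sol (V a Int V b) eps A0 (\<gamma> a b)"
  "!!a b c z. a \<in> I ==> b \<in> I ==> c \<in> I ==> z \<in> Pre (V a Int V b Int V c) ==> norm z < eps ==> \<gamma> a b z * \<gamma> b c z = \<gamma> a c z"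
proof -
 have cov: "open_covering (Eq_top q) I V" and car: "!!a b. a \<in> I ==> b \<in> I ==> g a b \<in> carrier (\<Lambda> (V a Int V b))"
  using coc by (auto simp: cech_cocycles_def)
 have coc': "Lambda_res q (V a Int V b) (V a Int V b Int V c) (g a b) \<otimes>\<^bsub>\<Lambda> (V a Int V b Int V c)\<^esub>
   Lambda_res q (V b Int V c) (V a Int V b Int V c) (g b c) = Lambda_res q (V a Int V c) (V a Int V b Int V c) (g a c)"
  if "a \<in> I" "b \<in> I" "c \<in> I" for a b c
  using coc that by (simp add: cech_cocycles_def Let_def)
 define \<gamma> where "\<gamma> a b = (SOME \<gamma>. g a b = cls (V a Int V b) \<gamma> & sol (V a Int V b) eps A0 \<gamma>)" for a b
 have \<gamma>: "g a b = cls (V a Int V b) (\<gamma> a b)" "sol (V a Int V b) eps A0 (\<gamma> a b)" if "a \<in> I" "b \<in> I" for a b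
 proof -
  have "\<exists>\<gamma>. g a b = cls (V a Int V b) \<gamma> & sol (V a Int V b) eps A0 \<gamma>"
   using car[OF that] Lambda_carrier[OF openin_Int_cover[OF cov that] eps] by blast
  from someI_ex[OF this] show "g a b = cls (V a Int V b) (\<gamma> a b)" "sol (V a Int V b) eps A0 (\<gamma> a b)"
   unfolding \<gamma>_def by blast+
 qed
 have "\<gamma> a b z * \<gamma> b c z = \<gamma> a c z"
  if abc: "a \<in> I" "b \<in> I" "c \<in> I" and z: "z \<in> Pre (V a Int V b Int V c)" "norm z < eps" for a b c z
 proof -
  let ?T = "V a Int V b Int V c"
  note op = openin_Int_cover[OF cov]
  have T: "openin (Eq_top q) ?T" using op[OF abc(1,2)] cov abc by (auto simp: open_covering_def)
  have res: "Lambda_res q (V a Int V b) ?T (cls (V a Int V b) F) = cls ?T F"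
   "Lambda_res q (V b Int V c) ?T (cls (V b Int V c) F) = cls ?T F"
   "Lambda_res q (V a Int V c) ?T (cls (V a Int V c) F) = cls ?T F" for F
   by (rule Lambda_res_cls[OF op T]; use abc in blast)+
  have "cls ?T (%z. \<gamma> a b z * \<gamma> b c z) = cls ?T (\<gamma> a c)"
   using coc'[OF abc] unfolding \<gamma>(1)[OF abc(1,2)] \<gamma>(1)[OF abc(2,3)] \<gamma>(1)[OF abc(1,3)] res Lambda_mult[OF T] .
  then obtain W where W: "sector q W" "horizon q W = ?T" "!!z. z \<in> W ==> \<gamma> a b z * \<gamma> b c z = \<gamma> a c z"
   by (rule cls_eqD[OF T]) blast
  have s: "sol ?T eps A0 (\<gamma> a b)" "sol ?T eps A0 (\<gamma> b c)" "sol ?T eps A0 (\<gamma> a c)"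
   by (rule sol_subset[OF \<gamma>(2)]; use abc in blast)+
  show ?thesis by (rule sol_unique[OF T sol_mult[OF s(1,2) form_A0] s(3) form_A0 W z])
 qed
 then show thesis using that \<gamma> by blast
qed

lemma Pre_cover: "open_covering (Eq_top q) I V ==> - {0} \<subseteq> (\<Union>a\<in>I. Pre (V a))"
proof
 fix z :: complex assume c: "open_covering (Eq_top q) I V" and "z \<in> - {0}"
 then have z: "z ~= 0" "Eq_proj q z \<in> carrier (Eq q)" by (auto simp: carrier_Eq)
 then have "Eq_proj q z \<in> (\<Union>a\<in>I. V a)" using c by (simp add: open_covering_def topspace_Eq_top)
 then show "z \<in> (\<Union>a\<in>I. Pre (V a))" using z by (auto simp: Pre_def)
qed

text \<open>The radii are chosen so that the thin annulus and its image under \<open>q\<close> both lie in the annulus where the Cousin problem is solved.\<close>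

theorem cocycle_trivialised:
 assumes coc: "d \<in> cocycles"
 shows "\<exists>U\<in>families. trivialised d U"
proof -
 obtain I V g where d: "d = (I, V, g)" by (cases d)
 have cov: "open_covering (Eq_top q) I V" using coc by (auto simp: d cech_cocycles_def)
 define \<rho> where "\<rho> = 2 * norm q"
 define R where "R = norm q * \<rho>"
 define eps where "eps = R * 2 ^ k"
 have \<rho>: "1 < \<rho>" "0 < \<rho>" "\<rho> < R" "1 < R" "0 < eps" "R <= eps" "norm q < \<rho>" "norm q < R"
 proof -
  show 1: "1 < \<rho>" "0 < \<rho>" "norm q < \<rho>" using q by (auto simp: \<rho>_def)
  then have "1 * \<rho> < norm q * \<rho>" using q by (intro mult_strict_right_mono) auto
  then show 2: "\<rho> < R" by (simp add: R_def)
  then show 3: "1 < R" "norm q < R" using 1 by auto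
  have "R * 1 <= R * 2 ^ k" using 3 by (intro mult_left_mono) auto
  then show "R <= eps" "0 < eps" using 3 by (auto simp: eps_def)
 qed
 obtain \<gamma> where \<gamma>: "!!a b. a \<in> I ==> b \<in> I ==> g a b = cls (V a Int V b) (\<gamma> a b)"
  "!!a b. a \<in> I ==> b \<in> I ==> sol (V a Int V b) eps A0 (\<gamma> a b)"
  "!!a b c z. a \<in> I ==> b \<in> I ==> c \<in> I ==> z \<in> Pre (V a Int V b Int V c) ==> norm z < eps ==> \<gamma> a b z * \<gamma> b c z = \<gamma> a c z"
  using coc unfolding d by (rule cocycle_representatives[OF _ \<rho>(5)]) blast
 have opP: "open (Pre (V a))" if "a \<in> I" for a using cov that by (auto simp: open_covering_def openin_Eq_iff)
 have "\<exists>f. (\<forall>a\<in>I. hol_mat (Pre (V a) Int annulus 1 R) (f a)) & (\<forall>a\<in>I. \<forall>z. f a z \<in> frakG k r) &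
  (\<forall>a\<in>I. \<forall>b\<in>I. \<forall>z \<in> Pre (V a) Int Pre (V b) Int annulus 1 R. f b z = f a z * \<gamma> a b z)"
 proof (rule unipotent_Cousin[OF opP Pre_cover[OF cov], of 1 R \<gamma>])
  show "\<gamma> a b z \<in> frakG k r" if "a \<in> I" "b \<in> I" "z \<in> Pre (V a) Int Pre (V b) Int annulus 0 (R * 2 ^ k)" for a b z
   by (rule solD(1)[OF \<gamma>(2)[OF that(1,2)]]) (use that in \<open>auto simp: eps_def\<close>)
  show "hol_mat (Pre (V a) Int Pre (V b) Int annulus 0 (R * 2 ^ k)) (\<gamma> a b)" if "a \<in> I" "b \<in> I" for a b
   by (rule hol_mat_subset[OF solD(2)[OF \<gamma>(2)[OF that]]]) (auto simp: eps_def)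
  show "\<gamma> a b z * \<gamma> b c z = \<gamma> a c z"
   if "a \<in> I" "b \<in> I" "c \<in> I" "z \<in> Pre (V a) Int Pre (V b) Int Pre (V c) Int annulus 0 (R * 2 ^ k)" for a b c z
   by (rule \<gamma>(3)) (use that in \<open>auto simp: eps_def\<close>)
  show "\<exists>f. (\<forall>a\<in>I. hol_mat (Pre (V a) Int annulus 1 R) (f a)) & (\<forall>a\<in>I. \<forall>z. f a z \<in> frakG k r) &
   (\<forall>a\<in>I. \<forall>b\<in>I. \<forall>z \<in> Pre (V a) Int Pre (V b) Int annulus 1 R. f b z = f a z * \<gamma> a b z)"
   if "!!a. a \<in> I ==> hol_mat (Pre (V a) Int annulus 1 R) (f a)" "!!a z. a \<in> I ==> f a z \<in> frakG k r"
    "!!a b z. a \<in> I ==> b \<in> I ==> z \<in> Pre (V a) Int Pre (V b) Int annulus 1 R ==> f b z = f a z * \<gamma> a b z" for f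
   by (intro exI[of _ f] conjI ballI allI that)
 qed (use \<rho> in auto)
 then obtain f where f0: "\<forall>a\<in>I. hol_mat (Pre (V a) Int annulus 1 R) (f a)" "\<forall>a\<in>I. \<forall>z. f a z \<in> frakG k r"
  "\<forall>a\<in>I. \<forall>b\<in>I. \<forall>z \<in> Pre (V a) Int Pre (V b) Int annulus 1 R. f b z = f a z * \<gamma> a b z"
  by (elim exE conjE) (rule that)
 have f: "!!a. a \<in> I ==> hol_mat (Pre (V a) Int annulus 1 R) (f a)" "!!a z. a \<in> I ==> f a z \<in> frakG k r"
  "!!a b z. a \<in> I ==> b \<in> I ==> z \<in> Pre (V a) Int Pre (V b) Int annulus 1 R ==> f b z = f a z * \<gamma> a b z"
  using f0 by blast+
 have fc: "f a z \<in> carrier_mat n n" "minv (f a z) \<in> carrier_mat n n" "f a z * minv (f a z) = 1\<^sub>m n" "minv (f a z) * f a z = 1\<^sub>m n"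
  if "a \<in> I" for a z
  using frakG_carrier[OF f(2)[OF that]] frakG_minv[OF f(2)[OF that]] by auto
 have qz: "norm (q * z) < R" "1 < norm (q * z)" "norm z < R" "norm z < eps" "norm (q * z) < eps" "z ~= 0" if "z \<in> annulus 1 \<rho>" for z
 proof -
  have "norm q * norm z < norm q * \<rho>" using that q by (intro mult_strict_left_mono) auto
  then show "norm (q * z) < R" by (simp add: norm_mult R_def)
  then show "norm (q * z) < eps" using \<rho>(6) by linarith
  show "1 < norm (q * z)" "norm z < R" "norm z < eps" "z ~= 0" using that norm_le_mult_q[of z] \<rho> by auto
 qed
 \<comment> \<open>The matrices \<open>f\<^sub>a(q z) A\<^sub>0(z) f\<^sub>a(z)\<close> inverse agree on overlaps, because the cocycle commutes with \<open>A\<^sub>0\<close>.\<close>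
 define Na where "Na a z = f a (q * z) * A0 z * minv (f a z)" for a z
 have agree: "Na b z = Na a z" if ab: "a \<in> I" "b \<in> I" and z: "z \<in> Pre (V a)" "z \<in> Pre (V b)" "z \<in> annulus 1 \<rho>" for a b z
 proof -
  have zz: "z \<in> Pre (V a) Int Pre (V b) Int annulus 1 R" "q * z \<in> Pre (V a) Int Pre (V b) Int annulus 1 R"
   using z qz[OF z(3)] by auto
  have zi: "z \<in> Pre (V a Int V b)" "q * z \<in> Pre (V a Int V b)" using z by auto
  note s = \<gamma>(2)[OF ab]
  note car = sol_carrier[OF s zi(1) qz(4)[OF z(3)]] sol_carrier[OF s zi(2) qz(5)[OF z(3)]]
   fc[OF ab(1), of z] fc[OF ab(1), of "q * z"] fc[OF ab(2), of z]
  have "Na a z * f b z = f a (q * z) * A0 z * (minv (f a z) * (f a z * \<gamma> a b z))"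
   unfolding Na_def f(3)[OF ab zz(1)] using car by (simp add: mat_simps)
  also have "... = f a (q * z) * (A0 z * \<gamma> a b z)"
   unfolding cancel_inverses[OF car(4,3,6,1)] using car by (simp add: mat_simps)
  also have "... = f a (q * z) * (\<gamma> a b (q * z) * A0 z)"
   using solD(3)[OF s zi(1) qz(5)[OF z(3)]] by simp
  also have "... = f b (q * z) * A0 z"
   unfolding f(3)[OF ab zz(2)] using car by (simp add: mat_simps)
  finally have e: "Na a z * f b z = f b (q * z) * A0 z" .
  have Nc: "Na a z \<in> carrier_mat n n" unfolding Na_def using car by (simp add: mat_simps)
  have "Na b z = Na a z * f b z * minv (f b z)" unfolding e by (simp add: Na_def)
  also have "... = Na a z" using Nc fc[OF ab(2), of z] by (simp add: mat_simps)
  finally show ?thesis .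
 qed
 define N where "N z = Na (SOME a. a \<in> I & z \<in> Pre (V a)) z" for z
 have N: "N z = Na a z" if "a \<in> I" "z \<in> Pre (V a)" "z \<in> annulus 1 \<rho>" for a z
 proof -
  have "\<exists>a. a \<in> I & z \<in> Pre (V a)" using that by blast
  note b = someI_ex[OF this]
  show ?thesis unfolding N_def by (rule agree[OF that(1) b[THEN conjunct1] that(2) b[THEN conjunct2] that(3)])
 qed
 have "annulus 1 \<rho> \<subseteq> (\<Union>a\<in>I. Pre (V a))" by (rule subset_trans[OF _ Pre_cover[OF cov]]) auto
 then have ann: "annulus 1 \<rho> = (\<Union>a\<in>I. Pre (V a) Int annulus 1 \<rho>)"
  by blast
 have hN: "hol_mat (annulus 1 \<rho>) N"
 proof (subst ann, rule hol_mat_UN)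
  fix a assume a: "a \<in> I"
  show "open (Pre (V a) Int annulus 1 \<rho>)" by (intro open_Int opP a open_annulus)
  have "hol_mat (Pre (V a) Int annulus 1 \<rho>) (Na a)"
   unfolding Na_def[abs_def]
  proof (intro hol_mat_mult hol_A0 hol_mat_minv)
   show "hol_mat (Pre (V a) Int annulus 1 \<rho>) (%z. f a (q * z))"
    by (rule hol_mat_compose_scale[OF f(1)[OF a]]) (use qz in auto)
   show "hol_mat (Pre (V a) Int annulus 1 \<rho>) (f a)"
    by (rule hol_mat_subset[OF f(1)[OF a]]) (use \<rho> in auto)
  qed (use fc[OF a] f(2)[OF a] in \<open>auto intro: mult_carrier_mat[of _ n n _ n]\<close>)
  then show "hol_mat (Pre (V a) Int annulus 1 \<rho>) N"
   by (rule hol_mat_cong) (use N[OF a] in auto)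
 qed
 have NB: "N z \<in> BU" "eqd (N z) (A0 z)" if z: "z \<in> annulus 1 \<rho>" for z
 proof -
  obtain a where a: "a \<in> I" "z \<in> Pre (V a)" using z ann by auto
  have m: "minv (f a z) \<in> frakG k r" by (rule minv_frakG[OF f(2)[OF a(1)]])
  have B: "f a (q * z) \<in> BU" "minv (f a z) \<in> BU" "eqd (f a (q * z)) (1\<^sub>m n)" "eqd (minv (f a z)) (1\<^sub>m n)"
   using f(2)[OF a(1), of "q * z"] m by (auto simp: frakG_iff)
  show "N z \<in> BU" unfolding N[OF a z] Na_def by (intro BU_mult B A0_BU)
  have "eqd (Na a z) (1\<^sub>m n * A0 z * 1\<^sub>m n)"
   unfolding Na_def by (intro eqd_mult BU_mult B A0_BU BU_one eqd_refl)
  then show "eqd (N z) (A0 z)" unfolding N[OF a z] by (simp add: left_mult_one_mat[OF A0_carrier] right_mult_one_mat[OF A0_carrier])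
 qed
 obtain F U where F: "hol_mat {z. 1 < norm z} F" "!!z. F z \<in> frakG k r" and U: "U \<in> families" "radius U \<rho>"
  and FN: "!!z. z \<in> annulus 1 \<rho> ==> F (q * z) * N z = AU U z * F z"
  using normal_form[of 1 \<rho> N, OF _ \<rho>(1) hN NB] by auto
 note Fc = frakG_carrier[OF F(2)]
 define Q where "Q a h \<longleftrightarrow> sol (V a) R (AU U) h & (\<forall>z \<in> Pre (V a) Int annulus 1 R. h z = F z * f a z)" for a h
 have "\<exists>h. Q a h" if a: "a \<in> I" for a
 proof -
  have opV: "openin (Eq_top q) (V a)" using cov a by (auto simp: open_covering_def)
  show ?thesis
  proof (rule sol_extend_down[OF opV form_AU[OF U(2)], of 1 R "%z. F z * f a z"])
   show "hol_mat (Pre (V a) Int annulus 1 R) (%z. F z * f a z)"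
    by (intro hol_mat_mult f(1)[OF a] hol_mat_subset[OF F(1)]) (use Fc fc(1)[OF a] in auto)
   show "F z * f a z \<in> frakG k r" for z by (intro frakG_mult F f a)
   fix z assume z: "z \<in> Pre (V a)" "1 < norm z" "norm (q * z) < R"
   have "norm q * norm z < norm q * \<rho>" using z(3) by (simp add: norm_mult R_def)
   then have zT: "z \<in> annulus 1 \<rho>" using z(2) by simp
   have z0: "z ~= 0" "norm z < \<rho>" using zT by auto
   note AUc = formD(3)[OF form_AU[OF U(2)] z0]
   note car = Fc[of z] Fc[of "q * z"] fc[OF a, of z] fc(1)[OF a, of "q * z"] AUc
   have "f a (q * z) * A0 z = N z * f a z"
    unfolding N[OF a z(1) zT] Na_def using car by (simp add: mat_simps)
   then have "F (q * z) * f a (q * z) * A0 z = F (q * z) * (N z * f a z)"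
    using car by (simp add: mat_simps)
   also have "... = (F (q * z) * N z) * f a z"
    using car BU_carrier[OF NB(1)[OF zT]] by (simp add: mat_simps)
   also have "... = AU U z * (F z * f a z)" unfolding FN[OF zT] using car by (simp add: mat_simps)
   finally show "F (q * z) * f a (q * z) * A0 z = AU U z * (F z * f a z)" .
  next
   fix F' assume "sol (V a) R (AU U) F'" "!!z. z \<in> Pre (V a) Int annulus 1 R ==> F' z = F z * f a z"
   then show "\<exists>h. Q a h" unfolding Q_def by blast
  qed (use \<rho> in \<open>auto simp: R_def\<close>)
 qed
 then obtain h where Q: "!!a. a \<in> I ==> Q a (h a)" by metis
 have h: "!!a. a \<in> I ==> sol (V a) R (AU U) (h a)"
  "!!a z. a \<in> I ==> z \<in> Pre (V a) Int annulus 1 R ==> h a z = F z * f a z"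
  using Q unfolding Q_def by blast+
 have hs: "sol T \<rho> (AU U) (h a)" if "a \<in> I" "T \<subseteq> V a" for a T
  by (rule sol_subset[OF h(1)[OF that(1)] that(2)]) (use \<rho> in simp)
 have "g a b = cls (V a Int V b) (%z. minv (h a z) * h b z)" if ab: "a \<in> I" "b \<in> I" for a b
  unfolding \<gamma>(1)[OF ab]
 proof (rule cls_sol_cong[OF openin_Int_cover[OF cov ab] \<rho>(2)])
  fix z assume z: "z \<in> Pre (V a Int V b)" "norm z < \<rho>"
  have g': "sol (V a Int V b) \<rho> A0 (\<gamma> a b)" by (rule sol_subset[OF \<gamma>(2)[OF ab]]) (use \<rho> in auto)
  have ha: "sol (V a Int V b) \<rho> (AU U) (h a)" "sol (V a Int V b) \<rho> (AU U) (h b)" by (rule hs; use ab in auto)+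
  show "\<gamma> a b z = minv (h a z) * h b z"
  proof (rule sol_unique_down[OF g' sol_quotient[OF ha form_AU[OF U(2)]] _ _ _ z])
   fix w assume w: "w \<in> Pre (V a Int V b)" "1 < norm w" "norm w < \<rho>"
   then have w': "w \<in> Pre (V a) Int annulus 1 R" "w \<in> Pre (V b) Int annulus 1 R" "w \<in> Pre (V a) Int Pre (V b) Int annulus 1 R"
    using \<rho> by auto
   note hg = solD(1)[OF ha(1) w(1,3)]
   note gc = sol_carrier[OF g' w(1,3)]
   have "h b w = h a w * \<gamma> a b w"
    unfolding h(2)[OF ab(2) w'(2)] h(2)[OF ab(1) w'(1)] f(3)[OF ab w'(3)]
    using gc Fc[of w] fc(1)[OF ab(1), of w] by (simp add: mat_simps)
   then show "\<gamma> a b w = minv (h a w) * h b w"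
    using cancel_inverses[OF frakG_minv(1)[OF hg] frakG_carrier[OF hg] frakG_minv(3)[OF hg] gc] by simp
  qed (use \<rho> in auto)
 qed
 then have "trivialised d U"
  unfolding trivialised_def d prod.case using U(2) hs by (intro exI[of _ \<rho>] exI[of _ h]) auto
 then show ?thesis using U(1) by blast
qed

end

section \<open>Theta functions of divisors\<close>

context q_base
begin

lemma comm_group_Cstar: "comm_group Cstar"
proof (rule comm_groupI)
 show "\<exists>y\<in>carrier Cstar. y \<otimes>\<^bsub>Cstar\<^esub> x = \<one>\<^bsub>Cstar\<^esub>" if "x \<in> carrier Cstar" for x
  using that by (intro bexI[of _ "inverse x"]) (auto simp: Cstar_def)
qed (auto simp: Cstar_def)

lemma qZ_subgroup: "subgroup (qZ q) Cstar"
proof -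
 interpret G: comm_group Cstar by (rule comm_group_Cstar)
 show ?thesis
 proof (rule G.subgroupI)
  fix a assume "a \<in> qZ q"
  then obtain m where m: "a = q powi m" by (auto simp: qZ_def)
  have "inv\<^bsub>Cstar\<^esub> a = q powi (- m)"
   by (rule G.inv_equality) (auto simp: Cstar_def m power_int_minus)
  then show "inv\<^bsub>Cstar\<^esub> a \<in> qZ q" by (simp add: qZ_def)
 next
  fix a b assume "a \<in> qZ q" "b \<in> qZ q"
  then obtain m m' where "a = q powi m" "b = q powi m'" by (auto simp: qZ_def)
  then have "a \<otimes>\<^bsub>Cstar\<^esub> b = q powi (m + m')" by (simp add: Cstar_def power_int_add)
  then show "a \<otimes>\<^bsub>Cstar\<^esub> b \<in> qZ q" by (simp add: qZ_def)
 qed (auto simp: qZ_def Cstar_def)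
qed

lemma comm_group_Eq: "comm_group (Eq q)"
 unfolding Eq_def by (rule comm_group.abelian_FactGroup[OF comm_group_Cstar qZ_subgroup])

lemma Eq_proj_times:
 assumes "a ~= 0" "b ~= 0"
 shows "Eq_proj q a \<otimes>\<^bsub>Eq q\<^esub> Eq_proj q b = Eq_proj q (a * b)"
proof -
 interpret N: normal "qZ q" Cstar by (rule comm_group.subgroup_imp_normal[OF comm_group_Cstar qZ_subgroup])
 show ?thesis
  using N.rcos_sum[of a b] assms by (simp add: Eq_def FactGroup_def Eq_proj_def Cstar_def)
qed

lemma Eq_proj_1: "Eq_proj q 1 = \<one>\<^bsub>Eq q\<^esub>"
proof -
 interpret G: comm_group Cstar by (rule comm_group_Cstar)
 have "qZ q #>\<^bsub>Cstar\<^esub> \<one>\<^bsub>Cstar\<^esub> = qZ q"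
  by (rule G.coset_mult_one) (auto simp: qZ_def Cstar_def)
 then show ?thesis by (simp add: Eq_proj_def Eq_def FactGroup_def Cstar_def)
qed

lemma Eq_proj_carrier: "z ~= 0 ==> Eq_proj q z \<in> carrier (Eq q)"
 by (auto simp: carrier_Eq)

lemma Eq_proj_nat_pow: "a ~= 0 ==> Eq_proj q a [^]\<^bsub>Eq q\<^esub> (m :: nat) = Eq_proj q (a ^ m)"
proof (induction m)
 case 0 then show ?case by (simp add: Eq_proj_1)
next
 case (Suc m)
 have "a ^ m ~= 0" using Suc.prems by simp
 from Eq_proj_times[OF this Suc.prems] show ?case using Suc by (simp add: mult.commute)
qed

definition rep :: "complex set => complex" where
 "rep \<alpha> = (SOME z. z ~= 0 & Eq_proj q z = \<alpha>)"

lemma rep: "\<alpha> \<in> carrier (Eq q) ==> rep \<alpha> ~= 0" "\<alpha> \<in> carrier (Eq q) ==> Eq_proj q (rep \<alpha>) = \<alpha>"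
proof -
 assume "\<alpha> \<in> carrier (Eq q)"
 then have "\<exists>z. z ~= 0 & Eq_proj q z = \<alpha>" by (auto simp: carrier_Eq)
 from someI_ex[OF this] show "rep \<alpha> ~= 0" "Eq_proj q (rep \<alpha>) = \<alpha>" unfolding rep_def by auto
qed

lemma rep_prod_nonzero: "set_mset D \<subseteq> carrier (Eq q) ==> (\<Prod>\<alpha>\<in>#D. rep \<alpha>) ~= 0"
 by (induction D) (auto simp: rep)

lemma ev_Eq_rep:
 assumes D: "set_mset D \<subseteq> carrier (Eq q)"
 shows "ev_Eq q D = Eq_proj q (\<Prod>\<alpha>\<in>#D. rep \<alpha>)"
proof -
 interpret E: comm_group "Eq q" by (rule comm_group_Eq)
 have "finite S ==> S \<subseteq> carrier (Eq q) ==> (\<Prod>\<alpha>\<in>S. rep \<alpha> ^ f \<alpha>) ~= 0 &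
   finprod (Eq q) (%\<alpha>. \<alpha> [^]\<^bsub>Eq q\<^esub> f \<alpha>) S = Eq_proj q (\<Prod>\<alpha>\<in>S. rep \<alpha> ^ f \<alpha>)" for f :: "complex set => nat" and S
 proof (induction S rule: finite_induct)
  case empty then show ?case by (simp add: Eq_proj_1)
 next
  case (insert \<alpha> S)
  then have a: "\<alpha> \<in> carrier (Eq q)" "S \<subseteq> carrier (Eq q)" by auto
  note IH = insert.IH[OF a(2)]
  have "\<alpha> [^]\<^bsub>Eq q\<^esub> f \<alpha> = Eq_proj q (rep \<alpha>) [^]\<^bsub>Eq q\<^esub> f \<alpha>" using rep(2)[OF a(1)] by simp
  also have "... = Eq_proj q (rep \<alpha> ^ f \<alpha>)" by (rule Eq_proj_nat_pow[OF rep(1)[OF a(1)]])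
  finally have p: "\<alpha> [^]\<^bsub>Eq q\<^esub> f \<alpha> = Eq_proj q (rep \<alpha> ^ f \<alpha>)" .
  have "finprod (Eq q) (%\<alpha>. \<alpha> [^]\<^bsub>Eq q\<^esub> f \<alpha>) (insert \<alpha> S) =
    \<alpha> [^]\<^bsub>Eq q\<^esub> f \<alpha> \<otimes>\<^bsub>Eq q\<^esub> finprod (Eq q) (%\<alpha>. \<alpha> [^]\<^bsub>Eq q\<^esub> f \<alpha>) S"
   by (rule E.finprod_insert[OF insert.hyps]) (use a in auto)
  also have "... = Eq_proj q (rep \<alpha> ^ f \<alpha> * (\<Prod>\<alpha>\<in>S. rep \<alpha> ^ f \<alpha>))"
   unfolding p IH[THEN conjunct2] by (rule Eq_proj_times) (use IH rep(1)[OF a(1)] in auto)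
  finally show ?case using IH rep(1)[OF a(1)] insert.hyps by simp
 qed
 from this[OF _ D, of "count D"] show ?thesis
  by (simp add: ev_Eq_def image_prod_mset_multiplicity)
qed

text \<open>The function with divisor \<open>D\<close>, up to the choice of representatives of the points.\<close>

definition theta :: "complex set multiset => complex => complex" where
 "theta D z = (\<Prod>\<alpha>\<in>#D. Theta (z / rep \<alpha>))"

definition theta_factor :: "complex set multiset => complex" where
 "theta_factor D = (-1) ^ size D / (\<Prod>\<alpha>\<in>#D. rep \<alpha>)"

lemma theta_add: "theta (D + D') z = theta D z * theta D' z"
 by (simp add: theta_def)

lemma theta_empty [simp]: "theta {#} z = 1"
 by (simp add: theta_def)

lemma theta_factor_nonzero: "set_mset D \<subseteq> carrier (Eq q) ==> theta_factor D ~= 0"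
 using rep_prod_nonzero by (simp add: theta_factor_def)

lemma theta_q:
 assumes "z ~= 0"
 shows "set_mset D \<subseteq> carrier (Eq q) ==> theta D (q * z) = theta_factor D * z ^ size D * theta D z"
proof (induction D)
 case (add \<alpha> D)
 have "Theta (q * z / rep \<alpha>) = - (z / rep \<alpha>) * Theta (z / rep \<alpha>)"
  using Theta_q[of "z / rep \<alpha>"] assms add.prems rep by simp
 then show ?case using add by (simp add: theta_def theta_factor_def)
qed (simp add: theta_def theta_factor_def)

lemma Theta_scaled_holomorphic: "c ~= 0 ==> (%z. Theta (z / c)) holomorphic_on (- {0})"
 by (rule holomorphic_on_compose_gen[OF _ Theta_holomorphic, unfolded o_def]) (auto intro!: holomorphic_intros)

lemma theta_holomorphic: "set_mset D \<subseteq> carrier (Eq q) ==> theta D holomorphic_on (- {0})"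
proof (induction D)
 case (add \<alpha> D)
 then have "(%z. Theta (z / rep \<alpha>) * theta D z) holomorphic_on (- {0})"
  by (intro holomorphic_on_mult Theta_scaled_holomorphic) (auto simp: rep)
 then show ?case by (simp add: theta_def[abs_def])
qed (simp add: theta_def[abs_def])

lemma Theta_scaled_zero_iff:
 assumes "\<alpha> \<in> carrier (Eq q)" "z ~= 0"
 shows "Theta (z / rep \<alpha>) = 0 \<longleftrightarrow> Eq_proj q z = \<alpha>"
proof -
 have "Theta (z / rep \<alpha>) = 0 \<longleftrightarrow> (\<exists>m. z = q powi m * rep \<alpha>)"
  using Theta_zero_iff[of "z / rep \<alpha>"] assms rep(1)[OF assms(1)] by (simp add: field_simps)
 also have "... \<longleftrightarrow> Eq_proj q (rep \<alpha>) = Eq_proj q z" by (rule Eq_proj_eq_iff[symmetric])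
 finally show ?thesis using rep(2)[OF assms(1)] by auto
qed

lemma theta_zero_iff:
 "z ~= 0 ==> set_mset D \<subseteq> carrier (Eq q) ==> theta D z = 0 \<longleftrightarrow> Eq_proj q z \<in># D"
 by (induction D) (auto simp: theta_def Theta_scaled_zero_iff)

lemma Theta_local_factor:
 assumes \<alpha>: "\<alpha> \<in> carrier (Eq q)" and w: "w ~= 0"
 shows "\<exists>u. u analytic_on {w} & u w ~= 0 &
  (\<forall>z. z ~= 0 --> Theta (z / rep \<alpha>) = (z - w) ^ (if Eq_proj q w = \<alpha> then 1 else 0) * u z)"
proof -
 define h where "h z = Theta (z / rep \<alpha>)" for z
 have hol: "h holomorphic_on - {0}" unfolding h_def[abs_def] by (rule Theta_scaled_holomorphic[OF rep(1)[OF \<alpha>]])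
 have op: "open (- {0 :: complex})" by auto
 show ?thesis
 proof (cases "Eq_proj q w = \<alpha>")
  case False
  have "h analytic_on {w}" by (rule holomorphic_on_imp_analytic_at[OF hol op]) (use w in auto)
  then show ?thesis using False Theta_scaled_zero_iff[OF \<alpha> w] by (intro exI[of _ h]) (simp add: h_def)
 next
  case True
  then have hw: "h w = 0" using Theta_scaled_zero_iff[OF \<alpha> w] by (simp add: h_def)
  define u where "u z = (if z = w then deriv h w else (h z - h w) / (z - w))" for z
  have "u holomorphic_on - {0}" unfolding u_def[abs_def] by (rule pole_lemma_open[OF hol op])
  then have "u analytic_on {w}" by (rule holomorphic_on_imp_analytic_at[OF _ op]) (use w in auto)
  moreover have "u w ~= 0"
  proof -
   have r0: "rep \<alpha> ~= 0" by (rule rep(1)[OF \<alpha>])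
   have "(Theta has_field_derivative deriv Theta (w / rep \<alpha>)) (at (w / rep \<alpha>))"
    by (rule holomorphic_derivI[OF Theta_holomorphic op]) (use w r0 in auto)
   then have "(h has_field_derivative deriv Theta (w / rep \<alpha>) * (1 / rep \<alpha>)) (at w)"
    unfolding h_def[abs_def] by (rule DERIV_chain2) (use r0 in \<open>auto intro!: derivative_eq_intros\<close>)
   then have "deriv h w = deriv Theta (w / rep \<alpha>) * (1 / rep \<alpha>)" by (rule DERIV_imp_deriv)
   moreover obtain m where "w / rep \<alpha> = q powi m"
    using Theta_zero_iff[of "w / rep \<alpha>"] hw w r0 by (auto simp: h_def)
   ultimately show ?thesis using deriv_Theta_nonzero[of m] r0 by (simp add: u_def)
  qed
  moreover have "h z = (z - w) * u z" for z using hw by (simp add: u_def)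
  ultimately show ?thesis using True by (intro exI[of _ u]) (auto simp: h_def)
 qed
qed

lemma theta_local_factor:
 assumes w: "w ~= 0"
 shows "set_mset D \<subseteq> carrier (Eq q) ==> \<exists>u. u analytic_on {w} & u w ~= 0 &
  (\<forall>z. z ~= 0 --> theta D z = (z - w) ^ count D (Eq_proj q w) * u z)"
proof (induction D)
 case empty
 then show ?case by (intro exI[of _ "%z. 1"]) auto
next
 case (add \<alpha> D)
 obtain u where u: "u analytic_on {w}" "u w ~= 0" "!!z. z ~= 0 ==> theta D z = (z - w) ^ count D (Eq_proj q w) * u z"
  using add by auto
 obtain v where v: "v analytic_on {w}" "v w ~= 0"
  "!!z. z ~= 0 ==> Theta (z / rep \<alpha>) = (z - w) ^ (if Eq_proj q w = \<alpha> then 1 else 0) * v z"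
  using Theta_local_factor[of \<alpha> w] add.prems w by auto
 have "theta (add_mset \<alpha> D) z = (z - w) ^ count (add_mset \<alpha> D) (Eq_proj q w) * (v z * u z)" if "z ~= 0" for z
 proof -
  have "theta (add_mset \<alpha> D) z = Theta (z / rep \<alpha>) * theta D z" by (simp add: theta_def)
  then show ?thesis unfolding u(3)[OF that] v(3)[OF that] by (simp add: power_add mult_ac)
 qed
 then show ?case using u v by (intro exI[of _ "%z. v z * u z"]) (auto intro: analytic_intros)
qed

lemma theta_eventually_nonzero:
 assumes "w ~= 0" "set_mset D \<subseteq> carrier (Eq q)"
 shows "eventually (%z. theta D z ~= 0) (at w)"
proof -
 obtain u where u: "u analytic_on {w}" "u w ~= 0"
  "!!z. z ~= 0 ==> theta D z = (z - w) ^ count D (Eq_proj q w) * u z"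
  using theta_local_factor[OF assms] by auto
 have "u \<midarrow>w\<rightarrow> u w" using u(1) analytic_at_imp_isCont isContD by blast
 then have "eventually (%z. u z ~= 0) (at w)" by (rule tendsto_imp_eventually_ne) (rule u(2))
 moreover have "eventually (%z. z ~= 0) (at w)" by (rule eventually_neq_at_within)
 moreover have "eventually (%z. z ~= w) (at w)" by (rule eventually_neq_at_within)
 ultimately show ?thesis by eventually_elim (simp add: u(3))
qed

lemma pole_order_divide_theta:
 assumes g: "g analytic_on {w}" and w: "w ~= 0" and D: "set_mset D \<subseteq> carrier (Eq q)"
  and pole: "is_pole (%z. g z / theta D z) w"
 shows "- zorder (%z. g z / theta D z) w <= int (count D (Eq_proj q w))"
proof -
 let ?f = "%z. g z / theta D z" and ?m = "count D (Eq_proj q w)"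
 obtain u where u: "u analytic_on {w}" "u w ~= 0" "!!z. z ~= 0 ==> theta D z = (z - w) ^ ?m * u z"
  using theta_local_factor[OF w D] by auto
 have an: "theta D analytic_on {w}"
  by (rule holomorphic_on_imp_analytic_at[OF theta_holomorphic[OF D]]) (use w in auto)
 have mero: "?f meromorphic_on {w}"
  by (intro meromorphic_on_divide analytic_on_imp_meromorphic_on g an)
 then have iso: "isolated_singularity_at ?f w" "not_essential ?f w"
  by (auto intro: meromorphic_on_isolated_singularity meromorphic_on_not_essential)
 have p: "(%z. (z - w) ^ ?m) analytic_on {w}" by (intro analytic_intros)
 have fne: "eventually (%z. ?f z ~= 0) (at w)" by (rule non_zero_neighbour_pole[OF pole])
 have zw: "eventually (%z. z ~= w) (at w)" by (rule eventually_neq_at_within)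
 have z0: "eventually (%z. z ~= 0) (at w)" by (rule eventually_neq_at_within)
 have ne: "eventually (%z. ?f z * (z - w) ^ ?m ~= 0) (at w)"
  using fne zw by eventually_elim simp
 have "zorder (%z. ?f z * (z - w) ^ ?m) w = zorder ?f w + zorder (%z. (z - w) ^ ?m) w"
  by (rule zorder_times_analytic'[OF iso p]) (rule eventually_frequently[OF trivial_limit_at ne])
 also have "zorder (%z. (z - w) ^ ?m) w = int ?m"
  by (rule zorder_eqI[of UNIV _ "%z. 1"]) (auto simp: power_int_def)
 finally have zo: "zorder (%z. ?f z * (z - w) ^ ?m) w = zorder ?f w + int ?m" .
 have gu: "(%z. g z / u z) analytic_on {w}" by (intro analytic_on_divide g u(1)) (use u(2) in auto)
 have eq: "eventually (%z. ?f z * (z - w) ^ ?m = g z / u z) (at w)"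
  using z0 zw by eventually_elim (simp add: u(3))
 then have "zorder (%z. ?f z * (z - w) ^ ?m) w = zorder (%z. g z / u z) w"
  by (intro zorder_cong refl)
 moreover have "zorder (%z. g z / u z) w >= 0"
 proof (rule zorder_ge_0[OF gu], rule eventually_frequently[OF trivial_limit_at])
  show "eventually (%z. g z / u z ~= 0) (at w)" using eq ne by eventually_elim simp
 qed
 ultimately show ?thesis using zo by linarith
qed

end

section \<open>The meromorphic gauge transformations\<close>

context qdiff
begin

lemma spectrum_nonzero:
 assumes i: "1 <= i" "i <= k" and s: "s \<in> spectrum (A i)"
 shows "s ~= 0"
proof
 assume "s = 0"
 then obtain v where v: "v \<in> carrier_vec (r i)" "v ~= 0\<^sub>v (r i)" "A i *\<^sub>v v = 0 \<cdot>\<^sub>v v"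
  using s A[OF i] by (auto simp: spectrum_def eigenvalue_def eigenvector_def)
 note M = A_minv[OF i]
 have Ai: "A i \<in> carrier_mat (r i) (r i)" using A[OF i] by simp
 have "v = (minv (A i) * A i) *\<^sub>v v" unfolding M(3) using v(1) by simp
 also have "... = minv (A i) *\<^sub>v (A i *\<^sub>v v)" by (rule assoc_mult_mat_vec[OF M(1) Ai v(1)])
 also have "... = 0\<^sub>v (r i)" unfolding v(3) using M(1) v(1) by (intro eq_vecI) (auto simp: scalar_prod_def)
 finally show False using v(2) by simp
qed

abbreviation allowed :: "sum_div set" where
 "allowed \<equiv> allowed_divisors q k mu A"

lemma allowedD:
 assumes D: "D \<in> allowed"
 shows "set_mset (D i j) \<subseteq> carrier (Eq q)"
  "1 <= i ==> i < j ==> j <= k ==> int (size (D i j)) = mu i - mu j"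
  "1 <= i ==> i < l ==> l <= j ==> j <= k ==> D i j = D i l + D l j"
  "\<not> (1 <= i & i < j & j <= k) ==> D i j = {#}"
proof -
 have SD: "summation_divisor q k mu D" using D by (simp add: allowed_divisors_def)
 show 1: "\<not> (1 <= i & i < j & j <= k) ==> D i j = {#}" for i j
  using SD unfolding summation_divisor_def by blast
 show "set_mset (D i j) \<subseteq> carrier (Eq q)"
 proof (cases "1 <= i & i < j & j <= k")
  case True then show ?thesis using SD unfolding summation_divisor_def by blast
 next
  case False then show ?thesis using 1[of i j] by simp
 qed
 show "1 <= i ==> i < j ==> j <= k ==> int (size (D i j)) = mu i - mu j"
  using SD unfolding summation_divisor_def by blast
 show "1 <= i ==> i < l ==> l <= j ==> j <= k ==> D i j = D i l + D l j"
 proof (cases "l = j")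
  case True then show ?thesis using 1[of j j] by simp
 next
  case False
  assume "1 <= i" "i < l" "l <= j" "j <= k"
  then show ?thesis using SD False unfolding summation_divisor_def by simp
 qed
qed

text \<open>A resonance would place the sum of the points of \<open>D\<^sub>i\<^sub>j\<close> in the forbidden set: the multiplier of the theta function is \<open>(-1)\<^sup>\<mu>\<close> divided by the product of the representatives.\<close>

lemma allowed_nonresonant:
 assumes D: "D \<in> allowed" and ij: "1 <= i" "i < j" "j <= k" and s: "s \<in> spectrum (A i)" and t: "t \<in> spectrum (A j)"
 shows "1 / theta_factor (D i j) * q powi m * t ~= s"
proof
 assume eq: "1 / theta_factor (D i j) * q powi m * t = s"
 have t0: "t ~= 0" by (rule spectrum_nonzero[OF _ _ t]) (use ij in auto)
 let ?p = "\<Prod>\<alpha>\<in>#D i j. rep \<alpha>" and ?s = "size (D i j)"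
 have p0: "?p ~= 0" by (rule rep_prod_nonzero[OF allowedD(1)[OF D]])
 have sg: "(-1) powi (mu i - mu j) = ((-1) ^ ?s :: complex)"
  unfolding allowedD(2)[OF D ij, symmetric] by simp
 have sq: "(-1) ^ ?s * (-1) ^ ?s = (1 :: complex)" by (simp flip: power_mult_distrib)
 have "s = ?p * (-1) ^ ?s * q powi m * t"
  unfolding eq[symmetric] theta_factor_def using sq by (simp add: field_simps)
 then have "q powi m * ?p = (-1) ^ ?s * (s / t)" using t0 sq by (simp add: mult_ac)
 then have "Eq_proj q ((-1) powi (mu i - mu j) * (s / t)) = Eq_proj q ?p"
  unfolding sg by (metis Eq_proj_powi)
 then have "ev_Eq q (D i j) = Eq_proj q ((-1) powi (mu i - mu j) * (s / t))"
  using ev_Eq_rep[OF allowedD(1)[OF D]] by simp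
 then have "ev_Eq q (D i j) \<in> {Eq_proj q ((-1) powi (mu i - mu j) * (s / t)) | s t. s \<in> spectrum (A i) & t \<in> spectrum (A j)}"
  using s t by blast
 then show False using D ij unfolding allowed_divisors_def by blast
qed

text \<open>The equation for the numerators \<open>G\<^sub>i\<^sub>j = \<theta>\<^sub>i\<^sub>j F\<^sub>i\<^sub>j\<close>. It has holomorphic coefficients because
 \<open>\<theta>\<^sub>i\<^sub>j = \<theta>\<^sub>i\<^sub>l \<theta>\<^sub>l\<^sub>j\<close>, and it is free of powers of \<open>z\<close> because the degree of \<open>D\<^sub>i\<^sub>j\<close> is \<open>\<mu>\<^sub>i - \<mu>\<^sub>j\<close>.\<close>

definition numerator_eq where
 "numerator_eq D U G i j z x y \<longleftrightarrow>
  1 / theta_factor (D i j) * rm (r j) (blk (G (q * z)) i j) (Aa j) x y - lm (r i) (Aa i) (blk (G z) i j) x y =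
  z powi mu i * (\<Sum>c | c < n & i < bl c & bl c <= j. AU U z $$ (offset r i + x, c) * theta (D i (bl c)) z * G z $$ (c, offset r j + y))"

lemma numerators:
 assumes D: "D \<in> allowed" and U: "radius U R"
 shows "\<exists>G. hol_mat (annulus 0 R) G & (\<forall>z. G z \<in> frakG k r) &
  (\<forall>i j x y z. z ~= 0 --> norm (q * z) < R --> 1 <= i --> i < j --> j <= k --> j - i <= d --> x < r i --> y < r j -->
   numerator_eq D U G i j z x y)"
proof (induction d)
 case 0
 then show ?case using frakG_one by (intro exI[of _ "%z. 1\<^sub>m n"]) (auto simp: hol_mat_def)
next
 case (Suc d)
 then obtain G where G: "hol_mat (annulus 0 R) G" "!!z. G z \<in> frakG k r"
  and eq: "!!i j x y z. z ~= 0 ==> norm (q * z) < R ==> 1 <= i ==> i < j ==> j <= k ==> j - i <= d ==> x < r i ==> y < r j ==>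
   numerator_eq D U G i j z x y"
  by auto
 have R: "0 < R" by (rule radius_pos[OF U])
 define H where "H i j x y z = z powi mu i * (\<Sum>c | c < n & i < bl c & bl c <= j. AU U z $$ (offset r i + x, c) * theta (D i (bl c)) z * G z $$ (c, offset r j + y))" for i j x y z
 define PP where "PP i j \<phi> \<longleftrightarrow> (\<forall>x<r i. \<forall>y<r j. \<phi> x y holomorphic_on annulus 0 R) &
   (\<forall>z. z ~= 0 --> norm (q * z) < R --> (\<forall>x<r i. \<forall>y<r j.
    1 / theta_factor (D i j) * rm (r j) (%x y. \<phi> x y (q * z)) (Aa j) x y - lm (r i) (Aa i) (%x y. \<phi> x y z) x y = H i j x y z))" for i j \<phi>
 have ex: "\<exists>\<phi>. PP i j \<phi>" if ij: "1 <= i" "i < j" "j <= k" for i j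
 proof -
  have ik: "i <= k" "1 <= j" using ij by auto
  note Ai = A[OF ij(1) ik(1), THEN conjunct1] and Aj = A[OF ik(2) ij(3), THEN conjunct1]
  have Hh: "H i j x y holomorphic_on annulus 0 R" if xy: "x < r i" "y < r j" for x y
  proof -
   have X: "offset r i + x < n" "offset r j + y < n" using index_props ij ik xy by auto
   have hU: "(%z. AU U z $$ (a, b)) holomorphic_on annulus 0 R" if "a < n" "b < n" for a b
    by (rule hol_matD[OF formD(4)[OF form_AU[OF U]] that])
   have ht: "theta (D i l) holomorphic_on annulus 0 R" for l
    by (rule holomorphic_on_subset[OF theta_holomorphic[OF allowedD(1)[OF D]]]) auto
   have hz: "(%z. z powi mu i) holomorphic_on annulus 0 R" by (intro holomorphic_intros) auto
   show ?thesis unfolding H_def[abs_def]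
    by (intro holomorphic_on_mult holomorphic_on_sum hU ht hz hol_matD[OF G(1)]) (use X in auto)
  qed
  have "\<exists>\<phi>. (\<forall>x<r i. \<forall>y<r j. \<phi> x y holomorphic_on annulus 0 R) &
   (\<forall>z. z ~= 0 --> norm (q * z) < R --> (\<forall>x<r i. \<forall>y<r j.
    1 / theta_factor (D i j) * rm (r j) (%x y. \<phi> x y (q * z)) (%x y. A j $$ (x, y)) x y -
    lm (r i) (%x y. A i $$ (x, y)) (%x y. \<phi> x y z) x y = H i j x y z))"
  proof (rule Sylvester_Laurent[OF Ai _ Aj _ _ _ Hh R])
   show "inverse_arrays (r i) (%x y. A i $$ (x, y)) (Aa' i)" using Aa_inverse[OF ij(1) ik(1)] by (simp add: Aa_def)
   show "inverse_arrays (r j) (%x y. A j $$ (x, y)) (Aa' j)" using Aa_inverse[OF ik(2) ij(3)] by (simp add: Aa_def)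
   show "1 / theta_factor (D i j) ~= 0" using theta_factor_nonzero[OF allowedD(1)[OF D]] by simp
   show "1 / theta_factor (D i j) * q powi m * t ~= s" if "s \<in> spectrum (A i)" "t \<in> spectrum (A j)" for m s t
    by (rule allowed_nonresonant[OF D ij that])
  qed
  then show ?thesis unfolding PP_def Aa_def .
 qed
 then obtain \<phi> where PP: "!!i j. 1 <= i ==> i < j ==> j <= k ==> PP i j (\<phi> i j)" by metis
 define new where "new i j \<longleftrightarrow> i < j & j - i = Suc d" for i j :: nat
 define G' where "G' z = Matrix.mat n n (%(a, b). if new (bl a) (bl b) then \<phi> (bl a) (bl b) (loc a) (loc b) z else G z $$ (a, b))" for z
 have G'_entry: "G' z $$ (a, b) = (if new (bl a) (bl b) then \<phi> (bl a) (bl b) (loc a) (loc b) z else G z $$ (a, b))"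
  if "a < n" "b < n" for a b z using that by (simp add: G'_def)
 have G'h: "hol_mat (annulus 0 R) G'"
  unfolding hol_mat_def
 proof (intro allI impI)
  fix a b assume ab: "a < n" "b < n"
  note B = block_bounds[OF ab(1)] block_bounds[OF ab(2)]
  show "(%z. G' z $$ (a, b)) holomorphic_on annulus 0 R"
  proof (cases "new (bl a) (bl b)")
   case True
   then have "PP (bl a) (bl b) (\<phi> (bl a) (bl b))" using B by (intro PP) (auto simp: new_def)
   then have "\<phi> (bl a) (bl b) (loc a) (loc b) holomorphic_on annulus 0 R" using B unfolding PP_def by auto
   then show ?thesis using True ab by (simp add: G'_entry)
  qed (use hol_matD[OF G(1) ab] ab in \<open>simp add: G'_entry\<close>)
 qed
 have G'g: "G' z \<in> frakG k r" for z
 proof (rule frakG_I)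
  fix a b assume ab: "a < n" "b < n" "bl b <= bl a"
  then have "\<not> new (bl a) (bl b)" by (simp add: new_def)
  then show "G' z $$ (a, b) = (if a = b then 1 else 0)" using frakG_entry[OF G(2) ab] ab by (simp add: G'_entry)
 qed (simp add: G'_def)
 have old: "G' z $$ (a, b) = G z $$ (a, b)" if "a < n" "b < n" "bl b - bl a <= d" for a b z
  using that by (simp add: G'_entry new_def)
 have "numerator_eq D U G' i j z x y" if z: "z ~= 0" "norm (q * z) < R" and ij: "1 <= i" "i < j" "j <= k" and d: "j - i <= Suc d"
  and xy: "x < r i" "y < r j" for i j x y z
 proof -
  have ik: "i <= k" "1 <= j" using ij by auto
  note P = index_props[OF ij(1) ik(1)] index_props[OF ik(2) ij(3)]
  note Px = P(1-3)[OF xy(1)] P(4-6)[OF xy(2)]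
  have rest: "(\<Sum>c | c < n & i < bl c & bl c <= j. AU U z $$ (offset r i + x, c) * theta (D i (bl c)) z * G' z $$ (c, offset r j + y)) =
    (\<Sum>c | c < n & i < bl c & bl c <= j. AU U z $$ (offset r i + x, c) * theta (D i (bl c)) z * G z $$ (c, offset r j + y))"
  proof (rule sum.cong)
   fix c assume c: "c \<in> {c. c < n & i < bl c & bl c <= j}"
   have "G' z $$ (c, offset r j + y) = G z $$ (c, offset r j + y)" by (rule old) (use c Px d in auto)
   then show "AU U z $$ (offset r i + x, c) * theta (D i (bl c)) z * G' z $$ (c, offset r j + y) =
    AU U z $$ (offset r i + x, c) * theta (D i (bl c)) z * G z $$ (c, offset r j + y)" by simp
  qed simp
  show ?thesis
  proof (cases "j - i <= d")
   case True
   have b: "blk (G' w) i j x y = blk (G w) i j x y" if "x < r i" "y < r j" for x y w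
    unfolding blk_def by (rule old) (use P that True in auto)
   have 1: "rm (r j) (blk (G' (q * z)) i j) (Aa j) x y = rm (r j) (blk (G (q * z)) i j) (Aa j) x y"
    by (rule rm_cong_entry) (rule b[OF xy(1)])
   have 2: "lm (r i) (Aa i) (blk (G' z) i j) x y = lm (r i) (Aa i) (blk (G z) i j) x y"
    by (rule lm_cong_entry) (rule b[OF _ xy(2)])
   show ?thesis using eq[OF z ij True xy] unfolding numerator_eq_def rest 1 2 .
  next
   case False
   then have new: "new i j" using ij d by (simp add: new_def)
   have b: "blk (G' w) i j x y = \<phi> i j x y w" if "x < r i" "y < r j" for x y w
    unfolding blk_def using P that new by (simp add: G'_entry)
   have 1: "rm (r j) (blk (G' (q * z)) i j) (Aa j) x y = rm (r j) (%x y. \<phi> i j x y (q * z)) (Aa j) x y"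
    by (rule rm_cong_entry) (rule b[OF xy(1)])
   have 2: "lm (r i) (Aa i) (blk (G' z) i j) x y = lm (r i) (Aa i) (%x y. \<phi> i j x y z) x y"
    by (rule lm_cong_entry) (rule b[OF _ xy(2)])
   show ?thesis using PP[OF ij] z xy unfolding PP_def H_def numerator_eq_def rest 1 2 by blast
  qed
 qed
 then show ?case using G'h G'g by (intro exI[of _ G'] conjI allI impI)
qed

lemma A0_rest_right: "1 <= i ==> i < j ==> j <= k ==> y < r j ==> rest_right X (A0 z) i j x y = 0"
 unfolding rest_right_def using index_props[of j y] by (intro sum.neutral) (auto simp: A0_def)

definition quotient_mat :: "sum_div => (complex => complex mat) => complex => complex mat" where
 "quotient_mat D G z = Matrix.mat n n (%(a, b). G z $$ (a, b) / theta (D (bl a) (bl b)) z)"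

text \<open>Removing singularities yields the normalised representative of a meromorphic germ.\<close>

definition clean_quotient :: "sum_div => (complex => complex mat) => complex => complex mat" where
 "clean_quotient D G z = Matrix.mat n n (%(a, b). if bl a < bl b then remove_sings (%z. G z $$ (a, b) / theta (D (bl a) (bl b)) z) z
   else if a = b then 1 else 0)"

lemma quotient_mat_frakG:
 assumes D: "D \<in> allowed" and G: "G z \<in> frakG k r"
 shows "quotient_mat D G z \<in> frakG k r"
proof (rule frakG_I)
 fix a b assume ab: "a < n" "b < n" "bl b <= bl a"
 have "D (bl a) (bl b) = {#}" by (rule allowedD(4)[OF D]) (use ab in auto)
 then show "quotient_mat D G z $$ (a, b) = (if a = b then 1 else 0)"
  using frakG_entry[OF G ab] ab by (simp add: quotient_mat_def)
qed (simp add: quotient_mat_def)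

lemma quotient_equation:
 assumes D: "D \<in> allowed" and U: "radius U R" and z: "z ~= 0" "norm (q * z) < R"
  and G: "!!z. G z \<in> frakG k r"
  and eq: "!!i j x y. 1 <= i ==> i < j ==> j <= k ==> x < r i ==> y < r j ==> numerator_eq D U G i j z x y"
  and \<theta>: "!!i j. theta (D i j) z ~= 0"
 shows "quotient_mat D G (q * z) * A0 z = AU U z * quotient_mat D G z"
proof -
 have z': "norm z < R" using norm_le_mult_q[of z] z by linarith
 note M = formD(1,2)[OF form_AU[OF U] z(1) z']
 show ?thesis
 proof (rule eq_from_blocks[OF quotient_mat_frakG[OF D G] quotient_mat_frakG[OF D G] A0_BU eqd_refl M])
  fix i j x y assume ij: "1 <= i" "i < j" "j <= k" and xy: "x < r i" "y < r j"
  have ik: "i <= k" "1 <= j" using ij by auto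
  note P = index_props[OF ij(1) ik(1)] index_props[OF ik(2) ij(3)]
  note Px = P(1-3)[OF xy(1)] P(4-6)[OF xy(2)]
  let ?t = "theta (D i j) z" and ?f = "theta_factor (D i j)" and ?\<mu> = "mu i - mu j"
  have f0: "?f ~= 0" by (rule theta_factor_nonzero[OF allowedD(1)[OF D]])
  have tq: "theta (D i j) (q * z) = ?f * z powi ?\<mu> * ?t"
   using theta_q[OF z(1) allowedD(1)[OF D]] unfolding allowedD(2)[OF D ij, symmetric] by simp
  have b: "blk (quotient_mat D G w) i j x y = blk (G w) i j x y / theta (D i j) w" if "x < r i" "y < r j" for w x y
   using P that by (simp add: blk_def quotient_mat_def)
  have "rm (r j) (blk (quotient_mat D G (q * z)) i j) (Aa j) x y = rm (r j) (%x y. blk (G (q * z)) i j x y / theta (D i j) (q * z)) (Aa j) x y"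
   by (rule rm_cong_entry) (rule b[OF xy(1)])
  also have "... = rm (r j) (blk (G (q * z)) i j) (Aa j) x y / theta (D i j) (q * z)"
   by (simp add: rm_def sum_divide_distrib)
  finally have 1: "rm (r j) (blk (quotient_mat D G (q * z)) i j) (Aa j) x y = rm (r j) (blk (G (q * z)) i j) (Aa j) x y / theta (D i j) (q * z)" .
  have "lm (r i) (Aa i) (blk (quotient_mat D G z) i j) x y = lm (r i) (Aa i) (%x y. blk (G z) i j x y / ?t) x y"
   by (rule lm_cong_entry) (rule b[OF _ xy(2)])
  also have "... = lm (r i) (Aa i) (blk (G z) i j) x y / ?t"
   by (simp add: lm_def sum_divide_distrib)
  finally have 2: "lm (r i) (Aa i) (blk (quotient_mat D G z) i j) x y = lm (r i) (Aa i) (blk (G z) i j) x y / ?t" .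
  define S where "S = (\<Sum>c | c < n & i < bl c & bl c <= j. AU U z $$ (offset r i + x, c) * theta (D i (bl c)) z * G z $$ (c, offset r j + y))"
  have 3: "rest_left (AU U z) (quotient_mat D G z) i j x y = S / ?t"
   unfolding rest_left_def S_def sum_divide_distrib
  proof (rule sum.cong)
   fix c assume c: "c \<in> {c. c < n & i < bl c & bl c <= j}"
   then have "D i j = D i (bl c) + D (bl c) j" using ij by (intro allowedD(3)[OF D]) auto
   then have t: "?t = theta (D i (bl c)) z * theta (D (bl c) j) z" by (simp add: theta_add)
   have "quotient_mat D G z $$ (c, offset r j + y) = G z $$ (c, offset r j + y) / theta (D (bl c) j) z"
    using c Px by (simp add: quotient_mat_def)
   then show "AU U z $$ (offset r i + x, c) * quotient_mat D G z $$ (c, offset r j + y) =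
    AU U z $$ (offset r i + x, c) * theta (D i (bl c)) z * G z $$ (c, offset r j + y) / ?t"
    unfolding t using \<theta> by simp
  qed simp
  define X where "X = rm (r j) (blk (G (q * z)) i j) (Aa j) x y"
  define Y where "Y = lm (r i) (Aa i) (blk (G z) i j) x y"
  have e: "1 / ?f * X - Y = z powi mu i * S"
   using eq[OF ij xy] unfolding numerator_eq_def X_def Y_def S_def .
  have zp: "z powi (- mu j) = z powi (- mu i) * z powi ?\<mu>"
   using z(1) by (simp add: power_int_add[symmetric])
  have "z powi (- mu j) * (X / (?f * z powi ?\<mu> * ?t)) = z powi (- mu i) * (1 / ?f * X) / ?t"
   unfolding zp using z(1) f0 \<theta>[of i j] by simp
  also have "1 / ?f * X = Y + z powi mu i * S" using e by (simp add: algebra_simps)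
  also have "z powi (- mu i) * (Y + z powi mu i * S) / ?t = z powi (- mu i) * (Y / ?t) + S / ?t"
   using z(1) \<theta>[of i j] by (simp add: power_int_minus field_simps)
  finally have "z powi (- mu j) * (X / (?f * z powi ?\<mu> * ?t)) = z powi (- mu i) * (Y / ?t) + S / ?t" .
  then show "z powi (- mu j) * rm (r j) (blk (quotient_mat D G (q * z)) i j) (Aa j) x y + rest_right (quotient_mat D G (q * z)) (A0 z) i j x y =
    z powi (- mu i) * lm (r i) (Aa i) (blk (quotient_mat D G z) i j) x y + rest_left (AU U z) (quotient_mat D G z) i j x y"
   unfolding 1 2 3 A0_rest_right[OF ij xy(2)] tq X_def Y_def by simp
 qed
qed

lemma gauge_fun_iff:
 assumes "F z \<in> frakG k r" "F (q * z) \<in> frakG k r" "M \<in> carrier_mat n n" "N \<in> carrier_mat n n"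
 shows "F (q * z) * M * minv (F z) = N \<longleftrightarrow> F (q * z) * M = N * F z"
proof -
 note car = frakG_carrier[OF assms(1)] frakG_carrier[OF assms(2)] assms(3,4) frakG_minv[OF assms(1)]
 have 1: "F (q * z) * M = (F (q * z) * M * minv (F z)) * F z" using car by (simp add: mat_simps)
 have 2: "(N * F z) * minv (F z) = N" using car by (simp add: mat_simps)
 show ?thesis
 proof
  assume "F (q * z) * M * minv (F z) = N"
  then show "F (q * z) * M = N * F z" using 1 by simp
 next
  assume "F (q * z) * M = N * F z"
  then show "F (q * z) * M * minv (F z) = N" using 2 by simp
 qed
qed

theorem is_FD_exists:
 assumes D: "D \<in> allowed" and U: "U \<in> families"
 shows "\<exists>F. is_FD q k r D (AM (zero_family r)) (AM U) F"
proof -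
 obtain R where R: "radius U R" using radius_exists[OF U] by blast
 have R0: "0 < R" by (rule radius_pos[OF R])
 obtain G where G: "hol_mat (annulus 0 R) G" "!!z. G z \<in> frakG k r"
  and eq: "!!i j x y z. z ~= 0 ==> norm (q * z) < R ==> 1 <= i ==> i < j ==> j <= k ==> j - i <= k ==> x < r i ==> y < r j ==>
   numerator_eq D U G i j z x y"
  using numerators[OF D R, of k] by auto
 define F where "F = clean_quotient D G"
 have ann: "ball 0 R - {0} = annulus 0 R" by auto
 have opA: "open (annulus 0 R)" by (rule open_annulus)
 note Dc = allowedD(1)[OF D]
 have FG: "F z \<in> frakG k r" for z
  unfolding F_def by (rule frakG_I) (auto simp: clean_quotient_def)
 have Gan: "(%z. G z $$ (a, b)) analytic_on {w}" if "a < n" "b < n" "w \<in> annulus 0 R" for a b w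
  by (rule holomorphic_on_imp_analytic_at[OF hol_matD[OF G(1) that(1,2)] opA that(3)])
 have tan: "theta (D i j) analytic_on {w}" if "w ~= 0" for i j w
  by (rule holomorphic_on_imp_analytic_at[OF theta_holomorphic[OF Dc]]) (use that in auto)
 have F_eq: "F z = quotient_mat D G z" if z: "z \<in> annulus 0 R" "!!i j. theta (D i j) z ~= 0" for z
 proof (rule eq_matI)
  fix a b assume "a < dim_row (quotient_mat D G z)" "b < dim_col (quotient_mat D G z)"
  then have ab: "a < n" "b < n" by (auto simp: quotient_mat_def)
  show "F z $$ (a, b) = quotient_mat D G z $$ (a, b)"
  proof (cases "bl a < bl b")
   case True
   have "(%z. G z $$ (a, b) / theta (D (bl a) (bl b)) z) analytic_on {z}"
    by (intro analytic_on_divide Gan tan ab z(1)) (use z in auto)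
   then show ?thesis using True ab by (simp add: F_def clean_quotient_def quotient_mat_def)
  next
   case False
   then show ?thesis using frakG_entry[OF FG ab] frakG_entry[OF quotient_mat_frakG[OF D G(2)] ab] by simp
  qed
 qed (auto simp: F_def clean_quotient_def quotient_mat_def)
 show ?thesis
  unfolding is_FD_def
 proof (intro exI[of _ F] conjI)
  show "\<exists>eps>0. (\<forall>z\<in>ball 0 eps - {0}. F z \<in> frakG k r) &
   (\<forall>i j a b. 1 <= i & i < j & j <= k & a < r i & b < r j -->
    (%z. block r (F z) i j $$ (a, b)) nicely_meromorphic_on (ball 0 eps - {0}) &
    (\<forall>z\<^sub>0 \<in> ball 0 eps - {0}.
      is_pole (%z. block r (F z) i j $$ (a, b)) z\<^sub>0 -->
      - zorder (%z. block r (F z) i j $$ (a, b)) z\<^sub>0 <= int (count (D i j) (Eq_proj q z\<^sub>0))))"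
  proof (intro exI[of _ R] conjI R0 ballI FG allI impI; elim conjE)
   fix i j a b assume ij: "1 <= i" "i < j" "j <= k" and ab: "a < r i" "b < r j"
   have ik: "i <= k" "1 <= j" using ij by auto
   note P = index_props[OF ij(1) ik(1) ab(1)] index_props[OF ik(2) ij(3) ab(2)]
   let ?g = "%z. G z $$ (offset r i + a, offset r j + b)"
   let ?f = "%z. ?g z / theta (D i j) z"
   have bl: "(%z. block r (F z) i j $$ (a, b)) = remove_sings ?f"
    using P ij ab by (simp add: block_def F_def clean_quotient_def fun_eq_iff)
   have mero: "?f meromorphic_on {w}" if "w \<in> annulus 0 R" for w
    by (intro meromorphic_on_divide analytic_on_imp_meromorphic_on Gan tan P that) (use that in auto)
   then have "?f meromorphic_on annulus 0 R" by (subst meromorphic_on_meromorphic_at) blast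
   then show "(%z. block r (F z) i j $$ (a, b)) nicely_meromorphic_on (ball 0 R - {0})"
    unfolding bl ann by (rule remove_sings_nicely_meromorphic)
   fix w assume w': "w \<in> ball 0 R - {0}" and pole: "is_pole (%z. block r (F z) i j $$ (a, b)) w"
   have w: "w \<in> annulus 0 R" using w' unfolding ann .
   have iso: "isolated_singularity_at ?f w" by (rule meromorphic_on_isolated_singularity[OF mero[OF w]])
   have "is_pole ?f w" using pole unfolding bl is_pole_remove_sings_iff[OF iso] .
   then have "- zorder ?f w <= int (count (D i j) (Eq_proj q w))"
    by (rule pole_order_divide_theta[OF Gan[OF P(1,4) w] _ Dc, rotated]) (use w in auto)
   then show "- zorder (%z. block r (F z) i j $$ (a, b)) w <= int (count (D i j) (Eq_proj q w))"
    unfolding bl zorder_remove_sings[OF iso] .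
  qed
  show "\<exists>\<delta>>0. \<forall>\<^sub>F z in cosparse (ball 0 \<delta> - {0}). gauge_fun q F (mat_fun (AM (zero_family r))) z = mat_fun (AM U) z"
  proof (intro exI[of _ "R / norm q"] conjI)
   show "0 < R / norm q" using R0 by simp
   have op: "open (ball 0 (R / norm q) - {0} :: complex set)" by (intro open_Diff) auto
   show "\<forall>\<^sub>F z in cosparse (ball 0 (R / norm q) - {0}). gauge_fun q F (mat_fun (AM (zero_family r))) z = mat_fun (AM U) z"
    unfolding eventually_cosparse_open_eq[OF op]
   proof
    fix w :: complex assume w: "w \<in> ball 0 (R / norm q) - {0}"
    then have w0: "w ~= 0" by simp
    have "eventually (%z. \<forall>i\<in>{..k}. \<forall>j\<in>{..k}. theta (D i j) z ~= 0) (at w)"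
     by (intro eventually_ball_finite ballI theta_eventually_nonzero w0 Dc) auto
    moreover have "eventually (%z. z \<in> ball 0 (R / norm q) - {0}) (at w)"
     by (rule eventually_at_in_open'[OF op w])
    ultimately show "\<forall>\<^sub>F z in at w. gauge_fun q F (mat_fun (AM (zero_family r))) z = mat_fun (AM U) z"
    proof eventually_elim
     case (elim z)
     have \<theta>: "theta (D i j) z ~= 0" for i j
     proof (cases "i <= k & j <= k")
      case True then show ?thesis using elim by simp
     next
      case False
      then have "D i j = {#}" by (intro allowedD(4)[OF D]) auto
      then show ?thesis by simp
     qed
     have z: "z ~= 0" "norm (q * z) < R" using elim q0 by (auto simp: norm_mult field_simps)
     have z': "norm z < R" using norm_le_mult_q[of z] z by linarith
     have \<theta>q: "theta (D i j) (q * z) ~= 0" for i j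
      unfolding theta_q[OF z(1) Dc] using \<theta> theta_factor_nonzero[OF Dc] z(1) by simp
     have Fz: "F z = quotient_mat D G z" "F (q * z) = quotient_mat D G (q * z)"
      by (rule F_eq; use z z' \<theta> \<theta>q in simp)+
     have "F (q * z) * A0 z = AU U z * F z"
      unfolding Fz by (rule quotient_equation[OF D R z G(2) eq[OF z] \<theta>]) auto
     then have "F (q * z) * A0 z * minv (F z) = AU U z"
      using gauge_fun_iff[of F z "A0 z" "AU U z"] FG by simp
     then show ?case by (simp add: gauge_fun_def A0_eq[OF z(1)] AU_def)
    qed
   qed
  qed
 qed
qed

end

section \<open>The cocycle of a matrix\<close>

context qdiff
begin

lemma Pre_V_set:
 assumes D: "D \<in> allowed"
 shows "z \<in> Pre (V_set q k D) \<longleftrightarrow> z ~= 0 & (\<forall>i\<in>{..k}. \<forall>j\<in>{..k}. theta (D i j) z ~= 0)"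
proof -
 have "Eq_proj q z \<in> V_set q k D \<longleftrightarrow> (\<forall>i\<in>{..k}. \<forall>j\<in>{..k}. theta (D i j) z ~= 0)" if z: "z ~= 0"
 proof -
  have "Eq_proj q z \<in> V_set q k D \<longleftrightarrow> (\<forall>i j. 1 <= i & i < j & j <= k --> Eq_proj q z \<notin># D i j)"
   using Eq_proj_carrier[OF z] by (auto simp: V_set_def)
  also have "... \<longleftrightarrow> (\<forall>i\<in>{..k}. \<forall>j\<in>{..k}. Eq_proj q z \<notin># D i j)"
  proof
   assume L: "\<forall>i j. 1 <= i & i < j & j <= k --> Eq_proj q z \<notin># D i j"
   show "\<forall>i\<in>{..k}. \<forall>j\<in>{..k}. Eq_proj q z \<notin># D i j"
   proof (intro ballI)
    fix i j show "Eq_proj q z \<notin># D i j"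
     using L allowedD(4)[OF D, of i j] by (cases "1 <= i & i < j & j <= k") auto
   qed
  qed auto
  finally show ?thesis by (simp add: theta_zero_iff[OF z allowedD(1)[OF D]])
 qed
 then show ?thesis by (auto simp: Pre_def)
qed

lemma openin_V_set:
 assumes D: "D \<in> allowed"
 shows "openin (Eq_top q) (V_set q k D)"
 unfolding openin_Eq_iff
proof
 show "V_set q k D \<subseteq> carrier (Eq q)" by (auto simp: V_set_def)
 have eq: "Pre (V_set q k D) = (\<Inter>i\<in>{..k}. \<Inter>j\<in>{..k}. (- {0}) Int theta (D i j) -` (- {0}))"
  using Pre_V_set[OF D] by auto
 have *: "open ((- {0}) Int theta (D i j) -` (- {0}))" for i j
  by (rule continuous_open_preimage[OF holomorphic_on_imp_continuous_on[OF theta_holomorphic[OF allowedD(1)[OF D]]]]) auto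
 show "open (Pre (V_set q k D))" unfolding eq by (intro open_INT ballI finite_atMost *)
qed

text \<open>A multiple of one point is allowed for all but countably many points.\<close>

lemma allowed_cover:
 assumes z: "z ~= 0"
 shows "\<exists>D\<in>allowed. z \<in> Pre (V_set q k D)"
proof -
 define w where "w i j s t = (-1) powi (mu i - mu j) * (s / t)" for i j and s t :: complex
 define bad where "bad i j = (if 1 <= i & i < j & j <= k
  then \<Union>s\<in>spectrum (A i). \<Union>t\<in>spectrum (A j). \<Union>m :: int. {b. b ^ nat (mu i - mu j) = q powi m * w i j s t} else {})" for i j
 have "countable (bad i j)" for i j
 proof (cases "1 <= i & i < j & j <= k")
  case True
  then have ij: "1 <= i" "i < j" "j <= k" "i <= k" "1 <= j" by auto
  have "0 < nat (mu i - mu j)" using mu[OF ij(1-3)] by simp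
  then have c: "countable {b :: complex. b ^ nat (mu i - mu j) = c}" for c
   by (intro countable_finite finite_nth_roots)
  have "countable (spectrum (A i))" "countable (spectrum (A j))"
   using A[OF ij(1,4)] A[OF ij(5,3)] by (auto intro!: countable_finite card_finite_spectrum(1))
  then show ?thesis unfolding bad_def using True by (simp add: c)
 next
  case False
  then have "bad i j = {}" unfolding bad_def by (rule if_not_P)
  then show ?thesis by simp
 qed
 define B where "B = {0} \<union> range (%m :: int. q powi m * z) \<union> (\<Union>i. \<Union>j. bad i j)"
 have "countable B"
  unfolding B_def using \<open>\<And>i j. countable (bad i j)\<close> by (intro countable_Un countable_UN) auto
 then have "B ~= UNIV" using uncountable_UNIV_complex by metis
 then obtain b where "b \<notin> B" by blast
 then have b: "b ~= 0" "!!m :: int. b ~= q powi m * z" "!!i j. b \<notin> bad i j" by (auto simp: B_def)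
 define D where "D i j = (if 1 <= i & i < j & j <= k then replicate_mset (nat (mu i - mu j)) (Eq_proj q b) else {#})" for i j
 have Dc: "set_mset (D i j) \<subseteq> {Eq_proj q b}" for i j by (auto simp: D_def)
 have Dc': "set_mset (D i j) \<subseteq> carrier (Eq q)" for i j using Dc[of i j] Eq_proj_carrier[OF b(1)] by auto
 have Dr: "D i j = replicate_mset (nat (mu i - mu j)) (Eq_proj q b)" if "1 <= i & i < j & j <= k" for i j
  unfolding D_def by (rule if_P[OF that])
 have sd: "summation_divisor q k mu D"
  unfolding summation_divisor_def
 proof (intro conjI allI impI)
  fix i j assume ij: "1 <= i & i < j & j <= k"
  show "set_mset (D i j) \<subseteq> carrier (Eq q)" by (rule Dc')
  have "mu i > mu j" by (rule mu) (use ij in auto)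
  then show "int (size (D i j)) = mu i - mu j" by (simp add: Dr[OF ij])
 next
  fix i l j assume ij: "1 <= i & i < l & l < j & j <= k"
  have c: "1 <= i & i < l & l <= k" "1 <= l & l < j & j <= k" "1 <= i & i < j & j <= k" using ij by auto
  have "mu i > mu l" by (rule mu) (use c in auto)
  moreover have "mu l > mu j" by (rule mu) (use c in auto)
  ultimately have e: "nat (mu i - mu j) = nat (mu i - mu l) + nat (mu l - mu j)" by simp
  have "replicate_mset (a + b) x = replicate_mset a x + replicate_mset b x" for a b :: nat and x :: "complex set"
   by (induction a) auto
  then show "D i j = D i l + D l j" unfolding Dr[OF c(1)] Dr[OF c(2)] Dr[OF c(3)] e .
 next
  fix i j assume "\<not> (1 <= i & i < j & j <= k)"
  then show "D i j = {#}" unfolding D_def by (rule if_not_P)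
 qed
 have ev: "ev_Eq q (D i j) \<notin> {Eq_proj q ((-1) powi (mu i - mu j) * (s / t)) | s t. s \<in> spectrum (A i) & t \<in> spectrum (A j)}"
  if ij: "1 <= i & i < j & j <= k" for i j
 proof
  assume "ev_Eq q (D i j) \<in> {Eq_proj q ((-1) powi (mu i - mu j) * (s / t)) | s t. s \<in> spectrum (A i) & t \<in> spectrum (A j)}"
  then obtain s t where st: "ev_Eq q (D i j) = Eq_proj q (w i j s t)" "s \<in> spectrum (A i)" "t \<in> spectrum (A j)"
   by (auto simp: w_def)
  define e where "e = rep (Eq_proj q b)"
  have e: "e ~= 0" "Eq_proj q e = Eq_proj q b" unfolding e_def using rep[OF Eq_proj_carrier[OF b(1)]] by auto
  have "ev_Eq q (D i j) = Eq_proj q (e ^ nat (mu i - mu j))"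
   using ev_Eq_rep[OF Dc', of i j] by (simp add: Dr[OF ij] e_def)
  also have "... = Eq_proj q (b ^ nat (mu i - mu j))"
   using Eq_proj_nat_pow[OF e(1)] Eq_proj_nat_pow[OF b(1)] e(2) by metis
  finally have "Eq_proj q (w i j s t) = Eq_proj q (b ^ nat (mu i - mu j))" using st(1) by simp
  then obtain m :: int where "b ^ nat (mu i - mu j) = q powi m * w i j s t" unfolding Eq_proj_eq_iff by blast
  then have "b \<in> bad i j" using st ij by (auto simp: bad_def)
  then show False using b(3) by blast
 qed
 have D: "D \<in> allowed"
  unfolding allowed_divisors_def by (intro CollectI conjI allI impI sd) (erule ev)
 have "Eq_proj q z ~= Eq_proj q b" using b(2) unfolding Eq_proj_eq_iff by blast
 then have "Eq_proj q z \<notin># D i j" for i j using Dc[of i j] by auto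
 then have "z \<in> Pre (V_set q k D)"
  unfolding Pre_V_set[OF D] using z by (simp add: theta_zero_iff[OF z Dc'])
 then show ?thesis using D by blast
qed

lemma allowed_open_covering: "open_covering (Eq_top q) allowed (V_set q k)"
 unfolding open_covering_def topspace_Eq_top
proof (intro conjI ballI equalityI subsetI)
 fix v assume "v \<in> carrier (Eq q)"
 then obtain z where z: "z ~= 0" "v = Eq_proj q z" by (auto simp: carrier_Eq)
 then show "v \<in> (\<Union>D\<in>allowed. V_set q k D)" using allowed_cover[OF z(1)] by (auto simp: Pre_def)
qed (rule openin_V_set, auto simp: V_set_def)

lemma coboundary_cocycle:
 assumes cov: "open_covering (Eq_top q) I V" and M: "form eps M" and eps: "0 < eps"
  and f: "!!a. a \<in> I ==> sol (V a) eps M (f a)"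
  and g: "!!a b. a \<in> I ==> b \<in> I ==> g a b = cls (V a Int V b) (%z. minv (f a z) * f b z)"
 shows "(I, V, g) \<in> cocycles"
proof -
 note op = openin_Int_cover[OF cov]
 have fs: "sol T eps M (f a)" if "a \<in> I" "T \<subseteq> V a" for a T by (rule sol_subset[OF f[OF that(1)] that(2)]) simp
 have "g a b \<in> carrier (\<Lambda> (V a Int V b))" if ab: "a \<in> I" "b \<in> I" for a b
  unfolding g[OF ab] Lambda_carrier[OF op[OF ab] eps] using sol_quotient[OF fs fs M, of a "V a Int V b" b] ab by blast
 moreover have "Lambda_res q (V a Int V b) (V a Int V b Int V c) (g a b) \<otimes>\<^bsub>\<Lambda> (V a Int V b Int V c)\<^esub>
   Lambda_res q (V b Int V c) (V a Int V b Int V c) (g b c) = Lambda_res q (V a Int V c) (V a Int V b Int V c) (g a c)"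
  if abc: "a \<in> I" "b \<in> I" "c \<in> I" for a b c
 proof -
  let ?T = "V a Int V b Int V c"
  have T: "openin (Eq_top q) ?T" using op[OF abc(1,2)] cov abc by (auto simp: open_covering_def)
  have res: "Lambda_res q (V a Int V b) ?T (cls (V a Int V b) F) = cls ?T F"
   "Lambda_res q (V b Int V c) ?T (cls (V b Int V c) F) = cls ?T F"
   "Lambda_res q (V a Int V c) ?T (cls (V a Int V c) F) = cls ?T F" for F
   by (rule Lambda_res_cls[OF op T]; use abc in blast)+
  show ?thesis
   unfolding g[OF abc(1,2)] g[OF abc(2,3)] g[OF abc(1,3)] res Lambda_mult[OF T]
  proof (rule cls_sol_cong[OF T eps])
   fix z assume z: "z \<in> Pre ?T" "norm z < eps"
   have m: "f x z \<in> frakG k r" if "x \<in> {a, b, c}" for x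
    by (rule solD(1)[OF fs[of x ?T] z]) (use that abc in auto)
   note i = frakG_minv[OF m[of a]] frakG_minv[OF m[of b]] frakG_carrier[OF m[of a]] frakG_carrier[OF m[of b]] frakG_carrier[OF m[of c]]
   have "minv (f a z) * f b z * (minv (f b z) * f c z) = minv (f a z) * (f b z * (minv (f b z) * f c z))"
    using i by (simp add: mat_simps)
   also have "f b z * (minv (f b z) * f c z) = f c z"
    by (rule cancel_inverses) (use i in auto)
   finally show "minv (f a z) * f b z * (minv (f b z) * f c z) = minv (f a z) * f c z" .
  qed
 qed
 ultimately show ?thesis using cov by (simp add: cech_cocycles_def Let_def)
qed

text \<open>On a sector over the complement of its polar divisor the meromorphic gauge transformation is holomorphic
 near \<open>0\<close>, and its functional equation, which holds outside a discrete set, holds everywhere by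
 continuity.\<close>

lemma FD_solution:
 assumes D: "D \<in> allowed" and U: "radius U R" and FD: "is_FD q k r D (AM (zero_family r)) (AM U) F"
 shows "\<exists>e F'. 0 < e & sol (V_set q k D) R (AU U) F' & (\<forall>z \<in> Pre (V_set q k D). norm z < e --> F' z = F z)"
proof -
 let ?V = "V_set q k D"
 have R: "0 < R" by (rule radius_pos[OF U])
 have V: "openin (Eq_top q) ?V" by (rule openin_V_set[OF D])
 obtain eps \<delta> where eps: "eps > 0" and \<delta>: "\<delta> > 0" and FG: "\<forall>z \<in> ball 0 eps - {0}. F z \<in> frakG k r"
  and Fm: "\<forall>i j a b. 1 <= i & i < j & j <= k & a < r i & b < r j -->
    (%z. block r (F z) i j $$ (a, b)) nicely_meromorphic_on (ball 0 eps - {0}) &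
    (\<forall>z\<^sub>0 \<in> ball 0 eps - {0}.
      is_pole (%z. block r (F z) i j $$ (a, b)) z\<^sub>0 -->
      - zorder (%z. block r (F z) i j $$ (a, b)) z\<^sub>0 <= int (count (D i j) (Eq_proj q z\<^sub>0)))"
  and ev: "\<forall>\<^sub>F z in cosparse (ball 0 \<delta> - {0}). gauge_fun q F (mat_fun (AM (zero_family r))) z = mat_fun (AM U) z"
  using FD unfolding is_FD_def by blast
 define e where "e = min R (min eps \<delta>)"
 have e: "0 < e" "e <= R" "e <= eps" "e <= \<delta>" using R eps \<delta> by (auto simp: e_def)
 define W where "W = Pre ?V Int ball 0 e"
 note W = sector_Pre[OF V e(1), folded W_def]
 have Wz: "z ~= 0" "norm z < e" "z \<in> ball 0 eps - {0}" "z \<in> Pre ?V" if "z \<in> W" for z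
  using that e by (auto simp: W_def Pre_def)
 have opW: "open W" using W(1) by (simp add: sector_def)
 have FGW: "F z \<in> frakG k r" if "z \<in> W" for z using FG Wz[OF that] by blast
 have hol: "hol_mat W F"
  unfolding hol_mat_def
 proof (intro allI impI)
  fix a b assume ab: "a < n" "b < n"
  note B = block_bounds[OF ab(1)] block_bounds[OF ab(2)]
  show "(%z. F z $$ (a, b)) holomorphic_on W"
  proof (cases "bl a < bl b")
   case True
   let ?i = "bl a" and ?j = "bl b"
   have c: "1 <= ?i & ?i < ?j & ?j <= k & loc a < r ?i & loc b < r ?j" using B True by auto
   have fe: "(%z. block r (F z) ?i ?j $$ (loc a, loc b)) = (%z. F z $$ (a, b))" using B by (simp add: block_def)
   have nm: "(%z. F z $$ (a, b)) nicely_meromorphic_on (ball 0 eps - {0})"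
    and po: "!!w. w \<in> ball 0 eps - {0} ==> is_pole (%z. F z $$ (a, b)) w ==>
      - zorder (%z. F z $$ (a, b)) w <= int (count (D ?i ?j) (Eq_proj q w))"
    using Fm[rule_format, OF c] unfolding fe by auto
   have "(%z. F z $$ (a, b)) analytic_on {w}" if w: "w \<in> W" for w
   proof (rule nicely_meromorphic_on_imp_analytic_at[OF nm Wz(3)[OF w]])
    show "\<not> is_pole (%z. F z $$ (a, b)) w"
    proof
     assume p: "is_pole (%z. F z $$ (a, b)) w"
     have "(%z. F z $$ (a, b)) meromorphic_on {w}"
      using nm Wz(3)[OF w] by (auto simp: nicely_meromorphic_on_def intro: meromorphic_on_subset)
     then have "zorder (%z. F z $$ (a, b)) w < 0"
      by (intro isolated_pole_imp_neg_zorder[OF _ p] meromorphic_on_isolated_singularity)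
     moreover have "count (D ?i ?j) (Eq_proj q w) = 0"
      using Wz(4)[OF w] c by (auto simp: Pre_def V_set_def not_in_iff)
     ultimately show False using po[OF Wz(3)[OF w] p] by simp
    qed
   qed
   then have "(%z. F z $$ (a, b)) analytic_on W" using analytic_on_analytic_at by blast
   then show ?thesis by (rule analytic_imp_holomorphic)
  next
   case False
   have "(%z. if a = b then 1 else 0) holomorphic_on W" by simp
   then show ?thesis
    by (rule holomorphic_transform) (use False frakG_entry[OF FGW ab] in auto)
  qed
 qed
 have eq: "F (q * w) * A0 w = AU U w * F w" if w: "w \<in> W" "q * w \<in> W" for w
 proof -
  define W' where "W' = {z \<in> W. q * z \<in> W}"
  have W': "open W'"
  proof -
   have "W' = W Int (%z. q * z) -` W" by (auto simp: W'_def)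
   then show ?thesis using opW by (simp add: open_Int open_vimage continuous_intros)
  qed
  have wW: "w \<in> W'" using w by (simp add: W'_def)
  have opB: "open (ball 0 \<delta> - {0} :: complex set)" by (intro open_Diff) auto
  have "w \<in> ball 0 \<delta> - {0}" using Wz[OF w(1)] e by auto
  then have "eventually (%z. gauge_fun q F (mat_fun (AM (zero_family r))) z = mat_fun (AM U) z) (at w)"
   using ev unfolding eventually_cosparse_open_eq[OF opB] by blast
  moreover have "eventually (%z. z \<in> W') (at w)" by (rule eventually_at_in_open'[OF W' wW])
  ultimately have near: "eventually (%z. F (q * z) * A0 z = AU U z * F z) (at w)"
  proof eventually_elim
   case (elim z)
   then have z: "z \<in> W" "q * z \<in> W" by (auto simp: W'_def)
   note z0 = Wz(1)[OF z(1)]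
   have "F (q * z) * A0 z * minv (F z) = AU U z"
    using elim(1) by (simp add: gauge_fun_def A0_eq[OF z0] AU_def)
   then show ?case using gauge_fun_iff[of F z "A0 z" "AU U z"] FGW z by simp
  qed
  have c1: "F (q * z) \<in> carrier_mat n n" "F z \<in> carrier_mat n n" if "z \<in> W'" for z
   using FGW frakG_carrier that by (auto simp: W'_def)
  have sub: "W' \<subseteq> W" "0 \<notin> W'" using Wz(1) by (auto simp: W'_def)
  have hl: "hol_mat W' (%z. F (q * z) * A0 z)"
   by (intro hol_mat_mult hol_mat_compose_scale[OF hol] hol_A0) (use c1 sub in \<open>auto simp: W'_def\<close>)
  have hr: "hol_mat W' (%z. AU U z * F z)"
  proof (intro hol_mat_mult hol_mat_subset[OF hol sub(1)] hol_mat_subset[OF formD(4)[OF form_AU[OF U]]])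
   show "W' \<subseteq> annulus 0 R" using Wz(1,2) e sub by force
  qed (use c1 in auto)
  show ?thesis
  proof (rule eq_matI)
   fix a b assume "a < dim_row (AU U w * F w)" "b < dim_col (AU U w * F w)"
   then have ab: "a < n" "b < n" using c1[OF wW] AU_carrier[of U w] by auto
   have lim: "f \<midarrow>w\<rightarrow> f w" if "f holomorphic_on W'" for f
    using holomorphic_on_imp_continuous_on[OF that] continuous_on_eq_continuous_at[OF W'] wW isContD by blast
   have l: "(%z. (F (q * z) * A0 z) $$ (a, b)) \<midarrow>w\<rightarrow> (F (q * w) * A0 w) $$ (a, b)"
    by (rule lim[OF hol_matD[OF hl ab]])
   have "(%z. (AU U z * F z) $$ (a, b)) \<midarrow>w\<rightarrow> (F (q * w) * A0 w) $$ (a, b)"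
    by (rule Lim_transform_eventually[OF l]) (use near in eventually_elim, simp)
   then show "(F (q * w) * A0 w) $$ (a, b) = (AU U w * F w) $$ (a, b)"
    using lim[OF hol_matD[OF hr ab]] by (rule LIM_unique)
  qed (simp_all add: carrier_matD[OF c1(1)[OF wW]] carrier_matD[OF c1(2)[OF wW]] carrier_matD[OF AU_carrier] carrier_matD[OF A0_carrier])
 qed
 have WR: "W \<subseteq> ball 0 R" using e by (auto simp: W_def)
 obtain F' where "sol ?V R (AU U) F'" "!!z. z \<in> W ==> F' z = F z"
  by (rule sol_extend_up[OF V form_AU[OF U] W WR hol FGW eq]) (assumption | rule that)+
 then show ?thesis using e(1) by (intro exI[of _ e] exI[of _ F']) (auto simp: W_def)
qed

theorem stokes_cocycle_trivialised:
 assumes U: "U \<in> families"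
 shows "stokes_cocycle q k mu r A U \<in> cocycles" "trivialised (stokes_cocycle q k mu r A U) U"
proof -
 obtain R where R: "radius U R" using radius_exists[OF U] by blast
 have R0: "0 < R" by (rule radius_pos[OF R])
 let ?V = "V_set q k" and ?F = "%D. F_D q k mu r A D U"
 have FD: "is_FD q k r D (AM (zero_family r)) (AM U) (?F D)" if "D \<in> allowed" for D
  unfolding F_D_def by (rule someI_ex[OF is_FD_exists[OF that U]])
 define P where "P D = (%(e, F'). 0 < e & sol (?V D) R (AU U) F' & (\<forall>z \<in> Pre (?V D). norm z < e --> F' z = ?F D z))" for D
 have "\<exists>x. P D x" if "D \<in> allowed" for D
  using FD_solution[OF that R FD[OF that]] by (auto simp: P_def)
 then obtain x where x: "!!D. D \<in> allowed ==> P D (x D)" by metis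
 define f where "f D = snd (x D)" for D
 define e where "e D = fst (x D)" for D
 have f: "0 < e D" "sol (?V D) R (AU U) (f D)" "!!z. z \<in> Pre (?V D) ==> norm z < e D ==> f D z = ?F D z" if "D \<in> allowed" for D
  using x[OF that] by (auto simp: P_def f_def e_def split: prod.splits)
 define g where "g D D' = cls (?V D Int ?V D') (F_DD q k mu r A D D' U)" for D D'
 have s: "stokes_cocycle q k mu r A U = (allowed, ?V, g)"
  by (simp add: stokes_cocycle_def g_def fun_eq_iff)
 have g: "g D D' = cls (?V D Int ?V D') (%z. minv (f D z) * f D' z)" if D: "D \<in> allowed" "D' \<in> allowed" for D D'
  unfolding g_def
 proof (rule cls_sol_cong)
  show "openin (Eq_top q) (?V D Int ?V D')" by (intro openin_Int openin_V_set D)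
  show "0 < min (e D) (e D')" using f(1) D by simp
  show "F_DD q k mu r A D D' U z = minv (f D z) * f D' z" if "z \<in> Pre (?V D Int ?V D')" "norm z < min (e D) (e D')" for z
   using f(3)[OF D(1), of z] f(3)[OF D(2), of z] that by (simp add: F_DD_def)
 qed
 show "stokes_cocycle q k mu r A U \<in> cocycles"
  unfolding s by (rule coboundary_cocycle[OF allowed_open_covering form_AU[OF R] R0 f(2) g])
 show "trivialised (stokes_cocycle q k mu r A U) U"
  unfolding s trivialised_def prod.case using R f(2) g by (intro exI[of _ R] exI[of _ f]) blast
qed

section \<open>The bijection\<close>

definition cohomology_class :: "(nat => nat => complex fls mat) => stokes_data set" where
 "cohomology_class U = {d \<in> cocycles. \<exists>U'\<in>families. trivialised d U' & iso_families U U'}"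

lemma cohomologous_cocycles: "(d, d') \<in> cohomologous ==> d \<in> cocycles & d' \<in> cocycles"
 unfolding cech_rel_def by blast

lemma cohomologous_class:
 assumes d: "d \<in> cocycles" "trivialised d U"
 shows "cohomologous `` {d} = cohomology_class U"
proof (intro equalityI subsetI)
 fix d' assume "d' \<in> cohomologous `` {d}"
 then have rel: "(d, d') \<in> cohomologous" by simp
 have c: "d' \<in> cocycles" using cohomologous_cocycles[OF rel] by simp
 obtain U' where U': "U' \<in> families" "trivialised d' U'" using cocycle_trivialised[OF c] by blast
 have "iso_families U U'" by (rule cohomologous_imp_iso[OF d(2) U'(2) rel])
 then show "d' \<in> cohomology_class U" using c U' by (auto simp: cohomology_class_def)
next
 fix d' assume "d' \<in> cohomology_class U"
 then obtain U' where U': "d' \<in> cocycles" "trivialised d' U'" "iso_families U U'" by (auto simp: cohomology_class_def)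
 show "d' \<in> cohomologous `` {d}" using iso_imp_cohomologous[OF d(2) U'(2,3) d(1) U'(1)] by simp
qed

lemma trivialised_unique:
 assumes "d \<in> cocycles" "U \<in> families" "trivialised d U" "trivialised d U'"
 shows "iso_families U' U"
 by (rule cohomologous_imp_iso[OF assms(4,3) iso_imp_cohomologous[OF assms(3,3) iso_families_refl[OF assms(2)] assms(1,1)]])

lemma cohomology_class_eq_iff:
 assumes U: "U \<in> families" "U' \<in> families"
 shows "cohomology_class U = cohomology_class U' \<longleftrightarrow> iso_families U U'"
proof
 assume eq: "cohomology_class U = cohomology_class U'"
 let ?s = "stokes_cocycle q k mu r A U'"
 note s = stokes_cocycle_trivialised[OF U(2)]
 have "?s \<in> cohomology_class U'" using s U iso_families_refl by (auto simp: cohomology_class_def)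
 then obtain U'' where U'': "trivialised ?s U''" "iso_families U U''" unfolding eq[symmetric] by (auto simp: cohomology_class_def)
 show "iso_families U U'" by (rule iso_families_trans[OF U''(2) trivialised_unique[OF s(1) U(2) s(2) U''(1)]])
next
 assume "iso_families U U'"
 then show "cohomology_class U = cohomology_class U'"
  unfolding cohomology_class_def using iso_families_trans iso_families_sym by blast
qed

lemma isoformal_class:
 assumes U: "U \<in> families"
 shows "isoformal_rel q k mu r A `` {AM U} = {AM U' | U'. U' \<in> families & iso_families U U'}"
proof (intro equalityI subsetI)
 fix M assume "M \<in> isoformal_rel q k mu r A `` {AM U}"
 then have rel: "(AM U, M) \<in> isoformal_rel q k mu r A" by simp
 then obtain U' where U': "U' \<in> families" "M = AM U'" unfolding isoformal_rel_def by blast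
 then show "M \<in> {AM U' | U'. U' \<in> families & iso_families U U'}" using rel isoformal_iff[OF U U'(1)] by blast
next
 fix M assume "M \<in> {AM U' | U'. U' \<in> families & iso_families U U'}"
 then show "M \<in> isoformal_rel q k mu r A `` {AM U}" using isoformal_iff[OF U] by blast
qed

lemma isoformal_class_eq_iff:
 assumes U: "U \<in> families" "U' \<in> families"
 shows "isoformal_rel q k mu r A `` {AM U} = isoformal_rel q k mu r A `` {AM U'} \<longleftrightarrow> iso_families U U'"
proof
 assume "isoformal_rel q k mu r A `` {AM U} = isoformal_rel q k mu r A `` {AM U'}"
 moreover have "(AM U', AM U') \<in> isoformal_rel q k mu r A"
  using isoformal_iff[OF U(2,2)] iso_families_refl[OF U(2)] by simp
 ultimately show "iso_families U U'" using isoformal_iff[OF U] by blast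
next
 assume "iso_families U U'"
 then show "isoformal_rel q k mu r A `` {AM U} = isoformal_rel q k mu r A `` {AM U'}"
  unfolding isoformal_class[OF U(1)] isoformal_class[OF U(2)] using iso_families_trans iso_families_sym by blast
qed

theorem stokes_bijection:
 "\<exists>\<Phi>. (\<forall>U \<in> families. stokes_cocycle q k mu r A U \<in> cocycles &
    \<Phi> (isoformal_rel q k mu r A `` {AM U}) = cohomologous `` {stokes_cocycle q k mu r A U}) &
  bij_betw \<Phi> (isoformal_classes q k mu r A) (cech_H1 (Eq_top q) \<Lambda> (Lambda_res q))"
proof -
 define cl where "cl U = isoformal_rel q k mu r A `` {AM U}" for U
 have cl_eq: "cl U = cl U' \<longleftrightarrow> cohomology_class U = cohomology_class U'" if "U \<in> families" "U' \<in> families" for U U'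
  unfolding cl_def isoformal_class_eq_iff[OF that] cohomology_class_eq_iff[OF that] ..
 define \<Phi> where "\<Phi> c = cohomology_class (SOME U. U \<in> families & cl U = c)" for c
 have \<Phi>: "\<Phi> (cl U) = cohomology_class U" if U: "U \<in> families" for U
 proof -
  have "\<exists>U'. U' \<in> families & cl U' = cl U" using U by blast
  from someI_ex[OF this] show ?thesis unfolding \<Phi>_def using cl_eq U by blast
 qed
 have coh: "cohomologous `` {stokes_cocycle q k mu r A U} = cohomology_class U" if "U \<in> families" for U
  by (rule cohomologous_class[OF stokes_cocycle_trivialised[OF that]])
 have dom: "isoformal_classes q k mu r A = cl ` families"
  by (auto simp: isoformal_classes_def quotient_def cl_def)
 have ran: "(cech_H1 (Eq_top q) \<Lambda> (Lambda_res q) :: stokes_data set set) = cohomology_class ` families"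
 proof (intro equalityI subsetI)
  fix c assume "c \<in> (cech_H1 (Eq_top q) \<Lambda> (Lambda_res q) :: stokes_data set set)"
  then obtain d where d: "d \<in> cocycles" "c = cohomologous `` {d}" by (auto simp: cech_H1_def quotient_def)
  obtain U where "U \<in> families" "trivialised d U" using cocycle_trivialised[OF d(1)] by blast
  then show "c \<in> cohomology_class ` families" using cohomologous_class[OF d(1)] d(2) by blast
 next
  fix c assume "c \<in> cohomology_class ` families"
  then obtain U where U: "U \<in> families" "c = cohomologous `` {stokes_cocycle q k mu r A U}" using coh by blast
  then show "c \<in> cech_H1 (Eq_top q) \<Lambda> (Lambda_res q)"
   using stokes_cocycle_trivialised(1)[OF U(1)] by (auto simp: cech_H1_def quotient_def)
 qed
 have "bij_betw \<Phi> (cl ` families) (cohomology_class ` families)"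
  unfolding bij_betw_def
 proof
  show "inj_on \<Phi> (cl ` families)"
  proof (rule inj_onI)
   fix c c' assume "c \<in> cl ` families" "c' \<in> cl ` families" "\<Phi> c = \<Phi> c'"
   then obtain U U' where U: "U \<in> families" "U' \<in> families" "c = cl U" "c' = cl U'" by blast
   then show "c = c'" using \<open>\<Phi> c = \<Phi> c'\<close> \<Phi> cl_eq[OF U(1,2)] by simp
  qed
  show "\<Phi> ` cl ` families = cohomology_class ` families" unfolding image_image by (rule image_cong) (use \<Phi> in auto)
 qed
 then show ?thesis
  using stokes_cocycle_trivialised(1) \<Phi> coh unfolding dom ran cl_def
  by (intro exI[of _ \<Phi>]) simp
qed

end

theorem theorem3p18:
  fixes q :: complex and k :: nat and mu :: "nat \<Rightarrow> int" and r :: "nat \<Rightarrow> nat"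
    and A :: "nat \<Rightarrow> complex mat"
  assumes "norm q > 1"
    and "k \<ge> 1"
    and "\<And>i j. 1 \<le> i \<Longrightarrow> i < j \<Longrightarrow> j \<le> k \<Longrightarrow> mu i > mu j"
    and "\<And>i. 1 \<le> i \<Longrightarrow> i \<le> k \<Longrightarrow> r i \<ge> 1"
    and "\<And>i. 1 \<le> i \<Longrightarrow> i \<le> k \<Longrightarrow> A i \<in> carrier_mat (r i) (r i) \<and> invertible_mat (A i)"
  shows "\<exists>\<Phi>.
    (\<forall>U \<in> over_diag_families k r.
       stokes_cocycle q k mu r A U
         \<in> cech_cocycles (Eq_top q) (Lambda_I q k mu r A) (Lambda_res q) \<and>
       \<Phi> (isoformal_rel q k mu r A `` {A_mat k mu r A U}) =
         cech_rel (Eq_top q) (Lambda_I q k mu r A) (Lambda_res q) `` {stokes_cocycle q k mu r A U}) \<and>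
    bij_betw \<Phi> (isoformal_classes q k mu r A)
      (cech_H1 (Eq_top q) (Lambda_I q k mu r A) (Lambda_res q))"
proof -
  interpret qdiff q k r mu A by unfold_locales (use assms in auto)
  show ?thesis by (rule stokes_bijection)
qed

end
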